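(* Let $A\in\hat{\mathcal C}_{W(\mathbb F)}$ and let $M$ be a finitely generated $A$-module. For $i=1,2$ let $\chi_{i,A}:G\to A^\times$ be a character deforming $\bar\chi_i$ and satisfying $\mathcal C$, and let $R^{\mathcal C,\mathrm{red}}_{\bar D}\to A$ be the unique local homomorphism classifying the pseudodeformation $\psi(\chi_{1,A}\oplus\chi_{2,A})$. Then there is a natural isomorphism $$\mathrm{Hom}_A\big(B^{\mathcal C,\mathrm{red}}\otimes_{R^{\mathcal C,\mathrm{red}}_{\bar D}}A,\,M\big)\xrightarrow{\sim}\mathrm{Ext}^1_{A[G],\mathcal C}\big(\chi_{2,A},\,\chi_{1,A}\otimes_AM\big),$$ and similarly a natural isomorphism $\mathrm{Hom}_A\big(C^{\mathcal C,\mathrm{red}}\otimes_{R^{\mathcal C,\mathrm{red}}_{\bar D}}A,M\big)\xrightarrow{\sim}\mathrm{Ext}^1_{A[G],\mathcal C}\big(\chi_{1,A},\chi_{2,A}\otimes_AM\big)$.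
   Context: Fix a prime $p$ and a profinite group $G$ satisfying Mazur's condition $\Phi_p$ (every open subgroup has topologically finitely generated maximal pro-$p$ quotient); $G$-actions are continuous. Fix a finite field $\mathbb F$ of characteristic $p$ and distinct characters $\bar\chi_1,\bar\chi_2:G\to\mathbb F^\times$, and $\bar D=\psi(\bar\chi_1\oplus\bar\chi_2)=\det\circ(\bar\chi_1\oplus\bar\chi_2)$ (pseudorepresentations in Chenevier's sense, i.e. multiplicative polynomial laws). $\hat{\mathcal C}_{W(\mathbb F)}$ is the category of complete Noetherian local $W(\mathbb F)$-algebras with residue field $\mathbb F$. A Cayley–Hamilton representation of $G$ over $A$ is $(E,\rho,D)$ with $D:E\to A$ a pseudorepresentation of a finitely generated $A$-algebra $E$ such that every element (after any base change) satisfies its characteristic polynomial, and $\rho:G\to E^\times$ a homomorphism. A stable condition $\mathcal C$ is a full subcategory of finite-cardinality $\mathbb Z_p[G]$-modules closed under isomorphisms, submodules, quotients and finite direct sums; fix one. For $A$ complete Noetherian local and an $A[G]$-module $M$ finitely generated over $A$, $M$ satisfies $\mathcal C$ if $M/\mathfrak m_A^iM\in\mathcal C$ for all $i\ge1$. For $A[G]$-modules $V_1,V_2$ satisfying $\mathcal C$, $\mathrm{Ext}^1_{A[G],\mathcal C}(V_1,V_2)\subseteq\mathrm{Ext}^1_{A[G]}(V_1,V_2)$ is the $A$-submodule of classes all of whose extension modules $V$ (middle terms of $0\to V_2\to V\to V_1\to0$) satisfy $\mathcal C$. A Cayley–Hamilton representation satisfies $\mathcal C$ if its algebra does as a left $A[G]$-module.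 Let $(E^{\mathcal C}_{\bar D},\rho^{\mathcal C},D_{E^{\mathcal C}_{\bar D}}:E^{\mathcal C}_{\bar D}\to R^{\mathcal C}_{\bar D})$ be the universal Cayley–Hamilton representation of $G$ with residual pseudorepresentation $\bar D$ satisfying $\mathcal C$ (it has a unique morphism to every Cayley–Hamilton representation over a complete Noetherian local $\mathbb Z_p$-algebra with residual pseudorepresentation $\bar D$ satisfying $\mathcal C$). It carries a generalized matrix algebra structure: orthogonal idempotents $e_1+e_2=1$ with $e_iE^{\mathcal C}_{\bar D}e_i\cong R^{\mathcal C}_{\bar D}$, such that $D_{E^{\mathcal C}_{\bar D}}$ is the associated $2\times2$ generalized determinant and $e_i\rho^{\mathcal C}e_i$ reduces to $\bar\chi_i$ modulo the maximal ideal. Write $B^{\mathcal C}=e_1E^{\mathcal C}_{\bar D}e_2$, $C^{\mathcal C}=e_2E^{\mathcal C}_{\bar D}e_1$, and let $J\subset R^{\mathcal C}_{\bar D}$ be the image of $B^{\mathcal C}\otimes C^{\mathcal C}$ under multiplication (into $e_1E^{\mathcal C}_{\bar D}e_1\cong R^{\mathcal C}_{\bar D}$), i.e. the image of the reducibility ideal of the universal pseudodeformation ring. Put $R^{\mathcal C,\mathrm{red}}_{\bar D}=R^{\mathcal C}_{\bar D}/J$, $E^{\mathcal C,\mathrm{red}}_{\bar D}=E^{\mathcal C}_{\bar D}/JE^{\mathcal C}_{\bar D}$, $B^{\mathcal C,\mathrm{red}}=e_1E^{\mathcal C,\mathrm{red}}_{\bar D}e_2$, $C^{\mathcal C,\mathrm{red}}=e_2E^{\mathcal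 C,\mathrm{red}}_{\bar D}e_1$. Pairs of characters $(\chi_{1,A},\chi_{2,A})$ deforming $(\bar\chi_1,\bar\chi_2)$ and satisfying $\mathcal C$ correspond bijectively to local homomorphisms $R^{\mathcal C,\mathrm{red}}_{\bar D}\to A$. *)

theory Defs
  imports "HOL-Algebra.Algebra" "HOL-Analysis.Product_Topology" "HOL-Analysis.T1_Spaces"
begin

section \<open>Profinite groups and the finiteness condition\<close>

definition profinite_group :: "'g monoid \<Rightarrow> 'g topology \<Rightarrow> bool" where
  "profinite_group G T \<longleftrightarrow>
     group G \<and> topspace T = carrier G \<and>
     continuous_map (prod_topology T T) T (\<lambda>(x, y). x \<otimes>\<^bsub>G\<^esub> y) \<and>
     continuous_map T T (\<lambda>x. inv\<^bsub>G\<^esub> x) \<and>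
     compact_space T \<and> Hausdorff_space T \<and>
     (\<forall>S. connectedin T S \<longrightarrow> (\<exists>x. S \<subseteq> {x}))"

definition quotient_group_topology :: "'g monoid \<Rightarrow> 'g topology \<Rightarrow> 'g set \<Rightarrow> 'g set topology" where
  "quotient_group_topology G T N =
     topology (\<lambda>U. U \<subseteq> carrier (G Mod N) \<and> openin T {x \<in> carrier G. N #>\<^bsub>G\<^esub> x \<in> U})"

definition top_fin_gen :: "'g monoid \<Rightarrow> 'g topology \<Rightarrow> bool" where
  "top_fin_gen G T \<longleftrightarrow>
     (\<exists>S. finite S \<and> S \<subseteq> carrier G \<and> T closure_of (generate G S) = carrier G)"

text \<open>The kernel of the projection onto the maximal pro-\<open>p\<close> quotient.\<close>

definition pro_p_kernel :: "nat \<Rightarrow> 'g monoid \<Rightarrow> 'g topology \<Rightarrow> 'g set" where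
  "pro_p_kernel p G T =
     \<Inter> {K. K \<lhd> G \<and> openin T K \<and> (\<exists>n. card (rcosets\<^bsub>G\<^esub> K) = p ^ n)}"

definition mazur_Phi :: "nat \<Rightarrow> 'g monoid \<Rightarrow> 'g topology \<Rightarrow> bool" where
  "mazur_Phi p G T \<longleftrightarrow>
     (\<forall>H. subgroup H G \<and> openin T H \<longrightarrow>
        (let G' = G\<lparr>carrier := H\<rparr>; T' = subtopology T H; N = pro_p_kernel p G' T'
         in top_fin_gen (G' Mod N) (quotient_group_topology G' T' N)))"


section \<open>Coefficient rings\<close>

text \<open>The non-units; this is the maximal ideal of a local ring.\<close>

definition maxid :: "('a, 'x) ring_scheme \<Rightarrow> 'a set" where
  "maxid A = carrier A - Units A"

fun ideal_pow :: "('a, 'x) ring_scheme \<Rightarrow> 'a set \<Rightarrow> nat \<Rightarrow> 'a set" where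
  "ideal_pow A I 0 = carrier A"
| "ideal_pow A I (Suc n) = ideal_prod A I (ideal_pow A I n)"

text \<open>Bijectivity of \<open>A \<rightarrow> lim A/I\<^sup>n\<close>: separatedness and convergence of compatible systems.\<close>

definition adically_complete :: "('a, 'x) ring_scheme \<Rightarrow> 'a set \<Rightarrow> bool" where
  "adically_complete A I \<longleftrightarrow>
     (\<Inter>n. ideal_pow A I n) = {\<zero>\<^bsub>A\<^esub>} \<and>
     (\<forall>x. (\<forall>n. x n \<in> carrier A \<and> x (Suc n) \<ominus>\<^bsub>A\<^esub> x n \<in> ideal_pow A I n) \<longrightarrow>
        (\<exists>a \<in> carrier A. \<forall>n. a \<ominus>\<^bsub>A\<^esub> x n \<in> ideal_pow A I n))"

definition complete_noetherian_local :: "('a, 'x) ring_scheme \<Rightarrow> bool" where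
  "complete_noetherian_local A \<longleftrightarrow>
     cring A \<and> \<one>\<^bsub>A\<^esub> \<noteq> \<zero>\<^bsub>A\<^esub> \<and> noetherian_ring A \<and> ideal (maxid A) A \<and>
     adically_complete A (maxid A)"

text \<open>For a finite (hence perfect) field \<open>F\<close> the ring of Witt vectors is the strict \<open>p\<close>-ring with
  residue field \<open>F\<close>: it is \<open>p\<close>-torsion free, \<open>p\<close>-adically separated and complete, with reduction
  map \<open>red\<close> modulo \<open>p\<close> onto \<open>F\<close>. It is unique up to unique isomorphism.\<close>

definition witt_ring :: "nat \<Rightarrow> 'f ring \<Rightarrow> 'w ring \<Rightarrow> ('w \<Rightarrow> 'f) \<Rightarrow> bool" where
  "witt_ring p F W red \<longleftrightarrow>
     cring W \<and>
     (\<forall>x \<in> carrier W. [p] \<cdot>\<^bsub>W\<^esub> x = \<zero>\<^bsub>W\<^esub> \<longrightarrow> x = \<zero>\<^bsub>W\<^esub>) \<and>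
     adically_complete W (PIdl\<^bsub>W\<^esub> ([p] \<cdot>\<^bsub>W\<^esub> \<one>\<^bsub>W\<^esub>)) \<and>
     red \<in> ring_hom W F \<and> red ` carrier W = carrier F \<and>
     a_kernel W F red = PIdl\<^bsub>W\<^esub> ([p] \<cdot>\<^bsub>W\<^esub> \<one>\<^bsub>W\<^esub>)"

record ('a, 'w, 'f) coef = "'a ring" +
  str :: "'w \<Rightarrow> 'a"
  res :: "'a \<Rightarrow> 'f"

definition coef_ring :: "'f ring \<Rightarrow> 'w ring \<Rightarrow> ('w \<Rightarrow> 'f) \<Rightarrow> ('a, 'w, 'f) coef \<Rightarrow> bool" where
  "coef_ring F W red A \<longleftrightarrow>
     complete_noetherian_local A \<and>
     str A \<in> ring_hom W A \<and>
     res A \<in> ring_hom A F \<and> res A ` carrier A = carrier F \<and> a_kernel A F (res A) = maxid A \<and>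
     (\<forall>w \<in> carrier W. res A (str A w) = red w)"

definition coef_hom :: "'w ring \<Rightarrow> ('a, 'w, 'f) coef \<Rightarrow> ('b, 'w, 'f) coef \<Rightarrow> ('a \<Rightarrow> 'b) \<Rightarrow> bool" where
  "coef_hom W A A' f \<longleftrightarrow>
     f \<in> ring_hom A A' \<and> f ` maxid A \<subseteq> maxid A' \<and>
     (\<forall>w \<in> carrier W. f (str A w) = str A' w)"

definition quot_coef :: "('a, 'w, 'f) coef \<Rightarrow> 'a set \<Rightarrow> ('a set, 'w, 'f) coef" where
  "quot_coef R J = ring.extend (R Quot J)
     (coef.fields (\<lambda>w. J +>\<^bsub>R\<^esub> str R w) (\<lambda>c. the_elem (res R ` c)))"


section \<open>Modules\<close>

text \<open>A ring \<open>B\<close> as a module over another ring along a ring homomorphism.\<close>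

definition via :: "('b, 'x) ring_scheme \<Rightarrow> ('r \<Rightarrow> 'b) \<Rightarrow> ('r, 'b) module" where
  "via B f = ring.extend (ring.truncate B) (module.fields (\<lambda>r b. f r \<otimes>\<^bsub>B\<^esub> b))"

abbreviation self_module :: "('b, 'x) ring_scheme \<Rightarrow> ('b, 'b) module" where
  "self_module B \<equiv> via B (\<lambda>b. b)"

definition fg_module :: "('a, 'x) ring_scheme \<Rightarrow> ('a, 'm, 'y) module_scheme \<Rightarrow> bool" where
  "fg_module A M \<longleftrightarrow> module A M \<and>
     (\<exists>S. finite S \<and> S \<subseteq> carrier M \<and> (\<forall>H. submodule H A M \<and> S \<subseteq> H \<longrightarrow> H = carrier M))"

definition mod_hom ::
  "('a, 'x) ring_scheme \<Rightarrow> ('a, 'm, 'y) module_scheme \<Rightarrow> ('a, 'n, 'z) module_scheme \<Rightarrow> ('m \<Rightarrow> 'n) set" where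
  "mod_hom A M N =
     {h \<in> carrier M \<rightarrow> carrier N.
        (\<forall>x \<in> carrier M. \<forall>y \<in> carrier M. h (x \<oplus>\<^bsub>M\<^esub> y) = h x \<oplus>\<^bsub>N\<^esub> h y) \<and>
        (\<forall>a \<in> carrier A. \<forall>x \<in> carrier M. h (a \<odot>\<^bsub>M\<^esub> x) = a \<odot>\<^bsub>N\<^esub> h x)}"

definition mod_iso ::
  "('a, 'x) ring_scheme \<Rightarrow> ('a, 'm, 'y) module_scheme \<Rightarrow> ('a, 'n, 'z) module_scheme \<Rightarrow> ('m \<Rightarrow> 'n) set" where
  "mod_iso A M N = {h \<in> mod_hom A M N. bij_betw h (carrier M) (carrier N)}"

text \<open>The multiplicative fields of the underlying ring record play no role.\<close>

definition Hom_module ::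
  "('a, 'x) ring_scheme \<Rightarrow> ('a, 'm, 'y) module_scheme \<Rightarrow> ('a, 'n, 'z) module_scheme
     \<Rightarrow> ('a, 'm \<Rightarrow> 'n) module" where
  "Hom_module A M N =
     \<lparr>carrier = mod_hom A M N \<inter> extensional (carrier M),
      monoid.mult = undefined, monoid.one = undefined,
      ring.zero = (\<lambda>x \<in> carrier M. \<zero>\<^bsub>N\<^esub>),
      ring.add = (\<lambda>h k. \<lambda>x \<in> carrier M. h x \<oplus>\<^bsub>N\<^esub> k x),
      smult = (\<lambda>a h. \<lambda>x \<in> carrier M. a \<odot>\<^bsub>N\<^esub> h x)\<rparr>"

definition ideal_smul :: "'a set \<Rightarrow> ('a, 'm, 'y) module_scheme \<Rightarrow> 'm set" where
  "ideal_smul I M = generate (add_monoid M) {a \<odot>\<^bsub>M\<^esub> x | a x. a \<in> I \<and> x \<in> carrier M}"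

definition adic :: "('a, 'x) ring_scheme \<Rightarrow> ('a, 'm, 'y) module_scheme \<Rightarrow> 'm topology" where
  "adic A M = topology (\<lambda>U. U \<subseteq> carrier M \<and>
     (\<forall>x \<in> U. \<exists>n. \<forall>y \<in> ideal_smul (ideal_pow A (maxid A) n) M. x \<oplus>\<^bsub>M\<^esub> y \<in> U))"


section \<open>Tensor products and base change\<close>

definition tensor_rel ::
  "('r, 'x) ring_scheme \<Rightarrow> ('r, 'm, 'y) module_scheme \<Rightarrow> ('r, 'n, 'z) module_scheme
     \<Rightarrow> ('m \<times> 'n \<Rightarrow>\<^sub>0 int) set" where
  "tensor_rel R M N = generate (free_Abelian_group (carrier M \<times> carrier N))
     ({frag_of (x \<oplus>\<^bsub>M\<^esub> x', y) - frag_of (x, y) - frag_of (x', y) | x x' y.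
         x \<in> carrier M \<and> x' \<in> carrier M \<and> y \<in> carrier N} \<union>
      {frag_of (x, y \<oplus>\<^bsub>N\<^esub> y') - frag_of (x, y) - frag_of (x, y') | x y y'.
         x \<in> carrier M \<and> y \<in> carrier N \<and> y' \<in> carrier N} \<union>
      {frag_of (r \<odot>\<^bsub>M\<^esub> x, y) - frag_of (x, r \<odot>\<^bsub>N\<^esub> y) | r x y.
         r \<in> carrier R \<and> x \<in> carrier M \<and> y \<in> carrier N})"

definition tensor_class ::
  "('r, 'x) ring_scheme \<Rightarrow> ('r, 'm, 'y) module_scheme \<Rightarrow> ('r, 'n, 'z) module_scheme
     \<Rightarrow> ('m \<times> 'n \<Rightarrow>\<^sub>0 int) \<Rightarrow> ('m \<times> 'n \<Rightarrow>\<^sub>0 int) set" where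
  "tensor_class R M N z =
     tensor_rel R M N #>\<^bsub>free_Abelian_group (carrier M \<times> carrier N)\<^esub> z"

text \<open>The group underlying \<open>M \<otimes>\<^sub>R N\<close>: the free abelian group on \<open>M \<times> N\<close> modulo the
  relations of additivity in each argument and \<open>R\<close>-balancedness.\<close>

definition tensor_group ::
  "('r, 'x) ring_scheme \<Rightarrow> ('r, 'm, 'y) module_scheme \<Rightarrow> ('r, 'n, 'z) module_scheme
     \<Rightarrow> ('m \<times> 'n \<Rightarrow>\<^sub>0 int) set monoid" where
  "tensor_group R M N = free_Abelian_group (carrier M \<times> carrier N) Mod tensor_rel R M N"

text \<open>The base change \<open>M \<otimes>\<^sub>R B\<close> along \<open>f : R \<rightarrow> B\<close>, as a module over \<open>B\<close>. If \<open>M\<close> is an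
  \<open>R\<close>-algebra then \<open>mult\<close> and \<open>one\<close> make it a \<open>B\<close>-algebra; for a mere module these two fields are
  meaningless. The operations are defined by applying the bilinear formula to all representatives
  of the cosets; the results lie in one coset.\<close>

definition base_change ::
  "('r, 'x) ring_scheme \<Rightarrow> ('r, 'm, 'y) module_scheme \<Rightarrow> ('b, 'z) ring_scheme \<Rightarrow> ('r \<Rightarrow> 'b)
     \<Rightarrow> ('b, ('m \<times> 'b \<Rightarrow>\<^sub>0 int) set) module" where
  "base_change R M B f =
     (let TG = tensor_group R M (via B f); cl = tensor_class R M (via B f) in
      \<lparr>carrier = carrier TG,
       monoid.mult = (\<lambda>c c'. \<Union>z \<in> c. \<Union>z' \<in> c'.
          cl (frag_extend (\<lambda>(x, b). frag_extend (\<lambda>(x', b'). frag_of (x \<otimes>\<^bsub>M\<^esub> x', b \<otimes>\<^bsub>B\<^esub> b')) z') z)),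
       monoid.one = cl (frag_of (\<one>\<^bsub>M\<^esub>, \<one>\<^bsub>B\<^esub>)),
       ring.zero = monoid.one TG,
       ring.add = monoid.mult TG,
       smult = (\<lambda>a c. \<Union>z \<in> c. cl (frag_extend (\<lambda>(x, b). frag_of (x, a \<otimes>\<^bsub>B\<^esub> b)) z))\<rparr>)"

definition pure ::
  "('r, 'x) ring_scheme \<Rightarrow> ('r, 'm, 'y) module_scheme \<Rightarrow> ('b, 'z) ring_scheme \<Rightarrow> ('r \<Rightarrow> 'b)
     \<Rightarrow> 'm \<Rightarrow> 'b \<Rightarrow> ('m \<times> 'b \<Rightarrow>\<^sub>0 int) set" where
  "pure R M B f x b = tensor_class R M (via B f) (frag_of (x, b))"

text \<open>The map \<open>M \<otimes>\<^sub>R B \<rightarrow> M' \<otimes>\<^bsub>R'\<^esub> B'\<close> induced by \<open>h : M \<rightarrow> M'\<close> and \<open>k : B \<rightarrow> B'\<close>; only the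
  target has to be specified, since elements of the source are sets of representatives.\<close>

definition base_change_map ::
  "('r, 'x) ring_scheme \<Rightarrow> ('r, 'n, 'y) module_scheme \<Rightarrow> ('c, 'z) ring_scheme \<Rightarrow> ('r \<Rightarrow> 'c)
     \<Rightarrow> ('m \<Rightarrow> 'n) \<Rightarrow> ('b \<Rightarrow> 'c)
     \<Rightarrow> ('m \<times> 'b \<Rightarrow>\<^sub>0 int) set \<Rightarrow> ('n \<times> 'c \<Rightarrow>\<^sub>0 int) set" where
  "base_change_map R' M' B' f' h k c =
     (\<Union>z \<in> c. tensor_class R' M' (via B' f') (frag_extend (\<lambda>(x, b). frag_of (h x, k b)) z))"


section \<open>Pseudorepresentations as multiplicative polynomial laws\<close>

definition nc_algebra :: "('a, 'x) ring_scheme \<Rightarrow> ('a, 'e) module \<Rightarrow> bool" where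
  "nc_algebra A E \<longleftrightarrow> module A E \<and> ring E \<and>
     (\<forall>a \<in> carrier A. \<forall>x \<in> carrier E. \<forall>y \<in> carrier E.
        (a \<odot>\<^bsub>E\<^esub> x) \<otimes>\<^bsub>E\<^esub> y = a \<odot>\<^bsub>E\<^esub> (x \<otimes>\<^bsub>E\<^esub> y) \<and> x \<otimes>\<^bsub>E\<^esub> (a \<odot>\<^bsub>E\<^esub> y) = a \<odot>\<^bsub>E\<^esub> (x \<otimes>\<^bsub>E\<^esub> y))"

definition fg_algebra :: "('a, 'x) ring_scheme \<Rightarrow> ('a, 'e) module \<Rightarrow> bool" where
  "fg_algebra A E \<longleftrightarrow> nc_algebra A E \<and>
     (\<exists>S. finite S \<and> S \<subseteq> carrier E \<and>
        (\<forall>H. submodule H A E \<and> subring H E \<and> S \<subseteq> H \<longrightarrow> H = carrier E))"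

definition comm_alg :: "('a, 'x) ring_scheme \<Rightarrow> 'u ring \<Rightarrow> ('a \<Rightarrow> 'u) \<Rightarrow> bool" where
  "comm_alg A B f \<longleftrightarrow> cring B \<and> f \<in> ring_hom A B"

text \<open>A polynomial law \<open>D : E \<rightarrow> A\<close> is a family of maps \<open>D\<^sub>B : E \<otimes>\<^sub>A B \<rightarrow> B\<close>, natural in the
  commutative \<open>A\<close>-algebra \<open>B\<close> (given with its structure map). The algebras \<open>B\<close> have their carriers
  in a type \<open>'u\<close>. If \<open>'u\<close> is infinite and at least as large as \<open>A\<close>, it contains copies of all
  polynomial rings over \<open>A\<close> in finitely many variables, and a law on these extends uniquely to all
  commutative \<open>A\<close>-algebras.\<close>

type_synonym ('a, 'e, 'u) law = "'u ring \<Rightarrow> ('a \<Rightarrow> 'u) \<Rightarrow> ('e \<times> 'u \<Rightarrow>\<^sub>0 int) set \<Rightarrow> 'u"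

definition polynomial_law ::
  "('a, 'x) ring_scheme \<Rightarrow> ('a, 'e) module \<Rightarrow> ('a, 'e, 'u) law \<Rightarrow> bool" where
  "polynomial_law A E D \<longleftrightarrow>
     (\<forall>B f. comm_alg A B f \<longrightarrow> D B f \<in> carrier (base_change A E B f) \<rightarrow> carrier B) \<and>
     (\<forall>B f B' f' k. comm_alg A B f \<and> comm_alg A B' f' \<and> k \<in> ring_hom B B' \<and>
        (\<forall>a \<in> carrier A. k (f a) = f' a) \<longrightarrow>
        (\<forall>x \<in> carrier (base_change A E B f).
           D B' f' (base_change_map A E B' f' (\<lambda>e. e) k x) = k (D B f x)))"

definition pseudorep ::
  "nat \<Rightarrow> ('a, 'x) ring_scheme \<Rightarrow> ('a, 'e) module \<Rightarrow> ('a, 'e, 'u) law \<Rightarrow> bool" where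
  "pseudorep d A E D \<longleftrightarrow> nc_algebra A E \<and> polynomial_law A E D \<and>
     (\<forall>B f. comm_alg A B f \<longrightarrow>
        (let EB = base_change A E B f in
         (\<forall>b \<in> carrier B. \<forall>x \<in> carrier EB. D B f (b \<odot>\<^bsub>EB\<^esub> x) = b [^]\<^bsub>B\<^esub> d \<otimes>\<^bsub>B\<^esub> D B f x) \<and>
         D B f \<one>\<^bsub>EB\<^esub> = \<one>\<^bsub>B\<^esub> \<and>
         (\<forall>x \<in> carrier EB. \<forall>y \<in> carrier EB.
            D B f (x \<otimes>\<^bsub>EB\<^esub> y) = D B f x \<otimes>\<^bsub>B\<^esub> D B f y)))"

text \<open>The characteristic polynomial \<open>D\<^bsub>B[t]\<^esub>(t - x)\<close> of \<open>x \<in> E \<otimes>\<^sub>A B\<close>. The library's polynomial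
  ring \<open>UP B\<close> lives on another type than \<open>B\<close>; \<open>P\<close> is a copy of it on the type of \<open>B\<close>, with
  \<open>h : UP B \<rightarrow> P\<close> an isomorphism.\<close>

definition char_poly ::
  "('a, 'x) ring_scheme \<Rightarrow> ('a, 'e) module \<Rightarrow> ('a, 'e, 'u) law \<Rightarrow> 'u ring \<Rightarrow> ('a \<Rightarrow> 'u)
     \<Rightarrow> 'u ring \<Rightarrow> ((nat \<Rightarrow> 'u) \<Rightarrow> 'u) \<Rightarrow> ('e \<times> 'u \<Rightarrow>\<^sub>0 int) set \<Rightarrow> (nat \<Rightarrow> 'u)" where
  "char_poly A E D B f P h x =
     (let inc = (\<lambda>b. h (monom (UP B) b 0));
          t = h (monom (UP B) \<one>\<^bsub>B\<^esub> 1);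
          f' = (\<lambda>a. inc (f a));
          EP = base_change A E P f'
      in inv_into (carrier (UP B)) h
           (D P f' ((t \<odot>\<^bsub>EP\<^esub> \<one>\<^bsub>EP\<^esub>) \<ominus>\<^bsub>EP\<^esub> base_change_map A E P f' (\<lambda>e. e) inc x)))"

definition cayley_hamilton ::
  "('a, 'x) ring_scheme \<Rightarrow> ('a, 'e) module \<Rightarrow> ('a, 'e, 'u) law \<Rightarrow> bool" where
  "cayley_hamilton A E D \<longleftrightarrow>
     (\<forall>B f P h. comm_alg A B f \<and> cring P \<and> h \<in> ring_iso (UP B) P \<longrightarrow>
        (let EB = base_change A E B f in
         \<forall>x \<in> carrier EB. eval B EB (\<lambda>b. b \<odot>\<^bsub>EB\<^esub> \<one>\<^bsub>EB\<^esub>) x (char_poly A E D B f P h x) = \<zero>\<^bsub>EB\<^esub>))"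

text \<open>Pseudorepresentations of \<open>G\<close> over \<open>A\<close> are polynomial laws on the group algebra \<open>A[G]\<close>, whose
  base change to \<open>B\<close> is \<open>B[G]\<close>, the ring of finitely supported functions \<open>G \<rightarrow> B\<close>.\<close>

definition group_ring_carrier :: "'g monoid \<Rightarrow> 'u ring \<Rightarrow> ('g \<Rightarrow> 'u) set" where
  "group_ring_carrier G B =
     {s \<in> carrier G \<rightarrow> carrier B. finite {g \<in> carrier G. s g \<noteq> \<zero>\<^bsub>B\<^esub>}}"

text \<open>The value on \<open>B[G]\<close> of the pseudorepresentation \<open>D \<circ> \<rho>\<close>.\<close>

definition induced_law ::
  "'g monoid \<Rightarrow> ('a, 'x) ring_scheme \<Rightarrow> ('a, 'e) module \<Rightarrow> ('g \<Rightarrow> 'e) \<Rightarrow> ('a, 'e, 'u) law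
     \<Rightarrow> 'u ring \<Rightarrow> ('a \<Rightarrow> 'u) \<Rightarrow> ('g \<Rightarrow> 'u) \<Rightarrow> 'u" where
  "induced_law G A E \<rho> D B f s =
     (let EB = base_change A E B f in
      D B f (\<Oplus>\<^bsub>EB\<^esub>g \<in> {g \<in> carrier G. s g \<noteq> \<zero>\<^bsub>B\<^esub>}. pure A E B f (\<rho> g) (s g)))"

text \<open>The value on \<open>B[G]\<close> of the determinant of the diagonal representation with entries
  \<open>\<chi>\<^sub>1\<close>, \<open>\<chi>\<^sub>2\<close>.\<close>

definition psi_sum ::
  "'g monoid \<Rightarrow> ('g \<Rightarrow> 'a) \<Rightarrow> ('g \<Rightarrow> 'a) \<Rightarrow> 'u ring \<Rightarrow> ('a \<Rightarrow> 'u) \<Rightarrow> ('g \<Rightarrow> 'u) \<Rightarrow> 'u" where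
  "psi_sum G \<chi>1 \<chi>2 B f s =
     (\<Oplus>\<^bsub>B\<^esub>g \<in> {g \<in> carrier G. s g \<noteq> \<zero>\<^bsub>B\<^esub>}. f (\<chi>1 g) \<otimes>\<^bsub>B\<^esub> s g) \<otimes>\<^bsub>B\<^esub>
     (\<Oplus>\<^bsub>B\<^esub>g \<in> {g \<in> carrier G. s g \<noteq> \<zero>\<^bsub>B\<^esub>}. f (\<chi>2 g) \<otimes>\<^bsub>B\<^esub> s g)"

text \<open>The base change along \<open>k : A \<rightarrow> A'\<close> of the pseudorepresentation \<open>D \<circ> \<rho>\<close> of \<open>G\<close> over \<open>A\<close>
  equals \<open>\<psi>(\<chi>\<^sub>1 \<oplus> \<chi>\<^sub>2)\<close>, for characters with values in \<open>A'\<close>.\<close>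

definition specializes_to_sum ::
  "'g monoid \<Rightarrow> ('a, 'x) ring_scheme \<Rightarrow> ('a, 'e) module \<Rightarrow> ('g \<Rightarrow> 'e) \<Rightarrow> ('a, 'e, 'u) law
     \<Rightarrow> ('b, 'y) ring_scheme \<Rightarrow> ('a \<Rightarrow> 'b) \<Rightarrow> ('g \<Rightarrow> 'b) \<Rightarrow> ('g \<Rightarrow> 'b) \<Rightarrow> bool" where
  "specializes_to_sum G A E \<rho> D A' k \<chi>1 \<chi>2 \<longleftrightarrow>
     (\<forall>B f. comm_alg A' B f \<longrightarrow> (\<forall>s \<in> group_ring_carrier G B.
        induced_law G A E \<rho> D B (\<lambda>a. f (k a)) s = psi_sum G \<chi>1 \<chi>2 B f s))"


section \<open>Stable conditions\<close>

text \<open>A finite \<open>\<int>\<^sub>p\<close>-module is the same thing as a finite abelian \<open>p\<close>-group, and all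
  homomorphisms of such groups are \<open>\<int>\<^sub>p\<close>-linear. A finite \<open>\<int>\<^sub>p[G]\<close>-module is such a group \<open>Q\<close>
  (written multiplicatively) with a continuous action \<open>a\<close> of \<open>G\<close>.\<close>

definition finite_ZpG_module ::
  "nat \<Rightarrow> 'g monoid \<Rightarrow> 'g topology \<Rightarrow> 'x monoid \<Rightarrow> ('g \<Rightarrow> 'x \<Rightarrow> 'x) \<Rightarrow> bool" where
  "finite_ZpG_module p G T Q a \<longleftrightarrow>
     comm_group Q \<and> (\<exists>n. order Q = p ^ n) \<and>
     (\<forall>g \<in> carrier G. a g \<in> hom Q Q) \<and>
     (\<forall>x \<in> carrier Q. a (\<one>\<^bsub>G\<^esub>) x = x) \<and>
     (\<forall>g \<in> carrier G. \<forall>h \<in> carrier G. \<forall>x \<in> carrier Q. a (g \<otimes>\<^bsub>G\<^esub> h) x = a g (a h x)) \<and>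
     continuous_map (prod_topology T (discrete_topology (carrier Q)))
       (discrete_topology (carrier Q)) (\<lambda>(g, x). a g x)"

definition G_isomorphic ::
  "'g monoid \<Rightarrow> 'x monoid \<Rightarrow> ('g \<Rightarrow> 'x \<Rightarrow> 'x) \<Rightarrow> 'y monoid \<Rightarrow> ('g \<Rightarrow> 'y \<Rightarrow> 'y) \<Rightarrow> bool" where
  "G_isomorphic G Q a Y b \<longleftrightarrow>
     (\<exists>h \<in> iso Q Y. \<forall>g \<in> carrier G. \<forall>x \<in> carrier Q. h (a g x) = b g (h x))"

text \<open>Every finite module has an isomorphic copy with carrier in \<open>nat\<close>; a class of finite modules
  closed under isomorphism is given by its members of this form.\<close>

type_synonym 'g fin_class = "(nat monoid \<times> ('g \<Rightarrow> nat \<Rightarrow> nat)) set"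

definition in_class :: "'g monoid \<Rightarrow> 'g fin_class \<Rightarrow> 'x monoid \<Rightarrow> ('g \<Rightarrow> 'x \<Rightarrow> 'x) \<Rightarrow> bool" where
  "in_class G C Q a \<longleftrightarrow> (\<exists>(Y, b) \<in> C. G_isomorphic G Q a Y b)"

definition stable_condition :: "nat \<Rightarrow> 'g monoid \<Rightarrow> 'g topology \<Rightarrow> 'g fin_class \<Rightarrow> bool" where
  "stable_condition p G T C \<longleftrightarrow>
     (\<forall>(Q, a) \<in> C. finite_ZpG_module p G T Q a) \<and>
     (\<forall>(Q, a) \<in> C. \<forall>Y b. finite_ZpG_module p G T Y b \<and> G_isomorphic G Q a Y b \<longrightarrow> (Y, b) \<in> C) \<and>
     (\<forall>(Q, a) \<in> C. \<forall>H. subgroup H Q \<and> (\<forall>g \<in> carrier G. a g ` H \<subseteq> H) \<longrightarrow>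
        in_class G C (Q\<lparr>carrier := H\<rparr>) a \<and> in_class G C (Q Mod H) (\<lambda>g c. a g ` c)) \<and>
     (\<forall>Q a. finite_ZpG_module p G T Q a \<and> carrier Q = {\<one>\<^bsub>Q\<^esub>} \<longrightarrow> (Q, a) \<in> C) \<and>
     (\<forall>(Q, a) \<in> C. \<forall>(Y, b) \<in> C. in_class G C (Q \<times>\<times> Y) (\<lambda>g (x, y). (a g x, b g y)))"


section \<open>Modules with an action of \<open>G\<close>\<close>

record ('a, 'm, 'g) gmodule = "('a, 'm) module" +
  act :: "'g \<Rightarrow> 'm \<Rightarrow> 'm"

definition AG_module ::
  "'g monoid \<Rightarrow> 'g topology \<Rightarrow> ('a, 'x) ring_scheme \<Rightarrow> ('a, 'm, 'g) gmodule \<Rightarrow> bool" where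
  "AG_module G T A V \<longleftrightarrow> module A V \<and>
     (\<forall>g \<in> carrier G. act V g \<in> mod_hom A V V) \<and>
     (\<forall>x \<in> carrier V. act V \<one>\<^bsub>G\<^esub> x = x) \<and>
     (\<forall>g \<in> carrier G. \<forall>h \<in> carrier G. \<forall>x \<in> carrier V. act V (g \<otimes>\<^bsub>G\<^esub> h) x = act V g (act V h x)) \<and>
     continuous_map (prod_topology T (adic A V)) (adic A V) (\<lambda>(g, x). act V g x)"

definition AG_hom ::
  "'g monoid \<Rightarrow> ('a, 'x) ring_scheme \<Rightarrow> ('a, 'm, 'g) gmodule \<Rightarrow> ('a, 'n, 'g) gmodule
     \<Rightarrow> ('m \<Rightarrow> 'n) set" where
  "AG_hom G A V W =
     {h \<in> mod_hom A V W. \<forall>g \<in> carrier G. \<forall>x \<in> carrier V. h (act V g x) = act W g (h x)}"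

definition satisfies ::
  "'g monoid \<Rightarrow> 'g fin_class \<Rightarrow> ('a, 'x) ring_scheme \<Rightarrow> ('a, 'm, 'g) gmodule \<Rightarrow> bool" where
  "satisfies G C A V \<longleftrightarrow>
     (\<forall>i \<ge> 1. in_class G C (add_monoid V Mod ideal_smul (ideal_pow A (maxid A) i) V)
                (\<lambda>g c. act V g ` c))"

definition with_action :: "('a, 'm) module \<Rightarrow> ('g \<Rightarrow> 'm \<Rightarrow> 'm) \<Rightarrow> ('a, 'm, 'g) gmodule" where
  "with_action M a = module.extend M (gmodule.fields a)"

text \<open>\<open>\<chi> \<otimes>\<^sub>A M\<close>: the \<open>A\<close>-module \<open>M\<close> on which \<open>G\<close> acts through \<open>\<chi>\<close>.\<close>

definition twist :: "('g \<Rightarrow> 'a) \<Rightarrow> ('a, 'm) module \<Rightarrow> ('a, 'm, 'g) gmodule" where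
  "twist \<chi> M = with_action M (\<lambda>g x. \<chi> g \<odot>\<^bsub>M\<^esub> x)"

abbreviation char_module :: "('a, 'x) ring_scheme \<Rightarrow> ('g \<Rightarrow> 'a) \<Rightarrow> ('a, 'a, 'g) gmodule" where
  "char_module A \<chi> \<equiv> twist \<chi> (self_module A)"

definition residual_character ::
  "'g monoid \<Rightarrow> 'g topology \<Rightarrow> 'f ring \<Rightarrow> ('g \<Rightarrow> 'f) \<Rightarrow> bool" where
  "residual_character G T F \<chi> \<longleftrightarrow>
     \<chi> \<in> hom G (units_of F) \<and> continuous_map T (discrete_topology (carrier F)) \<chi>"

definition character_deforming ::
  "'g monoid \<Rightarrow> 'g topology \<Rightarrow> ('a, 'w, 'f) coef \<Rightarrow> ('g \<Rightarrow> 'f) \<Rightarrow> ('g \<Rightarrow> 'a) \<Rightarrow> bool" where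
  "character_deforming G T A \<chi>b \<chi> \<longleftrightarrow>
     \<chi> \<in> hom G (units_of A) \<and> continuous_map T (adic A (self_module A)) \<chi> \<and>
     (\<forall>g \<in> carrier G. res A (\<chi> g) = \<chi>b g)"


section \<open>Extensions\<close>

text \<open>An extension \<open>0 \<rightarrow> V\<^sub>2 \<rightarrow> V \<rightarrow> V\<^sub>1 \<rightarrow> 0\<close> is a triple \<open>(V, i, q)\<close>. The underlying set of \<open>V\<close>
  is in bijection with \<open>V\<^sub>2 \<times> V\<^sub>1\<close>, so it is no restriction to take the middle terms in the
  corresponding product type.\<close>

type_synonym ('a, 'm, 'n, 'g) extension =
  "('a, 'm \<times> 'n, 'g) gmodule \<times> ('m \<Rightarrow> 'm \<times> 'n) \<times> ('m \<times> 'n \<Rightarrow> 'n)"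

definition extensions ::
  "'g monoid \<Rightarrow> 'g topology \<Rightarrow> ('a, 'x) ring_scheme \<Rightarrow> ('a, 'n, 'g) gmodule \<Rightarrow> ('a, 'm, 'g) gmodule
     \<Rightarrow> ('a, 'm, 'n, 'g) extension set" where
  "extensions G T A V1 V2 = {(V, i, q). AG_module G T A V \<and>
     i \<in> AG_hom G A V2 V \<and> q \<in> AG_hom G A V V1 \<and>
     inj_on i (carrier V2) \<and> q ` carrier V = carrier V1 \<and>
     i ` carrier V2 = {v \<in> carrier V. q v = \<zero>\<^bsub>V1\<^esub>}}"

definition ext_rel ::
  "'g monoid \<Rightarrow> 'g topology \<Rightarrow> ('a, 'x) ring_scheme \<Rightarrow> ('a, 'n, 'g) gmodule \<Rightarrow> ('a, 'm, 'g) gmodule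
     \<Rightarrow> (('a, 'm, 'n, 'g) extension \<times> ('a, 'm, 'n, 'g) extension) set" where
  "ext_rel G T A V1 V2 = {((V, i, q), (V', i', q')).
     (V, i, q) \<in> extensions G T A V1 V2 \<and> (V', i', q') \<in> extensions G T A V1 V2 \<and>
     (\<exists>\<phi> \<in> AG_hom G A V V'. bij_betw \<phi> (carrier V) (carrier V') \<and>
        (\<forall>x \<in> carrier V2. \<phi> (i x) = i' x) \<and> (\<forall>v \<in> carrier V. q' (\<phi> v) = q v))}"

text \<open>The pushforward of a class along \<open>f : V\<^sub>2 \<rightarrow> V\<^sub>2'\<close>: the class of all extensions of \<open>V\<^sub>1\<close> by
  \<open>V\<^sub>2'\<close> that receive a morphism inducing \<open>f\<close> on \<open>V\<^sub>2\<close> and the identity on \<open>V\<^sub>1\<close>.\<close>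

definition ext_push ::
  "'g monoid \<Rightarrow> 'g topology \<Rightarrow> ('a, 'x) ring_scheme \<Rightarrow> ('a, 'n, 'g) gmodule
     \<Rightarrow> ('a, 'm, 'g) gmodule \<Rightarrow> ('a, 'm2, 'g) gmodule \<Rightarrow> ('m \<Rightarrow> 'm2)
     \<Rightarrow> ('a, 'm, 'n, 'g) extension set \<Rightarrow> ('a, 'm2, 'n, 'g) extension set" where
  "ext_push G T A V1 V2 V2' f c = {(V', i', q') \<in> extensions G T A V1 V2'.
     \<exists>(V, i, q) \<in> c. \<exists>\<phi> \<in> AG_hom G A V V'.
        (\<forall>x \<in> carrier V2. \<phi> (i x) = i' (f x)) \<and> (\<forall>v \<in> carrier V. q' (\<phi> v) = q v)}"

definition fibre_product ::
  "('a, 'm, 'g) gmodule \<Rightarrow> ('m \<Rightarrow> 'k) \<Rightarrow> ('a, 'n, 'g) gmodule \<Rightarrow> ('n \<Rightarrow> 'k)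
     \<Rightarrow> ('a, 'm \<times> 'n, 'g) gmodule" where
  "fibre_product V q V' q' =
     \<lparr>carrier = {(v, v') \<in> carrier V \<times> carrier V'. q v = q' v'},
      monoid.mult = undefined, monoid.one = undefined,
      ring.zero = (\<zero>\<^bsub>V\<^esub>, \<zero>\<^bsub>V'\<^esub>),
      ring.add = (\<lambda>(v, v') (w, w'). (v \<oplus>\<^bsub>V\<^esub> w, v' \<oplus>\<^bsub>V'\<^esub> w')),
      smult = (\<lambda>a (v, v'). (a \<odot>\<^bsub>V\<^esub> v, a \<odot>\<^bsub>V'\<^esub> v')),
      act = (\<lambda>g (v, v'). (act V g v, act V' g v'))\<rparr>"

text \<open>The Baer sum: pull the direct sum of the two extensions back along the diagonal of \<open>V\<^sub>1\<close>
  (this is the fibre product, an extension of \<open>V\<^sub>1\<close> by \<open>V\<^sub>2 \<oplus> V\<^sub>2\<close>) and push forward along the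
  addition map \<open>V\<^sub>2 \<oplus> V\<^sub>2 \<rightarrow> V\<^sub>2\<close>.\<close>

definition baer_sum ::
  "'g monoid \<Rightarrow> 'g topology \<Rightarrow> ('a, 'x) ring_scheme \<Rightarrow> ('a, 'n, 'g) gmodule \<Rightarrow> ('a, 'm, 'g) gmodule
     \<Rightarrow> ('a, 'm, 'n, 'g) extension set \<Rightarrow> ('a, 'm, 'n, 'g) extension set
     \<Rightarrow> ('a, 'm, 'n, 'g) extension set" where
  "baer_sum G T A V1 V2 c c' = {(V'', i'', q'') \<in> extensions G T A V1 V2.
     \<exists>(V, i, q) \<in> c. \<exists>(V', i', q') \<in> c'. \<exists>\<phi> \<in> AG_hom G A (fibre_product V q V' q') V''.
        (\<forall>x \<in> carrier V2. \<forall>y \<in> carrier V2. \<phi> (i x, i' y) = i'' (x \<oplus>\<^bsub>V2\<^esub> y)) \<and>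
        (\<forall>(v, v') \<in> carrier (fibre_product V q V' q'). q'' (\<phi> (v, v')) = q v)}"

definition Ext1 ::
  "'g monoid \<Rightarrow> 'g topology \<Rightarrow> ('a, 'x) ring_scheme \<Rightarrow> ('a, 'n, 'g) gmodule \<Rightarrow> ('a, 'm, 'g) gmodule
     \<Rightarrow> ('a, ('a, 'm, 'n, 'g) extension set) module" where
  "Ext1 G T A V1 V2 =
     \<lparr>carrier = extensions G T A V1 V2 // ext_rel G T A V1 V2,
      monoid.mult = undefined, monoid.one = undefined,
      ring.zero = {(V, i, q) \<in> extensions G T A V1 V2.
                \<exists>s \<in> AG_hom G A V1 V. \<forall>x \<in> carrier V1. q (s x) = x},
      ring.add = baer_sum G T A V1 V2,
      smult = (\<lambda>a. ext_push G T A V1 V2 V2 (\<lambda>x. a \<odot>\<^bsub>V2\<^esub> x))\<rparr>"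

definition Ext1_C ::
  "'g monoid \<Rightarrow> 'g topology \<Rightarrow> 'g fin_class \<Rightarrow> ('a, 'x) ring_scheme
     \<Rightarrow> ('a, 'n, 'g) gmodule \<Rightarrow> ('a, 'm, 'g) gmodule
     \<Rightarrow> ('a, ('a, 'm, 'n, 'g) extension set) module" where
  "Ext1_C G T C A V1 V2 = (Ext1 G T A V1 V2)
     \<lparr>carrier := {c \<in> carrier (Ext1 G T A V1 V2). \<forall>(V, i, q) \<in> c. satisfies G C A V}\<rparr>"

text \<open>\<open>\<Phi>\<close> is an isomorphism \<open>Hom\<^sub>A(N, M) \<rightarrow> Ext\<^sup>1(\<chi>, \<chi>' \<otimes>\<^sub>A M)\<close> of \<open>A\<close>-modules, natural in the
  finitely generated \<open>A\<close>-module \<open>M\<close>.\<close>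

definition natural_Hom_Ext_iso ::
  "'g monoid \<Rightarrow> 'g topology \<Rightarrow> 'g fin_class \<Rightarrow> ('a, 'x) ring_scheme \<Rightarrow> ('a, 'n) module
     \<Rightarrow> ('g \<Rightarrow> 'a) \<Rightarrow> ('g \<Rightarrow> 'a)
     \<Rightarrow> (('a, 'm) module \<Rightarrow> ('n \<Rightarrow> 'm) \<Rightarrow> ('a, 'm, 'a, 'g) extension set) \<Rightarrow> bool" where
  "natural_Hom_Ext_iso G T C A N \<chi> \<chi>' \<Phi> \<longleftrightarrow>
     (\<forall>M. fg_module A M \<longrightarrow>
        \<Phi> M \<in> mod_iso A (Hom_module A N M) (Ext1_C G T C A (char_module A \<chi>) (twist \<chi>' M))) \<and>
     (\<forall>M M' f h. fg_module A M \<and> fg_module A M' \<and> f \<in> mod_hom A M M' \<and>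
        h \<in> carrier (Hom_module A N M) \<longrightarrow>
        \<Phi> M' (compose (carrier N) f h) =
          ext_push G T A (char_module A \<chi>) (twist \<chi>' M) (twist \<chi>' M') f (\<Phi> M h))"


section \<open>Cayley--Hamilton representations\<close>

definition CH_rep ::
  "'g monoid \<Rightarrow> 'g topology \<Rightarrow> ('a, 'x) ring_scheme \<Rightarrow> ('a, 'e) module \<Rightarrow> ('g \<Rightarrow> 'e)
     \<Rightarrow> ('a, 'e, 'u) law \<Rightarrow> bool" where
  "CH_rep G T A E \<rho> D \<longleftrightarrow>
     fg_algebra A E \<and> pseudorep 2 A E D \<and> cayley_hamilton A E D \<and>
     \<rho> \<in> hom G (units_of E) \<and> continuous_map T (adic A E) \<rho>"

definition CH_rep_satisfying ::
  "'g monoid \<Rightarrow> 'g topology \<Rightarrow> 'g fin_class \<Rightarrow> 'f ring \<Rightarrow> 'w ring \<Rightarrow> ('w \<Rightarrow> 'f)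
     \<Rightarrow> ('g \<Rightarrow> 'f) \<Rightarrow> ('g \<Rightarrow> 'f)
     \<Rightarrow> ('a, 'w, 'f) coef \<Rightarrow> ('a, 'e) module \<Rightarrow> ('g \<Rightarrow> 'e) \<Rightarrow> ('a, 'e, 'u) law \<Rightarrow> bool" where
  "CH_rep_satisfying G T C F W red \<chi>1 \<chi>2 A E \<rho> D \<longleftrightarrow>
     coef_ring F W red A \<and> CH_rep G T A E \<rho> D \<and>
     specializes_to_sum G A E \<rho> D F (res A) \<chi>1 \<chi>2 \<and>
     satisfies G C A (with_action E (\<lambda>g x. \<rho> g \<otimes>\<^bsub>E\<^esub> x))"

definition CH_morphism ::
  "'g monoid \<Rightarrow> 'w ring
     \<Rightarrow> ('a, 'w, 'f) coef \<Rightarrow> ('a, 'e) module \<Rightarrow> ('g \<Rightarrow> 'e) \<Rightarrow> ('a, 'e, 'u) law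
     \<Rightarrow> ('b, 'w, 'f) coef \<Rightarrow> ('b, 'd) module \<Rightarrow> ('g \<Rightarrow> 'd) \<Rightarrow> ('b, 'd, 'u) law
     \<Rightarrow> ('a \<Rightarrow> 'b) \<Rightarrow> ('e \<Rightarrow> 'd) \<Rightarrow> bool" where
  "CH_morphism G W A E \<rho> D A' E' \<rho>' D' f h \<longleftrightarrow>
     coef_hom W A A' f \<and> h \<in> ring_hom E E' \<and>
     (\<forall>a \<in> carrier A. \<forall>x \<in> carrier E. h (a \<odot>\<^bsub>E\<^esub> x) = f a \<odot>\<^bsub>E'\<^esub> h x) \<and>
     (\<forall>g \<in> carrier G. h (\<rho> g) = \<rho>' g) \<and>
     (\<forall>B k. comm_alg A' B k \<longrightarrow> (\<forall>x \<in> carrier (base_change A E B (\<lambda>a. k (f a))).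
        D' B k (base_change_map A' E' B k h (\<lambda>b. b) x) = D B (\<lambda>a. k (f a)) x))"

text \<open>The universal Cayley--Hamilton representation with residual pseudorepresentation
  \<open>\<psi>(\<chi>\<^sub>1 \<oplus> \<chi>\<^sub>2)\<close> satisfying \<open>C\<close>. All objects have their carriers in one type \<open>'u\<close>. Complete
  Noetherian local rings with finite residue field and their finitely generated algebras have at
  most the cardinality of the continuum, so for \<open>'u\<close> at least that large all isomorphism classes
  of test objects occur.\<close>

definition universal_CH_rep ::
  "'g monoid \<Rightarrow> 'g topology \<Rightarrow> 'g fin_class \<Rightarrow> 'f ring \<Rightarrow> 'w ring \<Rightarrow> ('w \<Rightarrow> 'f)
     \<Rightarrow> ('g \<Rightarrow> 'f) \<Rightarrow> ('g \<Rightarrow> 'f)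
     \<Rightarrow> ('u, 'w, 'f) coef \<Rightarrow> ('u, 'u) module \<Rightarrow> ('g \<Rightarrow> 'u) \<Rightarrow> ('u, 'u, 'u) law \<Rightarrow> bool" where
  "universal_CH_rep G T C F W red \<chi>1 \<chi>2 R E \<rho> D \<longleftrightarrow>
     CH_rep_satisfying G T C F W red \<chi>1 \<chi>2 R E \<rho> D \<and>
     (\<forall>(A :: ('u, 'w, 'f) coef) (E' :: ('u, 'u) module) \<rho>' (D' :: ('u, 'u, 'u) law).
        CH_rep_satisfying G T C F W red \<chi>1 \<chi>2 A E' \<rho>' D' \<longrightarrow>
        (\<exists>f h. CH_morphism G W R E \<rho> D A E' \<rho>' D' f h \<and>
           (\<forall>f' h'. CH_morphism G W R E \<rho> D A E' \<rho>' D' f' h' \<longrightarrow>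
              (\<forall>r \<in> carrier R. f' r = f r) \<and> (\<forall>x \<in> carrier E. h' x = h x))))"


section \<open>The generalized matrix algebra structure\<close>

definition corner :: "('e, 'x) ring_scheme \<Rightarrow> 'e \<Rightarrow> 'e \<Rightarrow> 'e set" where
  "corner E e e' = {e \<otimes>\<^bsub>E\<^esub> x \<otimes>\<^bsub>E\<^esub> e' | x. x \<in> carrier E}"

text \<open>The \<open>R\<close>-algebra isomorphism \<open>R \<cong> e\<^sub>i E e\<^sub>i\<close> is necessarily \<open>r \<mapsto> r e\<^sub>i\<close>. On a matrix with
  diagonal entries \<open>a\<^sub>1\<close>, \<open>a\<^sub>2\<close> and with \<open>m\<close> the product of the two off-diagonal entries, the
  generalized determinant is \<open>a\<^sub>1 a\<^sub>2 - m\<close>; \<open>a\<^sub>1\<close>, \<open>a\<^sub>2\<close>, \<open>m\<close> are read off in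
  \<open>e\<^sub>i (E \<otimes>\<^sub>R B) e\<^sub>i \<cong> B\<close>.\<close>

definition gma_structure ::
  "'g monoid \<Rightarrow> ('g \<Rightarrow> 'f) \<Rightarrow> ('g \<Rightarrow> 'f)
     \<Rightarrow> ('a, 'w, 'f) coef \<Rightarrow> ('a, 'e) module \<Rightarrow> ('g \<Rightarrow> 'e) \<Rightarrow> ('a, 'e, 'u) law
     \<Rightarrow> 'e \<Rightarrow> 'e \<Rightarrow> bool" where
  "gma_structure G \<chi>1 \<chi>2 R E \<rho> D e1 e2 \<longleftrightarrow>
     e1 \<in> carrier E \<and> e2 \<in> carrier E \<and>
     e1 \<otimes>\<^bsub>E\<^esub> e1 = e1 \<and> e2 \<otimes>\<^bsub>E\<^esub> e2 = e2 \<and> e1 \<otimes>\<^bsub>E\<^esub> e2 = \<zero>\<^bsub>E\<^esub> \<and> e2 \<otimes>\<^bsub>E\<^esub> e1 = \<zero>\<^bsub>E\<^esub> \<and>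
     e1 \<oplus>\<^bsub>E\<^esub> e2 = \<one>\<^bsub>E\<^esub> \<and>
     bij_betw (\<lambda>r. r \<odot>\<^bsub>E\<^esub> e1) (carrier R) (corner E e1 e1) \<and>
     bij_betw (\<lambda>r. r \<odot>\<^bsub>E\<^esub> e2) (carrier R) (corner E e2 e2) \<and>
     (\<forall>B k. comm_alg R B k \<longrightarrow>
        (let EB = base_change R E B k; d1 = pure R E B k e1 \<one>\<^bsub>B\<^esub>; d2 = pure R E B k e2 \<one>\<^bsub>B\<^esub> in
         \<forall>x \<in> carrier EB. \<forall>a1 \<in> carrier B. \<forall>a2 \<in> carrier B. \<forall>m \<in> carrier B.
           d1 \<otimes>\<^bsub>EB\<^esub> x \<otimes>\<^bsub>EB\<^esub> d1 = a1 \<odot>\<^bsub>EB\<^esub> d1 \<and>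
           d2 \<otimes>\<^bsub>EB\<^esub> x \<otimes>\<^bsub>EB\<^esub> d2 = a2 \<odot>\<^bsub>EB\<^esub> d2 \<and>
           (d1 \<otimes>\<^bsub>EB\<^esub> x \<otimes>\<^bsub>EB\<^esub> d2) \<otimes>\<^bsub>EB\<^esub> (d2 \<otimes>\<^bsub>EB\<^esub> x \<otimes>\<^bsub>EB\<^esub> d1) = m \<odot>\<^bsub>EB\<^esub> d1 \<longrightarrow>
           D B k x = a1 \<otimes>\<^bsub>B\<^esub> a2 \<ominus>\<^bsub>B\<^esub> m)) \<and>
     (\<forall>g \<in> carrier G. \<exists>r \<in> carrier R.
        e1 \<otimes>\<^bsub>E\<^esub> \<rho> g \<otimes>\<^bsub>E\<^esub> e1 = r \<odot>\<^bsub>E\<^esub> e1 \<and> res R r = \<chi>1 g) \<and>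
     (\<forall>g \<in> carrier G. \<exists>r \<in> carrier R.
        e2 \<otimes>\<^bsub>E\<^esub> \<rho> g \<otimes>\<^bsub>E\<^esub> e2 = r \<odot>\<^bsub>E\<^esub> e2 \<and> res R r = \<chi>2 g)"

text \<open>The image of \<open>e\<^sub>1 E e\<^sub>2 \<otimes> e\<^sub>2 E e\<^sub>1\<close> under multiplication, viewed in \<open>R \<cong> e\<^sub>1 E e\<^sub>1\<close>.\<close>

definition reducibility_ideal ::
  "('a, 'x) ring_scheme \<Rightarrow> ('a, 'e) module \<Rightarrow> 'e \<Rightarrow> 'e \<Rightarrow> 'a set" where
  "reducibility_ideal R E e1 e2 =
     {r \<in> carrier R. r \<odot>\<^bsub>E\<^esub> e1 \<in>
        generate (add_monoid E) {b \<otimes>\<^bsub>E\<^esub> c | b c. b \<in> corner E e1 e2 \<and> c \<in> corner E e2 e1}}"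

text \<open>\<open>E / J E\<close> as an algebra over \<open>R / J\<close>.\<close>

definition quot_algebra ::
  "('a, 'e) module \<Rightarrow> 'a set \<Rightarrow> ('a set, 'e set) module" where
  "quot_algebra E J =
     (let JE = ideal_smul J E in
      ring.extend (E Quot JE)
        (module.fields (\<lambda>r x. \<Union>a \<in> r. \<Union>y \<in> x. JE +>\<^bsub>E\<^esub> (a \<odot>\<^bsub>E\<^esub> y))))"

text \<open>\<open>e E\<^sup>r\<^sup>e\<^sup>d e'\<close> for \<open>E\<^sup>r\<^sup>e\<^sup>d = E / J E\<close>, as a module over \<open>R / J\<close>.\<close>

definition red_corner ::
  "('a, 'e) module \<Rightarrow> 'a set \<Rightarrow> 'e \<Rightarrow> 'e \<Rightarrow> ('a set, 'e set) module" where
  "red_corner E J e e' =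
     (let Er = quot_algebra E J; JE = ideal_smul J E in
      Er\<lparr>carrier := corner Er (JE +>\<^bsub>E\<^esub> e) (JE +>\<^bsub>E\<^esub> e')\<rparr>)"

end

theory Submission imports Defs
begin

text \<open>Write an element of \<open>E\<close> as a \<open>2 \<times> 2\<close> matrix with diagonal entries \<open>c1 x\<close>, \<open>c2 x\<close>. An \<open>A\<close>-linear
  map \<open>H\<close> on the base change of \<open>e1 E\<^sup>r\<^sup>e\<^sup>d e2\<close> is the same as an additive map \<open>\<beta> x = H (e1 x e2 \<otimes> 1)\<close> from
  \<open>E\<close> to \<open>M\<close> with \<open>\<beta> (x y) = c1 x \<cdot> \<beta> y + c2 y \<cdot> \<beta> x\<close>. Its values at \<open>\<rho> g\<close> form a cocycle \<open>b\<close>, hence an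
  extension on \<open>M \<times> A\<close> with matrices \<open>(\<chi>1 g, b g; 0, \<chi>2 g)\<close>; this extension satisfies the condition
  because each of its vectors lies in an equivariant image of \<open>E\<close>. Conversely, for an extension satisfying
  the condition, the algebra of matrices \<open>(a, m; 0, d)\<close> with entries in \<open>A\<close>, \<open>M\<close>, \<open>A\<close> is a Cayley--Hamilton
  representation satisfying it, and the upper right entry of the morphism from \<open>E\<close> given by universality is
  such a map up to an inner derivation. Uniqueness of this morphism, evaluated at \<open>e1\<close>, gives
  injectivity. Exchanging the two idempotents yields the second isomorphism.\<close>

section \<open>Adic filtrations\<close>

text \<open>Three obstacles shape the proof. The hypothesis on \<open>\<phi>\<close> equates
  determinants only, while the argument needs the diagonal entries of the universal representation
  to become \<open>\<chi>1\<close> and \<open>\<chi>2\<close> one by one. Polarization turns the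
  determinant into the trace, and the distinct residual characters supply a unit that separates the
  two roots. Next, universality returns a morphism together with its own map from \<open>R\<close>
  to \<open>A\<close>, not known to be the given one. Derivations are therefore taken along any
  admissible map (\<open>good\<close>), and comparing two such maps through the zero derivation
  shows that there is only one. Finally, the determinant formula of \<open>gma_structure\<close>
  measures the product of the off-diagonal entries in the first corner only. Multiplicativity of
  \<open>D\<close> forces the product in the other order to have the same coefficient in the second
  corner, so the structure and the reducibility ideal survive the exchange of \<open>e1\<close> and
  \<open>e2\<close>. That the triangular algebra of an extension satisfies the condition holds
  because, as a left module, it is the sum of its two columns.\<close>

lemma (in abelian_group) add_minus_cancel:
  assumes "y \<in> carrier G" "x \<in> carrier G"
  shows "x \<oplus> (y \<ominus> x) = y"
  using assms a_lcomm[of x y "\<ominus> x"] by (simp add: minus_eq r_neg)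

lemma ideal_pow_ideal:
  assumes "cring A" "ideal I A"
  shows "ideal (ideal_pow A I n) A"
proof (induction n)
  case 0
  interpret cring A by fact
  show ?case by (simp add: oneideal)
next
  case (Suc n)
  interpret cring A by fact
  show ?case using ideal_prod_is_ideal[OF assms(2) Suc] by simp
qed

lemma ideal_pow_Suc_subset:
  assumes "cring A" "ideal I A"
  shows "ideal_pow A I (Suc n) \<subseteq> ideal_pow A I n"
proof -
  interpret cring A by fact
  show ?thesis
    using ideal_prod_inter[OF assms(2) ideal_pow_ideal[OF assms, of n]] by auto
qed

lemma ideal_pow_mono:
  assumes "cring A" "ideal I A" "m \<le> n"
  shows "ideal_pow A I n \<subseteq> ideal_pow A I m"
  using assms(3)
proof (induction rule: dec_induct)
  case (step n)
  then show ?case using ideal_pow_Suc_subset[OF assms(1,2), of n] by blast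
qed simp

lemma ideal_pow_hom:
  assumes "cring R" "cring A" "f \<in> ring_hom R A" "ideal I R" "ideal I' A" "f ` I \<subseteq> I'"
  shows "f ` ideal_pow R I n \<subseteq> ideal_pow A I' n"
proof (induction n)
  case 0
  show ?case using ring_hom_closed[OF assms(3)] by auto
next
  case (Suc n)
  have c: "I \<subseteq> carrier R" "ideal_pow R I n \<subseteq> carrier R"
    using assms(4) ideal_pow_ideal[OF assms(1,4), of n]
    by (simp_all add: additive_subgroup.a_subset ideal.axioms(1))
  have "f x \<in> ideal_prod A I' (ideal_pow A I' n)"
    if "x \<in> ideal_prod R I (ideal_pow R I n)" for x
    using that
  proof (induction)
    case (prod i j)
    then have "f (i \<otimes>\<^bsub>R\<^esub> j) = f i \<otimes>\<^bsub>A\<^esub> f j"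
      using c by (intro ring_hom_mult[OF assms(3)]) auto
    then show ?case using prod Suc assms(6) by (auto intro!: ideal_prod.prod)
  next
    case (sum s1 s2)
    have "s1 \<in> carrier R" "s2 \<in> carrier R"
      using sum.hyps ring.ideal_prod_in_carrier[OF cring.axioms(1)[OF assms(1)] assms(4) ideal_pow_ideal[OF assms(1,4), of n]]
      by blast+
    then show ?case using sum ring_hom_add[OF assms(3)] by (auto intro: ideal_prod.sum)
  qed
  then show ?case by auto
qed

context module
begin

lemma ideal_smul_subgroup:
  assumes "I \<subseteq> carrier R"
  shows "subgroup (ideal_smul I M) (add_monoid M)"
  unfolding ideal_smul_def
  by (rule M.add.generate_is_subgroup) (use assms in auto)

lemma ideal_smul_carrier:
  assumes "I \<subseteq> carrier R" "x \<in> ideal_smul I M"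
  shows "x \<in> carrier M"
  using subgroup.mem_carrier[OF ideal_smul_subgroup[OF assms(1)] assms(2)] by simp

lemma ideal_smul_incl:
  assumes "a \<in> I" "x \<in> carrier M"
  shows "a \<odot>\<^bsub>M\<^esub> x \<in> ideal_smul I M"
  unfolding ideal_smul_def using assms by (blast intro: generate.incl)

lemma ideal_smul_closed:
  assumes "I \<subseteq> carrier R"
  shows "\<zero>\<^bsub>M\<^esub> \<in> ideal_smul I M"
    and "x \<in> ideal_smul I M \<Longrightarrow> y \<in> ideal_smul I M \<Longrightarrow> x \<oplus>\<^bsub>M\<^esub> y \<in> ideal_smul I M"
    and "x \<in> ideal_smul I M \<Longrightarrow> \<ominus>\<^bsub>M\<^esub> x \<in> ideal_smul I M"
  using ideal_smul_subgroup[OF assms]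
  by (simp_all add: a_inv_def subgroup.m_inv_closed subgroup.m_closed[of _ "add_monoid M", simplified]
      subgroup.one_closed[of _ "add_monoid M", simplified])

lemma ideal_smul_minimal:
  assumes "subgroup H (add_monoid M)" "\<And>a x. a \<in> I \<Longrightarrow> x \<in> carrier M \<Longrightarrow> a \<odot>\<^bsub>M\<^esub> x \<in> H"
  shows "ideal_smul I M \<subseteq> H"
  unfolding ideal_smul_def
  by (rule M.add.generate_subgroup_incl) (use assms in auto)

lemma ideal_smul_mono:
  assumes "I \<subseteq> I'" "I' \<subseteq> carrier R"
  shows "ideal_smul I M \<subseteq> ideal_smul I' M"
  by (rule ideal_smul_minimal[OF ideal_smul_subgroup]) (use assms in \<open>auto intro: ideal_smul_incl\<close>)

lemma ideal_smul_smult: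
  assumes "ideal I R" "r \<in> carrier R" "x \<in> ideal_smul I M"
  shows "r \<odot>\<^bsub>M\<^esub> x \<in> ideal_smul I M"
proof -
  have I: "I \<subseteq> carrier R" using assms(1) by (simp add: additive_subgroup.a_subset ideal.axioms(1))
  have "x \<in> generate (add_monoid M) {a \<odot>\<^bsub>M\<^esub> x | a x. a \<in> I \<and> x \<in> carrier M}"
    using assms(3) by (simp add: ideal_smul_def)
  then show ?thesis
  proof (induction)
    case one
    then show ?case using ideal_smul_closed(1)[OF I] assms(2) by simp
  next
    case (incl h)
    then obtain a y where h: "h = a \<odot>\<^bsub>M\<^esub> y" "a \<in> I" "y \<in> carrier M" by auto
    have "r \<odot>\<^bsub>M\<^esub> h = (r \<otimes> a) \<odot>\<^bsub>M\<^esub> y" using h I assms(2) by (auto simp: smult_assoc1)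
    then show ?case using h ideal.I_l_closed[OF assms(1) h(2) assms(2)] by (auto intro: ideal_smul_incl)
  next
    case (inv h)
    then obtain a y where h: "h = a \<odot>\<^bsub>M\<^esub> y" "a \<in> I" "y \<in> carrier M" by auto
    have hc: "h \<in> carrier M" using h I by auto
    have "r \<odot>\<^bsub>M\<^esub> (\<ominus>\<^bsub>M\<^esub> h) = \<ominus>\<^bsub>M\<^esub> ((r \<otimes> a) \<odot>\<^bsub>M\<^esub> y)"
      using h I assms(2) hc by (auto simp: smult_assoc1 smult_r_minus)
    then show ?case using h ideal.I_l_closed[OF assms(1) h(2) assms(2)] ideal_smul_closed(3)[OF I]
      by (simp add: a_inv_def ideal_smul_incl)
  next
    case (eng h1 h2)
    have "h1 \<in> carrier M" "h2 \<in> carrier M"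
      using eng.hyps ideal_smul_carrier[OF I] by (auto simp: ideal_smul_def)
    then show ?case using eng assms(2) ideal_smul_closed(2)[OF I] by (simp add: smult_r_distr)
  qed
qed

text \<open>The map is assumed additive only, with scalars controlled on the generators
  \<open>a \<odot> x\<close>. This form also serves semilinear maps between modules over different
  rings, such as maps from \<open>E\<close> over \<open>R\<close> to modules over
  \<open>A\<close>.\<close>

lemma ideal_smul_image:
  assumes "module R' N" "I' \<subseteq> carrier R'"
    and "\<theta> \<in> carrier M \<rightarrow> carrier N"
    and "\<And>x y. x \<in> carrier M \<Longrightarrow> y \<in> carrier M \<Longrightarrow> \<theta> (x \<oplus>\<^bsub>M\<^esub> y) = \<theta> x \<oplus>\<^bsub>N\<^esub> \<theta> y"
    and "\<And>a x. a \<in> I \<Longrightarrow> x \<in> carrier M \<Longrightarrow> \<theta> (a \<odot>\<^bsub>M\<^esub> x) \<in> ideal_smul I' N"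
    and "x \<in> ideal_smul I M" "I \<subseteq> carrier R"
  shows "\<theta> x \<in> ideal_smul I' N"
proof -
  interpret N: module R' N by fact
  interpret h: group_hom "add_monoid M" "add_monoid N" \<theta>
    using assms(3,4) by unfold_locales (auto simp: hom_def)
  have "x \<in> generate (add_monoid M) {a \<odot>\<^bsub>M\<^esub> x | a x. a \<in> I \<and> x \<in> carrier M}"
    using assms(6) by (simp add: ideal_smul_def)
  then show ?thesis
  proof (induction)
    case one
    then show ?case using N.ideal_smul_closed(1)[OF assms(2)] h.hom_one by simp
  next
    case (incl h)
    then show ?case using assms(5) by auto
  next
    case (inv h)
    then show ?case using assms(5,7) h.hom_inv[of h] N.ideal_smul_closed(3)[OF assms(2)]
      by (auto simp: a_inv_def)
  next
    case (eng h1 h2)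
    have "h1 \<in> carrier M" "h2 \<in> carrier M"
      using eng.hyps ideal_smul_carrier[OF assms(7)] by (auto simp: ideal_smul_def)
    then show ?case using eng assms(4) N.ideal_smul_closed(2)[OF assms(2)] by simp
  qed
qed

end

section \<open>The adic topology and continuity\<close>

locale adic_module = module +
  assumes max_ideal: "ideal (maxid R) R"
begin

abbreviation fil :: "nat \<Rightarrow> 'c set" where
  "fil n \<equiv> ideal_smul (ideal_pow R (maxid R) n) M"

lemma ideal_pow_carrier: "ideal_pow R (maxid R) n \<subseteq> carrier R"
  using ideal_pow_ideal[OF R.is_cring max_ideal, of n]
  by (simp add: additive_subgroup.a_subset ideal.axioms(1))

lemmas fil_subgroup = ideal_smul_subgroup[OF ideal_pow_carrier]
lemmas fil_carrier = ideal_smul_carrier[OF ideal_pow_carrier]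
lemmas fil_closed = ideal_smul_closed[OF ideal_pow_carrier]
lemma fil_mono: "m \<le> n \<Longrightarrow> fil n \<subseteq> fil m"
  by (rule ideal_smul_mono[OF ideal_pow_mono[OF R.is_cring max_ideal] ideal_pow_carrier])

text \<open>\<open>adic\<close> is defined through \<open>topology\<close>, so its open sets are
  known only after the predicate is checked to be a topology. For intersections the larger of the
  two exponents works, since the filtration decreases.\<close>

lemma openin_adic:
  "openin (adic R M) U \<longleftrightarrow> U \<subseteq> carrier M \<and> (\<forall>x \<in> U. \<exists>n. \<forall>y \<in> fil n. x \<oplus>\<^bsub>M\<^esub> y \<in> U)"
proof -
  have "istopology (\<lambda>U. U \<subseteq> carrier M \<and> (\<forall>x \<in> U. \<exists>n. \<forall>y \<in> fil n. x \<oplus>\<^bsub>M\<^esub> y \<in> U))"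
    unfolding istopology_def
  proof (intro conjI allI impI)
    fix S U assume S: "S \<subseteq> carrier M \<and> (\<forall>x \<in> S. \<exists>n. \<forall>y \<in> fil n. x \<oplus>\<^bsub>M\<^esub> y \<in> S)"
      and U: "U \<subseteq> carrier M \<and> (\<forall>x \<in> U. \<exists>n. \<forall>y \<in> fil n. x \<oplus>\<^bsub>M\<^esub> y \<in> U)"
    show "S \<inter> U \<subseteq> carrier M" using S by auto
    show "\<forall>x \<in> S \<inter> U. \<exists>n. \<forall>y \<in> fil n. x \<oplus>\<^bsub>M\<^esub> y \<in> S \<inter> U"
    proof
      fix x assume "x \<in> S \<inter> U"
      then obtain m n where "\<forall>y \<in> fil m. x \<oplus>\<^bsub>M\<^esub> y \<in> S" "\<forall>y \<in> fil n. x \<oplus>\<^bsub>M\<^esub> y \<in> U"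
        using S U by blast
      then have "\<forall>y \<in> fil (max m n). x \<oplus>\<^bsub>M\<^esub> y \<in> S \<inter> U"
        using fil_mono[of m "max m n"] fil_mono[of n "max m n"] by auto
      then show "\<exists>n. \<forall>y \<in> fil n. x \<oplus>\<^bsub>M\<^esub> y \<in> S \<inter> U" ..
    qed
  next
    fix \<K> assume K: "\<forall>K\<in>\<K>. K \<subseteq> carrier M \<and> (\<forall>x \<in> K. \<exists>n. \<forall>y \<in> fil n. x \<oplus>\<^bsub>M\<^esub> y \<in> K)"
    show "\<Union>\<K> \<subseteq> carrier M" using K by blast
    show "\<forall>x \<in> \<Union>\<K>. \<exists>n. \<forall>y \<in> fil n. x \<oplus>\<^bsub>M\<^esub> y \<in> \<Union>\<K>" using K by (metis UnionE UnionI)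
  qed
  then show ?thesis unfolding adic_def by (simp add: topology_inverse')
qed

lemma topspace_adic [simp]: "topspace (adic R M) = carrier M"
proof
  show "topspace (adic R M) \<subseteq> carrier M" using openin_adic openin_topspace by blast
  have "openin (adic R M) (carrier M)" unfolding openin_adic using fil_carrier by auto
  then show "carrier M \<subseteq> topspace (adic R M)" by (rule openin_subset)
qed

lemma openin_fil_coset:
  assumes "x \<in> carrier M"
  shows "openin (adic R M) {y \<in> carrier M. y \<ominus>\<^bsub>M\<^esub> x \<in> fil n}"
  unfolding openin_adic
proof (intro conjI ballI exI)
  fix y z assume y: "y \<in> {y \<in> carrier M. y \<ominus>\<^bsub>M\<^esub> x \<in> fil n}" and z: "z \<in> fil n"
  have c: "y \<in> carrier M" "z \<in> carrier M" using y fil_carrier[OF z] by auto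
  have "(y \<oplus>\<^bsub>M\<^esub> z) \<ominus>\<^bsub>M\<^esub> x = (y \<ominus>\<^bsub>M\<^esub> x) \<oplus>\<^bsub>M\<^esub> z"
    using c assms by (simp add: M.minus_eq M.a_ac)
  then show "y \<oplus>\<^bsub>M\<^esub> z \<in> {y \<in> carrier M. y \<ominus>\<^bsub>M\<^esub> x \<in> fil n}"
    using y z c fil_closed(2) by simp
qed auto

text \<open>The cosets of the filtration steps form a neighbourhood base at each point, which gives
  an epsilon-delta criterion with \<open>n\<close> in the role of epsilon.\<close>

lemma continuous_map_adic:
  "continuous_map T (adic R M) f \<longleftrightarrow> f \<in> topspace T \<rightarrow> carrier M \<and>
     (\<forall>t \<in> topspace T. \<forall>n. \<exists>U. openin T U \<and> t \<in> U \<and> (\<forall>u \<in> U. f u \<ominus>\<^bsub>M\<^esub> f t \<in> fil n))"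
    (is "?L \<longleftrightarrow> ?R")
proof
  assume L: ?L
  have f: "f \<in> topspace T \<rightarrow> carrier M" using continuous_map_funspace[OF L] by simp
  have "\<exists>U. openin T U \<and> t \<in> U \<and> (\<forall>u \<in> U. f u \<ominus>\<^bsub>M\<^esub> f t \<in> fil n)" if t: "t \<in> topspace T" for t n
  proof (intro exI conjI)
    have ft: "f t \<in> carrier M" using f t by auto
    show "openin T {u \<in> topspace T. f u \<in> {y \<in> carrier M. y \<ominus>\<^bsub>M\<^esub> f t \<in> fil n}}"
      using openin_continuous_map_preimage[OF L openin_fil_coset[OF ft]] .
    show "t \<in> {u \<in> topspace T. f u \<in> {y \<in> carrier M. y \<ominus>\<^bsub>M\<^esub> f t \<in> fil n}}"
      using t ft fil_closed(1) by (simp add: M.minus_eq M.r_neg)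
  qed auto
  with f show ?R by blast
next
  assume R: ?R
  show ?L unfolding continuous_map
  proof (intro conjI allI impI)
    show "f ` topspace T \<subseteq> topspace (adic R M)" using R by auto
    fix V assume V: "openin (adic R M) V"
    show "openin T {x \<in> topspace T. f x \<in> V}"
    proof (subst openin_subopen, intro ballI)
      fix t assume t: "t \<in> {x \<in> topspace T. f x \<in> V}"
      then obtain n where n: "\<forall>y \<in> fil n. f t \<oplus>\<^bsub>M\<^esub> y \<in> V" using V unfolding openin_adic by blast
      obtain U where U: "openin T U" "t \<in> U" "\<forall>u \<in> U. f u \<ominus>\<^bsub>M\<^esub> f t \<in> fil n"
        using R t by blast
      have "f u \<in> V" if "u \<in> U" for u
      proof -
        have u: "f u \<in> carrier M" "f t \<in> carrier M" using R that t openin_subset[OF U(1)] by auto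
        have "f t \<oplus>\<^bsub>M\<^esub> (f u \<ominus>\<^bsub>M\<^esub> f t) = f u" using u by (rule M.add_minus_cancel)
        then show ?thesis using n U(3) that by metis
      qed
      then show "\<exists>S. openin T S \<and> t \<in> S \<and> S \<subseteq> {x \<in> topspace T. f x \<in> V}"
        using U openin_subset[OF U(1)] by blast
    qed
  qed
qed

text \<open>Joint continuity reduces to continuity in the group variable: linear maps preserve every
  step of the filtration, and \<open>a u y - a g x\<close> equals
  \<open>(a u x - a g x) + a u (y - x)\<close>.\<close>

lemma continuous_map_action:
  assumes lin: "\<And>g. g \<in> topspace T \<Longrightarrow> a g \<in> mod_hom R M M"
  shows "continuous_map (prod_topology T (adic R M)) (adic R M) (\<lambda>(g, x). a g x) \<longleftrightarrow>
     (\<forall>x \<in> carrier M. continuous_map T (adic R M) (\<lambda>g. a g x))" (is "?L \<longleftrightarrow> ?R")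
proof
  assume L: ?L
  show ?R
  proof
    fix x assume x: "x \<in> carrier M"
    have "continuous_map T (prod_topology T (adic R M)) (\<lambda>g. (g, x))"
      using x by (simp add: continuous_map_pairwise o_def)
    from continuous_map_compose[OF this L] show "continuous_map T (adic R M) (\<lambda>g. a g x)"
      by (simp add: o_def)
  qed
next
  assume R: ?R
  have ac: "a g x \<in> carrier M" if "g \<in> topspace T" "x \<in> carrier M" for g x
    using lin[OF that(1)] that(2) by (auto simp: mod_hom_def)
  have aadd: "a g (x \<oplus>\<^bsub>M\<^esub> y) = a g x \<oplus>\<^bsub>M\<^esub> a g y"
    if "g \<in> topspace T" "x \<in> carrier M" "y \<in> carrier M" for g x y
    using lin[OF that(1)] that by (auto simp: mod_hom_def)
  have afil: "a g x \<in> fil n" if g: "g \<in> topspace T" and x: "x \<in> fil n" for g x n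
  proof (rule ideal_smul_image[OF module_axioms ideal_pow_carrier _ _ _ x ideal_pow_carrier])
    show "a g \<in> carrier M \<rightarrow> carrier M" using ac g by auto
    show "a g (r \<odot>\<^bsub>M\<^esub> y) \<in> fil n" if "r \<in> ideal_pow R (maxid R) n" "y \<in> carrier M" for r y
    proof -
      have "a g (r \<odot>\<^bsub>M\<^esub> y) = r \<odot>\<^bsub>M\<^esub> a g y"
        using lin[OF g] that(2) subsetD[OF ideal_pow_carrier that(1)] unfolding mod_hom_def by blast
      then show ?thesis using that ac[OF g] by (auto intro: ideal_smul_incl)
    qed
  qed (use aadd g in auto)
  show ?L unfolding continuous_map_adic
  proof (intro conjI ballI allI)
    show "(\<lambda>(g, x). a g x) \<in> topspace (prod_topology T (adic R M)) \<rightarrow> carrier M"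
      using ac by auto
    fix t n assume t: "t \<in> topspace (prod_topology T (adic R M))"
    obtain g x where gx: "t = (g, x)" "g \<in> topspace T" "x \<in> carrier M"
      using t by (cases t) simp
    obtain U where U: "openin T U" "g \<in> U" "\<forall>u \<in> U. a u x \<ominus>\<^bsub>M\<^esub> a g x \<in> fil n"
      using bspec[OF R gx(3)] gx(2) unfolding continuous_map_adic by blast
    let ?W = "{y \<in> carrier M. y \<ominus>\<^bsub>M\<^esub> x \<in> fil n}"
    show "\<exists>U. openin (prod_topology T (adic R M)) U \<and> t \<in> U \<and>
       (\<forall>u \<in> U. (case u of (g, x) \<Rightarrow> a g x) \<ominus>\<^bsub>M\<^esub> (case t of (g, x) \<Rightarrow> a g x) \<in> fil n)"
    proof (intro exI conjI ballI)
      show "openin (prod_topology T (adic R M)) (U \<times> ?W)"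
        by (simp add: openin_prod_Times_iff U(1) openin_fil_coset[OF gx(3)])
      show "t \<in> U \<times> ?W" using gx U fil_closed(1) by (simp add: M.minus_eq M.r_neg)
      fix w assume "w \<in> U \<times> ?W"
      then obtain u y where w: "w = (u, y)" "u \<in> U" "y \<in> carrier M" "y \<ominus>\<^bsub>M\<^esub> x \<in> fil n" by auto
      have u: "u \<in> topspace T" using w(2) openin_subset[OF U(1)] by auto
      have "y = x \<oplus>\<^bsub>M\<^esub> (y \<ominus>\<^bsub>M\<^esub> x)" using M.add_minus_cancel[of y x] w gx by simp
      then have "a u y = a u x \<oplus>\<^bsub>M\<^esub> a u (y \<ominus>\<^bsub>M\<^esub> x)" using aadd[OF u gx(3), of "y \<ominus>\<^bsub>M\<^esub> x"] w(3) gx(3) by simp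
      then have "a u y \<ominus>\<^bsub>M\<^esub> a g x = (a u x \<ominus>\<^bsub>M\<^esub> a g x) \<oplus>\<^bsub>M\<^esub> a u (y \<ominus>\<^bsub>M\<^esub> x)"
        using ac[OF u gx(3)] ac[OF u, of "y \<ominus>\<^bsub>M\<^esub> x"] ac[OF gx(2,3)] w(3) gx(3)
        by (simp add: M.minus_eq M.a_ac)
      then have "a u y \<ominus>\<^bsub>M\<^esub> a g x \<in> fil n" using U(3) w(2) afil[OF u w(4)] fil_closed(2) by simp
      then show "(case w of (g, x) \<Rightarrow> a g x) \<ominus>\<^bsub>M\<^esub> (case t of (g, x) \<Rightarrow> a g x) \<in> fil n"
        using w gx by simp
    qed
  qed
qed

end

section \<open>Base change\<close>

lemma free_Abelian_subgroup_closed: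
  assumes "subgroup K (free_Abelian_group S)"
  shows "0 \<in> K" "x \<in> K \<Longrightarrow> y \<in> K \<Longrightarrow> x + y \<in> K" "x \<in> K \<Longrightarrow> - x \<in> K" "x \<in> K \<Longrightarrow> y \<in> K \<Longrightarrow> x - y \<in> K"
    "x \<in> K \<Longrightarrow> Poly_Mapping.keys x \<subseteq> S"
proof -
  have c: "Poly_Mapping.keys x \<subseteq> S" if "x \<in> K" for x
    using subgroup.mem_carrier[OF assms that] by simp
  have n: "- x \<in> K" if "x \<in> K" for x
    using subgroup.m_inv_closed[OF assms that] c[OF that] by simp
  have a: "x + y \<in> K" if "x \<in> K" "y \<in> K" for x y
    using subgroup.m_closed[OF assms that] by simp
  show "0 \<in> K" using subgroup.one_closed[OF assms] by simp
  show "x \<in> K \<Longrightarrow> y \<in> K \<Longrightarrow> x + y \<in> K" by (rule a)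
  show "x \<in> K \<Longrightarrow> - x \<in> K" by (rule n)
  show "x \<in> K \<Longrightarrow> y \<in> K \<Longrightarrow> x - y \<in> K" using a[of x "- y"] n[of y] by simp
  show "x \<in> K \<Longrightarrow> Poly_Mapping.keys x \<subseteq> S" by (rule c)
qed

text \<open>The operations of \<open>base_change\<close> are unions over all representatives of a
  coset. An additive map that respects the relations sends all representatives into one coset, and
  the union over the nonempty coset collapses to it.\<close>

lemma UN_coset_image:
  assumes K: "subgroup K (free_Abelian_group S)" and K': "subgroup K' (free_Abelian_group S')"
    and F: "F ` K \<subseteq> K'" "\<And>x y. F (x + y) = F x + F y"
      "\<And>z. Poly_Mapping.keys z \<subseteq> S \<Longrightarrow> Poly_Mapping.keys (F z) \<subseteq> S'"
    and w: "Poly_Mapping.keys w \<subseteq> S"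
  shows "(\<Union>z \<in> K #>\<^bsub>free_Abelian_group S\<^esub> w. K' #>\<^bsub>free_Abelian_group S'\<^esub> F z) =
    K' #>\<^bsub>free_Abelian_group S'\<^esub> F w"
proof -
  interpret FS': group "free_Abelian_group S'" by simp
  have "K' #>\<^bsub>free_Abelian_group S'\<^esub> F z = K' #>\<^bsub>free_Abelian_group S'\<^esub> F w"
    if z: "z \<in> K #>\<^bsub>free_Abelian_group S\<^esub> w" for z
  proof -
    obtain y where y: "y \<in> K" "z = y + w" using z unfolding r_coset_def by auto
    have Fy: "F y \<in> K'" using F(1) y by auto
    have "K' #>\<^bsub>free_Abelian_group S'\<^esub> F z = (K' #>\<^bsub>free_Abelian_group S'\<^esub> F y) #>\<^bsub>free_Abelian_group S'\<^esub> F w"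
      using FS'.coset_mult_assoc[of K' "F y" "F w"] subgroup.subset[OF K'] F(3)[OF w] Fy y(2) F(2) by auto
    also have "K' #>\<^bsub>free_Abelian_group S'\<^esub> F y = K'"
      by (rule subgroup.rcos_const[OF K' FS'.is_group Fy])
    finally show ?thesis .
  qed
  moreover have "w \<in> K #>\<^bsub>free_Abelian_group S\<^esub> w"
    using free_Abelian_subgroup_closed(1)[OF K] unfolding r_coset_def by force
  ultimately show ?thesis by blast
qed

lemma via_simps [simp]:
  "carrier (via B f) = carrier B" "monoid.mult (via B f) = monoid.mult B"
  "monoid.one (via B f) = monoid.one B" "ring.zero (via B f) = ring.zero B"
  "ring.add (via B f) = ring.add B" "r \<odot>\<^bsub>via B f\<^esub> b = f r \<otimes>\<^bsub>B\<^esub> b"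
  by (simp_all add: via_def ring.defs module.defs)

locale scalar_ext = M?: module R M + B?: cring B
  for R :: "('r, 'x) ring_scheme" and M :: "('r, 'm, 'y) module_scheme"
    and B :: "('b, 'z) ring_scheme" (structure) +
  fixes k :: "'r \<Rightarrow> 'b"
  assumes k_hom: "k \<in> ring_hom R B"
begin

abbreviation "FS \<equiv> carrier M \<times> carrier B"
abbreviation "FG \<equiv> free_Abelian_group (carrier M \<times> carrier B)"
abbreviation "rel \<equiv> tensor_rel R M (via B k)"
abbreviation "cl \<equiv> tensor_class R M (via B k)"
abbreviation "MB \<equiv> base_change R M B k"
abbreviation "pu \<equiv> pure R M B k"

lemma k_closed [simp]: "r \<in> carrier R \<Longrightarrow> k r \<in> carrier B"
  by (rule ring_hom_closed[OF k_hom])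

lemma frag_carrier [simp]: "x \<in> carrier M \<Longrightarrow> b \<in> carrier B \<Longrightarrow> Poly_Mapping.keys (frag_of (x, b)) \<subseteq> FS"
  by simp

lemma frag_diff_carrier:
  fixes u v w :: "'m \<times> 'b"
  assumes "u \<in> FS" "v \<in> FS"
  shows "frag_of u - frag_of v \<in> carrier FG"
    and "w \<in> FS \<Longrightarrow> frag_of u - frag_of v - frag_of w \<in> carrier FG"
proof -
  have *: "Poly_Mapping.keys (frag_of u - frag_of v) \<subseteq> FS"
    by (rule order_trans[OF keys_diff]) (use assms in simp)
  then show "frag_of u - frag_of v \<in> carrier FG" by simp
  show "frag_of u - frag_of v - frag_of w \<in> carrier FG" if "w \<in> FS"
    using order_trans[OF keys_diff, of "frag_of u - frag_of v" "frag_of w" FS] * that by simp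
qed

lemma rel_subgroup: "subgroup rel FG"
  unfolding tensor_rel_def via_simps
proof (rule group.generate_is_subgroup, simp, intro Un_least subsetI)
  fix z assume "z \<in> {frag_of (x \<oplus>\<^bsub>M\<^esub> x', y) - frag_of (x, y) - frag_of (x', y) |x x' y.
               x \<in> carrier M \<and> x' \<in> carrier M \<and> y \<in> carrier B}"
  then show "z \<in> carrier FG" by (elim CollectE exE conjE) (simp only:, rule frag_diff_carrier; simp)
next
  fix z assume "z \<in> {frag_of (x, y \<oplus> y') - frag_of (x, y) - frag_of (x, y') |x y y'.
               x \<in> carrier M \<and> y \<in> carrier B \<and> y' \<in> carrier B}"
  then show "z \<in> carrier FG" by (elim CollectE exE conjE) (simp only:, rule frag_diff_carrier; simp)
next
  fix z assume "z \<in> {frag_of (r \<odot>\<^bsub>M\<^esub> x, y) - frag_of (x, k r \<otimes> y) |r x y.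
               r \<in> carrier R \<and> x \<in> carrier M \<and> y \<in> carrier B}"
  then show "z \<in> carrier FG" by (elim CollectE exE conjE) (simp only:, rule frag_diff_carrier; simp)
qed

lemmas rel_closed = free_Abelian_subgroup_closed[OF rel_subgroup]

lemma rel_normal: "rel \<lhd> FG"
  by (rule comm_group.normal_iff_subgroup[OF abelian_free_Abelian_group, THEN iffD2, OF rel_subgroup])

lemma rel_gens:
  shows "x \<in> carrier M \<Longrightarrow> x' \<in> carrier M \<Longrightarrow> b \<in> carrier B \<Longrightarrow>
      frag_of (x \<oplus>\<^bsub>M\<^esub> x', b) - frag_of (x, b) - frag_of (x', b) \<in> rel"
    and "x \<in> carrier M \<Longrightarrow> b \<in> carrier B \<Longrightarrow> b' \<in> carrier B \<Longrightarrow>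
      frag_of (x, b \<oplus> b') - frag_of (x, b) - frag_of (x, b') \<in> rel"
    and "r \<in> carrier R \<Longrightarrow> x \<in> carrier M \<Longrightarrow> b \<in> carrier B \<Longrightarrow>
      frag_of (r \<odot>\<^bsub>M\<^esub> x, b) - frag_of (x, k r \<otimes> b) \<in> rel"
  unfolding tensor_rel_def via_simps
  by (rule generate.incl, rule UnI1, rule UnI1, intro CollectI exI conjI, rule refl, assumption+)
    (rule generate.incl, rule UnI1, rule UnI2, intro CollectI exI conjI, rule refl, assumption+,
     rule generate.incl, rule UnI2, intro CollectI exI conjI, rule refl, assumption+)

text \<open>The relations are generated by three families, so an additive map has to be tested on
  these only. The target \<open>K\<close> is an arbitrary subgroup so that it may be the relation
  subgroup of another tensor product.\<close>

lemma rel_image: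
  assumes K: "subgroup K (free_Abelian_group S)" and F: "\<And>x y. F (x + y) = F x + F y"
    and 1: "\<And>x x' b. x \<in> carrier M \<Longrightarrow> x' \<in> carrier M \<Longrightarrow> b \<in> carrier B \<Longrightarrow>
      F (frag_of (x \<oplus>\<^bsub>M\<^esub> x', b)) - F (frag_of (x, b)) - F (frag_of (x', b)) \<in> K"
    and 2: "\<And>x b b'. x \<in> carrier M \<Longrightarrow> b \<in> carrier B \<Longrightarrow> b' \<in> carrier B \<Longrightarrow>
      F (frag_of (x, b \<oplus> b')) - F (frag_of (x, b)) - F (frag_of (x, b')) \<in> K"
    and 3: "\<And>r x b. r \<in> carrier R \<Longrightarrow> x \<in> carrier M \<Longrightarrow> b \<in> carrier B \<Longrightarrow>
      F (frag_of (r \<odot>\<^bsub>M\<^esub> x, b)) - F (frag_of (x, k r \<otimes> b)) \<in> K"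
    and w: "w \<in> rel"
  shows "F w \<in> K"
proof -
  note Kc = free_Abelian_subgroup_closed[OF K]
  have F0: "F 0 = 0" using F[of 0 0] by simp
  have Fn: "F (- x) = - F x" for x using F[of x "- x"] F0 by (simp add: eq_neg_iff_add_eq_0 add.commute)
  have Fm: "F (x - y) = F x - F y" for x y using F[of x "- y"] Fn by simp
  note g = w[unfolded tensor_rel_def via_simps]
  \<comment> \<open>Membership in \<open>rel\<close> is kept along because the inverse in the free
    abelian group is the negative only for elements of its carrier.\<close>
  have i: "F h \<in> K \<and> h \<in> rel" if "h \<in> {frag_of (x \<oplus>\<^bsub>M\<^esub> x', y) - frag_of (x, y) - frag_of (x', y) | x x' y.
         x \<in> carrier M \<and> x' \<in> carrier M \<and> y \<in> carrier B} \<union>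
      {frag_of (x, y \<oplus> y') - frag_of (x, y) - frag_of (x, y') | x y y'.
         x \<in> carrier M \<and> y \<in> carrier B \<and> y' \<in> carrier B} \<union>
      {frag_of (r \<odot>\<^bsub>M\<^esub> x, y) - frag_of (x, k r \<otimes> y) | r x y.
         r \<in> carrier R \<and> x \<in> carrier M \<and> y \<in> carrier B}" for h
    using that by (elim UnE CollectE exE conjE) (simp_all only: Fm 1 2 3 rel_gens)
  show ?thesis using g
  proof (induction)
    case one
    show ?case using F0 Kc(1) by simp
  next
    case (incl h)
    show ?case using i[OF incl] by blast
  next
    case (inv h)
    show ?case using i[OF inv] rel_closed(5) by (simp add: Fn Kc(3))
  next
    case (eng h1 h2)
    then show ?case by (simp add: F Kc(2))
  qed
qed

lemma cl_eqI:
  assumes "Poly_Mapping.keys z \<subseteq> FS" "Poly_Mapping.keys w \<subseteq> FS" "z - w \<in> rel"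
  shows "cl z = cl w"
proof -
  interpret FG: group FG by simp
  have "rel #>\<^bsub>FG\<^esub> z = (rel #>\<^bsub>FG\<^esub> (z - w)) #>\<^bsub>FG\<^esub> w"
    using FG.coset_mult_assoc[OF subgroup.subset[OF rel_subgroup], of "z - w" w] rel_closed(5) assms by simp
  also have "rel #>\<^bsub>FG\<^esub> (z - w) = rel"
    by (rule subgroup.rcos_const[OF rel_subgroup FG.is_group assms(3)])
  finally show ?thesis by (simp add: tensor_class_def)
qed

lemma MB_simps [simp]:
  "carrier MB = carrier (tensor_group R M (via B k))"
  "ring.zero MB = monoid.one (tensor_group R M (via B k))"
  "ring.add MB = monoid.mult (tensor_group R M (via B k))"
  by (simp_all add: base_change_def Let_def)

lemma MB_carrier: "carrier MB = cl ` {z. Poly_Mapping.keys z \<subseteq> FS}"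
  by (auto simp: tensor_group_def carrier_FactGroup tensor_class_def)

lemma cl_closed [simp]: "Poly_Mapping.keys z \<subseteq> FS \<Longrightarrow> cl z \<in> carrier MB"
  by (auto simp only: MB_carrier)

lemma cl_add:
  assumes "Poly_Mapping.keys z \<subseteq> FS" "Poly_Mapping.keys w \<subseteq> FS"
  shows "cl z \<oplus>\<^bsub>MB\<^esub> cl w = cl (z + w)"
  using normal.rcos_sum[OF rel_normal, of z w] assms
  by (simp add: tensor_group_def tensor_class_def)

lemma cl_zero: "cl 0 = \<zero>\<^bsub>MB\<^esub>"
proof -
  have "rel #>\<^bsub>FG\<^esub> 0 = rel" by (rule subgroup.rcos_const[OF rel_subgroup _ rel_closed(1)]) simp
  then show ?thesis by (simp add: tensor_group_def tensor_class_def)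
qed

lemma MB_abelian_group: "abelian_group MB"
proof -
  interpret TG: comm_group "tensor_group R M (via B k)"
    unfolding tensor_group_def via_simps
    by (rule comm_group.abelian_FactGroup[OF abelian_free_Abelian_group rel_subgroup])
  show ?thesis
    by (rule abelian_groupI) (simp_all add: TG.m_ac TG.l_inv_ex)
qed

sublocale MB: abelian_group MB by (rule MB_abelian_group)

declare MB_simps [simp del]

lemma pure_closed [simp]: "x \<in> carrier M \<Longrightarrow> b \<in> carrier B \<Longrightarrow> pu x b \<in> carrier MB"
  unfolding pure_def by simp

lemma pure_add_l:
  assumes "x \<in> carrier M" "x' \<in> carrier M" "b \<in> carrier B"
  shows "pu (x \<oplus>\<^bsub>M\<^esub> x') b = pu x b \<oplus>\<^bsub>MB\<^esub> pu x' b"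
proof -
  have "cl (frag_of (x \<oplus>\<^bsub>M\<^esub> x', b)) = cl (frag_of (x, b) + frag_of (x', b))"
    by (rule cl_eqI) (use assms rel_gens(1)[OF assms] Poly_Mapping.keys_add[of "frag_of (x, b)" "frag_of (x', b)"] in \<open>auto simp: algebra_simps\<close>)
  then show ?thesis unfolding pure_def using assms by (simp add: cl_add)
qed

lemma pure_add_r:
  assumes "x \<in> carrier M" "b \<in> carrier B" "b' \<in> carrier B"
  shows "pu x (b \<oplus> b') = pu x b \<oplus>\<^bsub>MB\<^esub> pu x b'"
proof -
  have "cl (frag_of (x, b \<oplus> b')) = cl (frag_of (x, b) + frag_of (x, b'))"
    by (rule cl_eqI) (use assms rel_gens(2)[OF assms] Poly_Mapping.keys_add[of "frag_of (x, b)" "frag_of (x, b')"] in \<open>auto simp: algebra_simps\<close>)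
  then show ?thesis unfolding pure_def using assms by (simp add: cl_add)
qed

lemma pure_balanced:
  assumes "r \<in> carrier R" "x \<in> carrier M" "b \<in> carrier B"
  shows "pu (r \<odot>\<^bsub>M\<^esub> x) b = pu x (k r \<otimes> b)"
  unfolding pure_def by (rule cl_eqI) (use assms rel_gens(3)[OF assms] in auto)

lemma pure_zero_l [simp]:
  assumes "b \<in> carrier B"
  shows "pu \<zero>\<^bsub>M\<^esub> b = \<zero>\<^bsub>MB\<^esub>"
  using pure_add_l[of "\<zero>\<^bsub>M\<^esub>" "\<zero>\<^bsub>M\<^esub>" b] assms by (simp add: MB.add.l_cancel_one')

lemma pure_zero_r [simp]:
  assumes "x \<in> carrier M"
  shows "pu x \<zero> = \<zero>\<^bsub>MB\<^esub>"
  using pure_add_r[of x "\<zero>" "\<zero>"] assms by (simp add: MB.add.l_cancel_one')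

lemma pure_minus:
  assumes "x \<in> carrier M" "b \<in> carrier B"
  shows "pu (\<ominus>\<^bsub>M\<^esub> x) b = \<ominus>\<^bsub>MB\<^esub> pu x b"
  using pure_add_l[of "\<ominus>\<^bsub>M\<^esub> x" x b] assms by (simp add: M.l_neg MB.minus_equality)

lemma cl_minus:
  assumes "Poly_Mapping.keys z \<subseteq> FS"
  shows "cl (- z) = \<ominus>\<^bsub>MB\<^esub> cl z"
  using cl_add[of "- z" z] assms by (simp add: cl_zero MB.minus_equality)

text \<open>Induction on the free abelian group proceeds by differences, so the claim is carried for
  \<open>cl z\<close> and \<open>cl (- z)\<close> together; the negative of a pure tensor is again
  pure.\<close>

lemma pure_induct [consumes 1, case_names zero pure add]:
  assumes c: "c \<in> carrier MB"
    and zero: "P \<zero>\<^bsub>MB\<^esub>"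
    and pure: "\<And>x b. x \<in> carrier M \<Longrightarrow> b \<in> carrier B \<Longrightarrow> P (pu x b)"
    and add: "\<And>c d. c \<in> carrier MB \<Longrightarrow> d \<in> carrier MB \<Longrightarrow> P c \<Longrightarrow> P d \<Longrightarrow> P (c \<oplus>\<^bsub>MB\<^esub> d)"
  shows "P c"
proof -
  obtain z where z: "Poly_Mapping.keys z \<subseteq> FS" "c = cl z" using c MB_carrier by auto
  have "Poly_Mapping.keys z \<subseteq> FS \<and> P (cl z) \<and> P (cl (- z))"
  proof (rule free_Abelian_group_induct[OF z(1)])
    show "Poly_Mapping.keys 0 \<subseteq> FS \<and> P (cl 0) \<and> P (cl (- 0))" using zero by (simp add: cl_zero)
    show "Poly_Mapping.keys (frag_of a) \<subseteq> FS \<and> P (cl (frag_of a)) \<and> P (cl (- frag_of a))" if aF: "a \<in> FS" for a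
    proof -
      obtain x b where a: "a = (x, b)" "x \<in> carrier M" "b \<in> carrier B" using aF by auto
      show ?thesis using pure[OF a(2,3)] pure[of "\<ominus>\<^bsub>M\<^esub> x" b] a pure_minus[OF a(2,3)]
        by (simp add: cl_minus) (simp add: pure_def)
    qed
    show "Poly_Mapping.keys (x - y) \<subseteq> FS \<and> P (cl (x - y)) \<and> P (cl (- (x - y)))"
      if "Poly_Mapping.keys x \<subseteq> FS" "Poly_Mapping.keys y \<subseteq> FS"
        "Poly_Mapping.keys x \<subseteq> FS \<and> P (cl x) \<and> P (cl (- x))"
        "Poly_Mapping.keys y \<subseteq> FS \<and> P (cl y) \<and> P (cl (- y))" for x y
      using that add[of "cl x" "cl (- y)"] add[of "cl y" "cl (- x)"] keys_diff[of x y]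
      by (auto simp: cl_add)
  qed
  then show ?thesis using z by simp
qed

text \<open>The universal property of the tensor product for biadditive balanced maps into an
  abelian group \<open>N\<close>. The induced map is additive; multiplicativity or linearity over
  \<open>B\<close> is checked afterwards on pure tensors where it is wanted.\<close>

lemma universal:
  assumes N: "abelian_group N"
    and u: "\<And>x b. x \<in> carrier M \<Longrightarrow> b \<in> carrier B \<Longrightarrow> u x b \<in> carrier N"
    and u_l: "\<And>x x' b. x \<in> carrier M \<Longrightarrow> x' \<in> carrier M \<Longrightarrow> b \<in> carrier B \<Longrightarrow>
      u (x \<oplus>\<^bsub>M\<^esub> x') b = u x b \<oplus>\<^bsub>N\<^esub> u x' b"
    and u_r: "\<And>x b b'. x \<in> carrier M \<Longrightarrow> b \<in> carrier B \<Longrightarrow> b' \<in> carrier B \<Longrightarrow>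
      u x (b \<oplus> b') = u x b \<oplus>\<^bsub>N\<^esub> u x b'"
    and u_bal: "\<And>r x b. r \<in> carrier R \<Longrightarrow> x \<in> carrier M \<Longrightarrow> b \<in> carrier B \<Longrightarrow>
      u (r \<odot>\<^bsub>M\<^esub> x) b = u x (k r \<otimes> b)"
  obtains h where "h \<in> carrier MB \<rightarrow> carrier N"
    "\<And>c d. c \<in> carrier MB \<Longrightarrow> d \<in> carrier MB \<Longrightarrow> h (c \<oplus>\<^bsub>MB\<^esub> d) = h c \<oplus>\<^bsub>N\<^esub> h d"
    "\<And>x b. x \<in> carrier M \<Longrightarrow> b \<in> carrier B \<Longrightarrow> h (pu x b) = u x b"
proof -
  interpret N: abelian_group N by fact
  have u': "(\<lambda>(x, b). u x b) ` FS \<subseteq> carrier N" using u by auto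
  from N.add.free_Abelian_group_universal[OF u']
  obtain h where h: "h \<in> hom FG (add_monoid N)" "\<And>x. x \<in> FS \<Longrightarrow> h (frag_of x) = (\<lambda>(x, b). u x b) x"
    by metis
  interpret h: group_hom FG "add_monoid N" h
    using h(1) by (simp add: group_hom_def group_hom_axioms_def)
  have ha: "h (x + y) = h x \<oplus>\<^bsub>N\<^esub> h y" if "Poly_Mapping.keys x \<subseteq> FS" "Poly_Mapping.keys y \<subseteq> FS" for x y
    using h.hom_mult[of x y] that by simp
  have hm: "h (x - y) = h x \<ominus>\<^bsub>N\<^esub> h y" if "Poly_Mapping.keys x \<subseteq> FS" "Poly_Mapping.keys y \<subseteq> FS" for x y
    using h.hom_mult[of x "- y"] h.hom_inv[of y] that by (simp add: a_inv_def a_minus_def)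
  have hc: "h z \<in> carrier N" if "Poly_Mapping.keys z \<subseteq> FS" for z
    using h.hom_closed[of z] that by simp
  have kd: "Poly_Mapping.keys (a - b) \<subseteq> S" if "Poly_Mapping.keys a \<subseteq> S" "Poly_Mapping.keys b \<subseteq> S"
    for a b :: "'m \<times> 'b \<Rightarrow>\<^sub>0 int" and S
    by (rule order_trans[OF keys_diff]) (use that in simp)
  have "tensor_rel R M (via B k) \<subseteq> kernel FG (add_monoid N) h"
    unfolding tensor_rel_def via_simps
  proof (rule h.G.generate_subgroup_incl[OF _ h.subgroup_kernel], intro Un_least subsetI)
    fix z assume "z \<in> {frag_of (x \<oplus>\<^bsub>M\<^esub> x', y) - frag_of (x, y) - frag_of (x', y) |x x' y.
               x \<in> carrier M \<and> x' \<in> carrier M \<and> y \<in> carrier B}"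
    then obtain x x' y where z: "z = frag_of (x \<oplus>\<^bsub>M\<^esub> x', y) - frag_of (x, y) - frag_of (x', y)" "x \<in> carrier M" "x' \<in> carrier M" "y \<in> carrier B"
      by blast
    have "z \<in> carrier FG" unfolding z(1) by (rule frag_diff_carrier) (use z in auto)
    moreover have "h z = \<zero>\<^bsub>N\<^esub>"
      using z u N.a_comm[of "u x y" "u x' y"]
      by (simp add: hm kd h(2) u_l N.minus_eq N.minus_add N.a_assoc N.r_neg N.r_neg1 N.r_neg2)
    ultimately show "z \<in> kernel FG (add_monoid N) h" by (simp add: kernel_def)
  next
    fix z assume "z \<in> {frag_of (x, y \<oplus> y') - frag_of (x, y) - frag_of (x, y') |x y y'.
               x \<in> carrier M \<and> y \<in> carrier B \<and> y' \<in> carrier B}"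
    then obtain x y y' where z: "z = frag_of (x, y \<oplus> y') - frag_of (x, y) - frag_of (x, y')" "x \<in> carrier M" "y \<in> carrier B" "y' \<in> carrier B"
      by blast
    have "z \<in> carrier FG" unfolding z(1) by (rule frag_diff_carrier) (use z in auto)
    moreover have "h z = \<zero>\<^bsub>N\<^esub>"
      using z u N.a_comm[of "u x y" "u x y'"]
      by (simp add: hm kd h(2) u_r N.minus_eq N.minus_add N.a_assoc N.r_neg N.r_neg1 N.r_neg2)
    ultimately show "z \<in> kernel FG (add_monoid N) h" by (simp add: kernel_def)
  next
    fix z assume "z \<in> {frag_of (r \<odot>\<^bsub>M\<^esub> x, y) - frag_of (x, k r \<otimes> y) |r x y.
               r \<in> carrier R \<and> x \<in> carrier M \<and> y \<in> carrier B}"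
    then obtain r x y where z: "z = frag_of (r \<odot>\<^bsub>M\<^esub> x, y) - frag_of (x, k r \<otimes> y)" "r \<in> carrier R" "x \<in> carrier M" "y \<in> carrier B"
      by blast
    have "z \<in> carrier FG" unfolding z(1) by (rule frag_diff_carrier) (use z in auto)
    moreover have "h z = \<zero>\<^bsub>N\<^esub>"
      using z u
      by (simp add: hm kd h(2) u_bal N.minus_eq N.minus_add N.a_assoc N.r_neg N.r_neg1 N.r_neg2)
    ultimately show "z \<in> kernel FG (add_monoid N) h" by (simp add: kernel_def)
  qed
  from h.FactGroup_universal_kernel[OF rel_normal this]
  obtain g where g: "g \<in> hom (FG Mod rel) (add_monoid N)" "\<And>x. x \<in> carrier FG \<Longrightarrow> g (rel #>\<^bsub>FG\<^esub> x) = h x"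
    by metis
  show thesis
  proof (rule that)
    show "g \<in> carrier MB \<rightarrow> carrier N" using g(1) by (simp add: hom_def MB_simps tensor_group_def)
    show "g (c \<oplus>\<^bsub>MB\<^esub> d) = g c \<oplus>\<^bsub>N\<^esub> g d" if "c \<in> carrier MB" "d \<in> carrier MB" for c d
      using g(1) that by (simp add: hom_def MB_simps tensor_group_def)
    show "g (pu x b) = u x b" if "x \<in> carrier M" "b \<in> carrier B" for x b
      using g(2)[of "frag_of (x, b)"] h(2)[of "(x, b)"] that by (simp add: pure_def tensor_class_def)
  qed
qed

lemma keys_frag_extend_subset:
  assumes "\<And>a. a \<in> S \<Longrightarrow> Poly_Mapping.keys (f a) \<subseteq> S'" "Poly_Mapping.keys z \<subseteq> S"
  shows "Poly_Mapping.keys (frag_extend f z) \<subseteq> S'"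
  using keys_frag_extend[of f z] assms by blast

text \<open>Multiplying the second factor by \<open>a\<close> respects balancedness because
  \<open>B\<close> is commutative: \<open>a\<close> moves past \<open>k r\<close>.\<close>

lemma smult_cl:
  assumes a: "a \<in> carrier B" and z: "Poly_Mapping.keys z \<subseteq> FS"
  shows "a \<odot>\<^bsub>MB\<^esub> cl z = cl (frag_extend (\<lambda>(x, b). frag_of (x, a \<otimes> b)) z)"
proof -
  let ?F = "frag_extend (\<lambda>(x :: 'm, b). frag_of (x, a \<otimes> b))"
  have "a \<odot>\<^bsub>MB\<^esub> cl z = (\<Union>w \<in> rel #>\<^bsub>FG\<^esub> z. rel #>\<^bsub>FG\<^esub> ?F w)"
    by (simp add: base_change_def Let_def tensor_class_def)
  also have "\<dots> = rel #>\<^bsub>FG\<^esub> ?F z"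
  proof (rule UN_coset_image[OF rel_subgroup rel_subgroup])
    show "?F ` rel \<subseteq> rel"
    proof clarify
      fix w assume w: "w \<in> rel"
      show "?F w \<in> rel"
      proof (rule rel_image[OF rel_subgroup _ _ _ _ w])
        show "?F (frag_of (r \<odot>\<^bsub>M\<^esub> x, b)) - ?F (frag_of (x, k r \<otimes> b)) \<in> rel"
          if "r \<in> carrier R" "x \<in> carrier M" "b \<in> carrier B" for r x b
          using rel_gens(3)[of r x "a \<otimes> b"] that a by (simp add: B.m_lcomm)
        show "?F (frag_of (x, b \<oplus> b')) - ?F (frag_of (x, b)) - ?F (frag_of (x, b')) \<in> rel"
          if "x \<in> carrier M" "b \<in> carrier B" "b' \<in> carrier B" for x b b'
          using rel_gens(2)[of x "a \<otimes> b" "a \<otimes> b'"] that a by (simp add: B.r_distr)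
      qed (use a in \<open>simp_all add: frag_extend_add rel_gens\<close>)
    qed
    show "Poly_Mapping.keys (?F z) \<subseteq> FS" if "Poly_Mapping.keys z \<subseteq> FS" for z
      by (rule keys_frag_extend_subset[OF _ that]) (use a in auto)
  qed (simp_all add: frag_extend_add z)
  finally show ?thesis by (simp add: tensor_class_def)
qed

lemma smult_pure [simp]:
  assumes "a \<in> carrier B" "x \<in> carrier M" "b \<in> carrier B"
  shows "a \<odot>\<^bsub>MB\<^esub> pu x b = pu x (a \<otimes> b)"
  using smult_cl[of a "frag_of (x, b)"] assms by (simp add: pure_def)

lemma MB_smult_closed [simp]:
  assumes "a \<in> carrier B" "c \<in> carrier MB"
  shows "a \<odot>\<^bsub>MB\<^esub> c \<in> carrier MB"
proof -
  obtain z where z: "Poly_Mapping.keys z \<subseteq> FS" "c = cl z" using assms(2) MB_carrier by auto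
  have "Poly_Mapping.keys (frag_extend (\<lambda>(x, b). frag_of (x, a \<otimes> b)) z) \<subseteq> FS"
    by (rule keys_frag_extend_subset[OF _ z(1)]) (use assms(1) in auto)
  then show ?thesis using z assms(1) by (simp add: smult_cl)
qed

lemma MB_smult_add:
  assumes "a \<in> carrier B" "c \<in> carrier MB" "d \<in> carrier MB"
  shows "a \<odot>\<^bsub>MB\<^esub> (c \<oplus>\<^bsub>MB\<^esub> d) = a \<odot>\<^bsub>MB\<^esub> c \<oplus>\<^bsub>MB\<^esub> a \<odot>\<^bsub>MB\<^esub> d"
proof -
  obtain z w where z: "Poly_Mapping.keys z \<subseteq> FS" "c = cl z" "Poly_Mapping.keys w \<subseteq> FS" "d = cl w"
    using assms(2,3) MB_carrier by auto
  have k: "Poly_Mapping.keys (frag_extend (\<lambda>(x, b). frag_of (x, a \<otimes> b)) z) \<subseteq> FS"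
    if "Poly_Mapping.keys z \<subseteq> FS" for z :: "'m \<times> 'b \<Rightarrow>\<^sub>0 int"
    by (rule keys_frag_extend_subset[OF _ that]) (use assms(1) in auto)
  have "Poly_Mapping.keys (z + w) \<subseteq> FS" using z Poly_Mapping.keys_add[of z w] by blast
  then show ?thesis using z assms(1) k by (simp add: smult_cl cl_add frag_extend_add)
qed

lemma MB_smult_zero [simp]:
  assumes "a \<in> carrier B"
  shows "a \<odot>\<^bsub>MB\<^esub> \<zero>\<^bsub>MB\<^esub> = \<zero>\<^bsub>MB\<^esub>"
  using MB_smult_add[OF assms, of "\<zero>\<^bsub>MB\<^esub>" "\<zero>\<^bsub>MB\<^esub>"] assms by (simp add: MB.add.l_cancel_one')

lemma MB_module: "module B MB"
proof (rule moduleI)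
  show "(a \<oplus> b) \<odot>\<^bsub>MB\<^esub> c = a \<odot>\<^bsub>MB\<^esub> c \<oplus>\<^bsub>MB\<^esub> b \<odot>\<^bsub>MB\<^esub> c"
    if "a \<in> carrier B" "b \<in> carrier B" "c \<in> carrier MB" for a b c
    using that(3)
  proof (induction rule: pure_induct)
    case (add c d)
    then show ?case using that by (simp add: MB_smult_add MB.a_ac)
  qed (use that in \<open>simp_all add: B.l_distr pure_add_r\<close>)
  show "(a \<otimes> b) \<odot>\<^bsub>MB\<^esub> c = a \<odot>\<^bsub>MB\<^esub> (b \<odot>\<^bsub>MB\<^esub> c)"
    if "a \<in> carrier B" "b \<in> carrier B" "c \<in> carrier MB" for a b c
    using that(3)
  proof (induction rule: pure_induct)
    case (add c d)
    then show ?case using that by (simp add: MB_smult_add)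
  qed (use that in \<open>simp_all add: B.m_assoc\<close>)
  show "\<one> \<odot>\<^bsub>MB\<^esub> c = c" if "c \<in> carrier MB" for c
    using that
  proof (induction rule: pure_induct)
    case (add c d)
    then show ?case by (simp add: MB_smult_add)
  qed simp_all
qed (simp_all add: B.is_cring MB_abelian_group MB_smult_add)

sublocale MB: module B MB by (rule MB_module)

text \<open>\<open>\<eta>\<close> is the map of base rings under which \<open>h\<close> is
  semilinear. Source and target have different base rings since a Cayley-Hamilton morphism covers a
  map from \<open>R\<close> to \<open>A\<close>; the commuting square
  \<open>k' \<circ> \<eta> = l \<circ> k\<close> carries the balancing relation over.\<close>

lemma base_change_map_cl:
  fixes R' :: "('r2, 'x2) ring_scheme" and M' :: "('r2, 'm2, 'y2) module_scheme"
    and B' :: "('b2, 'z2) ring_scheme" and \<eta> :: "'r \<Rightarrow> 'r2"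
  assumes T: "scalar_ext R' M' B' k'"
    and h: "\<And>x. x \<in> carrier M \<Longrightarrow> h x \<in> carrier M'"
      "\<And>x y. x \<in> carrier M \<Longrightarrow> y \<in> carrier M \<Longrightarrow> h (x \<oplus>\<^bsub>M\<^esub> y) = h x \<oplus>\<^bsub>M'\<^esub> h y"
      "\<And>r x. r \<in> carrier R \<Longrightarrow> x \<in> carrier M \<Longrightarrow> h (r \<odot>\<^bsub>M\<^esub> x) = \<eta> r \<odot>\<^bsub>M'\<^esub> h x"
    and \<eta>: "\<And>r. r \<in> carrier R \<Longrightarrow> \<eta> r \<in> carrier R'" "\<And>r. r \<in> carrier R \<Longrightarrow> k' (\<eta> r) = l (k r)"
    and l: "l \<in> ring_hom B B'"
    and z: "Poly_Mapping.keys z \<subseteq> FS"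
  shows "base_change_map R' M' B' k' h l (cl z) =
    tensor_class R' M' (via B' k') (frag_extend (\<lambda>(x, b). frag_of (h x, l b)) z)"
    "Poly_Mapping.keys (frag_extend (\<lambda>(x, b). frag_of (h x, l b)) z) \<subseteq> carrier M' \<times> carrier B'"
proof -
  interpret T: scalar_ext R' M' B' k' by fact
  let ?F = "frag_extend (\<lambda>(x, b). frag_of (h x, l b))"
  note lc = ring_hom_closed[OF l]
  have k: "Poly_Mapping.keys (?F z) \<subseteq> carrier M' \<times> carrier B'" if "Poly_Mapping.keys z \<subseteq> FS" for z
    by (rule keys_frag_extend_subset[OF _ that]) (use h lc in auto)
  have "base_change_map R' M' B' k' h l (cl z) = (\<Union>w \<in> rel #>\<^bsub>FG\<^esub> z. T.rel #>\<^bsub>T.FG\<^esub> ?F w)"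
    by (simp add: base_change_map_def tensor_class_def)
  also have "\<dots> = T.rel #>\<^bsub>T.FG\<^esub> ?F z"
  proof (rule UN_coset_image[OF rel_subgroup T.rel_subgroup])
    show "?F ` rel \<subseteq> T.rel"
    proof clarify
      fix w assume w: "w \<in> rel"
      show "?F w \<in> T.rel"
      proof (rule rel_image[OF T.rel_subgroup _ _ _ _ w])
        show "?F (frag_of (r \<odot>\<^bsub>M\<^esub> x, b)) - ?F (frag_of (x, k r \<otimes> b)) \<in> T.rel"
          if "r \<in> carrier R" "x \<in> carrier M" "b \<in> carrier B" for r x b
          using T.rel_gens(3)[of "\<eta> r" "h x" "l b"] that h \<eta> lc by (simp add: ring_hom_mult[OF l])
        show "?F (frag_of (x, b \<oplus> b')) - ?F (frag_of (x, b)) - ?F (frag_of (x, b')) \<in> T.rel"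
          if "x \<in> carrier M" "b \<in> carrier B" "b' \<in> carrier B" for x b b'
          using T.rel_gens(2)[of "h x" "l b" "l b'"] that h lc by (simp add: ring_hom_add[OF l])
      qed (use h lc T.rel_gens(1) in \<open>simp_all add: frag_extend_add\<close>)
    qed
  qed (use z k in \<open>simp_all add: frag_extend_add\<close>)
  finally show "base_change_map R' M' B' k' h l (cl z) =
    tensor_class R' M' (via B' k') (frag_extend (\<lambda>(x, b). frag_of (h x, l b)) z)"
    by (simp add: tensor_class_def)
  show "Poly_Mapping.keys (?F z) \<subseteq> carrier M' \<times> carrier B'" by (rule k[OF z])
qed

lemma base_change_map_hom:
  fixes R' :: "('r2, 'x2) ring_scheme" and M' :: "('r2, 'm2, 'y2) module_scheme"
    and B' :: "('b2, 'z2) ring_scheme" and \<eta> :: "'r \<Rightarrow> 'r2"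
  assumes T: "scalar_ext R' M' B' k'"
    and h: "\<And>x. x \<in> carrier M \<Longrightarrow> h x \<in> carrier M'"
      "\<And>x y. x \<in> carrier M \<Longrightarrow> y \<in> carrier M \<Longrightarrow> h (x \<oplus>\<^bsub>M\<^esub> y) = h x \<oplus>\<^bsub>M'\<^esub> h y"
      "\<And>r x. r \<in> carrier R \<Longrightarrow> x \<in> carrier M \<Longrightarrow> h (r \<odot>\<^bsub>M\<^esub> x) = \<eta> r \<odot>\<^bsub>M'\<^esub> h x"
    and \<eta>: "\<And>r. r \<in> carrier R \<Longrightarrow> \<eta> r \<in> carrier R'" "\<And>r. r \<in> carrier R \<Longrightarrow> k' (\<eta> r) = l (k r)"
    and l: "l \<in> ring_hom B B'"
  shows "c \<in> carrier MB \<Longrightarrow> base_change_map R' M' B' k' h l c \<in> carrier (base_change R' M' B' k')"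
    and "c \<in> carrier MB \<Longrightarrow> d \<in> carrier MB \<Longrightarrow> base_change_map R' M' B' k' h l (c \<oplus>\<^bsub>MB\<^esub> d) =
      base_change_map R' M' B' k' h l c \<oplus>\<^bsub>base_change R' M' B' k'\<^esub> base_change_map R' M' B' k' h l d"
    and "x \<in> carrier M \<Longrightarrow> b \<in> carrier B \<Longrightarrow>
      base_change_map R' M' B' k' h l (pu x b) = pure R' M' B' k' (h x) (l b)"
proof -
  interpret T: scalar_ext R' M' B' k' by fact
  have m: "base_change_map R' M' B' k' h l (cl z) =
      tensor_class R' M' (via B' k') (frag_extend (\<lambda>(x, b). frag_of (h x, l b)) z)"
    "Poly_Mapping.keys (frag_extend (\<lambda>(x, b). frag_of (h x, l b)) z) \<subseteq> carrier M' \<times> carrier B'"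
    if "Poly_Mapping.keys z \<subseteq> FS" for z
    using base_change_map_cl[of R' M' B' k' h \<eta> l z] T h \<eta> l that by blast+
  show "base_change_map R' M' B' k' h l c \<in> carrier (base_change R' M' B' k')" if c: "c \<in> carrier MB"
  proof -
    obtain z where z: "Poly_Mapping.keys z \<subseteq> FS" "c = cl z" using c MB_carrier by auto
    show ?thesis using m[OF z(1)] z(2) by simp
  qed
  show "base_change_map R' M' B' k' h l (c \<oplus>\<^bsub>MB\<^esub> d) =
      base_change_map R' M' B' k' h l c \<oplus>\<^bsub>base_change R' M' B' k'\<^esub> base_change_map R' M' B' k' h l d"
    if cd: "c \<in> carrier MB" "d \<in> carrier MB"
  proof -
    obtain z w where z: "Poly_Mapping.keys z \<subseteq> FS" "c = cl z" "Poly_Mapping.keys w \<subseteq> FS" "d = cl w"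
      using cd MB_carrier by auto
    have "Poly_Mapping.keys (z + w) \<subseteq> FS" using z Poly_Mapping.keys_add[of z w] by blast
    then show ?thesis using m[of z] m[of w] m[of "z + w"] z by (simp add: cl_add T.cl_add frag_extend_add)
  qed
  show "base_change_map R' M' B' k' h l (pu x b) = pure R' M' B' k' (h x) (l b)"
    if "x \<in> carrier M" "b \<in> carrier B"
    using m[of "frag_of (x, b)"] that by (simp add: pure_def)
qed

end

lemma additive_zero:
  assumes "abelian_group M" "abelian_group N" "f \<in> carrier M \<rightarrow> carrier N"
    "\<And>x y. x \<in> carrier M \<Longrightarrow> y \<in> carrier M \<Longrightarrow> f (x \<oplus>\<^bsub>M\<^esub> y) = f x \<oplus>\<^bsub>N\<^esub> f y"
  shows "f \<zero>\<^bsub>M\<^esub> = \<zero>\<^bsub>N\<^esub>"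
proof -
  interpret M: abelian_group M by fact
  interpret N: abelian_group N by fact
  have "f \<zero>\<^bsub>M\<^esub> \<in> carrier N" using assms(3) by auto
  then show ?thesis using assms(4)[of "\<zero>\<^bsub>M\<^esub>" "\<zero>\<^bsub>M\<^esub>"] by (simp add: N.add.l_cancel_one')
qed

lemma additive_minus:
  assumes "abelian_group M" "abelian_group N" "f \<in> carrier M \<rightarrow> carrier N"
    "\<And>x y. x \<in> carrier M \<Longrightarrow> y \<in> carrier M \<Longrightarrow> f (x \<oplus>\<^bsub>M\<^esub> y) = f x \<oplus>\<^bsub>N\<^esub> f y"
    and x: "x \<in> carrier M"
  shows "f (\<ominus>\<^bsub>M\<^esub> x) = \<ominus>\<^bsub>N\<^esub> f x"
proof -
  interpret M: abelian_group M by fact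
  interpret N: abelian_group N by fact
  have "f (\<ominus>\<^bsub>M\<^esub> x) \<oplus>\<^bsub>N\<^esub> f x = \<zero>\<^bsub>N\<^esub>"
    using assms(4)[of "\<ominus>\<^bsub>M\<^esub> x" x] x additive_zero[OF assms(1-3)] assms(4) by (simp add: M.l_neg)
  moreover have "f x \<in> carrier N" "f (\<ominus>\<^bsub>M\<^esub> x) \<in> carrier N" using assms(3) x by auto
  ultimately show ?thesis using N.minus_equality[of "f (\<ominus>\<^bsub>M\<^esub> x)" "f x"] by simp
qed

context scalar_ext
begin

lemma additive_eqI:
  assumes "abelian_group N" "f \<in> carrier MB \<rightarrow> carrier N" "g \<in> carrier MB \<rightarrow> carrier N"
    and "\<And>c d. c \<in> carrier MB \<Longrightarrow> d \<in> carrier MB \<Longrightarrow> f (c \<oplus>\<^bsub>MB\<^esub> d) = f c \<oplus>\<^bsub>N\<^esub> f d"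
    and "\<And>c d. c \<in> carrier MB \<Longrightarrow> d \<in> carrier MB \<Longrightarrow> g (c \<oplus>\<^bsub>MB\<^esub> d) = g c \<oplus>\<^bsub>N\<^esub> g d"
    and "\<And>x b. x \<in> carrier M \<Longrightarrow> b \<in> carrier B \<Longrightarrow> f (pu x b) = g (pu x b)"
    and "c \<in> carrier MB"
  shows "f c = g c"
  using assms(7)
proof (induction rule: pure_induct)
  case zero
  have "f \<zero>\<^bsub>MB\<^esub> = \<zero>\<^bsub>N\<^esub>"
    by (rule additive_zero[OF MB_abelian_group assms(1,2)]) (rule assms(4))
  moreover have "g \<zero>\<^bsub>MB\<^esub> = \<zero>\<^bsub>N\<^esub>"
    by (rule additive_zero[OF MB_abelian_group assms(1,3)]) (rule assms(5))
  ultimately show ?case by simp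
next
  case (pure x b)
  then show ?case by (rule assms(6))
next
  case (add c d)
  then show ?case by (simp only: assms(4,5))
qed

end

section \<open>Base change of algebras\<close>

locale algebra_ext = scalar_ext R M B k
  for R :: "('r, 'x) ring_scheme" and M :: "('r, 'm) module"
    and B :: "('b, 'z) ring_scheme" (structure) and k :: "'r \<Rightarrow> 'b" +
  assumes alg: "nc_algebra R M"

lemma algebra_extI:
  assumes "nc_algebra R M" "cring B" "k \<in> ring_hom R B"
  shows "algebra_ext R M B k"
  using assms unfolding nc_algebra_def algebra_ext_def algebra_ext_axioms_def scalar_ext_def scalar_ext_axioms_def
  by simp

context algebra_ext
begin

sublocale A?: ring M using alg by (simp add: nc_algebra_def)

lemma smult_mult:
  assumes "r \<in> carrier R" "x \<in> carrier M" "y \<in> carrier M"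
  shows "(r \<odot>\<^bsub>M\<^esub> x) \<otimes>\<^bsub>M\<^esub> y = r \<odot>\<^bsub>M\<^esub> (x \<otimes>\<^bsub>M\<^esub> y)" "x \<otimes>\<^bsub>M\<^esub> (r \<odot>\<^bsub>M\<^esub> y) = r \<odot>\<^bsub>M\<^esub> (x \<otimes>\<^bsub>M\<^esub> y)"
  using alg assms by (simp_all add: nc_algebra_def)

text \<open>The double sum on representatives that \<open>base_change\<close> uses for products,
  named so that its biadditivity can be stated.\<close>

definition bil :: "('m \<times> 'b \<Rightarrow>\<^sub>0 int) \<Rightarrow> ('m \<times> 'b \<Rightarrow>\<^sub>0 int) \<Rightarrow> ('m \<times> 'b \<Rightarrow>\<^sub>0 int)" where
  "bil z z' = frag_extend (\<lambda>(x, b). frag_extend (\<lambda>(x', b'). frag_of (x \<otimes>\<^bsub>M\<^esub> x', b \<otimes> b')) z') z"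

lemma frag_extend_fun_add: "frag_extend (\<lambda>a. f a + g a) z = frag_extend f z + frag_extend g z"
  by (induction z rule: frag_induction[where S = UNIV, OF subset_UNIV]) (auto simp: frag_extend_diff)

lemma bil_add_l: "bil (z + w) z' = bil z z' + bil w z'"
  by (simp add: bil_def frag_extend_add)

lemma bil_add_r: "bil z (z' + w') = bil z z' + bil z w'"
  unfolding bil_def by (simp add: frag_extend_add frag_extend_fun_add[symmetric] case_prod_unfold)

lemma bil_diff: "bil (z - w) z' = bil z z' - bil w z'" "bil z (z' - w') = bil z z' - bil z w'"
  using bil_add_l[of "z - w" w z', symmetric] bil_add_r[of z "z' - w'" w', symmetric]
  by (simp_all add: eq_diff_eq)

lemma bil_zero: "bil 0 z = 0" "bil z 0 = 0"
  using bil_diff(1)[of z z z] bil_diff(2)[of z z z] by simp_all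

lemma bil_keys:
  assumes "Poly_Mapping.keys z \<subseteq> FS" "Poly_Mapping.keys z' \<subseteq> FS"
  shows "Poly_Mapping.keys (bil z z') \<subseteq> FS"
  unfolding bil_def
proof (rule keys_frag_extend_subset[OF _ assms(1)], clarify)
  fix x b u v assume "x \<in> carrier M" "b \<in> carrier B"
    and u: "(u, v) \<in> Poly_Mapping.keys (frag_extend (\<lambda>(x', b'). frag_of (x \<otimes>\<^bsub>M\<^esub> x', b \<otimes> b')) z')"
  then have "Poly_Mapping.keys (frag_extend (\<lambda>(x', b'). frag_of (x \<otimes>\<^bsub>M\<^esub> x', b \<otimes> b')) z') \<subseteq> FS"
    by (intro keys_frag_extend_subset[OF _ assms(2)]) clarsimp
  then show "u \<in> carrier M \<and> v \<in> carrier B" using u by blast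
qed

text \<open>Together with its mirror image below this makes the relations a two-sided ideal for
  \<open>bil\<close>, as the product of cosets requires. By additivity the other argument may be
  taken to be a single basis element.\<close>

lemma bil_rel_r:
  assumes w: "w \<in> rel" and z: "Poly_Mapping.keys z \<subseteq> FS"
  shows "bil z w \<in> rel"
proof (rule free_Abelian_group_induct[OF z])
  show "bil (frag_of a) w \<in> rel" if aF: "a \<in> FS" for a
  proof -
    obtain x b where a: "a = (x, b)" "x \<in> carrier M" "b \<in> carrier B" using aF by auto
    show ?thesis
    proof (rule rel_image[OF rel_subgroup _ _ _ _ w])
      show "bil (frag_of a) (frag_of (y \<oplus>\<^bsub>M\<^esub> y', c)) - bil (frag_of a) (frag_of (y, c)) - bil (frag_of a) (frag_of (y', c)) \<in> rel"
        if "y \<in> carrier M" "y' \<in> carrier M" "c \<in> carrier B" for y y' c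
        using rel_gens(1)[of "x \<otimes>\<^bsub>M\<^esub> y" "x \<otimes>\<^bsub>M\<^esub> y'" "b \<otimes> c"] that a by (simp add: bil_def A.r_distr)
      show "bil (frag_of a) (frag_of (y, c \<oplus> c')) - bil (frag_of a) (frag_of (y, c)) - bil (frag_of a) (frag_of (y, c')) \<in> rel"
        if "y \<in> carrier M" "c \<in> carrier B" "c' \<in> carrier B" for y c c'
        using rel_gens(2)[of "x \<otimes>\<^bsub>M\<^esub> y" "b \<otimes> c" "b \<otimes> c'"] that a by (simp add: bil_def B.r_distr)
      show "bil (frag_of a) (frag_of (r \<odot>\<^bsub>M\<^esub> y, c)) - bil (frag_of a) (frag_of (y, k r \<otimes> c)) \<in> rel"
        if "r \<in> carrier R" "y \<in> carrier M" "c \<in> carrier B" for r y c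
        using rel_gens(3)[of r "x \<otimes>\<^bsub>M\<^esub> y" "b \<otimes> c"] that a by (simp add: bil_def smult_mult B.m_lcomm)
    qed (simp add: bil_add_r)
  qed
qed (simp_all add: bil_zero bil_diff rel_closed)

lemma bil_rel_l:
  assumes w: "w \<in> rel" and z: "Poly_Mapping.keys z \<subseteq> FS"
  shows "bil w z \<in> rel"
proof (rule free_Abelian_group_induct[OF z])
  show "bil w (frag_of a) \<in> rel" if aF: "a \<in> FS" for a
  proof -
    obtain x b where a: "a = (x, b)" "x \<in> carrier M" "b \<in> carrier B" using aF by auto
    show ?thesis
    proof (rule rel_image[OF rel_subgroup _ _ _ _ w])
      show "bil (frag_of (y \<oplus>\<^bsub>M\<^esub> y', c)) (frag_of a) - bil (frag_of (y, c)) (frag_of a) - bil (frag_of (y', c)) (frag_of a) \<in> rel"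
        if "y \<in> carrier M" "y' \<in> carrier M" "c \<in> carrier B" for y y' c
        using rel_gens(1)[of "y \<otimes>\<^bsub>M\<^esub> x" "y' \<otimes>\<^bsub>M\<^esub> x" "c \<otimes> b"] that a by (simp add: bil_def A.l_distr)
      show "bil (frag_of (y, c \<oplus> c')) (frag_of a) - bil (frag_of (y, c)) (frag_of a) - bil (frag_of (y, c')) (frag_of a) \<in> rel"
        if "y \<in> carrier M" "c \<in> carrier B" "c' \<in> carrier B" for y c c'
        using rel_gens(2)[of "y \<otimes>\<^bsub>M\<^esub> x" "c \<otimes> b" "c' \<otimes> b"] that a by (simp add: bil_def B.l_distr)
      show "bil (frag_of (r \<odot>\<^bsub>M\<^esub> y, c)) (frag_of a) - bil (frag_of (y, k r \<otimes> c)) (frag_of a) \<in> rel"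
        if "r \<in> carrier R" "y \<in> carrier M" "c \<in> carrier B" for r y c
        using rel_gens(3)[of r "y \<otimes>\<^bsub>M\<^esub> x" "c \<otimes> b"] that a by (simp add: bil_def smult_mult B.m_assoc)
    qed (simp add: bil_add_l)
  qed
qed (simp_all add: bil_zero bil_diff rel_closed)

text \<open>The two nested unions collapse one at a time: first over the right factor with the left
  representative fixed, then over the left factor.\<close>

lemma mult_cl:
  assumes z: "Poly_Mapping.keys z \<subseteq> FS" and z': "Poly_Mapping.keys z' \<subseteq> FS"
  shows "cl z \<otimes>\<^bsub>MB\<^esub> cl z' = cl (bil z z')"
proof -
  have inner: "(\<Union>w' \<in> cl z'. cl (bil w w')) = cl (bil w z')" if "w \<in> cl z" for w
  proof -
    have w: "Poly_Mapping.keys w \<subseteq> FS"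
      using monoid.r_coset_subset_G[OF group.is_monoid[OF group_free_Abelian_group] subgroup.subset[OF rel_subgroup], of z] z that
      unfolding tensor_class_def carrier_free_Abelian_group_iff[symmetric] via_simps by blast
    show ?thesis unfolding tensor_class_def via_simps
    proof (rule UN_coset_image[OF rel_subgroup rel_subgroup])
      show "bil w ` rel \<subseteq> rel" using bil_rel_r w by blast
    qed (rule bil_add_r, erule bil_keys[OF w], rule z')
  qed
  have "cl z \<otimes>\<^bsub>MB\<^esub> cl z' = (\<Union>w \<in> cl z. \<Union>w' \<in> cl z'. cl (bil w w'))"
    by (simp add: base_change_def Let_def bil_def)
  also have "\<dots> = (\<Union>w \<in> cl z. cl (bil w z'))" using inner by simp
  also have "\<dots> = cl (bil z z')" unfolding tensor_class_def via_simps
  proof (rule UN_coset_image[OF rel_subgroup rel_subgroup])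
    show "(\<lambda>w. bil w z') ` rel \<subseteq> rel" using bil_rel_l z' by blast
  qed (rule bil_add_l, erule bil_keys[OF _ z'], rule z)
  finally show ?thesis .
qed

lemma mult_pure [simp]:
  assumes "x \<in> carrier M" "b \<in> carrier B" "x' \<in> carrier M" "b' \<in> carrier B"
  shows "pu x b \<otimes>\<^bsub>MB\<^esub> pu x' b' = pu (x \<otimes>\<^bsub>M\<^esub> x') (b \<otimes> b')"
  using mult_cl[of "frag_of (x, b)" "frag_of (x', b')"] assms by (simp add: pure_def bil_def)

lemma one_pure: "\<one>\<^bsub>MB\<^esub> = pu \<one>\<^bsub>M\<^esub> \<one>"
  by (simp add: base_change_def Let_def pure_def)

lemma MB_mult_closed [simp]:
  assumes "c \<in> carrier MB" "d \<in> carrier MB"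
  shows "c \<otimes>\<^bsub>MB\<^esub> d \<in> carrier MB"
proof -
  obtain z w where z: "Poly_Mapping.keys z \<subseteq> FS" "c = cl z" "Poly_Mapping.keys w \<subseteq> FS" "d = cl w"
    using assms MB_carrier by auto
  then show ?thesis by (simp add: mult_cl bil_keys)
qed

lemma MB_distrib:
  assumes "c \<in> carrier MB" "d \<in> carrier MB" "e \<in> carrier MB"
  shows "(c \<oplus>\<^bsub>MB\<^esub> d) \<otimes>\<^bsub>MB\<^esub> e = c \<otimes>\<^bsub>MB\<^esub> e \<oplus>\<^bsub>MB\<^esub> d \<otimes>\<^bsub>MB\<^esub> e"
    and "e \<otimes>\<^bsub>MB\<^esub> (c \<oplus>\<^bsub>MB\<^esub> d) = e \<otimes>\<^bsub>MB\<^esub> c \<oplus>\<^bsub>MB\<^esub> e \<otimes>\<^bsub>MB\<^esub> d"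
proof -
  obtain z w v where z: "Poly_Mapping.keys z \<subseteq> FS" "c = cl z" "Poly_Mapping.keys w \<subseteq> FS" "d = cl w"
    "Poly_Mapping.keys v \<subseteq> FS" "e = cl v"
    using assms MB_carrier by auto
  have k: "Poly_Mapping.keys (z + w) \<subseteq> FS" using z Poly_Mapping.keys_add[of z w] by blast
  show "(c \<oplus>\<^bsub>MB\<^esub> d) \<otimes>\<^bsub>MB\<^esub> e = c \<otimes>\<^bsub>MB\<^esub> e \<oplus>\<^bsub>MB\<^esub> d \<otimes>\<^bsub>MB\<^esub> e"
    using z k by (simp add: cl_add mult_cl bil_keys bil_add_l)
  show "e \<otimes>\<^bsub>MB\<^esub> (c \<oplus>\<^bsub>MB\<^esub> d) = e \<otimes>\<^bsub>MB\<^esub> c \<oplus>\<^bsub>MB\<^esub> e \<otimes>\<^bsub>MB\<^esub> d"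
    using z k by (simp add: cl_add mult_cl bil_keys bil_add_r)
qed

lemma MB_null [simp]:
  assumes "c \<in> carrier MB"
  shows "c \<otimes>\<^bsub>MB\<^esub> \<zero>\<^bsub>MB\<^esub> = \<zero>\<^bsub>MB\<^esub>" "\<zero>\<^bsub>MB\<^esub> \<otimes>\<^bsub>MB\<^esub> c = \<zero>\<^bsub>MB\<^esub>"
  using MB_distrib[of "\<zero>\<^bsub>MB\<^esub>" "\<zero>\<^bsub>MB\<^esub>" c] assms by (simp_all add: MB.add.l_cancel_one')

lemma MB_ring: "ring MB"
proof (rule ringI)
  show "abelian_group MB" by (rule MB_abelian_group)
  show "monoid MB"
  proof (rule monoidI)
    show "\<one>\<^bsub>MB\<^esub> \<in> carrier MB" by (simp add: one_pure)
    show "\<one>\<^bsub>MB\<^esub> \<otimes>\<^bsub>MB\<^esub> c = c" if "c \<in> carrier MB" for c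
      using that by (induction rule: pure_induct) (simp_all add: one_pure MB_distrib)
    show "c \<otimes>\<^bsub>MB\<^esub> \<one>\<^bsub>MB\<^esub> = c" if "c \<in> carrier MB" for c
      using that by (induction rule: pure_induct) (simp_all add: one_pure MB_distrib)
    \<comment> \<open>Associativity is additive in each factor, so it is extended from pure tensors
      to all elements one factor at a time, starting with the last.\<close>
    have 1: "(pu x b \<otimes>\<^bsub>MB\<^esub> pu y b') \<otimes>\<^bsub>MB\<^esub> e = pu x b \<otimes>\<^bsub>MB\<^esub> (pu y b' \<otimes>\<^bsub>MB\<^esub> e)"
      if "x \<in> carrier M" "b \<in> carrier B" "y \<in> carrier M" "b' \<in> carrier B" "e \<in> carrier MB" for x b y b' e
      using that(5) that(1-4)
      by (induction rule: pure_induct) (simp_all add: MB_distrib A.m_assoc B.m_assoc)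
    have 2: "(pu x b \<otimes>\<^bsub>MB\<^esub> d) \<otimes>\<^bsub>MB\<^esub> e = pu x b \<otimes>\<^bsub>MB\<^esub> (d \<otimes>\<^bsub>MB\<^esub> e)"
      if "x \<in> carrier M" "b \<in> carrier B" "d \<in> carrier MB" "e \<in> carrier MB" for x b d e
      using that(3) that(1,2,4)
      by (induction rule: pure_induct) (simp_all add: MB_distrib 1 del: mult_pure)
    show "(c \<otimes>\<^bsub>MB\<^esub> d) \<otimes>\<^bsub>MB\<^esub> e = c \<otimes>\<^bsub>MB\<^esub> (d \<otimes>\<^bsub>MB\<^esub> e)"
      if "c \<in> carrier MB" "d \<in> carrier MB" "e \<in> carrier MB" for c d e
      using that(1) that(2,3)
      by (induction rule: pure_induct) (simp_all add: MB_distrib 2)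
  qed simp
qed (simp_all add: MB_distrib)

sublocale MB: ring MB by (rule MB_ring)

lemma MB_smult_mult:
  assumes "b \<in> carrier B" "c \<in> carrier MB" "d \<in> carrier MB"
  shows "(b \<odot>\<^bsub>MB\<^esub> c) \<otimes>\<^bsub>MB\<^esub> d = b \<odot>\<^bsub>MB\<^esub> (c \<otimes>\<^bsub>MB\<^esub> d)" "c \<otimes>\<^bsub>MB\<^esub> (b \<odot>\<^bsub>MB\<^esub> d) = b \<odot>\<^bsub>MB\<^esub> (c \<otimes>\<^bsub>MB\<^esub> d)"
proof -
  have p: "(b \<odot>\<^bsub>MB\<^esub> pu x a) \<otimes>\<^bsub>MB\<^esub> d = b \<odot>\<^bsub>MB\<^esub> (pu x a \<otimes>\<^bsub>MB\<^esub> d) \<and>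
      pu x a \<otimes>\<^bsub>MB\<^esub> (b \<odot>\<^bsub>MB\<^esub> d) = b \<odot>\<^bsub>MB\<^esub> (pu x a \<otimes>\<^bsub>MB\<^esub> d)"
    if "x \<in> carrier M" "a \<in> carrier B" for x a
    using assms(3)
  proof (induction rule: pure_induct)
    case (pure y c)
    then show ?case using that assms(1) by (simp add: B.m_assoc B.m_lcomm)
  next
    case (add u v)
    then show ?case using that assms(1) by (simp add: MB_distrib MB_smult_add del: smult_pure)
  qed (use that assms(1) in simp_all)
  have "(b \<odot>\<^bsub>MB\<^esub> c) \<otimes>\<^bsub>MB\<^esub> d = b \<odot>\<^bsub>MB\<^esub> (c \<otimes>\<^bsub>MB\<^esub> d) \<and> c \<otimes>\<^bsub>MB\<^esub> (b \<odot>\<^bsub>MB\<^esub> d) = b \<odot>\<^bsub>MB\<^esub> (c \<otimes>\<^bsub>MB\<^esub> d)"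
    using assms(2)
  proof (induction rule: pure_induct)
    case (pure x a)
    then show ?case by (rule p)
  next
    case (add u v)
    then show ?case using assms by (simp add: MB_distrib MB_smult_add)
  qed (use assms in simp_all)
  then show "(b \<odot>\<^bsub>MB\<^esub> c) \<otimes>\<^bsub>MB\<^esub> d = b \<odot>\<^bsub>MB\<^esub> (c \<otimes>\<^bsub>MB\<^esub> d)" "c \<otimes>\<^bsub>MB\<^esub> (b \<odot>\<^bsub>MB\<^esub> d) = b \<odot>\<^bsub>MB\<^esub> (c \<otimes>\<^bsub>MB\<^esub> d)"
    by simp_all
qed

text \<open>Source of the two diagonal projections of a triangular algebra after base change: an
  algebra map \<open>f\<close> over \<open>k\<close> extends by
  \<open>x \<otimes> b \<mapsto> f x \<cdot> b\<close>, which is multiplicative since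
  \<open>B\<close> is commutative.\<close>

lemma universal_ring_hom:
  assumes f: "f \<in> ring_hom M B" "\<And>r x. r \<in> carrier R \<Longrightarrow> x \<in> carrier M \<Longrightarrow> f (r \<odot>\<^bsub>M\<^esub> x) = k r \<otimes> f x"
  obtains \<pi> where "\<pi> \<in> ring_hom MB B"
    "\<And>b c. b \<in> carrier B \<Longrightarrow> c \<in> carrier MB \<Longrightarrow> \<pi> (b \<odot>\<^bsub>MB\<^esub> c) = b \<otimes> \<pi> c"
    "\<And>x b. x \<in> carrier M \<Longrightarrow> b \<in> carrier B \<Longrightarrow> \<pi> (pu x b) = f x \<otimes> b"
proof -
  note fc = ring_hom_closed[OF f(1)]
  obtain \<pi> where \<pi>: "\<pi> \<in> carrier MB \<rightarrow> carrier B"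
    "\<And>c d. c \<in> carrier MB \<Longrightarrow> d \<in> carrier MB \<Longrightarrow> \<pi> (c \<oplus>\<^bsub>MB\<^esub> d) = \<pi> c \<oplus> \<pi> d"
    "\<And>x b. x \<in> carrier M \<Longrightarrow> b \<in> carrier B \<Longrightarrow> \<pi> (pu x b) = f x \<otimes> b"
  proof (rule universal[of B "\<lambda>x b. f x \<otimes> b"])
    show "abelian_group B" by (rule B.abelian_group_axioms)
  qed (use fc f in \<open>auto simp: ring_hom_add B.l_distr B.r_distr B.m_ac\<close>)
  have \<pi>c: "\<pi> c \<in> carrier B" if "c \<in> carrier MB" for c using \<pi>(1) that by auto
  have \<pi>0: "\<pi> \<zero>\<^bsub>MB\<^esub> = \<zero>"
    by (rule additive_zero[OF MB_abelian_group B.abelian_group_axioms \<pi>(1)]) (rule \<pi>(2))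
  have p: "\<pi> (pu x b \<otimes>\<^bsub>MB\<^esub> d) = \<pi> (pu x b) \<otimes> \<pi> d"
    if "x \<in> carrier M" "b \<in> carrier B" "d \<in> carrier MB" for x b d
    using that(3)
  proof (induction rule: pure_induct)
    case (pure y c)
    then show ?case using that fc by (simp add: \<pi> ring_hom_mult[OF f(1)] B.m_ac)
  next
    case (add u v)
    then show ?case using that fc by (simp add: \<pi> \<pi>c MB_distrib B.r_distr)
  qed (use that fc in \<open>simp add: \<pi>0 \<pi>\<close>)
  have m: "\<pi> (c \<otimes>\<^bsub>MB\<^esub> d) = \<pi> c \<otimes> \<pi> d" if "c \<in> carrier MB" "d \<in> carrier MB" for c d
    using that(1)
  proof (induction rule: pure_induct)
    case (add u v)
    then show ?case using that fc by (simp add: \<pi> \<pi>c MB_distrib B.l_distr)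
  qed (use that p in \<open>simp_all add: \<pi>0 \<pi>c\<close>)
  have s: "\<pi> (b \<odot>\<^bsub>MB\<^esub> c) = b \<otimes> \<pi> c" if "b \<in> carrier B" "c \<in> carrier MB" for b c
    using that(2)
  proof (induction rule: pure_induct)
    case (add u v)
    then show ?case using that fc by (simp add: \<pi> \<pi>c MB_smult_add B.r_distr)
  qed (use that fc in \<open>simp_all add: \<pi>0 \<pi> B.m_ac\<close>)
  show thesis
  proof (rule that[OF _ s \<pi>(3)])
    show "\<pi> \<in> ring_hom MB B"
      by (rule ring_hom_memI) (use m \<pi> \<pi>c fc in \<open>simp_all add: one_pure ring_hom_one[OF f(1)]\<close>)
  qed
qed

end

section \<open>Stable conditions\<close>

locale stable_class =
  fixes p :: nat and G :: "'g monoid" and T :: "'g topology" and C :: "'g fin_class"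
  assumes grp: "group G" and prime_p: "Factorial_Ring.prime p"
    and topspace_T: "topspace T = carrier G"
    and stable: "stable_condition p G T C"
begin

lemma class_module:
  assumes "(Y, b) \<in> C"
  shows "finite_ZpG_module p G T Y b"
  using stable assms unfolding stable_condition_def by blast

lemma in_class_finite:
  assumes "in_class G C Q a"
  shows "finite (carrier Q)"
proof -
  obtain Y b h where Y: "(Y, b) \<in> C" "h \<in> iso Q Y"
    using assms unfolding in_class_def G_isomorphic_def by auto
  obtain n where "order Y = p ^ n" using class_module[OF Y(1)] unfolding finite_ZpG_module_def by auto
  \<comment> \<open>\<open>card\<close> is 0 on infinite sets, so the nonzero value
    \<open>p ^ n\<close> forces finiteness.\<close>
  then have "card (carrier Y) \<noteq> 0" using prime_gt_0_nat[OF prime_p] by (simp add: order_def)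
  then have "finite (carrier Y)" using card.infinite[of "carrier Y"] by argo
  moreover have "bij_betw h (carrier Q) (carrier Y)" using Y(2) by (simp add: iso_def)
  ultimately show ?thesis using bij_betw_finite[of h] by simp
qed

text \<open>Closure under quotients is postulated only for members with carrier in
  \<open>nat\<close> and quotients by subgroups. An arbitrary equivariant quotient of
  \<open>Q\<close> is reached by carrying \<open>f\<close> over to the copy \<open>Y\<close> of
  \<open>Q\<close> and dividing \<open>Y\<close> by its kernel.\<close>

lemma in_class_factor:
  assumes Q: "in_class G C Q a" "group Q" "group Q'"
    and closed: "\<And>g x. g \<in> carrier G \<Longrightarrow> x \<in> carrier Q \<Longrightarrow> a g x \<in> carrier Q"
    and f: "f \<in> hom Q Q'" "f ` carrier Q = carrier Q'"
    and equiv: "\<And>g x. g \<in> carrier G \<Longrightarrow> x \<in> carrier Q \<Longrightarrow> f (a g x) = a' g (f x)"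
  shows "in_class G C Q' a'"
proof -
  obtain Y b h where Y: "(Y, b) \<in> C" and h: "h \<in> iso Q Y"
    "\<And>g x. g \<in> carrier G \<Longrightarrow> x \<in> carrier Q \<Longrightarrow> h (a g x) = b g (h x)"
    using Q(1) unfolding in_class_def G_isomorphic_def by auto
  interpret Q: group Q by fact
  interpret Q': group Q' by fact
  interpret G: group G by (rule grp)
  have fin: "finite_ZpG_module p G T Y b" by (rule class_module[OF Y])
  then interpret Y: comm_group Y unfolding finite_ZpG_module_def by blast
  have bhom: "b g \<in> hom Y Y" if "g \<in> carrier G" for g using fin that unfolding finite_ZpG_module_def by blast
  have bone: "b \<one>\<^bsub>G\<^esub> y = y" if "y \<in> carrier Y" for y using fin that unfolding finite_ZpG_module_def by blast
  have bmult: "b (g \<otimes>\<^bsub>G\<^esub> g') y = b g (b g' y)" if "g \<in> carrier G" "g' \<in> carrier G" "y \<in> carrier Y" for g g' y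
    using fin that unfolding finite_ZpG_module_def by blast
  have bc: "b g y \<in> carrier Y" if "g \<in> carrier G" "y \<in> carrier Y" for g y
    using hom_in_carrier[OF bhom] that by blast
  define k where "k = inv_into (carrier Q) h"
  have k: "k \<in> iso Y Q" unfolding k_def by (rule Q.iso_set_sym[OF h(1)])
  have hb: "bij_betw h (carrier Q) (carrier Y)" using h(1) by (simp add: iso_def)
  have kh: "k (h x) = x" if "x \<in> carrier Q" for x
    unfolding k_def using hb that by (simp add: bij_betw_def)
  have hk: "\<exists>x \<in> carrier Q. y = h x" if "y \<in> carrier Y" for y
    using hb that unfolding bij_betw_def by blast
  define f' where "f' = f \<circ> k"
  interpret f': group_hom Y Q' f'
    using k f(1) hom_compose[of k Y Q f Q'] by unfold_locales (simp add: f'_def iso_def)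
  have f'surj: "f' ` carrier Y = carrier Q'"
  proof -
    have "k ` carrier Y = carrier Q" using k by (simp add: iso_def bij_betw_def)
    then show ?thesis using f(2) unfolding f'_def by (metis image_comp)
  qed
  have f'eq: "f' (b g y) = a' g (f' y)" if g: "g \<in> carrier G" and y: "y \<in> carrier Y" for g y
  proof -
    obtain x where x: "x \<in> carrier Q" "y = h x" using hk y by blast
    have "f' (b g y) = f (k (h (a g x)))" using x g h(2)[of g x] by (simp add: f'_def)
    also have "\<dots> = a' g (f x)" using kh[OF closed[OF g x(1)]] equiv[OF g x(1)] by simp
    also have "f x = f' y" using x kh by (simp add: f'_def)
    finally show ?thesis .
  qed
  let ?K = "kernel Y Q' f'"
  have bK: "b g ` ?K \<subseteq> ?K" if g: "g \<in> carrier G" for g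
  proof clarify
    fix y assume y: "y \<in> ?K"
    \<comment> \<open>That \<open>a'\<close> fixes the identity is not a hypothesis; it is inherited
      from \<open>b g\<close> through \<open>f'\<close>.\<close>
    have "a' g \<one>\<^bsub>Q'\<^esub> = \<one>\<^bsub>Q'\<^esub>"
      using f'eq[OF g Y.one_closed] group_hom.hom_one[of Y Y "b g"] bhom[OF g] Y.group_axioms
      by (simp add: group_hom_def group_hom_axioms_def)
    then show "b g y \<in> ?K" using y g f'eq bc by (simp add: kernel_def)
  qed
  \<comment> \<open>On cosets the group acts by images of sets, so the image of the kernel must be
    the whole kernel; the inverse group element gives the missing inclusion.\<close>
  have bK': "b g ` ?K = ?K" if g: "g \<in> carrier G" for g
  proof
    show "b g ` ?K \<subseteq> ?K" by (rule bK[OF g])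
    show "?K \<subseteq> b g ` ?K"
    proof
      fix y assume y: "y \<in> ?K"
      then have yc: "y \<in> carrier Y" by (simp add: kernel_def)
      have "b (inv\<^bsub>G\<^esub> g) y \<in> ?K" using bK[of "inv\<^bsub>G\<^esub> g"] g y by blast
      moreover have "b g (b (inv\<^bsub>G\<^esub> g) y) = y"
        using bmult[of g "inv\<^bsub>G\<^esub> g" y] g yc bone by simp
      ultimately show "y \<in> b g ` ?K" by (metis image_eqI)
    qed
  qed
  have bcos: "b g ` (?K #>\<^bsub>Y\<^esub> y) = ?K #>\<^bsub>Y\<^esub> b g y" if g: "g \<in> carrier G" and y: "y \<in> carrier Y" for g y
  proof -
    have m: "b g (u \<otimes>\<^bsub>Y\<^esub> y) = b g u \<otimes>\<^bsub>Y\<^esub> b g y" if "u \<in> ?K" for u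
      using hom_mult[OF bhom[OF g]] that y by (simp add: kernel_def)
    have "b g ` (?K #>\<^bsub>Y\<^esub> y) = (\<lambda>u. b g (u \<otimes>\<^bsub>Y\<^esub> y)) ` ?K"
      unfolding r_coset_def by blast
    also have "\<dots> = (\<lambda>u. b g u \<otimes>\<^bsub>Y\<^esub> b g y) ` ?K" using m by (rule image_cong[OF refl])
    also have "\<dots> = (\<lambda>u. u \<otimes>\<^bsub>Y\<^esub> b g y) ` (b g ` ?K)" by (simp add: image_image)
    also have "\<dots> = ?K #>\<^bsub>Y\<^esub> b g y" unfolding bK'[OF g] r_coset_def by blast
    finally show ?thesis .
  qed
  have "\<forall>(Q, a) \<in> C. \<forall>H. subgroup H Q \<and> (\<forall>g \<in> carrier G. a g ` H \<subseteq> H) \<longrightarrow>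
        in_class G C (Q\<lparr>carrier := H\<rparr>) a \<and> in_class G C (Q Mod H) (\<lambda>g c. a g ` c)"
    using stable unfolding stable_condition_def by blast
  then have "in_class G C (Y Mod ?K) (\<lambda>g c. b g ` c)"
    using Y f'.subgroup_kernel bK by blast
  then obtain Z c \<eta> where Z: "(Z, c) \<in> C" and \<eta>: "\<eta> \<in> iso (Y Mod ?K) Z"
    "\<And>g U. g \<in> carrier G \<Longrightarrow> U \<in> carrier (Y Mod ?K) \<Longrightarrow> \<eta> (b g ` U) = c g (\<eta> U)"
    unfolding in_class_def G_isomorphic_def by auto
  let ?\<tau> = "\<lambda>U. the_elem (f' ` U)"
  have \<tau>: "?\<tau> \<in> iso (Y Mod ?K) Q'" by (rule f'.FactGroup_iso_set[OF f'surj])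
  have quot: "group (Y Mod ?K)" using Y.abelian_FactGroup[OF f'.subgroup_kernel] by (simp add: comm_group_def)
  let ?\<sigma> = "inv_into (carrier (Y Mod ?K)) ?\<tau>"
  have \<sigma>: "?\<sigma> \<in> iso Q' (Y Mod ?K)" by (rule group.iso_set_sym[OF quot \<tau>])
  have \<tau>_coset: "?\<tau> (?K #>\<^bsub>Y\<^esub> y) = f' y" if y: "y \<in> carrier Y" for y
  proof -
    have "f' ` (?K #>\<^bsub>Y\<^esub> y) = {f' y}"
    proof
      show "f' ` (?K #>\<^bsub>Y\<^esub> y) \<subseteq> {f' y}" using y by (auto simp: r_coset_def kernel_def)
      have "\<one>\<^bsub>Y\<^esub> \<in> ?K" by (simp add: kernel_def)
      then have "y \<in> ?K #>\<^bsub>Y\<^esub> y" using y unfolding r_coset_def by force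
      then show "{f' y} \<subseteq> f' ` (?K #>\<^bsub>Y\<^esub> y)" by blast
    qed
    then show ?thesis by simp
  qed
  have inj: "inj_on ?\<tau> (carrier (Y Mod ?K))" using \<tau> by (simp add: iso_def bij_betw_def)
  have co: "?K #>\<^bsub>Y\<^esub> y \<in> carrier (Y Mod ?K)" if "y \<in> carrier Y" for y
    using that by (simp add: carrier_FactGroup)
  have "G_isomorphic G Q' a' Z c"
    unfolding G_isomorphic_def
  proof (intro bexI ballI)
    show "\<eta> \<circ> ?\<sigma> \<in> iso Q' Z" by (rule iso_set_trans[OF \<sigma> \<eta>(1)])
    fix g v assume g: "g \<in> carrier G" and v: "v \<in> carrier Q'"
    obtain y where y: "y \<in> carrier Y" "v = f' y" using f'surj v by blast
    have 1: "?\<sigma> v = ?K #>\<^bsub>Y\<^esub> y"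
      unfolding y(2) \<tau>_coset[OF y(1), symmetric] by (rule inv_into_f_f[OF inj co[OF y(1)]])
    have "a' g v = ?\<tau> (?K #>\<^bsub>Y\<^esub> b g y)" using \<tau>_coset[OF bc[OF g y(1)]] f'eq[OF g y(1)] y(2) by simp
    then have 2: "?\<sigma> (a' g v) = ?K #>\<^bsub>Y\<^esub> b g y" using inv_into_f_f[OF inj co[OF bc[OF g y(1)]]] by simp
    show "(\<eta> \<circ> ?\<sigma>) (a' g v) = c g ((\<eta> \<circ> ?\<sigma>) v)"
      using 1 2 \<eta>(2)[OF g co[OF y(1)]] bcos[OF g y(1)] by simp
  qed
  then show ?thesis using Z unfolding in_class_def by blast
qed

lemma in_class_prod:
  assumes "in_class G C Q a" "in_class G C Q' a'" "group Q" "group Q'"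
    and "\<And>g x. g \<in> carrier G \<Longrightarrow> x \<in> carrier Q \<Longrightarrow> a g x \<in> carrier Q"
    and "\<And>g x. g \<in> carrier G \<Longrightarrow> x \<in> carrier Q' \<Longrightarrow> a' g x \<in> carrier Q'"
  shows "in_class G C (Q \<times>\<times> Q') (\<lambda>g (x, y). (a g x, a' g y))"
proof -
  obtain Y b h where Y: "(Y, b) \<in> C" and h: "h \<in> iso Q Y"
    "\<And>g x. g \<in> carrier G \<Longrightarrow> x \<in> carrier Q \<Longrightarrow> h (a g x) = b g (h x)"
    using assms(1) unfolding in_class_def G_isomorphic_def by auto
  obtain Y' b' h' where Y': "(Y', b') \<in> C" and h': "h' \<in> iso Q' Y'"
    "\<And>g x. g \<in> carrier G \<Longrightarrow> x \<in> carrier Q' \<Longrightarrow> h' (a' g x) = b' g (h' x)"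
    using assms(2) unfolding in_class_def G_isomorphic_def by auto
  have "in_class G C (Y \<times>\<times> Y') (\<lambda>g (x, y). (b g x, b' g y))"
  proof -
    have "\<forall>(Q, a) \<in> C. \<forall>(Y, b) \<in> C. in_class G C (Q \<times>\<times> Y) (\<lambda>g (x, y). (a g x, b g y))"
      using stable unfolding stable_condition_def by blast
    then show ?thesis using Y Y' by blast
  qed
  then obtain Z c \<eta> where Z: "(Z, c) \<in> C" and \<eta>: "\<eta> \<in> iso (Y \<times>\<times> Y') Z"
    "\<And>g x y. g \<in> carrier G \<Longrightarrow> x \<in> carrier Y \<Longrightarrow> y \<in> carrier Y' \<Longrightarrow> \<eta> (b g x, b' g y) = c g (\<eta> (x, y))"
    unfolding in_class_def G_isomorphic_def by auto
  have hc: "h x \<in> carrier Y" if "x \<in> carrier Q" for x using h(1) that by (auto simp: iso_def hom_def)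
  have hc': "h' x \<in> carrier Y'" if "x \<in> carrier Q'" for x using h'(1) that by (auto simp: iso_def hom_def)
  have "G_isomorphic G (Q \<times>\<times> Q') (\<lambda>g (x, y). (a g x, a' g y)) Z c"
    unfolding G_isomorphic_def
  proof (intro bexI ballI)
    show "\<eta> \<circ> (\<lambda>(x, y). (h x, h' y)) \<in> iso (Q \<times>\<times> Q') Z"
      by (rule iso_set_trans[OF group.DirProd_iso_set_trans[OF assms(3) h(1) h'(1)] \<eta>(1)])
    fix g v assume "g \<in> carrier G" "v \<in> carrier (Q \<times>\<times> Q')"
    then show "(\<eta> \<circ> (\<lambda>(x, y). (h x, h' y))) (case v of (x, y) \<Rightarrow> (a g x, a' g y)) =
      c g ((\<eta> \<circ> (\<lambda>(x, y). (h x, h' y))) v)"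
      using h(2) h'(2) \<eta>(2) hc hc' by (cases v) simp
  qed
  then show ?thesis using Z unfolding in_class_def by blast
qed

lemma in_class_trivial:
  assumes "group Q" "carrier Q = {\<one>\<^bsub>Q\<^esub>}" "\<And>g. g \<in> carrier G \<Longrightarrow> a g \<one>\<^bsub>Q\<^esub> = \<one>\<^bsub>Q\<^esub>"
  shows "in_class G C Q a"
proof -
  \<comment> \<open>The zero module on a one-element subset of \<open>nat\<close>, the form in which
    members of the class are recorded.\<close>
  let ?Z = "\<lparr>carrier = {0 :: nat}, monoid.mult = (\<lambda>_ _. 0), one = 0\<rparr>"
  have Z: "finite_ZpG_module p G T ?Z (\<lambda>_ _. 0)"
    unfolding finite_ZpG_module_def
  proof (intro conjI)
    show "comm_group ?Z" by (rule comm_groupI) auto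
    show "\<exists>n. order ?Z = p ^ n" by (rule exI[of _ 0]) (simp add: order_def)
    show "continuous_map (prod_topology T (discrete_topology (carrier ?Z)))
        (discrete_topology (carrier ?Z)) (\<lambda>(g, x). (\<lambda>_ _. 0) g x)"
      by (simp add: case_prod_unfold)
  qed (auto simp: hom_def)
  moreover have "\<forall>Q a. finite_ZpG_module p G T Q a \<and> carrier Q = {\<one>\<^bsub>Q\<^esub>} \<longrightarrow> (Q, a) \<in> C"
    using stable unfolding stable_condition_def by blast
  ultimately have "(?Z, \<lambda>_ _. 0) \<in> C" by (metis monoid.select_convs(2) partial_object.select_convs(1))
  moreover have "G_isomorphic G Q a ?Z (\<lambda>_ _. 0)"
    unfolding G_isomorphic_def
    by (rule bexI[of _ "\<lambda>_. 0"]) (use assms in \<open>auto simp: iso_def hom_def bij_betw_def\<close>)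
  ultimately show ?thesis unfolding in_class_def by blast
qed

text \<open>A stable subgroup that itself satisfies the condition. Large modules are shown to
  satisfy it by exhausting them with such subgroups.\<close>

definition sub_class :: "'x monoid \<Rightarrow> ('g \<Rightarrow> 'x \<Rightarrow> 'x) \<Rightarrow> 'x set \<Rightarrow> bool" where
  "sub_class Q a H \<longleftrightarrow> subgroup H Q \<and> (\<forall>g \<in> carrier G. a g ` H \<subseteq> H) \<and> in_class G C (Q\<lparr>carrier := H\<rparr>) a"

lemma sub_class_image:
  assumes P: "in_class G C P b" "group P" "\<And>g x. g \<in> carrier G \<Longrightarrow> x \<in> carrier P \<Longrightarrow> b g x \<in> carrier P"
    and Q: "group Q" and f: "f \<in> hom P Q"
    and equiv: "\<And>g x. g \<in> carrier G \<Longrightarrow> x \<in> carrier P \<Longrightarrow> f (b g x) = a g (f x)"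
  shows "sub_class Q a (f ` carrier P)"
proof -
  interpret f: group_hom P Q f using P Q f by (simp add: group_hom_def group_hom_axioms_def)
  have s: "subgroup (f ` carrier P) Q" by (rule f.img_is_subgroup)
  have "in_class G C (Q\<lparr>carrier := f ` carrier P\<rparr>) a"
  proof (rule in_class_factor[OF P(1,2)])
    show "group (Q\<lparr>carrier := f ` carrier P\<rparr>)" by (rule subgroup.subgroup_is_group[OF s Q])
    show "f \<in> hom P (Q\<lparr>carrier := f ` carrier P\<rparr>)" using hom_mult[OF f] by (intro homI) simp_all
  qed (simp_all add: P(3) equiv)
  moreover have "a g ` f ` carrier P \<subseteq> f ` carrier P" if g: "g \<in> carrier G" for g
  proof clarify
    fix x assume "x \<in> carrier P"
    then show "a g (f x) \<in> f ` carrier P" using equiv[of g x] P(3)[of g x] g by (metis image_eqI)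
  qed
  ultimately show ?thesis using s unfolding sub_class_def by blast
qed

text \<open>The sum of two submodules is a quotient of their direct sum, so closure under direct
  sums and quotients applies.\<close>

lemma sub_class_join:
  assumes Q: "comm_group Q" "\<And>g. g \<in> carrier G \<Longrightarrow> a g \<in> hom Q Q"
    and H: "sub_class Q a H" and K: "sub_class Q a K"
  shows "sub_class Q a (H <#>\<^bsub>Q\<^esub> K)"
proof -
  interpret Q: comm_group Q by fact
  have sH: "subgroup H Q" and sK: "subgroup K Q" using H K by (auto simp: sub_class_def)
  have c: "x \<in> carrier Q" if "x \<in> H \<or> x \<in> K" for x
    using that subgroup.subset[OF sH] subgroup.subset[OF sK] by blast
  have aH: "a g x \<in> H" if "g \<in> carrier G" "x \<in> H" for g x using H that unfolding sub_class_def by blast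
  have aK: "a g x \<in> K" if "g \<in> carrier G" "x \<in> K" for g x using K that unfolding sub_class_def by blast
  let ?P = "Q\<lparr>carrier := H\<rparr> \<times>\<times> Q\<lparr>carrier := K\<rparr>"
  let ?f = "\<lambda>(x, y). x \<otimes>\<^bsub>Q\<^esub> y"
  have gH: "group (Q\<lparr>carrier := H\<rparr>)" "group (Q\<lparr>carrier := K\<rparr>)"
    using subgroup.subgroup_is_group sH sK Q.group_axioms by blast+
  have "sub_class Q a (?f ` carrier ?P)"
  proof (rule sub_class_image)
    show "in_class G C ?P (\<lambda>g (x, y). (a g x, a g y))"
      by (rule in_class_prod) (use H K gH aH aK in \<open>auto simp: sub_class_def\<close>)
    show "group ?P" by (rule DirProd_group[OF gH])
    show "(case x of (x, y) \<Rightarrow> (a g x, a g y)) \<in> carrier ?P" if "g \<in> carrier G" "x \<in> carrier ?P" for g x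
      using that aH aK by auto
    show "?f \<in> hom ?P Q" using c by (auto simp: hom_def Q.m_ac)
    show "?f (case x of (x, y) \<Rightarrow> (a g x, a g y)) = a g (?f x)" if "g \<in> carrier G" "x \<in> carrier ?P" for g x
      using that c hom_mult[OF Q(2)[OF that(1)]] by auto
  qed (rule Q.group_axioms)
  moreover have "?f ` carrier ?P = H <#>\<^bsub>Q\<^esub> K" by (auto simp: set_mult_def)
  ultimately show ?thesis by simp
qed

text \<open>Finiteness allows the submodules through the individual elements to be joined, one after
  the other, into a single one, which is then everything.\<close>

lemma in_class_cover:
  assumes Q: "comm_group Q" "\<And>g. g \<in> carrier G \<Longrightarrow> a g \<in> hom Q Q" "finite (carrier Q)"
    and cover: "\<And>x. x \<in> carrier Q \<Longrightarrow> \<exists>H. sub_class Q a H \<and> x \<in> H"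
  shows "in_class G C Q a"
proof -
  interpret Q: comm_group Q by fact
  have "\<exists>H. sub_class Q a H \<and> F \<subseteq> H" if "finite F" "F \<subseteq> carrier Q" for F
    using that
  proof (induction)
    case empty
    have one: "a g \<one>\<^bsub>Q\<^esub> = \<one>\<^bsub>Q\<^esub>" if "g \<in> carrier G" for g
      using group_hom.hom_one[of Q Q "a g"] Q(2)[OF that] Q.group_axioms
      by (simp add: group_hom_def group_hom_axioms_def)
    have "sub_class Q a {\<one>\<^bsub>Q\<^esub>}"
      unfolding sub_class_def
      using Q.triv_subgroup one in_class_trivial[of "Q\<lparr>carrier := {\<one>\<^bsub>Q\<^esub>}\<rparr>" a]
        subgroup.subgroup_is_group[OF Q.triv_subgroup Q.group_axioms] by auto
    then show ?case by blast
  next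
    case (insert x F)
    obtain H K where H: "sub_class Q a H" "F \<subseteq> H" and K: "sub_class Q a K" "x \<in> K"
      using insert cover[of x] by blast
    have s: "subgroup H Q" "subgroup K Q" using H K by (auto simp: sub_class_def)
    have "y \<in> H <#>\<^bsub>Q\<^esub> K" if "y \<in> H" for y
      unfolding set_mult_def using that subgroup.one_closed[OF s(2)] subgroup.mem_carrier[OF s(1) that] by force
    moreover have "x \<in> H <#>\<^bsub>Q\<^esub> K"
      unfolding set_mult_def using K(2) subgroup.one_closed[OF s(1)] subgroup.mem_carrier[OF s(2) K(2)] by force
    ultimately show ?case using sub_class_join[OF Q(1,2) H(1) K(1)] H(2) by blast
  qed
  from this[OF Q(3)] obtain H where "sub_class Q a H" "carrier Q \<subseteq> H" by blast
  then show ?thesis using subgroup.subset[of H Q] by (auto simp: sub_class_def dest: antisym)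
qed

end

section \<open>Extensions of characters\<close>

lemma with_action_simps [simp]:
  "carrier (with_action M a) = carrier M" "ring.zero (with_action M a) = ring.zero M"
  "ring.add (with_action M a) = ring.add M" "smult (with_action M a) = smult M"
  "act (with_action M a) = a"
  by (simp_all add: with_action_def module.defs gmodule.defs)

lemma twist_simps [simp]:
  "carrier (twist \<chi> M) = carrier M" "ring.zero (twist \<chi> M) = ring.zero M"
  "ring.add (twist \<chi> M) = ring.add M" "smult (twist \<chi> M) = smult M"
  "act (twist \<chi> M) g x = \<chi> g \<odot>\<^bsub>M\<^esub> x"
  by (simp_all add: twist_def)

text \<open>Passing to \<open>twist\<close> or \<open>with_action\<close> keeps the fields that the
  module axioms read, so module structures transfer.\<close>

lemma module_cong:
  assumes "module A M" "carrier M' = carrier M" "ring.zero M' = ring.zero M"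
    "ring.add M' = ring.add M" "smult M' = smult M"
  shows "module A M'"
proof -
  interpret module A M by fact
  have "abelian_group M'"
  proof (rule abelian_groupI)
    show "\<exists>y \<in> carrier M'. y \<oplus>\<^bsub>M'\<^esub> x = \<zero>\<^bsub>M'\<^esub>" if "x \<in> carrier M'" for x
      using that by (intro bexI[of _ "\<ominus>\<^bsub>M\<^esub> x"]) (simp_all add: assms M.l_neg)
  qed (simp_all add: assms M.a_ac)
  then show ?thesis
    by (intro moduleI) (simp_all add: assms is_cring smult_l_distr smult_r_distr smult_assoc1)
qed

lemma self_module: "cring A \<Longrightarrow> module A (self_module A)"
proof -
  assume "cring A"
  then interpret cring A .
  have "abelian_group (self_module A)"
  proof (rule abelian_groupI)
    show "\<exists>y \<in> carrier (self_module A). y \<oplus>\<^bsub>self_module A\<^esub> x = \<zero>\<^bsub>self_module A\<^esub>"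
      if "x \<in> carrier (self_module A)" for x
      using that by (intro bexI[of _ "\<ominus>\<^bsub>A\<^esub> x"]) (simp_all add: l_neg)
  qed (simp_all add: a_ac)
  then show ?thesis by (intro moduleI) (simp_all add: is_cring l_distr r_distr m_assoc)
qed

lemma ideal_smul_cong:
  assumes "carrier M' = carrier M" "ring.zero M' = ring.zero M"
    "ring.add M' = ring.add M" "smult M' = smult M"
  shows "ideal_smul I M' = ideal_smul I M"
proof -
  have *: "generate (add_monoid M') S = generate (add_monoid M) S" for S
  proof -
    have inv_eq: "inv\<^bsub>add_monoid M'\<^esub> x = inv\<^bsub>add_monoid M\<^esub> x" for x
      by (simp add: m_inv_def assms)
    have "x \<in> generate (add_monoid M') S \<longleftrightarrow> x \<in> generate (add_monoid M) S" for x
    proof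
      show "x \<in> generate (add_monoid M') S \<Longrightarrow> x \<in> generate (add_monoid M) S"
      proof (induction rule: generate.induct)
        case one
        show ?case using generate.one[of "add_monoid M" S] by (simp add: assms)
      next
        case (incl h)
        then show ?case by (rule generate.incl)
      next
        case (inv h)
        then show ?case unfolding inv_eq by (rule generate.inv)
      next
        case (eng h1 h2)
        then show ?case using generate.eng[OF eng.IH] by (simp add: assms)
      qed
      show "x \<in> generate (add_monoid M) S \<Longrightarrow> x \<in> generate (add_monoid M') S"
      proof (induction rule: generate.induct)
        case one
        show ?case using generate.one[of "add_monoid M'" S] by (simp add: assms)
      next
        case (incl h)
        then show ?case by (rule generate.incl)
      next
        case (inv h)
        then show ?case unfolding inv_eq[symmetric] by (rule generate.inv)
      next
        case (eng h1 h2)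
        then show ?case using generate.eng[OF eng.IH] by (simp add: assms)
      qed
    qed
    then show ?thesis by blast
  qed
  show ?thesis unfolding ideal_smul_def * by (simp add: assms)
qed

lemma AG_moduleD:
  assumes "AG_module G T A V"
  shows "module A V"
    and "\<And>g x. g \<in> carrier G \<Longrightarrow> x \<in> carrier V \<Longrightarrow> act V g x \<in> carrier V"
    and "\<And>g x y. g \<in> carrier G \<Longrightarrow> x \<in> carrier V \<Longrightarrow> y \<in> carrier V \<Longrightarrow>
      act V g (x \<oplus>\<^bsub>V\<^esub> y) = act V g x \<oplus>\<^bsub>V\<^esub> act V g y"
    and "\<And>g a x. g \<in> carrier G \<Longrightarrow> a \<in> carrier A \<Longrightarrow> x \<in> carrier V \<Longrightarrow>
      act V g (a \<odot>\<^bsub>V\<^esub> x) = a \<odot>\<^bsub>V\<^esub> act V g x"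
    and "\<And>x. x \<in> carrier V \<Longrightarrow> act V \<one>\<^bsub>G\<^esub> x = x"
    and "\<And>g h x. g \<in> carrier G \<Longrightarrow> h \<in> carrier G \<Longrightarrow> x \<in> carrier V \<Longrightarrow>
      act V (g \<otimes>\<^bsub>G\<^esub> h) x = act V g (act V h x)"
    and "continuous_map (prod_topology T (adic A V)) (adic A V) (\<lambda>(g, x). act V g x)"
  using assms unfolding AG_module_def mod_hom_def by blast+

lemma mod_homD:
  assumes "f \<in> mod_hom A M N"
  shows "x \<in> carrier M \<Longrightarrow> f x \<in> carrier N"
    and "x \<in> carrier M \<Longrightarrow> y \<in> carrier M \<Longrightarrow> f (x \<oplus>\<^bsub>M\<^esub> y) = f x \<oplus>\<^bsub>N\<^esub> f y"
    and "a \<in> carrier A \<Longrightarrow> x \<in> carrier M \<Longrightarrow> f (a \<odot>\<^bsub>M\<^esub> x) = a \<odot>\<^bsub>N\<^esub> f x"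
  using assms unfolding mod_hom_def by blast+

lemma mod_homI:
  assumes "\<And>x. x \<in> carrier M \<Longrightarrow> f x \<in> carrier N"
    and "\<And>x y. x \<in> carrier M \<Longrightarrow> y \<in> carrier M \<Longrightarrow> f (x \<oplus>\<^bsub>M\<^esub> y) = f x \<oplus>\<^bsub>N\<^esub> f y"
    and "\<And>a x. a \<in> carrier A \<Longrightarrow> x \<in> carrier M \<Longrightarrow> f (a \<odot>\<^bsub>M\<^esub> x) = a \<odot>\<^bsub>N\<^esub> f x"
  shows "f \<in> mod_hom A M N"
  using assms unfolding mod_hom_def by blast

lemma AG_homD:
  assumes "f \<in> AG_hom G A M N"
  shows "f \<in> mod_hom A M N"
    and "g \<in> carrier G \<Longrightarrow> x \<in> carrier M \<Longrightarrow> f (act M g x) = act N g (f x)"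
  using assms unfolding AG_hom_def by blast+

lemma AG_homI:
  assumes "f \<in> mod_hom A M N"
    and "\<And>g x. g \<in> carrier G \<Longrightarrow> x \<in> carrier M \<Longrightarrow> f (act M g x) = act N g (f x)"
  shows "f \<in> AG_hom G A M N"
  using assms unfolding AG_hom_def by blast

lemma mod_hom_zero:
  assumes "module A M" "module A N" "f \<in> mod_hom A M N"
  shows "f \<zero>\<^bsub>M\<^esub> = \<zero>\<^bsub>N\<^esub>"
proof -
  interpret M: module A M by fact
  interpret N: module A N by fact
  have "f \<zero>\<^bsub>M\<^esub> \<in> carrier N" using mod_homD(1)[OF assms(3)] by simp
  then show ?thesis using mod_homD(2)[OF assms(3), of "\<zero>\<^bsub>M\<^esub>" "\<zero>\<^bsub>M\<^esub>"] by (simp add: N.add.l_cancel_one')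
qed

lemma mod_hom_minus:
  assumes "module A M" "module A N" "f \<in> mod_hom A M N" "x \<in> carrier M" "y \<in> carrier M"
  shows "f (x \<ominus>\<^bsub>M\<^esub> y) = f x \<ominus>\<^bsub>N\<^esub> f y"
proof -
  interpret M: module A M by fact
  interpret N: module A N by fact
  note f = mod_homD[OF assms(3)]
  have "f (x \<ominus>\<^bsub>M\<^esub> y) \<oplus>\<^bsub>N\<^esub> f y = f x"
    using f(2)[of "x \<ominus>\<^bsub>M\<^esub> y" y] assms(4,5) by (simp add: M.minus_eq M.a_assoc M.l_neg)
  then have "f x \<ominus>\<^bsub>N\<^esub> f y = (f (x \<ominus>\<^bsub>M\<^esub> y) \<oplus>\<^bsub>N\<^esub> f y) \<ominus>\<^bsub>N\<^esub> f y" by simp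
  also have "\<dots> = f (x \<ominus>\<^bsub>M\<^esub> y)" using f(1) assms(4,5) by (simp add: N.minus_eq N.a_assoc N.r_neg)
  finally show ?thesis by simp
qed

lemma mod_hom_fil:
  assumes "adic_module A M" "adic_module A N" "f \<in> mod_hom A M N"
    "x \<in> ideal_smul (ideal_pow A (maxid A) n) M"
  shows "f x \<in> ideal_smul (ideal_pow A (maxid A) n) N"
proof -
  interpret M: adic_module A M by fact
  interpret N: adic_module A N by fact
  note f = mod_homD[OF assms(3)]
  show ?thesis
  proof (rule M.ideal_smul_image[OF N.module_axioms N.ideal_pow_carrier _ _ _ assms(4) M.ideal_pow_carrier])
    show "f \<in> carrier M \<rightarrow> carrier N" using f(1) by blast
    show "f (a \<odot>\<^bsub>M\<^esub> x) \<in> ideal_smul (ideal_pow A (maxid A) n) N"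
      if "a \<in> ideal_pow A (maxid A) n" "x \<in> carrier M" for a x
      using f(3)[of a x] N.ideal_smul_incl[OF that(1), of "f x"] f(1) that subsetD[OF M.ideal_pow_carrier] by simp
  qed (rule f(2))
qed

lemma continuous_map_mod_hom:
  assumes "adic_module A M" "adic_module A N" "f \<in> mod_hom A M N"
  shows "continuous_map (adic A M) (adic A N) f"
proof -
  interpret M: adic_module A M by fact
  interpret N: adic_module A N by fact
  note f = mod_homD[OF assms(3)]
  show ?thesis unfolding N.continuous_map_adic
  proof (intro conjI ballI allI exI)
    show "f \<in> topspace (adic A M) \<rightarrow> carrier N" using f(1) by simp
    fix t n assume t: "t \<in> topspace (adic A M)"
    then have tc: "t \<in> carrier M" by simp
    show "openin (adic A M) {y \<in> carrier M. y \<ominus>\<^bsub>M\<^esub> t \<in> M.fil n}" by (rule M.openin_fil_coset[OF tc])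
    show "t \<in> {y \<in> carrier M. y \<ominus>\<^bsub>M\<^esub> t \<in> M.fil n}"
      using tc M.fil_closed(1) by (simp add: M.minus_eq M.M.r_neg)
    fix u assume "u \<in> {y \<in> carrier M. y \<ominus>\<^bsub>M\<^esub> t \<in> M.fil n}"
    then show "f u \<ominus>\<^bsub>N\<^esub> f t \<in> N.fil n"
      using mod_hom_fil[OF assms, of "u \<ominus>\<^bsub>M\<^esub> t" n]
        mod_hom_minus[OF M.module_axioms N.module_axioms assms(3), of u t] tc by simp
  qed
qed

section \<open>Equivalence of extensions\<close>

lemma extensionsD:
  assumes "(V, i, q) \<in> extensions G T A V1 V2"
  shows "AG_module G T A V" "i \<in> AG_hom G A V2 V" "q \<in> AG_hom G A V V1" "inj_on i (carrier V2)"
    "q ` carrier V = carrier V1" "i ` carrier V2 = {v \<in> carrier V. q v = \<zero>\<^bsub>V1\<^esub>}"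
  using assms unfolding extensions_def by blast+

text \<open>The short five lemma: a morphism that is the identity on both ends is bijective, so any
  such morphism already witnesses equivalence of extensions.\<close>

lemma extension_morphism_iso:
  assumes V1: "module A V1" and V2: "module A V2"
    and V: "(V, i, q) \<in> extensions G T A V1 V2" and V': "(V', i', q') \<in> extensions G T A V1 V2"
    and \<phi>: "\<phi> \<in> AG_hom G A V V'" "\<And>x. x \<in> carrier V2 \<Longrightarrow> \<phi> (i x) = i' x"
      "\<And>v. v \<in> carrier V \<Longrightarrow> q' (\<phi> v) = q v"
  shows "((V, i, q), (V', i', q')) \<in> ext_rel G T A V1 V2"
proof -
  note VD = extensionsD[OF V] and VD' = extensionsD[OF V']
  interpret V1: module A V1 by fact
  interpret V2: module A V2 by fact
  interpret V: module A V by (rule AG_moduleD(1)[OF VD(1)])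
  interpret V': module A V' by (rule AG_moduleD(1)[OF VD'(1)])
  note h\<phi> = AG_homD(1)[OF \<phi>(1)] note \<phi>h = mod_homD[OF h\<phi>]
  note hq = AG_homD(1)[OF VD(3)] note qh = mod_homD[OF hq]
  note hi = AG_homD(1)[OF VD(2)] note ih = mod_homD[OF hi]
  note hq' = AG_homD(1)[OF VD'(3)] note qh' = mod_homD[OF hq']
  note hi' = AG_homD(1)[OF VD'(2)] note ih' = mod_homD[OF hi']
  have inj: "inj_on \<phi> (carrier V)"
  proof (rule inj_onI)
    fix v w assume v: "v \<in> carrier V" and w: "w \<in> carrier V" and eq: "\<phi> v = \<phi> w"
    let ?d = "v \<ominus>\<^bsub>V\<^esub> w"
    have d: "?d \<in> carrier V" using v w by simp
    have \<phi>d: "\<phi> ?d = \<zero>\<^bsub>V'\<^esub>"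
      using mod_hom_minus[OF V.module_axioms V'.module_axioms h\<phi> v w] eq \<phi>h(1)[OF w]
      by (simp add: V'.minus_eq V'.M.r_neg)
    \<comment> \<open>A difference killed by \<open>\<phi>\<close> lies in the kernel of
      \<open>q\<close>, hence comes from \<open>V2\<close>, where \<open>\<phi>\<close> restricts to
      the injective map \<open>i'\<close>.\<close>
    have "q ?d = q' (\<phi> ?d)" using \<phi>(3)[OF d] by simp
    also have "\<dots> = \<zero>\<^bsub>V1\<^esub>" unfolding \<phi>d by (rule mod_hom_zero[OF V'.module_axioms V1.module_axioms hq'])
    finally have "?d \<in> i ` carrier V2" using d VD(6) by blast
    then obtain x where x: "x \<in> carrier V2" "?d = i x" by blast
    have "i' x = i' \<zero>\<^bsub>V2\<^esub>"
      using \<phi>(2)[OF x(1)] x(2) \<phi>d mod_hom_zero[OF V2.module_axioms V'.module_axioms hi'] by simp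
    then have "x = \<zero>\<^bsub>V2\<^esub>" using VD'(4) x(1) by (auto dest: inj_onD)
    then have "?d = \<zero>\<^bsub>V\<^esub>" using x(2) mod_hom_zero[OF V2.module_axioms V.module_axioms hi] by simp
    then show "v = w" using v w V.M.add_minus_cancel[OF v w] by simp
  qed
  moreover have "\<phi> ` carrier V = carrier V'"
  proof
    show "\<phi> ` carrier V \<subseteq> carrier V'" using \<phi>h(1) by blast
    show "carrier V' \<subseteq> \<phi> ` carrier V"
    proof
      fix v' assume v': "v' \<in> carrier V'"
      have "q' v' \<in> q ` carrier V" using VD(5) qh'(1)[OF v'] by simp
      then obtain v where v: "v \<in> carrier V" "q v = q' v'" by auto
      \<comment> \<open>A lift \<open>v\<close> of the image of \<open>v'\<close> hits
        \<open>v'\<close> up to an element of \<open>V2\<close>, which then corrects the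
        lift.\<close>
      have "q' (v' \<ominus>\<^bsub>V'\<^esub> \<phi> v) = \<zero>\<^bsub>V1\<^esub>"
        using mod_hom_minus[OF V'.module_axioms V1.module_axioms hq' v' \<phi>h(1)[OF v(1)]] v \<phi>(3)[OF v(1)] qh(1)[OF v(1)]
        by (simp add: V1.minus_eq V1.M.r_neg)
      then have "v' \<ominus>\<^bsub>V'\<^esub> \<phi> v \<in> i' ` carrier V2" using VD'(6) v' \<phi>h(1)[OF v(1)] by simp
      then obtain x where x: "x \<in> carrier V2" "v' \<ominus>\<^bsub>V'\<^esub> \<phi> v = i' x" by blast
      have "\<phi> (v \<oplus>\<^bsub>V\<^esub> i x) = \<phi> v \<oplus>\<^bsub>V'\<^esub> (v' \<ominus>\<^bsub>V'\<^esub> \<phi> v)"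
        using \<phi>h(2)[OF v(1) ih(1)[OF x(1)]] \<phi>(2)[OF x(1)] x(2) by simp
      also have "\<dots> = v'" by (rule V'.M.add_minus_cancel[OF v' \<phi>h(1)[OF v(1)]])
      finally show "v' \<in> \<phi> ` carrier V" using v(1) ih(1)[OF x(1)] by (metis V.M.a_closed image_eqI)
    qed
  qed
  ultimately have "bij_betw \<phi> (carrier V) (carrier V')" by (simp add: bij_betw_def)
  then show ?thesis using V V' \<phi> unfolding ext_rel_def by blast
qed

lemma ext_relD:
  assumes "((V, i, q), (V', i', q')) \<in> ext_rel G T A V1 V2"
  obtains \<phi> where "(V, i, q) \<in> extensions G T A V1 V2" "(V', i', q') \<in> extensions G T A V1 V2"
    "\<phi> \<in> AG_hom G A V V'" "bij_betw \<phi> (carrier V) (carrier V')"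
    "\<And>x. x \<in> carrier V2 \<Longrightarrow> \<phi> (i x) = i' x" "\<And>v. v \<in> carrier V \<Longrightarrow> q' (\<phi> v) = q v"
  using assms unfolding ext_rel_def by blast

lemma AG_hom_compose:
  assumes "f \<in> AG_hom G A U V" "h \<in> AG_hom G A V W"
  shows "(\<lambda>x. h (f x)) \<in> AG_hom G A U W"
proof -
  note f = mod_homD[OF AG_homD(1)[OF assms(1)]] AG_homD(2)[OF assms(1)]
  note h = mod_homD[OF AG_homD(1)[OF assms(2)]] AG_homD(2)[OF assms(2)]
  show ?thesis by (intro AG_homI mod_homI) (simp_all add: f h)
qed

lemma AG_hom_inv:
  assumes f: "f \<in> AG_hom G A U V" "bij_betw f (carrier U) (carrier V)"
    and U: "AG_module G T A U" and V: "AG_module G T A V"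
  shows "inv_into (carrier U) f \<in> AG_hom G A V U"
proof -
  note fh = mod_homD[OF AG_homD(1)[OF f(1)]] AG_homD(2)[OF f(1)]
  interpret U: module A U by (rule AG_moduleD(1)[OF U])
  let ?k = "inv_into (carrier U) f"
  have k: "?k y \<in> carrier U" "f (?k y) = y" if "y \<in> carrier V" for y
    using f(2) that by (auto simp: bij_betw_def inv_into_into f_inv_into_f)
  have kf: "?k (f x) = x" if "x \<in> carrier U" for x using f(2) that by (simp add: bij_betw_def)
  show ?thesis
  proof (intro AG_homI mod_homI)
    show "?k x \<in> carrier U" if "x \<in> carrier V" for x by (rule k(1)[OF that])
    show "?k (x \<oplus>\<^bsub>V\<^esub> y) = ?k x \<oplus>\<^bsub>U\<^esub> ?k y" if "x \<in> carrier V" "y \<in> carrier V" for x y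
      using fh(2)[of "?k x" "?k y"] kf[of "?k x \<oplus>\<^bsub>U\<^esub> ?k y"] k that by simp
    show "?k (a \<odot>\<^bsub>V\<^esub> x) = a \<odot>\<^bsub>U\<^esub> ?k x" if "a \<in> carrier A" "x \<in> carrier V" for a x
      using fh(3)[of a "?k x"] kf[of "a \<odot>\<^bsub>U\<^esub> ?k x"] k that by simp
    show "?k (act V g x) = act U g (?k x)" if "g \<in> carrier G" "x \<in> carrier V" for g x
      using fh(4)[of g "?k x"] kf[of "act U g (?k x)"] AG_moduleD(2)[OF U, of g "?k x"] k that by simp
  qed
qed

lemma ext_rel_sym:
  assumes "(x, y) \<in> ext_rel G T A V1 V2"
  shows "(y, x) \<in> ext_rel G T A V1 V2"
proof -
  obtain V i q V' i' q' where xy: "x = (V, i, q)" "y = (V', i', q')" by (cases x; cases y) auto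
  obtain \<phi> where V: "(V, i, q) \<in> extensions G T A V1 V2" and V': "(V', i', q') \<in> extensions G T A V1 V2"
    and \<phi>: "\<phi> \<in> AG_hom G A V V'" "bij_betw \<phi> (carrier V) (carrier V')"
    "\<And>x. x \<in> carrier V2 \<Longrightarrow> \<phi> (i x) = i' x" "\<And>v. v \<in> carrier V \<Longrightarrow> q' (\<phi> v) = q v"
    using assms unfolding xy by (rule ext_relD) blast
  note VD = extensionsD[OF V] and VD' = extensionsD[OF V']
  let ?k = "inv_into (carrier V) \<phi>"
  have k: "?k y \<in> carrier V" "\<phi> (?k y) = y" if "y \<in> carrier V'" for y
    using \<phi>(2) that by (auto simp: bij_betw_def inv_into_into f_inv_into_f)
  have "?k \<in> AG_hom G A V' V" by (rule AG_hom_inv[OF \<phi>(1,2) VD(1) VD'(1)])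
  moreover have "bij_betw ?k (carrier V') (carrier V)" by (rule bij_betw_inv_into[OF \<phi>(2)])
  moreover have "?k (i' x) = i x" if "x \<in> carrier V2" for x
  proof -
    have "i x \<in> carrier V" using mod_homD(1)[OF AG_homD(1)[OF VD(2)] that] .
    then have "?k (\<phi> (i x)) = i x" using \<phi>(2) by (simp add: bij_betw_def)
    then show ?thesis using \<phi>(3)[OF that] by simp
  qed
  moreover have "q (?k v) = q' v" if "v \<in> carrier V'" for v
    using \<phi>(4)[OF k(1)[OF that]] k(2)[OF that] by simp
  ultimately show ?thesis using V V' unfolding xy ext_rel_def by blast
qed

lemma ext_rel_trans:
  assumes "(x, y) \<in> ext_rel G T A V1 V2" "(y, z) \<in> ext_rel G T A V1 V2"
  shows "(x, z) \<in> ext_rel G T A V1 V2"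
proof -
  obtain V i q V' i' q' V'' i'' q'' where xy: "x = (V, i, q)" "y = (V', i', q')" "z = (V'', i'', q'')"
    by (cases x; cases y; cases z) auto
  obtain \<phi> where V: "(V, i, q) \<in> extensions G T A V1 V2"
    and \<phi>: "\<phi> \<in> AG_hom G A V V'" "bij_betw \<phi> (carrier V) (carrier V')"
    "\<And>x. x \<in> carrier V2 \<Longrightarrow> \<phi> (i x) = i' x" "\<And>v. v \<in> carrier V \<Longrightarrow> q' (\<phi> v) = q v"
    using assms(1) unfolding xy by (rule ext_relD) blast
  obtain \<psi> where V': "(V'', i'', q'') \<in> extensions G T A V1 V2"
    and \<psi>: "\<psi> \<in> AG_hom G A V' V''" "bij_betw \<psi> (carrier V') (carrier V'')"
    "\<And>x. x \<in> carrier V2 \<Longrightarrow> \<psi> (i' x) = i'' x" "\<And>v. v \<in> carrier V' \<Longrightarrow> q'' (\<psi> v) = q' v"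
    using assms(2) unfolding xy by (rule ext_relD) blast
  have c: "\<phi> v \<in> carrier V'" if "v \<in> carrier V" for v using mod_homD(1)[OF AG_homD(1)[OF \<phi>(1)] that] .
  have "bij_betw (\<lambda>x. \<psi> (\<phi> x)) (carrier V) (carrier V'')"
    using bij_betw_trans[OF \<phi>(2) \<psi>(2)] by (simp add: o_def)
  moreover have "\<psi> (\<phi> (i x)) = i'' x" if "x \<in> carrier V2" for x using \<phi>(3) \<psi>(3) that by simp
  moreover have "q'' (\<psi> (\<phi> v)) = q v" if "v \<in> carrier V" for v using \<phi>(4) \<psi>(4) c that by simp
  ultimately show ?thesis using V V' AG_hom_compose[OF \<phi>(1) \<psi>(1)] unfolding xy ext_rel_def by blast
qed

lemma ext_rel_refl:
  assumes "x \<in> extensions G T A V1 V2"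
  shows "(x, x) \<in> ext_rel G T A V1 V2"
proof -
  obtain V i q where x: "x = (V, i, q)" by (cases x) auto
  have "(\<lambda>v. v) \<in> AG_hom G A V V" by (intro AG_homI mod_homI) simp_all
  moreover have "bij_betw (\<lambda>v. v) (carrier V) (carrier V)" by (simp add: bij_betw_def)
  ultimately show ?thesis using assms unfolding x ext_rel_def by blast
qed

lemma ext_rel_equiv: "equiv (extensions G T A V1 V2) (ext_rel G T A V1 V2)"
proof (rule equivI)
  show "ext_rel G T A V1 V2 \<subseteq> extensions G T A V1 V2 \<times> extensions G T A V1 V2"
    unfolding ext_rel_def by auto
  show "refl_on (extensions G T A V1 V2) (ext_rel G T A V1 V2)"
    by (rule refl_onI) (rule ext_rel_refl)
  show "sym (ext_rel G T A V1 V2)" by (rule symI) (rule ext_rel_sym)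
  show "trans (ext_rel G T A V1 V2)" by (rule transI) (rule ext_rel_trans)
qed

section \<open>Cocycles and the extensions they define\<close>

lemma (in adic_module) continuous_map_add:
  assumes f: "continuous_map T (adic R M) f" and h: "continuous_map T (adic R M) h"
  shows "continuous_map T (adic R M) (\<lambda>t. f t \<oplus>\<^bsub>M\<^esub> h t)"
  unfolding continuous_map_adic
proof (intro conjI ballI allI)
  note f' = f[unfolded continuous_map_adic] and h' = h[unfolded continuous_map_adic]
  have fc: "f t \<in> carrier M" "h t \<in> carrier M" if "t \<in> topspace T" for t using f' h' that by auto
  show "(\<lambda>t. f t \<oplus>\<^bsub>M\<^esub> h t) \<in> topspace T \<rightarrow> carrier M" using fc by simp
  fix t n assume t: "t \<in> topspace T"
  obtain U where U: "openin T U" "t \<in> U" "\<forall>u \<in> U. f u \<ominus>\<^bsub>M\<^esub> f t \<in> fil n"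
    using f' t by blast
  obtain W where W: "openin T W" "t \<in> W" "\<forall>u \<in> W. h u \<ominus>\<^bsub>M\<^esub> h t \<in> fil n"
    using h' t by blast
  show "\<exists>U. openin T U \<and> t \<in> U \<and> (\<forall>u \<in> U. (f u \<oplus>\<^bsub>M\<^esub> h u) \<ominus>\<^bsub>M\<^esub> (f t \<oplus>\<^bsub>M\<^esub> h t) \<in> fil n)"
  proof (intro exI conjI ballI)
    show "openin T (U \<inter> W)" using U W by blast
    show "t \<in> U \<inter> W" using U W by blast
    fix u assume u: "u \<in> U \<inter> W"
    have uc: "u \<in> topspace T" using u openin_subset[OF U(1)] by blast
    have "(f u \<oplus>\<^bsub>M\<^esub> h u) \<ominus>\<^bsub>M\<^esub> (f t \<oplus>\<^bsub>M\<^esub> h t) = (f u \<ominus>\<^bsub>M\<^esub> f t) \<oplus>\<^bsub>M\<^esub> (h u \<ominus>\<^bsub>M\<^esub> h t)"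
      using fc[OF uc] fc[OF t] by (simp add: M.minus_eq M.minus_add M.a_ac)
    then show "(f u \<oplus>\<^bsub>M\<^esub> h u) \<ominus>\<^bsub>M\<^esub> (f t \<oplus>\<^bsub>M\<^esub> h t) \<in> fil n"
      using u U(3) W(3) fil_closed(2) by simp
  qed
qed

text \<open>Upper triangular matrices acting on column vectors. \<open>\<chi>'\<close> is the
  character on the submodule and \<open>\<chi>\<close> the one on the quotient; \<open>M\<close>
  stands first because \<open>extensions\<close> puts the submodule first in the product
  type.\<close>

definition ext_module ::
  "('a, 'x) ring_scheme \<Rightarrow> ('a, 'm) module \<Rightarrow> ('g \<Rightarrow> 'a) \<Rightarrow> ('g \<Rightarrow> 'a) \<Rightarrow> ('g \<Rightarrow> 'm)
     \<Rightarrow> ('a, 'm \<times> 'a, 'g) gmodule" where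
  "ext_module A M \<chi> \<chi>' b =
     \<lparr>carrier = carrier M \<times> carrier A, monoid.mult = undefined, monoid.one = undefined,
      ring.zero = (\<zero>\<^bsub>M\<^esub>, \<zero>\<^bsub>A\<^esub>),
      ring.add = (\<lambda>v w. (fst v \<oplus>\<^bsub>M\<^esub> fst w, snd v \<oplus>\<^bsub>A\<^esub> snd w)),
      smult = (\<lambda>a v. (a \<odot>\<^bsub>M\<^esub> fst v, a \<otimes>\<^bsub>A\<^esub> snd v)),
      act = (\<lambda>g v. (\<chi>' g \<odot>\<^bsub>M\<^esub> fst v \<oplus>\<^bsub>M\<^esub> snd v \<odot>\<^bsub>M\<^esub> b g, \<chi> g \<otimes>\<^bsub>A\<^esub> snd v))\<rparr>"

locale char_pair =
  fixes A :: "('a, 'x) ring_scheme" (structure) and G :: "'g monoid" and T :: "'g topology"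
    and \<chi> \<chi>' :: "'g \<Rightarrow> 'a"
  assumes A: "cring A" and max: "ideal (maxid A) A"
    and grp: "group G" and top: "topspace T = carrier G"
    and \<chi>: "\<chi> \<in> hom G (units_of A)" "continuous_map T (adic A (self_module A)) \<chi>"
    and \<chi>': "\<chi>' \<in> hom G (units_of A)" "continuous_map T (adic A (self_module A)) \<chi>'"
begin

sublocale A: cring A by (rule A)
sublocale G: group G by (rule grp)

lemma \<chi>_closed [simp]: "g \<in> carrier G \<Longrightarrow> \<chi> g \<in> carrier A" "g \<in> carrier G \<Longrightarrow> \<chi>' g \<in> carrier A"
  using \<chi>(1) \<chi>'(1) by (auto simp: hom_def units_of_def)

lemma \<chi>_mult [simp]:
  "g \<in> carrier G \<Longrightarrow> h \<in> carrier G \<Longrightarrow> \<chi> (g \<otimes>\<^bsub>G\<^esub> h) = \<chi> g \<otimes> \<chi> h"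
  "g \<in> carrier G \<Longrightarrow> h \<in> carrier G \<Longrightarrow> \<chi>' (g \<otimes>\<^bsub>G\<^esub> h) = \<chi>' g \<otimes> \<chi>' h"
  using \<chi>(1) \<chi>'(1) by (auto simp: hom_def units_of_def)

lemma \<chi>_one [simp]: "\<chi> \<one>\<^bsub>G\<^esub> = \<one>" "\<chi>' \<one>\<^bsub>G\<^esub> = \<one>"
  using hom_one[OF \<chi>(1) grp A.units_group] hom_one[OF \<chi>'(1) grp A.units_group]
  by (simp_all add: units_of_def)

lemma adic_moduleI: "module A M \<Longrightarrow> adic_module A M"
  using max by (simp add: adic_module_def adic_module_axioms_def)

lemma self_adic: "adic_module A (self_module A)" by (rule adic_moduleI[OF self_module[OF A]])

abbreviation "V1 \<equiv> char_module A \<chi>"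
abbreviation "V2 M \<equiv> twist \<chi>' M"
abbreviation "VE M b \<equiv> ext_module A M \<chi> \<chi>' b"

lemma VE_simps [simp]:
  "carrier (VE M b) = carrier M \<times> carrier A" "ring.zero (VE M b) = (\<zero>\<^bsub>M\<^esub>, \<zero>)"
  "v \<oplus>\<^bsub>VE M b\<^esub> w = (fst v \<oplus>\<^bsub>M\<^esub> fst w, snd v \<oplus> snd w)"
  "a \<odot>\<^bsub>VE M b\<^esub> v = (a \<odot>\<^bsub>M\<^esub> fst v, a \<otimes> snd v)"
  "act (VE M b) g v = (\<chi>' g \<odot>\<^bsub>M\<^esub> fst v \<oplus>\<^bsub>M\<^esub> snd v \<odot>\<^bsub>M\<^esub> b g, \<chi> g \<otimes> snd v)"
  by (simp_all add: ext_module_def)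

lemma VE_module:
  assumes "module A M"
  shows "module A (VE M b)"
proof -
  interpret M: module A M by fact
  have "abelian_group (VE M b)"
  proof (rule abelian_groupI)
    show "\<exists>y \<in> carrier (VE M b). y \<oplus>\<^bsub>VE M b\<^esub> v = \<zero>\<^bsub>VE M b\<^esub>" if "v \<in> carrier (VE M b)" for v
      using that by (intro bexI[of _ "(\<ominus>\<^bsub>M\<^esub> fst v, \<ominus> snd v)"]) (auto simp: M.M.l_neg A.l_neg)
  qed (auto simp: M.M.a_ac A.a_ac)
  then show ?thesis
    by (intro moduleI) (auto simp: A M.smult_l_distr M.smult_r_distr M.smult_assoc1 A.l_distr A.r_distr A.m_assoc)
qed

text \<open>The rule for the upper right entry of a product of matrices
  \<open>(\<chi>' g, b g; 0, \<chi> g)\<close>, with continuity added. After division by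
  \<open>\<chi>\<close> this is a continuous 1-cocycle with values in \<open>M\<close> twisted by
  the quotient of \<open>\<chi>'\<close> by \<open>\<chi>\<close>.\<close>

definition cocycle :: "('a, 'm) module \<Rightarrow> ('g \<Rightarrow> 'm) \<Rightarrow> bool" where
  "cocycle M b \<longleftrightarrow> (\<forall>g \<in> carrier G. b g \<in> carrier M) \<and>
     (\<forall>g \<in> carrier G. \<forall>h \<in> carrier G. b (g \<otimes>\<^bsub>G\<^esub> h) = \<chi>' g \<odot>\<^bsub>M\<^esub> b h \<oplus>\<^bsub>M\<^esub> \<chi> h \<odot>\<^bsub>M\<^esub> b g) \<and>
     continuous_map T (adic A M) b"

lemma cocycleD:
  assumes "cocycle M b"
  shows "g \<in> carrier G \<Longrightarrow> b g \<in> carrier M"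
    and "g \<in> carrier G \<Longrightarrow> h \<in> carrier G \<Longrightarrow> b (g \<otimes>\<^bsub>G\<^esub> h) = \<chi>' g \<odot>\<^bsub>M\<^esub> b h \<oplus>\<^bsub>M\<^esub> \<chi> h \<odot>\<^bsub>M\<^esub> b g"
    and "continuous_map T (adic A M) b"
  using assms unfolding cocycle_def by blast+

lemma VE_AG_module:
  assumes M: "module A M" and b: "cocycle M b"
  shows "AG_module G T A (VE M b)"
proof -
  interpret M: module A M by fact
  interpret V: adic_module A "VE M b" by (rule adic_moduleI[OF VE_module[OF M]])
  note bc = cocycleD(1)[OF b]
  have b1: "b \<one>\<^bsub>G\<^esub> = \<zero>\<^bsub>M\<^esub>"
    using cocycleD(2)[OF b, of "\<one>\<^bsub>G\<^esub>" "\<one>\<^bsub>G\<^esub>"] bc[of "\<one>\<^bsub>G\<^esub>"] by (simp add: M.M.add.l_cancel_one')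
  have lin: "act (VE M b) g \<in> mod_hom A (VE M b) (VE M b)" if g: "g \<in> carrier G" for g
  proof (rule mod_homI)
    show "act (VE M b) g v \<in> carrier (VE M b)" if "v \<in> carrier (VE M b)" for v
      using that g bc by auto
    show "act (VE M b) g (v \<oplus>\<^bsub>VE M b\<^esub> w) = act (VE M b) g v \<oplus>\<^bsub>VE M b\<^esub> act (VE M b) g w"
      if "v \<in> carrier (VE M b)" "w \<in> carrier (VE M b)" for v w
      using that g bc by (auto simp: M.smult_l_distr M.smult_r_distr A.r_distr M.M.a_ac)
    show "act (VE M b) g (a \<odot>\<^bsub>VE M b\<^esub> v) = a \<odot>\<^bsub>VE M b\<^esub> act (VE M b) g v"
      if "a \<in> carrier A" "v \<in> carrier (VE M b)" for a v
      using that g bc by (auto simp: M.smult_r_distr A.m_lcomm A.m_comm simp flip: M.smult_assoc1)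
  qed
  \<comment> \<open>For a fixed vector \<open>(m, x)\<close> the orbit map is a sum of three terms,
    each of them \<open>\<chi>'\<close>, \<open>b\<close> or \<open>\<chi>\<close> followed by a
    linear map, and linear maps are adically continuous.\<close>
  have cont: "continuous_map T (adic A (VE M b)) (\<lambda>g. act (VE M b) g v)" if v: "v \<in> carrier (VE M b)" for v
  proof -
    obtain m x where mx: "v = (m, x)" "m \<in> carrier M" "x \<in> carrier A" using v by auto
    have 1: "(\<lambda>a. (a \<odot>\<^bsub>M\<^esub> m, \<zero>)) \<in> mod_hom A (self_module A) (VE M b)"
      by (rule mod_homI) (simp_all add: mx M.smult_l_distr M.smult_assoc1)
    have 2: "(\<lambda>m'. (x \<odot>\<^bsub>M\<^esub> m', \<zero>)) \<in> mod_hom A M (VE M b)"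
      by (rule mod_homI) (simp_all add: mx M.smult_r_distr A.m_comm flip: M.smult_assoc1)
    have 3: "(\<lambda>a. (\<zero>\<^bsub>M\<^esub>, a \<otimes> x)) \<in> mod_hom A (self_module A) (VE M b)"
      by (rule mod_homI) (simp_all add: mx A.l_distr A.m_assoc)
    note c = continuous_map_mod_hom[OF _ V.adic_module_axioms]
    have "continuous_map T (adic A (VE M b)) (\<lambda>g. ((\<chi>' g \<odot>\<^bsub>M\<^esub> m, \<zero>) \<oplus>\<^bsub>VE M b\<^esub>
        (x \<odot>\<^bsub>M\<^esub> b g, \<zero>)) \<oplus>\<^bsub>VE M b\<^esub> (\<zero>\<^bsub>M\<^esub>, \<chi> g \<otimes> x))"
      by (intro V.continuous_map_add)
        (use continuous_map_compose[OF \<chi>'(2) c[OF self_adic 1]]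
          continuous_map_compose[OF cocycleD(3)[OF b] c[OF adic_moduleI[OF M] 2]]
          continuous_map_compose[OF \<chi>(2) c[OF self_adic 3]] in \<open>simp_all only: o_def\<close>)
    then show ?thesis
      by (rule continuous_map_eq) (simp add: top mx bc)
  qed
  show ?thesis unfolding AG_module_def
  proof (intro conjI ballI)
    show "module A (VE M b)" by (rule V.module_axioms)
    show "act (VE M b) \<one>\<^bsub>G\<^esub> v = v" if "v \<in> carrier (VE M b)" for v
      using that by (auto simp: b1)
    show "act (VE M b) (g \<otimes>\<^bsub>G\<^esub> h) v = act (VE M b) g (act (VE M b) h v)"
      if "g \<in> carrier G" "h \<in> carrier G" "v \<in> carrier (VE M b)" for g h v
    proof -
      obtain m x where mx: "v = (m, x)" "m \<in> carrier M" "x \<in> carrier A" using \<open>v \<in> carrier (VE M b)\<close> by auto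
      have "(\<chi> h \<otimes> x) \<odot>\<^bsub>M\<^esub> b g = x \<odot>\<^bsub>M\<^esub> (\<chi> h \<odot>\<^bsub>M\<^esub> b g)"
        "\<chi>' g \<odot>\<^bsub>M\<^esub> (x \<odot>\<^bsub>M\<^esub> b h) = x \<odot>\<^bsub>M\<^esub> (\<chi>' g \<odot>\<^bsub>M\<^esub> b h)"
        using mx that(1,2) bc by (simp_all add: A.m_comm flip: M.smult_assoc1)
      then show ?thesis using mx that(1,2) bc
        by (simp add: cocycleD(2)[OF b] M.smult_assoc1 M.smult_r_distr M.M.a_ac A.m_assoc)
    qed
    show "continuous_map (prod_topology T (adic A (VE M b))) (adic A (VE M b)) (\<lambda>(g, x). act (VE M b) g x)"
      by (subst V.continuous_map_action) (use lin cont top in auto)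
  qed (rule lin)
qed

lemma VE_extension:
  assumes M: "module A M" and b: "cocycle M b"
  shows "(VE M b, \<lambda>m. (m, \<zero>), snd) \<in> extensions G T A V1 (V2 M)"
proof -
  interpret M: module A M by fact
  note bc = cocycleD(1)[OF b]
  have "(\<lambda>m. (m, \<zero>)) \<in> AG_hom G A (V2 M) (VE M b)"
    by (intro AG_homI mod_homI) (simp_all add: bc)
  moreover have "snd \<in> AG_hom G A (VE M b) V1"
    by (intro AG_homI mod_homI) auto
  moreover have "snd ` carrier (VE M b) = carrier V1" by (force intro: M.M.zero_closed)
  ultimately show ?thesis
    using VE_AG_module[OF M b] unfolding extensions_def by (auto simp: inj_on_def image_iff)
qed

definition ext_class :: "('a, 'm) module \<Rightarrow> ('g \<Rightarrow> 'm) \<Rightarrow> ('a, 'm, 'a, 'g) extension set" where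
  "ext_class M b = ext_rel G T A V1 (V2 M) `` {(VE M b, \<lambda>m. (m, \<zero>), snd)}"

lemma ext_class_iff:
  "e \<in> ext_class M b \<longleftrightarrow> ((VE M b, \<lambda>m. (m, \<zero>), snd), e) \<in> ext_rel G T A V1 (V2 M)"
  by (simp add: ext_class_def)

lemma ext_class_self:
  assumes "module A M" "cocycle M b"
  shows "(VE M b, \<lambda>m. (m, \<zero>), snd) \<in> ext_class M b"
  unfolding ext_class_iff by (rule ext_rel_refl[OF VE_extension[OF assms]])

lemma ext_class_mem:
  assumes "e \<in> ext_class M b"
  shows "e \<in> extensions G T A V1 (V2 M)"
  using assms unfolding ext_class_iff ext_rel_def by auto

lemma ext_class_eq:
  assumes "e \<in> ext_class M b" "e \<in> ext_class M b'"
  shows "ext_class M b = ext_class M b'"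
  using equiv_class_eq[OF ext_rel_equiv] ext_rel_trans[OF assms(1)[unfolded ext_class_iff] ext_rel_sym[OF assms(2)[unfolded ext_class_iff]]]
  unfolding ext_class_def by blast

lemma V1_module: "module A V1"
  by (rule module_cong[OF self_module[OF A]]) simp_all

lemma V2_module: "module A M \<Longrightarrow> module A (V2 M)"
  by (erule module_cong) simp_all

text \<open>An extension with an \<open>A\<close>-linear section \<open>\<sigma>\<close> is determined by the cocycle measuring the
  failure of \<open>\<sigma>\<close> to be equivariant.\<close>

lemma section_ext_class:
  assumes M: "module A M" and b: "cocycle M b"
    and V: "(V, i, q) \<in> extensions G T A V1 (V2 M)"
    and \<sigma>: "\<sigma> \<in> mod_hom A (self_module A) V" "\<And>x. x \<in> carrier A \<Longrightarrow> q (\<sigma> x) = x"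
      "\<And>g x. g \<in> carrier G \<Longrightarrow> x \<in> carrier A \<Longrightarrow>
        act V g (\<sigma> x) = \<sigma> (\<chi> g \<otimes> x) \<oplus>\<^bsub>V\<^esub> i (x \<odot>\<^bsub>M\<^esub> b g)"
  shows "(V, i, q) \<in> ext_class M b"
proof -
  interpret M: module A M by fact
  note VD = extensionsD[OF V]
  interpret V: module A V by (rule AG_moduleD(1)[OF VD(1)])
  note ih = mod_homD[OF AG_homD(1)[OF VD(2)]] AG_homD(2)[OF VD(2)]
  note qh = mod_homD[OF AG_homD(1)[OF VD(3)]]
  note \<sigma>h = mod_homD[OF \<sigma>(1)]
  note av = AG_moduleD(2-4)[OF VD(1)]
  note bc = cocycleD(1)[OF b]
  have ic: "i m \<in> carrier V" if "m \<in> carrier M" for m using ih(1) that by simp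
  have iadd: "i (m \<oplus>\<^bsub>M\<^esub> n) = i m \<oplus>\<^bsub>V\<^esub> i n" if "m \<in> carrier M" "n \<in> carrier M" for m n
    using ih(2)[of m n] that by simp
  have ismul: "i (a \<odot>\<^bsub>M\<^esub> m) = a \<odot>\<^bsub>V\<^esub> i m" if "a \<in> carrier A" "m \<in> carrier M" for a m
    using ih(3)[of a m] that by simp
  have iact: "act V g (i m) = i (\<chi>' g \<odot>\<^bsub>M\<^esub> m)" if "g \<in> carrier G" "m \<in> carrier M" for g m
    using ih(4)[of g m] that by simp
  have \<sigma>c: "\<sigma> x \<in> carrier V" if "x \<in> carrier A" for x using \<sigma>h(1) that by simp
  have \<sigma>add: "\<sigma> (x \<oplus> y) = \<sigma> x \<oplus>\<^bsub>V\<^esub> \<sigma> y" if "x \<in> carrier A" "y \<in> carrier A" for x y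
    using \<sigma>h(2)[of x y] that by simp
  have \<sigma>smul: "\<sigma> (a \<otimes> x) = a \<odot>\<^bsub>V\<^esub> \<sigma> x" if "a \<in> carrier A" "x \<in> carrier A" for a x
    using \<sigma>h(3)[of a x] that by simp
  have q0: "q (i m) = \<zero>" if "m \<in> carrier M" for m
    using VD(6) that by auto
  have \<sigma>0: "\<sigma> \<zero> = \<zero>\<^bsub>V\<^esub>"
    using mod_hom_zero[OF self_module[OF A] V.module_axioms \<sigma>(1)] by simp
  \<comment> \<open>The section identifies the middle term with the product; equivariance is the
    hypothesis on \<open>act V g (\<sigma> x)\<close>.\<close>
  let ?\<phi> = "\<lambda>v. i (fst v) \<oplus>\<^bsub>V\<^esub> \<sigma> (snd v)"
  have "((VE M b, \<lambda>m. (m, \<zero>), snd), (V, i, q)) \<in> ext_rel G T A V1 (V2 M)"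
  proof (rule extension_morphism_iso[OF V1_module V2_module[OF M] VE_extension[OF M b] V])
    show "?\<phi> \<in> AG_hom G A (VE M b) V"
    proof (intro AG_homI mod_homI)
      show "?\<phi> v \<in> carrier V" if "v \<in> carrier (VE M b)" for v using that ic \<sigma>c by auto
      show "?\<phi> (v \<oplus>\<^bsub>VE M b\<^esub> w) = ?\<phi> v \<oplus>\<^bsub>V\<^esub> ?\<phi> w"
        if "v \<in> carrier (VE M b)" "w \<in> carrier (VE M b)" for v w
        using that ic \<sigma>c iadd \<sigma>add by (auto simp: V.M.a_ac)
      show "?\<phi> (a \<odot>\<^bsub>VE M b\<^esub> v) = a \<odot>\<^bsub>V\<^esub> ?\<phi> v" if "a \<in> carrier A" "v \<in> carrier (VE M b)" for a v
        using that ic \<sigma>c ismul \<sigma>smul by (auto simp: V.smult_r_distr)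
      show "?\<phi> (act (VE M b) g v) = act V g (?\<phi> v)" if "g \<in> carrier G" "v \<in> carrier (VE M b)" for g v
      proof -
        obtain m x where mx: "v = (m, x)" "m \<in> carrier M" "x \<in> carrier A" using \<open>v \<in> carrier (VE M b)\<close> by auto
        have "act V g (?\<phi> v) = i (\<chi>' g \<odot>\<^bsub>M\<^esub> m) \<oplus>\<^bsub>V\<^esub> (\<sigma> (\<chi> g \<otimes> x) \<oplus>\<^bsub>V\<^esub> i (x \<odot>\<^bsub>M\<^esub> b g))"
          using av(2)[of g "i m" "\<sigma> x"] mx that(1) ic \<sigma>c iact \<sigma>(3) by simp
        then show ?thesis using mx that(1) ic \<sigma>c bc iadd by (simp add: V.M.a_ac)
      qed
    qed
    show "?\<phi> (m, \<zero>) = i m" if "m \<in> carrier (V2 M)" for m using that ic \<sigma>0 by simp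
    show "q (?\<phi> v) = snd v" if v: "v \<in> carrier (VE M b)" for v
    proof -
      obtain m x where mx: "v = (m, x)" "m \<in> carrier M" "x \<in> carrier A" using v by auto
      show ?thesis using mx qh(2)[of "i m" "\<sigma> x"] ic \<sigma>c q0 \<sigma>(2) by simp
    qed
  qed
  then show ?thesis by (simp add: ext_class_iff)
qed

text \<open>The quotient \<open>A\<close> is free of rank one, so a preimage \<open>s\<close> of
  \<open>\<one>\<close> splits every extension linearly. The cocycle is the component in
  \<open>M\<close> of \<open>act V g s\<close>.\<close>

lemma extension_ext_class:
  assumes M: "module A M" and V: "(V, i, q) \<in> extensions G T A V1 (V2 M)"
  obtains b where "cocycle M b" "(V, i, q) \<in> ext_class M b"
proof -
  interpret M: module A M by fact
  note VD = extensionsD[OF V]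
  interpret V: adic_module A V by (rule adic_moduleI[OF AG_moduleD(1)[OF VD(1)]])
  note ih = mod_homD[OF AG_homD(1)[OF VD(2)]] AG_homD(2)[OF VD(2)]
  note qh = mod_homD[OF AG_homD(1)[OF VD(3)]] AG_homD(2)[OF VD(3)]
  note av = AG_moduleD(2-6)[OF VD(1)]
  have ic: "i m \<in> carrier V" if "m \<in> carrier M" for m using ih(1) that by simp
  have iadd: "i (m \<oplus>\<^bsub>M\<^esub> n) = i m \<oplus>\<^bsub>V\<^esub> i n" if "m \<in> carrier M" "n \<in> carrier M" for m n
    using ih(2)[of m n] that by simp
  have ismul: "i (a \<odot>\<^bsub>M\<^esub> m) = a \<odot>\<^bsub>V\<^esub> i m" if "a \<in> carrier A" "m \<in> carrier M" for a m
    using ih(3)[of a m] that by simp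
  have iact: "act V g (i m) = i (\<chi>' g \<odot>\<^bsub>M\<^esub> m)" if "g \<in> carrier G" "m \<in> carrier M" for g m
    using ih(4)[of g m] that by simp
  have qadd: "q (v \<oplus>\<^bsub>V\<^esub> w) = q v \<oplus> q w" if "v \<in> carrier V" "w \<in> carrier V" for v w
    using qh(2)[OF that] by simp
  have qsmul: "q (a \<odot>\<^bsub>V\<^esub> v) = a \<otimes> q v" if "a \<in> carrier A" "v \<in> carrier V" for a v
    using qh(3)[OF that] by simp
  have qc: "q v \<in> carrier A" if "v \<in> carrier V" for v using qh(1)[OF that] by simp
  have qi: "i m \<in> carrier V \<and> q (i m) = \<zero>" if "m \<in> carrier M" for m
    using VD(6) that by auto
  have qD: "\<exists>m \<in> carrier M. v = i m" if "v \<in> carrier V" "q v = \<zero>" for v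
    using VD(6) that by auto
  have "\<one> \<in> q ` carrier V" unfolding VD(5) by simp
  then obtain s where s: "s \<in> carrier V" "q s = \<one>" by force
  \<comment> \<open>The linear retraction onto \<open>M\<close> along the chosen section. Being
    linear it is continuous, so it turns the orbit map of \<open>s\<close> into a continuous
    cocycle.\<close>
  define r where "r v = inv_into (carrier M) i (v \<ominus>\<^bsub>V\<^esub> q v \<odot>\<^bsub>V\<^esub> s)" for v
  have inj: "inj_on i (carrier M)" using VD(4) by simp
  have r: "r v \<in> carrier M \<and> v = i (r v) \<oplus>\<^bsub>V\<^esub> q v \<odot>\<^bsub>V\<^esub> s" if v: "v \<in> carrier V" for v
  proof -
    have c: "q v \<odot>\<^bsub>V\<^esub> s \<in> carrier V" using qc[OF v] s by simp
    have "q (v \<ominus>\<^bsub>V\<^esub> q v \<odot>\<^bsub>V\<^esub> s) = \<zero>"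
      using qadd[of "q v \<odot>\<^bsub>V\<^esub> s" "v \<ominus>\<^bsub>V\<^esub> q v \<odot>\<^bsub>V\<^esub> s"] V.M.add_minus_cancel[OF v c]
        qsmul[OF qc[OF v] s(1)] s qc v c by (simp add: A.add.l_cancel_one)
    then obtain m where m: "m \<in> carrier M" "v \<ominus>\<^bsub>V\<^esub> q v \<odot>\<^bsub>V\<^esub> s = i m"
      using qD[of "v \<ominus>\<^bsub>V\<^esub> q v \<odot>\<^bsub>V\<^esub> s"] v c by auto
    then have "r v = m" unfolding r_def using inj by simp
    moreover have "v = q v \<odot>\<^bsub>V\<^esub> s \<oplus>\<^bsub>V\<^esub> (v \<ominus>\<^bsub>V\<^esub> q v \<odot>\<^bsub>V\<^esub> s)"
      using V.M.add_minus_cancel[OF v c] by simp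
    ultimately show ?thesis using m c ic[OF m(1)] by (metis V.M.a_comm)
  qed
  have r_unique: "r v = m" if "v \<in> carrier V" "m \<in> carrier M" "x \<in> carrier A" "v = i m \<oplus>\<^bsub>V\<^esub> x \<odot>\<^bsub>V\<^esub> s" for v m x
  proof -
    have "q v = x" using that s qi[of m] by (simp add: qadd qsmul)
    then have "i m \<oplus>\<^bsub>V\<^esub> x \<odot>\<^bsub>V\<^esub> s = i (r v) \<oplus>\<^bsub>V\<^esub> x \<odot>\<^bsub>V\<^esub> s" using r[OF that(1)] that(4) by simp
    then have "i m = i (r v)" using r[OF that(1)] ic that s by (simp add: V.M.add.right_cancel)
    then show ?thesis using inj that(2) r[OF that(1)] by (auto dest: inj_onD)
  qed
  have r_hom: "r \<in> mod_hom A V M"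
  proof (rule mod_homI)
    show "r v \<in> carrier M" if "v \<in> carrier V" for v using r[OF that] by simp
    show "r (v \<oplus>\<^bsub>V\<^esub> w) = r v \<oplus>\<^bsub>M\<^esub> r w" if "v \<in> carrier V" "w \<in> carrier V" for v w
    proof (rule r_unique[of _ _ "q v \<oplus> q w"])
      have "v \<oplus>\<^bsub>V\<^esub> w = (i (r v) \<oplus>\<^bsub>V\<^esub> q v \<odot>\<^bsub>V\<^esub> s) \<oplus>\<^bsub>V\<^esub> (i (r w) \<oplus>\<^bsub>V\<^esub> q w \<odot>\<^bsub>V\<^esub> s)"
        using r that by simp
      also have "\<dots> = i (r v \<oplus>\<^bsub>M\<^esub> r w) \<oplus>\<^bsub>V\<^esub> (q v \<oplus> q w) \<odot>\<^bsub>V\<^esub> s"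
        using r[OF that(1)] r[OF that(2)] qc that s ic
        by (simp add: iadd V.smult_l_distr V.M.a_ac)
      finally show "v \<oplus>\<^bsub>V\<^esub> w = i (r v \<oplus>\<^bsub>M\<^esub> r w) \<oplus>\<^bsub>V\<^esub> (q v \<oplus> q w) \<odot>\<^bsub>V\<^esub> s" .
    qed (use that r qc in auto)
    show "r (a \<odot>\<^bsub>V\<^esub> v) = a \<odot>\<^bsub>M\<^esub> r v" if "a \<in> carrier A" "v \<in> carrier V" for a v
    proof (rule r_unique[of _ _ "a \<otimes> q v"])
      have "a \<odot>\<^bsub>V\<^esub> v = a \<odot>\<^bsub>V\<^esub> (i (r v) \<oplus>\<^bsub>V\<^esub> q v \<odot>\<^bsub>V\<^esub> s)" using r that by simp
      also have "\<dots> = i (a \<odot>\<^bsub>M\<^esub> r v) \<oplus>\<^bsub>V\<^esub> (a \<otimes> q v) \<odot>\<^bsub>V\<^esub> s"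
        using conjunct1[OF r[OF that(2)]] qc[OF that(2)] that(1) s ic
        by (simp add: ismul V.smult_r_distr V.smult_assoc1)
      finally show "a \<odot>\<^bsub>V\<^esub> v = i (a \<odot>\<^bsub>M\<^esub> r v) \<oplus>\<^bsub>V\<^esub> (a \<otimes> q v) \<odot>\<^bsub>V\<^esub> s" .
    qed (use that r qc in auto)
  qed
  define b where "b g = r (act V g s)" for g
  have gs: "act V g s = i (b g) \<oplus>\<^bsub>V\<^esub> \<chi> g \<odot>\<^bsub>V\<^esub> s" and bc: "b g \<in> carrier M" if g: "g \<in> carrier G" for g
  proof -
    have "q (act V g s) = \<chi> g" using qh(4)[OF g s(1)] s g by simp
    then show "act V g s = i (b g) \<oplus>\<^bsub>V\<^esub> \<chi> g \<odot>\<^bsub>V\<^esub> s" "b g \<in> carrier M"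
      using r[OF av(1)[OF g s(1)]] by (simp_all add: b_def)
  qed
  have "cocycle M b" unfolding cocycle_def
  proof (intro conjI ballI)
    show "b (g \<otimes>\<^bsub>G\<^esub> h) = \<chi>' g \<odot>\<^bsub>M\<^esub> b h \<oplus>\<^bsub>M\<^esub> \<chi> h \<odot>\<^bsub>M\<^esub> b g" if g: "g \<in> carrier G" and h: "h \<in> carrier G" for g h
      unfolding b_def[of "g \<otimes>\<^bsub>G\<^esub> h"]
    proof (rule r_unique[of _ _ "\<chi> g \<otimes> \<chi> h"])
      have "act V (g \<otimes>\<^bsub>G\<^esub> h) s = act V g (i (b h) \<oplus>\<^bsub>V\<^esub> \<chi> h \<odot>\<^bsub>V\<^esub> s)"
        using av(5)[OF g h s(1)] gs[OF h] by simp
      also have "\<dots> = i (\<chi>' g \<odot>\<^bsub>M\<^esub> b h) \<oplus>\<^bsub>V\<^esub> \<chi> h \<odot>\<^bsub>V\<^esub> (i (b g) \<oplus>\<^bsub>V\<^esub> \<chi> g \<odot>\<^bsub>V\<^esub> s)"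
        using av(2)[OF g] av(3)[OF g] g h s ic bc iact gs by simp
      also have "\<dots> = i (\<chi>' g \<odot>\<^bsub>M\<^esub> b h \<oplus>\<^bsub>M\<^esub> \<chi> h \<odot>\<^bsub>M\<^esub> b g) \<oplus>\<^bsub>V\<^esub> (\<chi> g \<otimes> \<chi> h) \<odot>\<^bsub>V\<^esub> s"
        using g h s ic bc by (simp add: iadd ismul V.smult_r_distr V.M.a_assoc A.m_comm[of "\<chi> g"] flip: V.smult_assoc1)
      finally show "act V (g \<otimes>\<^bsub>G\<^esub> h) s = i (\<chi>' g \<odot>\<^bsub>M\<^esub> b h \<oplus>\<^bsub>M\<^esub> \<chi> h \<odot>\<^bsub>M\<^esub> b g) \<oplus>\<^bsub>V\<^esub> (\<chi> g \<otimes> \<chi> h) \<odot>\<^bsub>V\<^esub> s" .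
    qed (use g h bc av(1) s in auto)
    have "continuous_map T (prod_topology T (adic A V)) (\<lambda>g. (g, s))"
      using s by (simp add: continuous_map_pairwise o_def)
    from continuous_map_compose[OF this AG_moduleD(7)[OF VD(1)]]
    have "continuous_map T (adic A V) (\<lambda>g. act V g s)" by (simp add: o_def)
    from continuous_map_compose[OF this continuous_map_mod_hom[OF V.adic_module_axioms adic_moduleI[OF M] r_hom]]
    show "continuous_map T (adic A M) b" by (simp add: o_def b_def[abs_def])
  qed (rule bc)
  moreover have "(V, i, q) \<in> ext_class M b"
  proof (rule section_ext_class[OF M \<open>cocycle M b\<close> V])
    show "(\<lambda>x. x \<odot>\<^bsub>V\<^esub> s) \<in> mod_hom A (self_module A) V"
      by (rule mod_homI) (simp_all add: s V.smult_l_distr V.smult_assoc1)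
    show "q (x \<odot>\<^bsub>V\<^esub> s) = x" if "x \<in> carrier A" for x using qsmul[OF that s(1)] s that by simp
    show "act V g (x \<odot>\<^bsub>V\<^esub> s) = (\<chi> g \<otimes> x) \<odot>\<^bsub>V\<^esub> s \<oplus>\<^bsub>V\<^esub> i (x \<odot>\<^bsub>M\<^esub> b g)"
      if "g \<in> carrier G" "x \<in> carrier A" for g x
      using av(3)[OF that s(1)] gs[OF that(1)] that s ic[OF bc[OF that(1)]] bc[OF that(1)]
      by (simp add: V.smult_r_distr ismul V.M.a_comm A.m_comm[of "\<chi> g"] flip: V.smult_assoc1)
  qed
  ultimately show thesis by (rule that)
qed

text \<open>An equivalence sends \<open>(0, 1)\<close> to some \<open>(n, 1)\<close>, and
  equivariance on this vector says that the two cocycles differ by the coboundary of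
  \<open>n\<close>, written here without subtraction.\<close>

lemma ext_class_eqD:
  assumes M: "module A M" and b: "cocycle M b" and b': "cocycle M b'"
    and eq: "ext_class M b = ext_class M b'"
  obtains n where "n \<in> carrier M"
    "\<And>g. g \<in> carrier G \<Longrightarrow> b g \<oplus>\<^bsub>M\<^esub> \<chi> g \<odot>\<^bsub>M\<^esub> n = b' g \<oplus>\<^bsub>M\<^esub> \<chi>' g \<odot>\<^bsub>M\<^esub> n"
proof -
  interpret M: module A M by fact
  note bc = cocycleD(1)[OF b] and bc' = cocycleD(1)[OF b']
  have "((VE M b, \<lambda>m. (m, \<zero>), snd), (VE M b', \<lambda>m. (m, \<zero>), snd)) \<in> ext_rel G T A V1 (V2 M)"
    using ext_class_self[OF M b'] eq ext_class_iff by blast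
  then obtain \<phi> where \<phi>: "\<phi> \<in> AG_hom G A (VE M b) (VE M b')"
    "\<And>x. x \<in> carrier (V2 M) \<Longrightarrow> \<phi> (x, \<zero>) = (x, \<zero>)"
    "\<And>v. v \<in> carrier (VE M b) \<Longrightarrow> snd (\<phi> v) = snd v"
    by (rule ext_relD) blast
  note \<phi>h = mod_homD[OF AG_homD(1)[OF \<phi>(1)]] AG_homD(2)[OF \<phi>(1)]
  obtain n where n: "\<phi> (\<zero>\<^bsub>M\<^esub>, \<one>) = (n, \<one>)" "n \<in> carrier M"
    using \<phi>(3)[of "(\<zero>\<^bsub>M\<^esub>, \<one>)"] \<phi>h(1)[of "(\<zero>\<^bsub>M\<^esub>, \<one>)"]
    by (cases "\<phi> (\<zero>\<^bsub>M\<^esub>, \<one>)") auto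
  show thesis
  proof (rule that[OF n(2)])
    fix g assume g: "g \<in> carrier G"
    have "\<phi> (act (VE M b) g (\<zero>\<^bsub>M\<^esub>, \<one>)) = \<phi> ((b g, \<zero>) \<oplus>\<^bsub>VE M b\<^esub> \<chi> g \<odot>\<^bsub>VE M b\<^esub> (\<zero>\<^bsub>M\<^esub>, \<one>))"
      using g bc by simp
    also have "\<dots> = \<phi> (b g, \<zero>) \<oplus>\<^bsub>VE M b'\<^esub> \<chi> g \<odot>\<^bsub>VE M b'\<^esub> \<phi> (\<zero>\<^bsub>M\<^esub>, \<one>)"
      using g bc \<phi>h(2)[of "(b g, \<zero>)" "\<chi> g \<odot>\<^bsub>VE M b\<^esub> (\<zero>\<^bsub>M\<^esub>, \<one>)"] \<phi>h(3)[of "\<chi> g" "(\<zero>\<^bsub>M\<^esub>, \<one>)"]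
      by simp
    also have "\<dots> = (b g \<oplus>\<^bsub>M\<^esub> \<chi> g \<odot>\<^bsub>M\<^esub> n, \<chi> g)" using g n bc \<phi>(2)[of "b g"] by simp
    finally show "b g \<oplus>\<^bsub>M\<^esub> \<chi> g \<odot>\<^bsub>M\<^esub> n = b' g \<oplus>\<^bsub>M\<^esub> \<chi>' g \<odot>\<^bsub>M\<^esub> n"
      using \<phi>h(4)[OF g, of "(\<zero>\<^bsub>M\<^esub>, \<one>)"] n g bc' by (simp add: M.M.a_comm)
  qed
qed

text \<open>Converse to the preceding lemma: \<open>x \<mapsto> (x n, x)\<close> is a linear section
  of the extension of \<open>b'\<close> whose failure to be equivariant is measured by
  \<open>b\<close>.\<close>

lemma ext_class_eqI:
  assumes M: "module A M" and b: "cocycle M b" and b': "cocycle M b'" and n: "n \<in> carrier M"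
    and eq: "\<And>g. g \<in> carrier G \<Longrightarrow> b g \<oplus>\<^bsub>M\<^esub> \<chi> g \<odot>\<^bsub>M\<^esub> n = b' g \<oplus>\<^bsub>M\<^esub> \<chi>' g \<odot>\<^bsub>M\<^esub> n"
  shows "ext_class M b = ext_class M b'"
proof (rule ext_class_eq)
  interpret M: module A M by fact
  note bc = cocycleD(1)[OF b] and bc' = cocycleD(1)[OF b']
  show "(VE M b', \<lambda>m. (m, \<zero>), snd) \<in> ext_class M b'" by (rule ext_class_self[OF M b'])
  show "(VE M b', \<lambda>m. (m, \<zero>), snd) \<in> ext_class M b"
  proof (rule section_ext_class[OF M b VE_extension[OF M b']])
    show "(\<lambda>x. (x \<odot>\<^bsub>M\<^esub> n, x)) \<in> mod_hom A (self_module A) (VE M b')"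
      by (rule mod_homI) (simp_all add: n M.smult_l_distr M.smult_assoc1)
    show "act (VE M b') g (x \<odot>\<^bsub>M\<^esub> n, x) =
      ((\<chi> g \<otimes> x) \<odot>\<^bsub>M\<^esub> n, \<chi> g \<otimes> x) \<oplus>\<^bsub>VE M b'\<^esub> (x \<odot>\<^bsub>M\<^esub> b g, \<zero>)"
      if g: "g \<in> carrier G" and x: "x \<in> carrier A" for g x
    proof -
      have "\<chi>' g \<odot>\<^bsub>M\<^esub> (x \<odot>\<^bsub>M\<^esub> n) \<oplus>\<^bsub>M\<^esub> x \<odot>\<^bsub>M\<^esub> b' g = x \<odot>\<^bsub>M\<^esub> (b' g \<oplus>\<^bsub>M\<^esub> \<chi>' g \<odot>\<^bsub>M\<^esub> n)"
        using g x n bc' by (simp add: M.smult_r_distr M.M.a_comm A.m_comm flip: M.smult_assoc1)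
      also have "\<dots> = x \<odot>\<^bsub>M\<^esub> (b g \<oplus>\<^bsub>M\<^esub> \<chi> g \<odot>\<^bsub>M\<^esub> n)" using eq[OF g] by simp
      also have "\<dots> = (\<chi> g \<otimes> x) \<odot>\<^bsub>M\<^esub> n \<oplus>\<^bsub>M\<^esub> x \<odot>\<^bsub>M\<^esub> b g"
        using g x n bc by (simp add: M.smult_r_distr M.M.a_comm A.m_comm[of "\<chi> g"] M.smult_assoc1)
      finally show ?thesis using g x by simp
    qed
  qed simp
qed

lemma cocycle_map:
  assumes M: "module A M" and M': "module A M'" and b: "cocycle M b" and f: "f \<in> mod_hom A M M'"
  shows "cocycle M' (\<lambda>g. f (b g))"
proof -
  interpret M: module A M by fact
  note bc = cocycleD(1)[OF b] and fh = mod_homD[OF f]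
  show ?thesis unfolding cocycle_def
  proof (intro conjI ballI)
    show "f (b (g \<otimes>\<^bsub>G\<^esub> h)) = \<chi>' g \<odot>\<^bsub>M'\<^esub> f (b h) \<oplus>\<^bsub>M'\<^esub> \<chi> h \<odot>\<^bsub>M'\<^esub> f (b g)"
      if "g \<in> carrier G" "h \<in> carrier G" for g h
      using that bc fh by (simp add: cocycleD(2)[OF b])
    show "continuous_map T (adic A M') (\<lambda>g. f (b g))"
      using continuous_map_compose[OF cocycleD(3)[OF b] continuous_map_mod_hom[OF adic_moduleI[OF M] adic_moduleI[OF M'] f]]
      by (simp add: o_def)
  qed (use bc fh in simp)
qed

lemma cocycle_add:
  assumes M: "module A M" and b: "cocycle M b" and b': "cocycle M b'"
  shows "cocycle M (\<lambda>g. b g \<oplus>\<^bsub>M\<^esub> b' g)"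
proof -
  interpret M: adic_module A M by (rule adic_moduleI[OF M])
  note bc = cocycleD(1)[OF b] and bc' = cocycleD(1)[OF b']
  show ?thesis unfolding cocycle_def
  proof (intro conjI ballI)
    show "b (g \<otimes>\<^bsub>G\<^esub> h) \<oplus>\<^bsub>M\<^esub> b' (g \<otimes>\<^bsub>G\<^esub> h) = \<chi>' g \<odot>\<^bsub>M\<^esub> (b h \<oplus>\<^bsub>M\<^esub> b' h) \<oplus>\<^bsub>M\<^esub> \<chi> h \<odot>\<^bsub>M\<^esub> (b g \<oplus>\<^bsub>M\<^esub> b' g)"
      if "g \<in> carrier G" "h \<in> carrier G" for g h
      using that bc bc' by (simp add: cocycleD(2)[OF b] cocycleD(2)[OF b'] M.smult_r_distr M.M.a_ac)
    show "continuous_map T (adic A M) (\<lambda>g. b g \<oplus>\<^bsub>M\<^esub> b' g)"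
      by (rule M.continuous_map_add[OF cocycleD(3)[OF b] cocycleD(3)[OF b']])
  qed (use bc bc' in simp)
qed

text \<open>The pushforward is the set of extensions receiving a suitable morphism, so two
  inclusions arise. Given a morphism, the images of the vectors \<open>(0, x)\<close> form a section
  with cocycle \<open>f (b g)\<close>; in the other direction, \<open>f\<close> applied to the first
  coordinate supplies the morphism.\<close>

lemma ext_push_class:
  assumes M: "module A M" and M': "module A M'" and b: "cocycle M b" and f: "f \<in> mod_hom A M M'"
  shows "ext_push G T A V1 (V2 M) (V2 M') f (ext_class M b) = ext_class M' (\<lambda>g. f (b g))"
proof -
  interpret M: module A M by fact
  interpret M': module A M' by fact
  note bc = cocycleD(1)[OF b] and fh = mod_homD[OF f]
  note fb = cocycle_map[OF M M' b f]
  have f0: "f \<zero>\<^bsub>M\<^esub> = \<zero>\<^bsub>M'\<^esub>" by (rule mod_hom_zero[OF M M' f])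
  show ?thesis
  proof (intro equalityI subsetI)
    fix e assume "e \<in> ext_push G T A V1 (V2 M) (V2 M') f (ext_class M b)"
    then obtain W j r V i q \<phi> where e: "e = (W, j, r)" and W: "(W, j, r) \<in> extensions G T A V1 (V2 M')"
      and V: "(V, i, q) \<in> ext_class M b" and \<phi>: "\<phi> \<in> AG_hom G A V W"
      "\<And>x. x \<in> carrier (V2 M) \<Longrightarrow> \<phi> (i x) = j (f x)" "\<And>v. v \<in> carrier V \<Longrightarrow> r (\<phi> v) = q v"
      unfolding ext_push_def by blast
    obtain \<psi> where \<psi>: "\<psi> \<in> AG_hom G A (VE M b) V" "\<And>x. x \<in> carrier (V2 M) \<Longrightarrow> \<psi> (x, \<zero>) = i x"
      "\<And>v. v \<in> carrier (VE M b) \<Longrightarrow> q (\<psi> v) = snd v"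
      using V[unfolded ext_class_iff] by (rule ext_relD) blast
    note \<psi>c = mod_homD(1)[OF AG_homD(1)[OF \<psi>(1)]]
    have h: "(\<lambda>v. \<phi> (\<psi> v)) \<in> AG_hom G A (VE M b) W" by (rule AG_hom_compose[OF \<psi>(1) \<phi>(1)])
    note hD = mod_homD[OF AG_homD(1)[OF h]] AG_homD(2)[OF h]
    show "e \<in> ext_class M' (\<lambda>g. f (b g))" unfolding e
    proof (rule section_ext_class[OF M' fb W])
      show "(\<lambda>x. \<phi> (\<psi> (\<zero>\<^bsub>M\<^esub>, x))) \<in> mod_hom A (self_module A) W"
      proof (rule mod_homI)
        show "\<phi> (\<psi> (\<zero>\<^bsub>M\<^esub>, x \<oplus>\<^bsub>self_module A\<^esub> y)) = \<phi> (\<psi> (\<zero>\<^bsub>M\<^esub>, x)) \<oplus>\<^bsub>W\<^esub> \<phi> (\<psi> (\<zero>\<^bsub>M\<^esub>, y))"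
          if "x \<in> carrier (self_module A)" "y \<in> carrier (self_module A)" for x y
          using hD(2)[of "(\<zero>\<^bsub>M\<^esub>, x)" "(\<zero>\<^bsub>M\<^esub>, y)"] that by simp
        show "\<phi> (\<psi> (\<zero>\<^bsub>M\<^esub>, a \<odot>\<^bsub>self_module A\<^esub> x)) = a \<odot>\<^bsub>W\<^esub> \<phi> (\<psi> (\<zero>\<^bsub>M\<^esub>, x))"
          if "a \<in> carrier A" "x \<in> carrier (self_module A)" for a x
          using hD(3)[of a "(\<zero>\<^bsub>M\<^esub>, x)"] that by simp
      qed (use hD(1) in simp)
      show "r (\<phi> (\<psi> (\<zero>\<^bsub>M\<^esub>, x))) = x" if "x \<in> carrier A" for x
        using \<phi>(3)[OF \<psi>c, of "(\<zero>\<^bsub>M\<^esub>, x)"] \<psi>(3)[of "(\<zero>\<^bsub>M\<^esub>, x)"] that by simp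
      show "act W g (\<phi> (\<psi> (\<zero>\<^bsub>M\<^esub>, x))) = \<phi> (\<psi> (\<zero>\<^bsub>M\<^esub>, \<chi> g \<otimes> x)) \<oplus>\<^bsub>W\<^esub> j (x \<odot>\<^bsub>M'\<^esub> f (b g))"
        if g: "g \<in> carrier G" and x: "x \<in> carrier A" for g x
      proof -
        have "act W g (\<phi> (\<psi> (\<zero>\<^bsub>M\<^esub>, x))) = \<phi> (\<psi> (x \<odot>\<^bsub>M\<^esub> b g, \<chi> g \<otimes> x))"
          using hD(4)[OF g, of "(\<zero>\<^bsub>M\<^esub>, x)"] x g bc by simp
        also have "\<dots> = \<phi> (\<psi> (\<zero>\<^bsub>M\<^esub>, \<chi> g \<otimes> x)) \<oplus>\<^bsub>W\<^esub> \<phi> (\<psi> (x \<odot>\<^bsub>M\<^esub> b g, \<zero>))"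
          using hD(2)[of "(\<zero>\<^bsub>M\<^esub>, \<chi> g \<otimes> x)" "(x \<odot>\<^bsub>M\<^esub> b g, \<zero>)"] x g bc by simp
        also have "\<phi> (\<psi> (x \<odot>\<^bsub>M\<^esub> b g, \<zero>)) = j (x \<odot>\<^bsub>M'\<^esub> f (b g))"
          using \<psi>(2)[of "x \<odot>\<^bsub>M\<^esub> b g"] \<phi>(2)[of "x \<odot>\<^bsub>M\<^esub> b g"] x g bc fh by simp
        finally show ?thesis .
      qed
    qed
  next
    fix e assume "e \<in> ext_class M' (\<lambda>g. f (b g))"
    moreover obtain W j r where e: "e = (W, j, r)" by (cases e) auto
    ultimately have W: "(W, j, r) \<in> ext_class M' (\<lambda>g. f (b g))" by simp
    obtain \<psi> where \<psi>: "\<psi> \<in> AG_hom G A (VE M' (\<lambda>g. f (b g))) W"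
      "\<And>x. x \<in> carrier (V2 M') \<Longrightarrow> \<psi> (x, \<zero>) = j x"
      "\<And>v. v \<in> carrier (VE M' (\<lambda>g. f (b g))) \<Longrightarrow> r (\<psi> v) = snd v"
      using W[unfolded ext_class_iff] by (rule ext_relD) blast
    have k: "(\<lambda>v. (f (fst v), snd v)) \<in> AG_hom G A (VE M b) (VE M' (\<lambda>g. f (b g)))"
      using fh bc by (intro AG_homI mod_homI) auto
    have "(\<lambda>v. \<psi> (f (fst v), snd v)) \<in> AG_hom G A (VE M b) W"
      by (rule AG_hom_compose[OF k \<psi>(1)])
    moreover have "\<psi> (f (fst (x, \<zero>)), snd (x, \<zero>)) = j (f x)" if "x \<in> carrier (V2 M)" for x
      using \<psi>(2)[of "f x"] fh(1)[of x] that by simp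
    moreover have "r (\<psi> (f (fst v), snd v)) = snd v" if "v \<in> carrier (VE M b)" for v
      using \<psi>(3)[of "(f (fst v), snd v)"] fh(1)[of "fst v"] that by auto
    ultimately have *: "\<exists>\<phi> \<in> AG_hom G A (VE M b) W. (\<forall>x \<in> carrier (V2 M). \<phi> (x, \<zero>) = j (f x)) \<and>
        (\<forall>v \<in> carrier (VE M b). r (\<phi> v) = snd v)"
      by (intro bexI[of _ "\<lambda>v. \<psi> (f (fst v), snd v)"]) auto
    show "e \<in> ext_push G T A V1 (V2 M) (V2 M') f (ext_class M b)"
      unfolding e ext_push_def
    proof (intro CollectI, simp only: prod.case, intro conjI bexI[OF _ ext_class_self[OF M b]])
      show "(W, j, r) \<in> extensions G T A V1 (V2 M')" by (rule ext_class_mem[OF W])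
    qed (use * in \<open>simp only: prod.case\<close>)
  qed
qed

text \<open>As for the pushforward: the pairs of vectors \<open>(0, x)\<close> in the fibre product
  give a section whose cocycle is the sum of the two, and adding the first coordinates gives a
  morphism out of the fibre product.\<close>

lemma baer_sum_class:
  assumes M: "module A M" and b: "cocycle M b" and b': "cocycle M b'"
  shows "baer_sum G T A V1 (V2 M) (ext_class M b) (ext_class M b') = ext_class M (\<lambda>g. b g \<oplus>\<^bsub>M\<^esub> b' g)"
proof -
  interpret M: module A M by fact
  note bc = cocycleD(1)[OF b] and bc' = cocycleD(1)[OF b']
  note bb = cocycle_add[OF M b b']
  show ?thesis
  proof (intro equalityI subsetI)
    fix e assume "e \<in> baer_sum G T A V1 (V2 M) (ext_class M b) (ext_class M b')"
    then obtain W j r V i q V' i' q' \<phi> where e: "e = (W, j, r)" and W: "(W, j, r) \<in> extensions G T A V1 (V2 M)"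
      and V: "(V, i, q) \<in> ext_class M b" and V': "(V', i', q') \<in> ext_class M b'"
      and \<phi>: "\<phi> \<in> AG_hom G A (fibre_product V q V' q') W"
      "\<And>x y. x \<in> carrier (V2 M) \<Longrightarrow> y \<in> carrier (V2 M) \<Longrightarrow> \<phi> (i x, i' y) = j (x \<oplus>\<^bsub>V2 M\<^esub> y)"
      "\<And>v v'. (v, v') \<in> carrier (fibre_product V q V' q') \<Longrightarrow> r (\<phi> (v, v')) = q v"
      unfolding baer_sum_def by blast
    obtain \<psi> where \<psi>: "\<psi> \<in> AG_hom G A (VE M b) V" "\<And>x. x \<in> carrier (V2 M) \<Longrightarrow> \<psi> (x, \<zero>) = i x"
      "\<And>v. v \<in> carrier (VE M b) \<Longrightarrow> q (\<psi> v) = snd v"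
      using V[unfolded ext_class_iff] by (rule ext_relD) blast
    obtain \<psi>' where \<psi>': "\<psi>' \<in> AG_hom G A (VE M b') V'" "\<And>x. x \<in> carrier (V2 M) \<Longrightarrow> \<psi>' (x, \<zero>) = i' x"
      "\<And>v. v \<in> carrier (VE M b') \<Longrightarrow> q' (\<psi>' v) = snd v"
      using V'[unfolded ext_class_iff] by (rule ext_relD) blast
    note \<psi>h = mod_homD[OF AG_homD(1)[OF \<psi>(1)]] AG_homD(2)[OF \<psi>(1)]
    note \<psi>h' = mod_homD[OF AG_homD(1)[OF \<psi>'(1)]] AG_homD(2)[OF \<psi>'(1)]
    note \<phi>h = mod_homD[OF AG_homD(1)[OF \<phi>(1)]] AG_homD(2)[OF \<phi>(1)]
    let ?F = "fibre_product V q V' q'"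
    have F: "(\<psi> (m, x), \<psi>' (m', x)) \<in> carrier ?F"
      if "m \<in> carrier M" "m' \<in> carrier M" "x \<in> carrier A" for m m' x
      using that \<psi>h(1)[of "(m, x)"] \<psi>h'(1)[of "(m', x)"] \<psi>(3)[of "(m, x)"] \<psi>'(3)[of "(m', x)"]
      by (simp add: fibre_product_def)
    have Fadd: "(\<psi> (m, x), \<psi>' (m', x)) \<oplus>\<^bsub>?F\<^esub> (\<psi> (n, y), \<psi>' (n', y)) =
        (\<psi> (m \<oplus>\<^bsub>M\<^esub> n, x \<oplus> y), \<psi>' (m' \<oplus>\<^bsub>M\<^esub> n', x \<oplus> y))"
      if "m \<in> carrier M" "m' \<in> carrier M" "x \<in> carrier A" "n \<in> carrier M" "n' \<in> carrier M" "y \<in> carrier A" for m m' x n n' y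
      using that \<psi>h(2)[of "(m, x)" "(n, y)"] \<psi>h'(2)[of "(m', x)" "(n', y)"]
      by (simp add: fibre_product_def)
    show "e \<in> ext_class M (\<lambda>g. b g \<oplus>\<^bsub>M\<^esub> b' g)" unfolding e
    proof (rule section_ext_class[OF M bb W])
      let ?\<sigma> = "\<lambda>x. \<phi> (\<psi> (\<zero>\<^bsub>M\<^esub>, x), \<psi>' (\<zero>\<^bsub>M\<^esub>, x))"
      show "?\<sigma> \<in> mod_hom A (self_module A) W"
      proof (rule mod_homI)
        show "?\<sigma> (x \<oplus>\<^bsub>self_module A\<^esub> y) = ?\<sigma> x \<oplus>\<^bsub>W\<^esub> ?\<sigma> y"
          if "x \<in> carrier (self_module A)" "y \<in> carrier (self_module A)" for x y
          using \<phi>h(2)[OF F F, of "\<zero>\<^bsub>M\<^esub>" "\<zero>\<^bsub>M\<^esub>" x "\<zero>\<^bsub>M\<^esub>" "\<zero>\<^bsub>M\<^esub>" y] Fadd[of "\<zero>\<^bsub>M\<^esub>" "\<zero>\<^bsub>M\<^esub>" x "\<zero>\<^bsub>M\<^esub>" "\<zero>\<^bsub>M\<^esub>" y] that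
          by simp
        show "?\<sigma> (a \<odot>\<^bsub>self_module A\<^esub> x) = a \<odot>\<^bsub>W\<^esub> ?\<sigma> x"
          if "a \<in> carrier A" "x \<in> carrier (self_module A)" for a x
          using \<phi>h(3)[OF _ F, of a "\<zero>\<^bsub>M\<^esub>" "\<zero>\<^bsub>M\<^esub>" x] \<psi>h(3)[of a "(\<zero>\<^bsub>M\<^esub>, x)"] \<psi>h'(3)[of a "(\<zero>\<^bsub>M\<^esub>, x)"] that
          by (simp add: fibre_product_def)
      qed (use \<phi>h(1)[OF F] in simp)
      show "r (?\<sigma> x) = x" if "x \<in> carrier A" for x
        using \<phi>(3)[OF F, of "\<zero>\<^bsub>M\<^esub>" "\<zero>\<^bsub>M\<^esub>" x] \<psi>(3)[of "(\<zero>\<^bsub>M\<^esub>, x)"] that by simp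
      show "act W g (?\<sigma> x) = ?\<sigma> (\<chi> g \<otimes> x) \<oplus>\<^bsub>W\<^esub> j (x \<odot>\<^bsub>M\<^esub> (b g \<oplus>\<^bsub>M\<^esub> b' g))"
        if g: "g \<in> carrier G" and x: "x \<in> carrier A" for g x
      proof -
        have "act W g (?\<sigma> x) = \<phi> (act ?F g (\<psi> (\<zero>\<^bsub>M\<^esub>, x), \<psi>' (\<zero>\<^bsub>M\<^esub>, x)))"
          using \<phi>h(4)[OF g F, of "\<zero>\<^bsub>M\<^esub>" "\<zero>\<^bsub>M\<^esub>" x] x by simp
        also have "\<dots> = \<phi> (\<psi> (x \<odot>\<^bsub>M\<^esub> b g, \<chi> g \<otimes> x), \<psi>' (x \<odot>\<^bsub>M\<^esub> b' g, \<chi> g \<otimes> x))"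
          using \<psi>h(4)[OF g, of "(\<zero>\<^bsub>M\<^esub>, x)"] \<psi>h'(4)[OF g, of "(\<zero>\<^bsub>M\<^esub>, x)"] g x bc bc'
          by (simp add: fibre_product_def)
        also have "\<dots> = ?\<sigma> (\<chi> g \<otimes> x) \<oplus>\<^bsub>W\<^esub> \<phi> (\<psi> (x \<odot>\<^bsub>M\<^esub> b g, \<zero>), \<psi>' (x \<odot>\<^bsub>M\<^esub> b' g, \<zero>))"
          using \<phi>h(2)[OF F F, of "\<zero>\<^bsub>M\<^esub>" "\<zero>\<^bsub>M\<^esub>" "\<chi> g \<otimes> x" "x \<odot>\<^bsub>M\<^esub> b g" "x \<odot>\<^bsub>M\<^esub> b' g" "\<zero>"]
            Fadd[of "\<zero>\<^bsub>M\<^esub>" "\<zero>\<^bsub>M\<^esub>" "\<chi> g \<otimes> x" "x \<odot>\<^bsub>M\<^esub> b g" "x \<odot>\<^bsub>M\<^esub> b' g" "\<zero>"] g x bc bc' by simp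
        also have "\<phi> (\<psi> (x \<odot>\<^bsub>M\<^esub> b g, \<zero>), \<psi>' (x \<odot>\<^bsub>M\<^esub> b' g, \<zero>)) = j (x \<odot>\<^bsub>M\<^esub> (b g \<oplus>\<^bsub>M\<^esub> b' g))"
          using \<psi>(2)[of "x \<odot>\<^bsub>M\<^esub> b g"] \<psi>'(2)[of "x \<odot>\<^bsub>M\<^esub> b' g"] \<phi>(2)[of "x \<odot>\<^bsub>M\<^esub> b g" "x \<odot>\<^bsub>M\<^esub> b' g"] g x bc bc'
          by (simp add: M.smult_r_distr)
        finally show ?thesis .
      qed
    qed
  next
    fix e assume "e \<in> ext_class M (\<lambda>g. b g \<oplus>\<^bsub>M\<^esub> b' g)"
    moreover obtain W j r where e: "e = (W, j, r)" by (cases e) auto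
    ultimately have W: "(W, j, r) \<in> ext_class M (\<lambda>g. b g \<oplus>\<^bsub>M\<^esub> b' g)" by simp
    obtain \<psi> where \<psi>: "\<psi> \<in> AG_hom G A (VE M (\<lambda>g. b g \<oplus>\<^bsub>M\<^esub> b' g)) W"
      "\<And>x. x \<in> carrier (V2 M) \<Longrightarrow> \<psi> (x, \<zero>) = j x"
      "\<And>v. v \<in> carrier (VE M (\<lambda>g. b g \<oplus>\<^bsub>M\<^esub> b' g)) \<Longrightarrow> r (\<psi> v) = snd v"
      using W[unfolded ext_class_iff] by (rule ext_relD) blast
    let ?F = "fibre_product (VE M b) snd (VE M b') snd"
    let ?k = "\<lambda>w. (fst (fst w) \<oplus>\<^bsub>M\<^esub> fst (snd w), snd (fst w))"
    have k: "?k \<in> AG_hom G A ?F (VE M (\<lambda>g. b g \<oplus>\<^bsub>M\<^esub> b' g))"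
      using bc bc'
      by (intro AG_homI mod_homI) (auto simp: fibre_product_def M.M.a_ac M.smult_r_distr)
    have "(\<lambda>w. \<psi> (?k w)) \<in> AG_hom G A ?F W"
      by (rule AG_hom_compose[OF k \<psi>(1)])
    moreover have "\<psi> (?k ((x, \<zero>), (y, \<zero>))) = j (x \<oplus>\<^bsub>V2 M\<^esub> y)"
      if "x \<in> carrier (V2 M)" "y \<in> carrier (V2 M)" for x y
      using \<psi>(2)[of "x \<oplus>\<^bsub>M\<^esub> y"] that by simp
    moreover have "r (\<psi> (?k (v, v'))) = snd v" if "(v, v') \<in> carrier ?F" for v v'
      using \<psi>(3)[of "?k (v, v')"] that by (auto simp: fibre_product_def)
    ultimately have *: "\<exists>\<phi> \<in> AG_hom G A ?F W.
        (\<forall>x \<in> carrier (V2 M). \<forall>y \<in> carrier (V2 M). \<phi> ((x, \<zero>), (y, \<zero>)) = j (x \<oplus>\<^bsub>V2 M\<^esub> y)) \<and>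
        (\<forall>(v, v') \<in> carrier ?F. r (\<phi> (v, v')) = snd v)"
      by (intro bexI[of _ "\<lambda>w. \<psi> (?k w)"]) auto
    show "e \<in> baer_sum G T A V1 (V2 M) (ext_class M b) (ext_class M b')"
      unfolding e baer_sum_def
    proof (intro CollectI, simp only: prod.case, intro conjI bexI[OF _ ext_class_self[OF M b]])
      show "(W, j, r) \<in> extensions G T A V1 (V2 M)" by (rule ext_class_mem[OF W])
      show "case (VE M b, \<lambda>m. (m, \<zero>), snd) of (V, i, q) \<Rightarrow> \<exists>(V', i', q') \<in> ext_class M b'.
          \<exists>\<phi> \<in> AG_hom G A (fibre_product V q V' q') W.
            (\<forall>x \<in> carrier (V2 M). \<forall>y \<in> carrier (V2 M). \<phi> (i x, i' y) = j (x \<oplus>\<^bsub>V2 M\<^esub> y)) \<and>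
            (\<forall>(v, v') \<in> carrier (fibre_product V q V' q'). r (\<phi> (v, v')) = q v)"
        unfolding prod.case by (rule bexI[OF _ ext_class_self[OF M b']]) (use * in \<open>simp only: prod.case\<close>)
    qed
  qed
qed

lemma ext_class_in_Ext1:
  assumes "module A M" "cocycle M b"
  shows "ext_class M b \<in> carrier (Ext1 G T A V1 (V2 M))"
  using VE_extension[OF assms] unfolding Ext1_def ext_class_def by (simp add: quotientI)

lemma Ext1_ext_class:
  assumes M: "module A M" and c: "c \<in> carrier (Ext1 G T A V1 (V2 M))"
  obtains b where "cocycle M b" "c = ext_class M b"
proof -
  obtain V i q where V: "(V, i, q) \<in> extensions G T A V1 (V2 M)"
    and cV: "c = ext_rel G T A V1 (V2 M) `` {(V, i, q)}"
    using c unfolding Ext1_def by (auto elim!: quotientE)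
  obtain b where b: "cocycle M b" "(V, i, q) \<in> ext_class M b" by (rule extension_ext_class[OF M V])
  have "c = ext_class M b"
    using equiv_class_eq[OF ext_rel_equiv b(2)[unfolded ext_class_iff]] unfolding cV ext_class_def by simp
  then show thesis using b(1) that by blast
qed

end

section \<open>Quotients by the adic filtration\<close>

definition fil_quot :: "('a, 'x) ring_scheme \<Rightarrow> nat \<Rightarrow> ('a, 'm, 'y) module_scheme \<Rightarrow> 'm set monoid" where
  "fil_quot A n M = add_monoid M Mod ideal_smul (ideal_pow A (maxid A) n) M"

definition fil_coset :: "('a, 'x) ring_scheme \<Rightarrow> nat \<Rightarrow> ('a, 'm, 'y) module_scheme \<Rightarrow> 'm \<Rightarrow> 'm set" where
  "fil_coset A n M x = ideal_smul (ideal_pow A (maxid A) n) M #>\<^bsub>add_monoid M\<^esub> x"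

context adic_module
begin

lemma fil_quot_comm_group: "comm_group (fil_quot R n M)"
  unfolding fil_quot_def by (rule M.add.abelian_FactGroup[OF fil_subgroup])

lemma fil_normal: "fil n \<lhd> add_monoid M"
  using M.add.normal_iff_subgroup fil_subgroup by blast

lemma carrier_fil_quot: "carrier (fil_quot R n M) = fil_coset R n M ` carrier M"
  by (simp add: fil_quot_def carrier_FactGroup fil_coset_def)

lemma fil_coset_closed [simp]: "x \<in> carrier M \<Longrightarrow> fil_coset R n M x \<in> carrier (fil_quot R n M)"
  by (simp add: carrier_fil_quot)

lemma fil_coset_add:
  assumes "x \<in> carrier M" "y \<in> carrier M"
  shows "fil_coset R n M x \<otimes>\<^bsub>fil_quot R n M\<^esub> fil_coset R n M y = fil_coset R n M (x \<oplus>\<^bsub>M\<^esub> y)"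
  using normal.rcos_sum[OF fil_normal, of x y n] assms by (simp add: fil_quot_def fil_coset_def)

lemma fil_coset_fil:
  assumes "x \<in> fil n"
  shows "fil_coset R n M x = \<one>\<^bsub>fil_quot R n M\<^esub>"
  unfolding fil_coset_def fil_quot_def
  using subgroup.rcos_const[OF fil_subgroup M.add.is_group assms] by simp

text \<open>Two rings are allowed so that maps from \<open>E\<close> over \<open>R\<close> into
  modules over \<open>A\<close> descend to the filtration quotients as well.\<close>

lemma fil_quot_map:
  assumes N: "adic_module R' N" and \<theta>: "\<And>x. x \<in> carrier M \<Longrightarrow> \<theta> x \<in> carrier N"
    "\<And>x y. x \<in> carrier M \<Longrightarrow> y \<in> carrier M \<Longrightarrow> \<theta> (x \<oplus>\<^bsub>M\<^esub> y) = \<theta> x \<oplus>\<^bsub>N\<^esub> \<theta> y"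
    "\<And>x. x \<in> fil n \<Longrightarrow> \<theta> x \<in> ideal_smul (ideal_pow R' (maxid R') n) N"
  shows "\<exists>f \<in> hom (fil_quot R n M) (fil_quot R' n N).
    \<forall>x \<in> carrier M. f (fil_coset R n M x) = fil_coset R' n N (\<theta> x)"
proof -
  interpret N: adic_module R' N by fact
  interpret Q: comm_group "fil_quot R' n N" by (rule N.fil_quot_comm_group)
  interpret h: group_hom "add_monoid M" "fil_quot R' n N" "\<lambda>x. fil_coset R' n N (\<theta> x)"
    by unfold_locales (auto simp: hom_def \<theta> N.fil_coset_add)
  have "fil n \<subseteq> kernel (add_monoid M) (fil_quot R' n N) (\<lambda>x. fil_coset R' n N (\<theta> x))"
    using \<theta>(3) fil_carrier by (auto simp: kernel_def N.fil_coset_fil)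
  from h.FactGroup_universal_kernel[OF fil_normal this]
  obtain f where "f \<in> hom (add_monoid M Mod fil n) (fil_quot R' n N)"
    "\<And>x. x \<in> carrier (add_monoid M) \<Longrightarrow> f (fil n #>\<^bsub>add_monoid M\<^esub> x) = fil_coset R' n N (\<theta> x)"
    by metis
  then show ?thesis by (intro bexI[of _ f]) (simp_all add: fil_quot_def fil_coset_def)
qed

end

section \<open>Finitely generated modules\<close>

text \<open>Generators are adjoined one at a time. \<open>P\<close> speaks of subsets, so that it
  can state finiteness of a set of cosets or embeddability of a carrier.\<close>

lemma fg_module_induct:
  assumes fg: "fg_module A M" and zero: "P {\<zero>\<^bsub>M\<^esub>}"
    and step: "\<And>H s. submodule H A M \<Longrightarrow> P H \<Longrightarrow> s \<in> carrier M \<Longrightarrow>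
      P ((\<lambda>(a, x). a \<odot>\<^bsub>M\<^esub> s \<oplus>\<^bsub>M\<^esub> x) ` (carrier A \<times> H))"
  shows "P (carrier M)"
proof -
  obtain S where S: "finite S" "S \<subseteq> carrier M" "\<And>H. submodule H A M \<Longrightarrow> S \<subseteq> H \<Longrightarrow> H = carrier M"
    using fg unfolding fg_module_def by blast
  interpret M: module A M using fg by (simp add: fg_module_def)
  have "\<exists>H. submodule H A M \<and> S \<subseteq> H \<and> P H" using S(1,2)
  proof (induction)
    case empty
    have "submodule {\<zero>\<^bsub>M\<^esub>} A M" by (rule M.submoduleI) auto
    then show ?case using zero by blast
  next
    case (insert s F)
    then obtain H where H: "submodule H A M" "F \<subseteq> H" "P H" by blast
    have s: "s \<in> carrier M" using insert by blast
    note Hs = M.submoduleE[OF H(1)]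
    have Hc: "x \<in> carrier M" if "x \<in> H" for x using Hs(1) that by blast
    let ?H = "(\<lambda>(a, x). a \<odot>\<^bsub>M\<^esub> s \<oplus>\<^bsub>M\<^esub> x) ` (carrier A \<times> H)"
    have mem: "a \<odot>\<^bsub>M\<^esub> s \<oplus>\<^bsub>M\<^esub> x \<in> ?H" if "a \<in> carrier A" "x \<in> H" for a x
      using that by (intro rev_image_eqI[of "(a, x)"]) simp_all
    have H0: "\<zero>\<^bsub>M\<^esub> \<in> H" using subgroup.one_closed[OF submodule.axioms(1)[OF H(1)]] by simp
    have "submodule ?H A M"
    proof (rule M.submoduleI)
      show "?H \<subseteq> carrier M" using s Hc by auto
      show "\<zero>\<^bsub>M\<^esub> \<in> ?H" using mem[OF M.R.zero_closed H0] s by simp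
      show "\<ominus>\<^bsub>M\<^esub> y \<in> ?H" if y: "y \<in> ?H" for y
      proof -
        obtain a x where ax: "y = a \<odot>\<^bsub>M\<^esub> s \<oplus>\<^bsub>M\<^esub> x" "a \<in> carrier A" "x \<in> H" using y by auto
        have "\<ominus>\<^bsub>M\<^esub> y = (\<ominus>\<^bsub>A\<^esub> a) \<odot>\<^bsub>M\<^esub> s \<oplus>\<^bsub>M\<^esub> (\<ominus>\<^bsub>M\<^esub> x)"
          using ax s Hc by (simp add: M.M.minus_add M.smult_l_minus)
        then show ?thesis using mem[of "\<ominus>\<^bsub>A\<^esub> a" "\<ominus>\<^bsub>M\<^esub> x"] ax Hs(3) by simp
      qed
      show "y \<oplus>\<^bsub>M\<^esub> z \<in> ?H" if y: "y \<in> ?H" and z: "z \<in> ?H" for y z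
      proof -
        obtain a x where ax: "y = a \<odot>\<^bsub>M\<^esub> s \<oplus>\<^bsub>M\<^esub> x" "a \<in> carrier A" "x \<in> H" using y by auto
        obtain c w where cw: "z = c \<odot>\<^bsub>M\<^esub> s \<oplus>\<^bsub>M\<^esub> w" "c \<in> carrier A" "w \<in> H" using z by auto
        have "y \<oplus>\<^bsub>M\<^esub> z = (a \<oplus>\<^bsub>A\<^esub> c) \<odot>\<^bsub>M\<^esub> s \<oplus>\<^bsub>M\<^esub> (x \<oplus>\<^bsub>M\<^esub> w)"
          using ax cw s Hc by (simp add: M.smult_l_distr M.M.a_ac)
        then show ?thesis using mem[of "a \<oplus>\<^bsub>A\<^esub> c" "x \<oplus>\<^bsub>M\<^esub> w"] ax cw Hs(5) by simp
      qed
      show "c \<odot>\<^bsub>M\<^esub> y \<in> ?H" if c: "c \<in> carrier A" and y: "y \<in> ?H" for c y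
      proof -
        obtain a x where ax: "y = a \<odot>\<^bsub>M\<^esub> s \<oplus>\<^bsub>M\<^esub> x" "a \<in> carrier A" "x \<in> H" using y by auto
        have "c \<odot>\<^bsub>M\<^esub> y = (c \<otimes>\<^bsub>A\<^esub> a) \<odot>\<^bsub>M\<^esub> s \<oplus>\<^bsub>M\<^esub> c \<odot>\<^bsub>M\<^esub> x"
          using ax c s Hc by (simp add: M.smult_r_distr M.smult_assoc1)
        then show ?thesis using mem[of "c \<otimes>\<^bsub>A\<^esub> a" "c \<odot>\<^bsub>M\<^esub> x"] ax c Hs(4) by simp
      qed
    qed
    moreover have "F \<subseteq> ?H"
    proof
      fix x assume "x \<in> F"
      then have x: "x \<in> H" using H(2) by blast
      show "x \<in> ?H" using mem[OF M.R.zero_closed x] s Hc[OF x] by simp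
    qed
    moreover have "s \<in> ?H" using mem[OF M.R.one_closed H0] s by simp
    ultimately show ?case using step[OF H(1,3) s] by blast
  qed
  then show ?thesis using S(3) by blast
qed

text \<open>Each new generator \<open>s\<close> multiplies the number of cosets by at most the
  number of cosets in \<open>A\<close>, through the map \<open>a \<mapsto> a s\<close>.\<close>

lemma fg_module_finite_quot:
  assumes fg: "fg_module A M" and max: "ideal (maxid A) A"
    and fin: "finite (carrier (fil_quot A n (self_module A)))"
  shows "finite (carrier (fil_quot A n M))"
proof -
  have M: "module A M" using fg by (simp add: fg_module_def)
  interpret M: adic_module A M using M max by (simp add: adic_module_def adic_module_axioms_def)
  interpret S: adic_module A "self_module A"
    using self_module[OF M.R.is_cring] max by (simp add: adic_module_def adic_module_axioms_def)
  have "finite (fil_coset A n M ` carrier M)"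
  proof (rule fg_module_induct[OF fg])
    fix H s assume H: "submodule H A M" "finite (fil_coset A n M ` H)" and s: "s \<in> carrier M"
    have Hc: "x \<in> carrier M" if "x \<in> H" for x using M.submoduleE(1)[OF H(1)] that by blast
    have \<theta>: "(\<lambda>a. a \<odot>\<^bsub>M\<^esub> s) \<in> mod_hom A (self_module A) M"
      by (rule mod_homI) (simp_all add: s M.smult_l_distr M.smult_assoc1)
    have "\<exists>f \<in> hom (fil_quot A n (self_module A)) (fil_quot A n M).
        \<forall>a \<in> carrier (self_module A). f (fil_coset A n (self_module A) a) = fil_coset A n M (a \<odot>\<^bsub>M\<^esub> s)"
    proof (rule S.fil_quot_map[OF M.adic_module_axioms])
      show "a \<odot>\<^bsub>M\<^esub> s \<in> M.fil n" if "a \<in> S.fil n" for a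
        by (rule mod_hom_fil[OF S.adic_module_axioms M.adic_module_axioms \<theta> that])
    qed (use mod_homD(1,2)[OF \<theta>] in blast)+
    then obtain f where f: "\<And>a. a \<in> carrier (self_module A) \<Longrightarrow> f (fil_coset A n (self_module A) a) = fil_coset A n M (a \<odot>\<^bsub>M\<^esub> s)"
      by blast
    have "fil_coset A n M ` (\<lambda>(a, x). a \<odot>\<^bsub>M\<^esub> s \<oplus>\<^bsub>M\<^esub> x) ` (carrier A \<times> H) \<subseteq>
        (\<lambda>(c, d). c \<otimes>\<^bsub>fil_quot A n M\<^esub> d) ` ((f ` carrier (fil_quot A n (self_module A))) \<times> fil_coset A n M ` H)"
    proof clarify
      fix a x assume a: "a \<in> carrier A" and x: "x \<in> H"
      have "fil_coset A n M (a \<odot>\<^bsub>M\<^esub> s \<oplus>\<^bsub>M\<^esub> x) =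
          f (fil_coset A n (self_module A) a) \<otimes>\<^bsub>fil_quot A n M\<^esub> fil_coset A n M x"
        using a x s Hc f by (simp add: M.fil_coset_add)
      moreover have "fil_coset A n (self_module A) a \<in> carrier (fil_quot A n (self_module A))"
        using a by simp
      ultimately show "fil_coset A n M (a \<odot>\<^bsub>M\<^esub> s \<oplus>\<^bsub>M\<^esub> x) \<in>
          (\<lambda>(c, d). c \<otimes>\<^bsub>fil_quot A n M\<^esub> d) ` ((f ` carrier (fil_quot A n (self_module A))) \<times> fil_coset A n M ` H)"
        using x by (metis (mono_tags, lifting) SigmaI case_prod_conv image_eqI)
    qed
    then show "finite (fil_coset A n M ` (\<lambda>(a, x). a \<odot>\<^bsub>M\<^esub> s \<oplus>\<^bsub>M\<^esub> x) ` (carrier A \<times> H))"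
      by (rule finite_subset) (use H(2) fin in simp)
  qed simp
  then show ?thesis by (simp add: M.carrier_fil_quot)
qed

section \<open>Encoding modules in the type of the coefficients\<close>

lemma infinite_pairing:
  assumes "infinite (UNIV :: 'u set)"
  obtains \<pi> :: "'u \<times> 'u \<Rightarrow> 'u" where "inj \<pi>"
proof -
  have "\<exists>\<pi>. bij_betw \<pi> (UNIV \<times> UNIV :: ('u \<times> 'u) set) (UNIV :: 'u set)"
    unfolding card_of_ordIso by (rule card_of_Times_same_infinite[OF assms])
  then show thesis using that by (auto simp: bij_betw_def)
qed

text \<open>With one more generator, an element is described by a scalar and an element already
  encoded. Choosing such a description and pairing the two codes gives an injection.\<close>

lemma fg_module_inj:
  fixes A :: "('u, 'x) ring_scheme" and M :: "('u, 'm, 'y) module_scheme"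
  assumes fg: "fg_module A M" and inf: "infinite (UNIV :: 'u set)"
  shows "\<exists>f :: 'm \<Rightarrow> 'u. inj_on f (carrier M)"
proof (rule fg_module_induct[OF fg])
  obtain \<pi> :: "'u \<times> 'u \<Rightarrow> 'u" where \<pi>: "inj \<pi>" by (rule infinite_pairing[OF inf])
  fix H s assume "\<exists>f :: 'm \<Rightarrow> 'u. inj_on f H"
  then obtain f :: "'m \<Rightarrow> 'u" where f: "inj_on f H" by blast
  let ?F = "\<lambda>(a, x). a \<odot>\<^bsub>M\<^esub> s \<oplus>\<^bsub>M\<^esub> x" and ?k = "\<lambda>(a, x). \<pi> (a, f x)"
  have "inj_on ?k (carrier A \<times> H)"
    by (auto intro!: inj_onI dest!: injD[OF \<pi>] dest: inj_onD[OF f])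
  moreover have "inv_into (carrier A \<times> H) ?F ` (?F ` (carrier A \<times> H)) \<subseteq> carrier A \<times> H"
    by (rule image_subsetI) (rule inv_into_into)
  ultimately have "inj_on (?k \<circ> inv_into (carrier A \<times> H) ?F) (?F ` (carrier A \<times> H))"
    by (intro comp_inj_on inj_on_inv_into subset_refl) (rule inj_on_subset)
  then show "\<exists>f :: 'm \<Rightarrow> 'u. inj_on f (?F ` (carrier A \<times> H))" by blast
qed simp

text \<open>The universal property tests only algebras with carrier in \<open>'u\<close>, while
  \<open>M\<close> may live on any type. The carrier of \<open>M\<close> embeds in
  \<open>'u\<close>, hence so does the set of triangular matrices.\<close>

lemma fg_module_encoding:
  fixes A :: "('u, 'x) ring_scheme" and M :: "('u, 'm, 'y) module_scheme"
  assumes fg: "fg_module A M" and inf: "infinite (UNIV :: 'u set)"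
  obtains enc :: "'u \<times> 'm \<times> 'u \<Rightarrow> 'u" where "inj_on enc (carrier A \<times> carrier M \<times> carrier A)"
proof -
  obtain f :: "'m \<Rightarrow> 'u" where f: "inj_on f (carrier M)" using fg_module_inj[OF assms] by blast
  obtain \<pi> :: "'u \<times> 'u \<Rightarrow> 'u" where \<pi>: "inj \<pi>" by (rule infinite_pairing[OF inf])
  show thesis
    by (rule that[of "\<lambda>(a, m, d). \<pi> (a, \<pi> (f m, d))"])
      (auto intro!: inj_onI simp: inj_eq[OF \<pi>] dest: inj_onD[OF f])
qed

section \<open>Modules with action satisfying a stable condition\<close>

text \<open>The algebraic part of \<open>AG_module\<close>. Stable conditions pass along maps
  through the filtration quotients, and for this \<open>E\<close>, the triangular algebras and the
  extensions are treated alike.\<close>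

definition lin_action :: "'g monoid \<Rightarrow> ('a, 'x) ring_scheme \<Rightarrow> ('a, 'm, 'g) gmodule \<Rightarrow> bool" where
  "lin_action G A V \<longleftrightarrow> adic_module A V \<and>
     (\<forall>g \<in> carrier G. act V g \<in> mod_hom A V V) \<and>
     (\<forall>x \<in> carrier V. act V \<one>\<^bsub>G\<^esub> x = x) \<and>
     (\<forall>g \<in> carrier G. \<forall>h \<in> carrier G. \<forall>x \<in> carrier V. act V (g \<otimes>\<^bsub>G\<^esub> h) x = act V g (act V h x))"

context
  fixes G :: "'g monoid" and A :: "('a, 'x) ring_scheme" and V :: "('a, 'm, 'g) gmodule"
  assumes G: "group G" and lin: "lin_action G A V"
begin

interpretation V: adic_module A V using lin by (simp add: lin_action_def)
interpretation G: group G by (rule G)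

lemma lin_actionD:
  "g \<in> carrier G \<Longrightarrow> act V g \<in> mod_hom A V V"
  "x \<in> carrier V \<Longrightarrow> act V \<one>\<^bsub>G\<^esub> x = x"
  "g \<in> carrier G \<Longrightarrow> h \<in> carrier G \<Longrightarrow> x \<in> carrier V \<Longrightarrow> act V (g \<otimes>\<^bsub>G\<^esub> h) x = act V g (act V h x)"
  using lin unfolding lin_action_def by blast+

text \<open>The action on quotients is by images of sets. Each \<open>act V g\<close> maps a
  filtration step onto itself, because the inverse element preserves it too, and so sends cosets to
  cosets.\<close>

lemma act_fil_coset:
  assumes g: "g \<in> carrier G" and x: "x \<in> carrier V"
  shows "act V g ` fil_coset A n V x = fil_coset A n V (act V g x)"
proof -
  note h = mod_homD[OF lin_actionD(1)[OF g]]
  have sub: "act V g ` V.fil n \<subseteq> V.fil n" if "g \<in> carrier G" for g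
    using mod_hom_fil[OF V.adic_module_axioms V.adic_module_axioms lin_actionD(1)[OF that]] by blast
  have eq: "act V g ` V.fil n = V.fil n"
  proof
    show "act V g ` V.fil n \<subseteq> V.fil n" by (rule sub[OF g])
    show "V.fil n \<subseteq> act V g ` V.fil n"
    proof
      fix y assume y: "y \<in> V.fil n"
      have "act V (inv\<^bsub>G\<^esub> g) y \<in> V.fil n" using sub[of "inv\<^bsub>G\<^esub> g"] g y by blast
      moreover have "act V g (act V (inv\<^bsub>G\<^esub> g) y) = y"
        using lin_actionD(3)[of g "inv\<^bsub>G\<^esub> g" y] lin_actionD(2)[of y] V.fil_carrier[OF y] g by simp
      ultimately show "y \<in> act V g ` V.fil n" by (metis image_eqI)
    qed
  qed
  have "act V g ` fil_coset A n V x = (\<lambda>u. act V g (u \<oplus>\<^bsub>V\<^esub> x)) ` V.fil n"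
    unfolding fil_coset_def r_coset_def by auto
  also have "\<dots> = (\<lambda>u. act V g u \<oplus>\<^bsub>V\<^esub> act V g x) ` V.fil n"
    by (rule image_cong[OF refl]) (use h(2) V.fil_carrier x in blast)
  also have "\<dots> = (\<lambda>u. u \<oplus>\<^bsub>V\<^esub> act V g x) ` (act V g ` V.fil n)" by (simp add: image_image)
  also have "\<dots> = fil_coset A n V (act V g x)" unfolding eq fil_coset_def r_coset_def by auto
  finally show ?thesis .
qed

lemma act_fil_quot_hom:
  assumes g: "g \<in> carrier G"
  shows "(\<lambda>c. act V g ` c) \<in> hom (fil_quot A n V) (fil_quot A n V)"
proof (rule homI)
  note h = mod_homD[OF lin_actionD(1)[OF g]]
  show "act V g ` c \<in> carrier (fil_quot A n V)" if "c \<in> carrier (fil_quot A n V)" for c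
    using that h(1) by (auto simp: V.carrier_fil_quot act_fil_coset[OF g])
  show "act V g ` (c \<otimes>\<^bsub>fil_quot A n V\<^esub> d) = act V g ` c \<otimes>\<^bsub>fil_quot A n V\<^esub> act V g ` d"
    if c: "c \<in> carrier (fil_quot A n V)" and d: "d \<in> carrier (fil_quot A n V)" for c d
  proof -
    obtain x y where xy: "x \<in> carrier V" "c = fil_coset A n V x" "y \<in> carrier V" "d = fil_coset A n V y"
      using c d unfolding V.carrier_fil_quot by blast
    then show ?thesis using h by (simp add: V.fil_coset_add act_fil_coset[OF g])
  qed
qed

end

lemma AG_module_lin_action:
  assumes "AG_module G T A V" "ideal (maxid A) A"
  shows "lin_action G A V"
  using assms unfolding AG_module_def lin_action_def adic_module_def adic_module_axioms_def by blast

context stable_class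
begin

lemma satisfies_iff:
  "satisfies G C A V \<longleftrightarrow> (\<forall>i \<ge> 1. in_class G C (fil_quot A i V) (\<lambda>g c. act V g ` c))"
  by (simp add: satisfies_def fil_quot_def)

text \<open>The map descends to the filtration quotients, and a quotient of a member is a member.
  Source and target may be modules over different rings, as for maps from the universal algebra to
  an extension.\<close>

lemma image_sub_class:
  assumes V: "lin_action G R V" "satisfies G C R V" and W: "lin_action G A W" and i: "i \<ge> 1"
    and \<theta>: "\<And>x. x \<in> carrier V \<Longrightarrow> \<theta> x \<in> carrier W"
      "\<And>x y. x \<in> carrier V \<Longrightarrow> y \<in> carrier V \<Longrightarrow> \<theta> (x \<oplus>\<^bsub>V\<^esub> y) = \<theta> x \<oplus>\<^bsub>W\<^esub> \<theta> y"
      "\<And>x. x \<in> ideal_smul (ideal_pow R (maxid R) i) V \<Longrightarrow> \<theta> x \<in> ideal_smul (ideal_pow A (maxid A) i) W"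
      "\<And>g x. g \<in> carrier G \<Longrightarrow> x \<in> carrier V \<Longrightarrow> \<theta> (act V g x) = act W g (\<theta> x)"
  shows "sub_class (fil_quot A i W) (\<lambda>g c. act W g ` c) ((\<lambda>x. fil_coset A i W (\<theta> x)) ` carrier V)"
proof -
  interpret V: adic_module R V using V(1) by (simp add: lin_action_def)
  interpret W: adic_module A W using W by (simp add: lin_action_def)
  have "\<exists>f \<in> hom (fil_quot R i V) (fil_quot A i W).
      \<forall>x \<in> carrier V. f (fil_coset R i V x) = fil_coset A i W (\<theta> x)"
    by (rule V.fil_quot_map[OF W.adic_module_axioms]) (erule \<theta>(1), erule (1) \<theta>(2), erule \<theta>(3))
  then obtain f where f: "f \<in> hom (fil_quot R i V) (fil_quot A i W)"
    "\<And>x. x \<in> carrier V \<Longrightarrow> f (fil_coset R i V x) = fil_coset A i W (\<theta> x)"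
    by blast
  have aV: "act V g x \<in> carrier V" if "g \<in> carrier G" "x \<in> carrier V" for g x
    using mod_homD(1)[OF lin_actionD(1)[OF grp V(1) that(1)] that(2)] .
  have "sub_class (fil_quot A i W) (\<lambda>g c. act W g ` c) (f ` carrier (fil_quot R i V))"
  proof (rule sub_class_image[OF _ _ _ _ f(1)])
    show "in_class G C (fil_quot R i V) (\<lambda>g c. act V g ` c)" using V(2) i unfolding satisfies_iff by blast
    show "group (fil_quot R i V)" "group (fil_quot A i W)"
      using V.fil_quot_comm_group W.fil_quot_comm_group by (simp_all add: comm_group_def)
    show "act V g ` c \<in> carrier (fil_quot R i V)" if "g \<in> carrier G" "c \<in> carrier (fil_quot R i V)" for g c
      using hom_in_carrier[OF act_fil_quot_hom[OF grp V(1) that(1)] that(2)] .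
    show "f (act V g ` c) = act W g ` f c" if g: "g \<in> carrier G" and c: "c \<in> carrier (fil_quot R i V)" for g c
    proof -
      obtain x where x: "x \<in> carrier V" "c = fil_coset R i V x" using c unfolding V.carrier_fil_quot by blast
      then show ?thesis
        using act_fil_coset[OF grp V(1) g x(1)] act_fil_coset[OF grp W g \<theta>(1)[OF x(1)]] f(2) aV[OF g x(1)] \<theta>(4)[OF g x(1)]
        by simp
    qed
  qed
  moreover have "f ` carrier (fil_quot R i V) = (\<lambda>x. fil_coset A i W (\<theta> x)) ` carrier V"
    unfolding V.carrier_fil_quot image_image using f(2) by (rule image_cong[OF refl])
  ultimately show ?thesis by simp
qed

lemma AG_hom_sub_class:
  assumes V: "lin_action G A V" "satisfies G C A V" and W: "lin_action G A W" and i: "i \<ge> 1"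
    and \<theta>: "\<theta> \<in> AG_hom G A V W"
  shows "sub_class (fil_quot A i W) (\<lambda>g c. act W g ` c) ((\<lambda>x. fil_coset A i W (\<theta> x)) ` carrier V)"
proof (rule image_sub_class[OF V W i])
  have a: "adic_module A V" "adic_module A W" using V(1) W by (simp_all add: lin_action_def)
  show "\<theta> x \<in> ideal_smul (ideal_pow A (maxid A) i) W" if "x \<in> ideal_smul (ideal_pow A (maxid A) i) V" for x
    by (rule mod_hom_fil[OF a AG_homD(1)[OF \<theta>] that])
qed (use mod_homD[OF AG_homD(1)[OF \<theta>]] AG_homD(2)[OF \<theta>] in blast)+

lemma satisfies_surj:
  assumes V: "lin_action G A V" "satisfies G C A V" and W: "lin_action G A W"
    and \<theta>: "\<theta> \<in> AG_hom G A V W" "\<theta> ` carrier V = carrier W"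
  shows "satisfies G C A W"
  unfolding satisfies_iff
proof (intro allI impI)
  fix i :: nat assume i: "1 \<le> i"
  interpret W: adic_module A W using W by (simp add: lin_action_def)
  have "(\<lambda>x. fil_coset A i W (\<theta> x)) ` carrier V = carrier (fil_quot A i W)"
    unfolding W.carrier_fil_quot \<theta>(2)[symmetric] by (simp add: image_image)
  then show "in_class G C (fil_quot A i W) (\<lambda>g c. act W g ` c)"
    using AG_hom_sub_class[OF V W i \<theta>(1)] by (simp add: sub_class_def)
qed

text \<open>Each filtration quotient of \<open>W\<close> is the join of the images of those of
  \<open>V\<close> and \<open>V'\<close>.\<close>

lemma satisfies_sum:
  assumes V: "lin_action G A V" "satisfies G C A V" and V': "lin_action G A V'" "satisfies G C A V'"
    and W: "lin_action G A W" and \<theta>: "\<theta> \<in> AG_hom G A V W" and \<theta>': "\<theta>' \<in> AG_hom G A V' W"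
    and sum: "\<And>w. w \<in> carrier W \<Longrightarrow> \<exists>v \<in> carrier V. \<exists>v' \<in> carrier V'. w = \<theta> v \<oplus>\<^bsub>W\<^esub> \<theta>' v'"
  shows "satisfies G C A W"
  unfolding satisfies_iff
proof (intro allI impI)
  fix i :: nat assume i: "1 \<le> i"
  interpret W: adic_module A W using W by (simp add: lin_action_def)
  note h = mod_homD(1)[OF AG_homD(1)[OF \<theta>]] and h' = mod_homD(1)[OF AG_homD(1)[OF \<theta>']]
  let ?H = "(\<lambda>x. fil_coset A i W (\<theta> x)) ` carrier V" and ?H' = "(\<lambda>x. fil_coset A i W (\<theta>' x)) ` carrier V'"
  have s: "sub_class (fil_quot A i W) (\<lambda>g c. act W g ` c) (?H <#>\<^bsub>fil_quot A i W\<^esub> ?H')"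
    by (rule sub_class_join[OF W.fil_quot_comm_group act_fil_quot_hom[OF grp W]
          AG_hom_sub_class[OF V W i \<theta>] AG_hom_sub_class[OF V' W i \<theta>']])
  have "carrier (fil_quot A i W) \<subseteq> ?H <#>\<^bsub>fil_quot A i W\<^esub> ?H'"
  proof
    fix c assume "c \<in> carrier (fil_quot A i W)"
    then obtain w where w: "w \<in> carrier W" "c = fil_coset A i W w" unfolding W.carrier_fil_quot by blast
    obtain v v' where v: "v \<in> carrier V" "v' \<in> carrier V'" "w = \<theta> v \<oplus>\<^bsub>W\<^esub> \<theta>' v'" using sum[OF w(1)] by blast
    have "c = fil_coset A i W (\<theta> v) \<otimes>\<^bsub>fil_quot A i W\<^esub> fil_coset A i W (\<theta>' v')"
      using v h h' w(2) by (simp add: W.fil_coset_add)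
    then show "c \<in> ?H <#>\<^bsub>fil_quot A i W\<^esub> ?H'" using v unfolding set_mult_def by blast
  qed
  moreover have "?H <#>\<^bsub>fil_quot A i W\<^esub> ?H' \<subseteq> carrier (fil_quot A i W)"
    using s subgroup.subset unfolding sub_class_def by blast
  ultimately have "?H <#>\<^bsub>fil_quot A i W\<^esub> ?H' = carrier (fil_quot A i W)" by blast
  then show "in_class G C (fil_quot A i W) (\<lambda>g c. act W g ` c)"
    using s by (simp add: sub_class_def)
qed

text \<open>The submodule around a vector may depend on the level \<open>i\<close> and on the vector
  \<open>w\<close>; no single map onto \<open>W\<close> is required, because finiteness of the
  quotient joins finitely many such submodules.\<close>

lemma satisfies_cover:
  assumes W: "lin_action G A W"
    and fin: "\<And>i. i \<ge> 1 \<Longrightarrow> finite (carrier (fil_quot A i W))"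
    and cover: "\<And>i w. i \<ge> 1 \<Longrightarrow> w \<in> carrier W \<Longrightarrow>
      \<exists>H. sub_class (fil_quot A i W) (\<lambda>g c. act W g ` c) H \<and> fil_coset A i W w \<in> H"
  shows "satisfies G C A W"
  unfolding satisfies_iff
proof (intro allI impI)
  fix i :: nat assume i: "1 \<le> i"
  interpret W: adic_module A W using W by (simp add: lin_action_def)
  show "in_class G C (fil_quot A i W) (\<lambda>g c. act W g ` c)"
    by (rule in_class_cover[OF W.fil_quot_comm_group act_fil_quot_hom[OF grp W] fin[OF i]])
      (use cover[OF i] in \<open>auto simp: W.carrier_fil_quot\<close>)
qed

end

section \<open>Triangular algebras\<close>

text \<open>The algebra of matrices with rows \<open>(a, m)\<close>, \<open>(0, d)\<close> for \<open>a\<close>, \<open>d\<close> in \<open>A\<close> and \<open>m\<close> in \<open>M\<close>.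
  An injection \<open>enc\<close> moves it to the type over which the universal property quantifies.\<close>

definition tri_dec :: "('a, 'x) ring_scheme \<Rightarrow> ('a, 'm) module \<Rightarrow> ('a \<times> 'm \<times> 'a \<Rightarrow> 'u) \<Rightarrow> 'u \<Rightarrow> 'a \<times> 'm \<times> 'a" where
  "tri_dec A M enc = inv_into (carrier A \<times> carrier M \<times> carrier A) enc"

definition tri_algebra :: "('a, 'x) ring_scheme \<Rightarrow> ('a, 'm) module \<Rightarrow> ('a \<times> 'm \<times> 'a \<Rightarrow> 'u) \<Rightarrow> ('a, 'u) module" where
  "tri_algebra A M enc =
     (let a = (\<lambda>x. fst (tri_dec A M enc x)); m = (\<lambda>x. fst (snd (tri_dec A M enc x)));
          d = (\<lambda>x. snd (snd (tri_dec A M enc x)))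
      in \<lparr>carrier = enc ` (carrier A \<times> carrier M \<times> carrier A),
       monoid.mult = (\<lambda>x y. enc (a x \<otimes>\<^bsub>A\<^esub> a y, a x \<odot>\<^bsub>M\<^esub> m y \<oplus>\<^bsub>M\<^esub> d y \<odot>\<^bsub>M\<^esub> m x, d x \<otimes>\<^bsub>A\<^esub> d y)),
       monoid.one = enc (\<one>\<^bsub>A\<^esub>, \<zero>\<^bsub>M\<^esub>, \<one>\<^bsub>A\<^esub>),
       ring.zero = enc (\<zero>\<^bsub>A\<^esub>, \<zero>\<^bsub>M\<^esub>, \<zero>\<^bsub>A\<^esub>),
       ring.add = (\<lambda>x y. enc (a x \<oplus>\<^bsub>A\<^esub> a y, m x \<oplus>\<^bsub>M\<^esub> m y, d x \<oplus>\<^bsub>A\<^esub> d y)),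
       smult = (\<lambda>r x. enc (r \<otimes>\<^bsub>A\<^esub> a x, r \<odot>\<^bsub>M\<^esub> m x, r \<otimes>\<^bsub>A\<^esub> d x))\<rparr>)"

locale triangular = M?: module A M
  for A :: "('u, 'x) ring_scheme" (structure) and M :: "('u, 'm) module" +
  fixes enc :: "'u \<times> 'm \<times> 'u \<Rightarrow> 'u"
  assumes enc_inj: "inj_on enc (carrier A \<times> carrier M \<times> carrier A)"
begin

abbreviation "E \<equiv> tri_algebra A M enc"

definition pa where "pa x = fst (tri_dec A M enc x)"
definition pm where "pm x = fst (snd (tri_dec A M enc x))"
definition pd where "pd x = snd (snd (tri_dec A M enc x))"

lemma proj_enc [simp]:
  assumes "a \<in> carrier A" "m \<in> carrier M" "d \<in> carrier A"
  shows "pa (enc (a, m, d)) = a" "pm (enc (a, m, d)) = m" "pd (enc (a, m, d)) = d"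
  using inv_into_f_f[OF enc_inj, of "(a, m, d)"] assms by (simp_all add: pa_def pm_def pd_def tri_dec_def)

lemma E_simps:
  "carrier E = enc ` (carrier A \<times> carrier M \<times> carrier A)"
  "x \<otimes>\<^bsub>E\<^esub> y = enc (pa x \<otimes> pa y, pa x \<odot>\<^bsub>M\<^esub> pm y \<oplus>\<^bsub>M\<^esub> pd y \<odot>\<^bsub>M\<^esub> pm x, pd x \<otimes> pd y)"
  "\<one>\<^bsub>E\<^esub> = enc (\<one>, \<zero>\<^bsub>M\<^esub>, \<one>)" "\<zero>\<^bsub>E\<^esub> = enc (\<zero>, \<zero>\<^bsub>M\<^esub>, \<zero>)"
  "x \<oplus>\<^bsub>E\<^esub> y = enc (pa x \<oplus> pa y, pm x \<oplus>\<^bsub>M\<^esub> pm y, pd x \<oplus> pd y)"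
  "r \<odot>\<^bsub>E\<^esub> x = enc (r \<otimes> pa x, r \<odot>\<^bsub>M\<^esub> pm x, r \<otimes> pd x)"
  by (simp_all add: tri_algebra_def Let_def pa_def pm_def pd_def)

lemma E_cases:
  assumes "x \<in> carrier E"
  obtains a m d where "x = enc (a, m, d)" "a \<in> carrier A" "m \<in> carrier M" "d \<in> carrier A"
  using assms unfolding E_simps(1) by auto

lemma enc_closed [simp]:
  "a \<in> carrier A \<Longrightarrow> m \<in> carrier M \<Longrightarrow> d \<in> carrier A \<Longrightarrow> enc (a, m, d) \<in> carrier E"
  by (simp add: E_simps(1))

lemma E_enc [simp]:
  assumes "a \<in> carrier A" "m \<in> carrier M" "d \<in> carrier A"
  shows "a' \<in> carrier A \<Longrightarrow> m' \<in> carrier M \<Longrightarrow> d' \<in> carrier A \<Longrightarrow>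
      enc (a, m, d) \<otimes>\<^bsub>E\<^esub> enc (a', m', d') = enc (a \<otimes> a', a \<odot>\<^bsub>M\<^esub> m' \<oplus>\<^bsub>M\<^esub> d' \<odot>\<^bsub>M\<^esub> m, d \<otimes> d')"
    and "a' \<in> carrier A \<Longrightarrow> m' \<in> carrier M \<Longrightarrow> d' \<in> carrier A \<Longrightarrow>
      enc (a, m, d) \<oplus>\<^bsub>E\<^esub> enc (a', m', d') = enc (a \<oplus> a', m \<oplus>\<^bsub>M\<^esub> m', d \<oplus> d')"
    and "r \<in> carrier A \<Longrightarrow> r \<odot>\<^bsub>E\<^esub> enc (a, m, d) = enc (r \<otimes> a, r \<odot>\<^bsub>M\<^esub> m, r \<otimes> d)"
  using assms by (simp_all add: E_simps(2,5,6))

lemma proj_closed [simp]: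
  "x \<in> carrier E \<Longrightarrow> pa x \<in> carrier A" "x \<in> carrier E \<Longrightarrow> pm x \<in> carrier M" "x \<in> carrier E \<Longrightarrow> pd x \<in> carrier A"
  by (erule E_cases; simp)+

lemma E_abelian_group: "abelian_group E"
proof (rule abelian_groupI)
  show "\<exists>y \<in> carrier E. y \<oplus>\<^bsub>E\<^esub> x = \<zero>\<^bsub>E\<^esub>" if "x \<in> carrier E" for x
    using that
  proof (rule E_cases)
    fix a m d assume x: "x = enc (a, m, d)" "a \<in> carrier A" "m \<in> carrier M" "d \<in> carrier A"
    then show ?thesis
      by (intro bexI[of _ "enc (\<ominus> a, \<ominus>\<^bsub>M\<^esub> m, \<ominus> d)"])
        (simp_all add: R.l_neg M.l_neg E_simps(4))
  qed
  show "x \<oplus>\<^bsub>E\<^esub> y \<in> carrier E" if "x \<in> carrier E" "y \<in> carrier E" for x y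
    using that by (elim E_cases) simp
  show "\<zero>\<^bsub>E\<^esub> \<in> carrier E" by (simp add: E_simps(4))
  show "(x \<oplus>\<^bsub>E\<^esub> y) \<oplus>\<^bsub>E\<^esub> z = x \<oplus>\<^bsub>E\<^esub> (y \<oplus>\<^bsub>E\<^esub> z)" if "x \<in> carrier E" "y \<in> carrier E" "z \<in> carrier E" for x y z
    using that by (elim E_cases) (simp add: R.a_assoc M.a_assoc)
  show "x \<oplus>\<^bsub>E\<^esub> y = y \<oplus>\<^bsub>E\<^esub> x" if "x \<in> carrier E" "y \<in> carrier E" for x y
    using that by (elim E_cases) (simp add: R.a_comm M.a_comm)
  show "\<zero>\<^bsub>E\<^esub> \<oplus>\<^bsub>E\<^esub> x = x" if "x \<in> carrier E" for x
    using that by (elim E_cases) (simp add: E_simps(4))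
qed

lemma E_ring: "ring E"
proof (rule ringI[OF E_abelian_group])
  show "monoid E"
  proof (rule monoidI)
    show "x \<otimes>\<^bsub>E\<^esub> y \<in> carrier E" if "x \<in> carrier E" "y \<in> carrier E" for x y
      using that by (elim E_cases) simp
    show "\<one>\<^bsub>E\<^esub> \<in> carrier E" by (simp add: E_simps(3))
    show "(x \<otimes>\<^bsub>E\<^esub> y) \<otimes>\<^bsub>E\<^esub> z = x \<otimes>\<^bsub>E\<^esub> (y \<otimes>\<^bsub>E\<^esub> z)" if "x \<in> carrier E" "y \<in> carrier E" "z \<in> carrier E" for x y z
      using that
    proof (elim E_cases)
      fix a m d a' m' d' a'' m'' d''
      assume x: "x = enc (a, m, d)" "a \<in> carrier A" "m \<in> carrier M" "d \<in> carrier A"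
        "y = enc (a', m', d')" "a' \<in> carrier A" "m' \<in> carrier M" "d' \<in> carrier A"
        "z = enc (a'', m'', d'')" "a'' \<in> carrier A" "m'' \<in> carrier M" "d'' \<in> carrier A"
      have "d'' \<odot>\<^bsub>M\<^esub> (a \<odot>\<^bsub>M\<^esub> m') = a \<odot>\<^bsub>M\<^esub> (d'' \<odot>\<^bsub>M\<^esub> m')"
        "d'' \<odot>\<^bsub>M\<^esub> (d' \<odot>\<^bsub>M\<^esub> m) = d' \<odot>\<^bsub>M\<^esub> (d'' \<odot>\<^bsub>M\<^esub> m)"
        using x by (simp_all add: R.m_comm flip: smult_assoc1)
      then show ?thesis using x by (simp add: R.m_assoc smult_r_distr smult_assoc1 M.a_assoc)
    qed
    show "\<one>\<^bsub>E\<^esub> \<otimes>\<^bsub>E\<^esub> x = x" "x \<otimes>\<^bsub>E\<^esub> \<one>\<^bsub>E\<^esub> = x" if "x \<in> carrier E" for x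
      using that by (elim E_cases, simp add: E_simps(3))+
  qed
  show "(x \<oplus>\<^bsub>E\<^esub> y) \<otimes>\<^bsub>E\<^esub> z = x \<otimes>\<^bsub>E\<^esub> z \<oplus>\<^bsub>E\<^esub> y \<otimes>\<^bsub>E\<^esub> z" "z \<otimes>\<^bsub>E\<^esub> (x \<oplus>\<^bsub>E\<^esub> y) = z \<otimes>\<^bsub>E\<^esub> x \<oplus>\<^bsub>E\<^esub> z \<otimes>\<^bsub>E\<^esub> y"
    if "x \<in> carrier E" "y \<in> carrier E" "z \<in> carrier E" for x y z
    using that by (elim E_cases, simp add: R.l_distr R.r_distr smult_l_distr smult_r_distr M.a_ac)+
qed

lemma E_module: "module A E"
proof (rule moduleI[OF R.is_cring E_abelian_group])
  show "a \<odot>\<^bsub>E\<^esub> x \<in> carrier E" if "a \<in> carrier A" "x \<in> carrier E" for a x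
    using that(2) by (elim E_cases) (simp add: that(1))
  show "(a \<oplus> b) \<odot>\<^bsub>E\<^esub> x = a \<odot>\<^bsub>E\<^esub> x \<oplus>\<^bsub>E\<^esub> b \<odot>\<^bsub>E\<^esub> x" if "a \<in> carrier A" "b \<in> carrier A" "x \<in> carrier E" for a b x
    using that(3) by (elim E_cases) (simp add: that(1,2) R.l_distr smult_l_distr)
  show "a \<odot>\<^bsub>E\<^esub> (x \<oplus>\<^bsub>E\<^esub> y) = a \<odot>\<^bsub>E\<^esub> x \<oplus>\<^bsub>E\<^esub> a \<odot>\<^bsub>E\<^esub> y" if "a \<in> carrier A" "x \<in> carrier E" "y \<in> carrier E" for a x y
    using that(2,3) by (elim E_cases) (simp add: that(1) R.r_distr smult_r_distr)
  show "(a \<otimes> b) \<odot>\<^bsub>E\<^esub> x = a \<odot>\<^bsub>E\<^esub> (b \<odot>\<^bsub>E\<^esub> x)" if "a \<in> carrier A" "b \<in> carrier A" "x \<in> carrier E" for a b x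
    using that(3) by (elim E_cases) (simp add: that(1,2) R.m_assoc smult_assoc1)
  show "\<one> \<odot>\<^bsub>E\<^esub> x = x" if "x \<in> carrier E" for x
    using that by (elim E_cases) simp
qed

sublocale E: ring E by (rule E_ring)
sublocale E: module A E by (rule E_module)

lemma E_algebra: "nc_algebra A E"
  unfolding nc_algebra_def
proof (intro conjI ballI E_module E_ring)
  fix a x y assume a: "a \<in> carrier A" and "x \<in> carrier E" "y \<in> carrier E"
  then obtain b m d b' m' d' where x: "x = enc (b, m, d)" "b \<in> carrier A" "m \<in> carrier M" "d \<in> carrier A"
    "y = enc (b', m', d')" "b' \<in> carrier A" "m' \<in> carrier M" "d' \<in> carrier A"
    by (elim E_cases) blast
  have s: "d' \<odot>\<^bsub>M\<^esub> (a \<odot>\<^bsub>M\<^esub> m) = a \<odot>\<^bsub>M\<^esub> (d' \<odot>\<^bsub>M\<^esub> m)" "b \<odot>\<^bsub>M\<^esub> (a \<odot>\<^bsub>M\<^esub> m') = a \<odot>\<^bsub>M\<^esub> (b \<odot>\<^bsub>M\<^esub> m')"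
    using x a by (simp_all add: R.m_comm flip: smult_assoc1)
  show "(a \<odot>\<^bsub>E\<^esub> x) \<otimes>\<^bsub>E\<^esub> y = a \<odot>\<^bsub>E\<^esub> (x \<otimes>\<^bsub>E\<^esub> y)"
    using x a s by (simp add: R.m_assoc smult_assoc1 smult_r_distr)
  show "x \<otimes>\<^bsub>E\<^esub> (a \<odot>\<^bsub>E\<^esub> y) = a \<odot>\<^bsub>E\<^esub> (x \<otimes>\<^bsub>E\<^esub> y)"
    using x a s by (simp add: R.m_lcomm smult_assoc1 smult_r_distr)
qed

text \<open>The two diagonal idempotents and generators of \<open>M\<close> span the algebra already
  as a module.\<close>

lemma E_fg:
  assumes "fg_module A M"
  shows "fg_algebra A E"
proof -
  obtain S where S: "finite S" "S \<subseteq> carrier M" "\<And>H. submodule H A M \<Longrightarrow> S \<subseteq> H \<Longrightarrow> H = carrier M"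
    using assms unfolding fg_module_def by blast
  let ?S = "insert (enc (\<one>, \<zero>\<^bsub>M\<^esub>, \<zero>)) (insert (enc (\<zero>, \<zero>\<^bsub>M\<^esub>, \<one>)) ((\<lambda>s. enc (\<zero>, s, \<zero>)) ` S))"
  have "H = carrier E" if H: "submodule H A E" and SH: "?S \<subseteq> H" for H
  proof -
    note Hs = E.submoduleE[OF H]
    have zero: "\<zero>\<^bsub>E\<^esub> \<in> H" using subgroup.one_closed[OF submodule.axioms(1)[OF H]] by simp
    \<comment> \<open>A submodule of \<open>E\<close> containing the chosen elements cuts out a
      submodule of \<open>M\<close> containing the generators, hence all of
      \<open>M\<close>.\<close>
    let ?K = "{m \<in> carrier M. enc (\<zero>, m, \<zero>) \<in> H}"
    have "submodule ?K A M"
    proof (rule M.submoduleI)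
      show "\<zero>\<^bsub>M\<^esub> \<in> ?K" using zero by (simp add: E_simps(4))
      show "a \<oplus>\<^bsub>M\<^esub> b \<in> ?K" if "a \<in> ?K" "b \<in> ?K" for a b
        using that Hs(5)[of "enc (\<zero>, a, \<zero>)" "enc (\<zero>, b, \<zero>)"] by simp
      show smul: "r \<odot>\<^bsub>M\<^esub> a \<in> ?K" if "r \<in> carrier A" "a \<in> ?K" for r a
        using that Hs(4)[of r "enc (\<zero>, a, \<zero>)"] by simp
      show "\<ominus>\<^bsub>M\<^esub> a \<in> ?K" if "a \<in> ?K" for a
        using smul[of "\<ominus> \<one>" a] that by (simp add: smult_l_minus)
    qed auto
    then have K: "?K = carrier M" by (rule S(3)) (use S(2) SH in auto)
    have "enc (a, m, d) \<in> H" if "a \<in> carrier A" "m \<in> carrier M" "d \<in> carrier A" for a m d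
    proof -
      have "a \<odot>\<^bsub>E\<^esub> enc (\<one>, \<zero>\<^bsub>M\<^esub>, \<zero>) \<oplus>\<^bsub>E\<^esub> (enc (\<zero>, m, \<zero>) \<oplus>\<^bsub>E\<^esub> d \<odot>\<^bsub>E\<^esub> enc (\<zero>, \<zero>\<^bsub>M\<^esub>, \<one>)) \<in> H"
      proof (rule Hs(5)[OF Hs(4)[OF that(1)] Hs(5)[OF _ Hs(4)[OF that(3)]]])
        show "enc (\<zero>, m, \<zero>) \<in> H" using K that(2) by blast
      qed (use SH in auto)
      then show ?thesis using that by simp
    qed
    then show ?thesis using Hs(1) by (auto simp: E_simps(1))
  qed
  then show ?thesis unfolding fg_algebra_def using S(1,2)
    by (intro conjI E_algebra exI[of _ ?S]) auto
qed

text \<open>The base change of a diagonal entry \<open>pr\<close>, an algebra homomorphism pinned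
  down by its values on pure tensors; the choice turns an existence statement into a
  function.\<close>

definition tri_proj :: "('u \<Rightarrow> 'u) \<Rightarrow> 'u ring \<Rightarrow> ('u \<Rightarrow> 'u) \<Rightarrow> ('u \<times> 'u \<Rightarrow>\<^sub>0 int) set \<Rightarrow> 'u" where
  "tri_proj pr B f = (SOME \<pi>. \<pi> \<in> ring_hom (base_change A E B f) B \<and>
     (\<forall>b \<in> carrier B. \<forall>c \<in> carrier (base_change A E B f). \<pi> (b \<odot>\<^bsub>base_change A E B f\<^esub> c) = b \<otimes>\<^bsub>B\<^esub> \<pi> c) \<and>
     (\<forall>x \<in> carrier E. \<forall>b \<in> carrier B. \<pi> (pure A E B f x b) = f (pr x) \<otimes>\<^bsub>B\<^esub> b))"

text \<open>The determinant of an upper triangular matrix, as a polynomial law.\<close>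

definition tri_law :: "('u, 'u, 'u) law" where
  "tri_law B f x = tri_proj pa B f x \<otimes>\<^bsub>B\<^esub> tri_proj pd B f x"

lemma ext_alg:
  assumes "comm_alg A B f"
  shows "algebra_ext A E B f"
  using algebra_extI[OF E_algebra, of B f] assms by (simp add: comm_alg_def)

lemma tri_proj:
  assumes B: "comm_alg A B f" and pr: "pr = pa \<or> pr = pd"
  shows "tri_proj pr B f \<in> ring_hom (base_change A E B f) B"
    and "b \<in> carrier B \<Longrightarrow> c \<in> carrier (base_change A E B f) \<Longrightarrow>
      tri_proj pr B f (b \<odot>\<^bsub>base_change A E B f\<^esub> c) = b \<otimes>\<^bsub>B\<^esub> tri_proj pr B f c"
    and "x \<in> carrier E \<Longrightarrow> b \<in> carrier B \<Longrightarrow> tri_proj pr B f (pure A E B f x b) = f (pr x) \<otimes>\<^bsub>B\<^esub> b"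
proof -
  interpret X: algebra_ext A E B f by (rule ext_alg[OF B])
  note fh = ring_hom_closed[OF X.k_hom] ring_hom_add[OF X.k_hom] ring_hom_mult[OF X.k_hom] ring_hom_one[OF X.k_hom]
  have prh: "pr x \<in> carrier A \<and> pr (x \<oplus>\<^bsub>E\<^esub> y) = pr x \<oplus> pr y \<and> pr (x \<otimes>\<^bsub>E\<^esub> y) = pr x \<otimes> pr y"
    if "x \<in> carrier E" "y \<in> carrier E" for x y
    using that pr by (auto elim!: E_cases)
  have pr1: "pr \<one>\<^bsub>E\<^esub> = \<one>" using pr by (auto simp: E_simps(3))
  have prs: "pr (r \<odot>\<^bsub>E\<^esub> x) = r \<otimes> pr x" if "r \<in> carrier A" "x \<in> carrier E" for r x
    using that(2) pr that(1) by (auto elim!: E_cases)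
  have "(\<lambda>x. f (pr x)) \<in> ring_hom E B"
    by (rule ring_hom_memI) (use prh pr1 fh in auto)
  moreover have "f (pr (r \<odot>\<^bsub>E\<^esub> x)) = f r \<otimes>\<^bsub>B\<^esub> f (pr x)" if "r \<in> carrier A" "x \<in> carrier E" for r x
    using prs[OF that] fh(3)[OF that(1)] prh[OF that(2) that(2)] by simp
  ultimately obtain \<pi> where "\<pi> \<in> ring_hom X.MB B"
    "\<And>b c. b \<in> carrier B \<Longrightarrow> c \<in> carrier X.MB \<Longrightarrow> \<pi> (b \<odot>\<^bsub>X.MB\<^esub> c) = b \<otimes>\<^bsub>B\<^esub> \<pi> c"
    "\<And>x b. x \<in> carrier E \<Longrightarrow> b \<in> carrier B \<Longrightarrow> \<pi> (X.pu x b) = f (pr x) \<otimes>\<^bsub>B\<^esub> b"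
    by (rule X.universal_ring_hom) blast+
  then have "\<exists>\<pi>. \<pi> \<in> ring_hom X.MB B \<and>
     (\<forall>b \<in> carrier B. \<forall>c \<in> carrier X.MB. \<pi> (b \<odot>\<^bsub>X.MB\<^esub> c) = b \<otimes>\<^bsub>B\<^esub> \<pi> c) \<and>
     (\<forall>x \<in> carrier E. \<forall>b \<in> carrier B. \<pi> (X.pu x b) = f (pr x) \<otimes>\<^bsub>B\<^esub> b)"
    by blast
  from someI_ex[OF this, folded tri_proj_def]
  show "tri_proj pr B f \<in> ring_hom X.MB B"
    "b \<in> carrier B \<Longrightarrow> c \<in> carrier X.MB \<Longrightarrow> tri_proj pr B f (b \<odot>\<^bsub>X.MB\<^esub> c) = b \<otimes>\<^bsub>B\<^esub> tri_proj pr B f c"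
    "x \<in> carrier E \<Longrightarrow> b \<in> carrier B \<Longrightarrow> tri_proj pr B f (X.pu x b) = f (pr x) \<otimes>\<^bsub>B\<^esub> b"
    by blast+
qed

lemma tri_proj_natural:
  assumes B: "comm_alg A B f" and B': "comm_alg A B' f'" and k: "k \<in> ring_hom B B'"
    and kf: "\<And>a. a \<in> carrier A \<Longrightarrow> k (f a) = f' a" and pr: "pr = pa \<or> pr = pd"
    and x: "x \<in> carrier (base_change A E B f)"
  shows "tri_proj pr B' f' (base_change_map A E B' f' (\<lambda>e. e) k x) = k (tri_proj pr B f x)"
proof -
  interpret X: algebra_ext A E B f by (rule ext_alg[OF B])
  interpret Y: algebra_ext A E B' f' by (rule ext_alg[OF B'])
  have se: "scalar_ext A E B' f'" by (rule Y.scalar_ext_axioms)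
  have bcm: "base_change_map A E B' f' (\<lambda>e. e) k c \<in> carrier Y.MB" if "c \<in> carrier X.MB" for c
    by (rule X.base_change_map_hom(1)[OF se, where \<eta> = "\<lambda>a. a"]) (use k kf that in simp_all)
  have bca: "base_change_map A E B' f' (\<lambda>e. e) k (c \<oplus>\<^bsub>X.MB\<^esub> d) =
      base_change_map A E B' f' (\<lambda>e. e) k c \<oplus>\<^bsub>Y.MB\<^esub> base_change_map A E B' f' (\<lambda>e. e) k d"
    if "c \<in> carrier X.MB" "d \<in> carrier X.MB" for c d
    by (rule X.base_change_map_hom(2)[OF se, where \<eta> = "\<lambda>a. a"]) (use k kf that in simp_all)
  have bcp: "base_change_map A E B' f' (\<lambda>e. e) k (X.pu e b) = Y.pu e (k b)"
    if "e \<in> carrier E" "b \<in> carrier B" for e b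
    by (rule X.base_change_map_hom(3)[OF se, where \<eta> = "\<lambda>a. a"]) (use k kf that in simp_all)
  note p = tri_proj[OF B pr] and p' = tri_proj[OF B' pr]
  note pc = ring_hom_closed[OF p(1)] and pc' = ring_hom_closed[OF p'(1)]
  show ?thesis
  proof (rule X.additive_eqI[OF Y.B.abelian_group_axioms _ _ _ _ _ x])
    show "(\<lambda>x. tri_proj pr B' f' (base_change_map A E B' f' (\<lambda>e. e) k x)) \<in> carrier X.MB \<rightarrow> carrier B'"
      using bcm pc' by blast
    show "(\<lambda>x. k (tri_proj pr B f x)) \<in> carrier X.MB \<rightarrow> carrier B'"
      using pc ring_hom_closed[OF k] by blast
    show "tri_proj pr B' f' (base_change_map A E B' f' (\<lambda>e. e) k (c \<oplus>\<^bsub>X.MB\<^esub> d)) =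
        tri_proj pr B' f' (base_change_map A E B' f' (\<lambda>e. e) k c) \<oplus>\<^bsub>B'\<^esub> tri_proj pr B' f' (base_change_map A E B' f' (\<lambda>e. e) k d)"
      if "c \<in> carrier X.MB" "d \<in> carrier X.MB" for c d
      using bca[OF that] bcm that by (simp add: ring_hom_add[OF p'(1)])
    show "k (tri_proj pr B f (c \<oplus>\<^bsub>X.MB\<^esub> d)) = k (tri_proj pr B f c) \<oplus>\<^bsub>B'\<^esub> k (tri_proj pr B f d)"
      if "c \<in> carrier X.MB" "d \<in> carrier X.MB" for c d
      using that pc by (simp add: ring_hom_add[OF p(1)] ring_hom_add[OF k])
    show "tri_proj pr B' f' (base_change_map A E B' f' (\<lambda>e. e) k (X.pu e b)) = k (tri_proj pr B f (X.pu e b))"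
      if e: "e \<in> carrier E" and b: "b \<in> carrier B" for e b
    proof -
      have pe: "pr e \<in> carrier A" using pr e by auto
      show ?thesis
        using bcp[OF e b] p(3)[OF e b] p'(3)[OF e ring_hom_closed[OF k b]] kf[OF pe]
          ring_hom_mult[OF k X.k_closed[OF pe] b] by simp
    qed
  qed
qed

text \<open>Both diagonal projections are algebra homomorphisms to a commutative ring, so their
  product is multiplicative and homogeneous of degree 2.\<close>

lemma tri_pseudorep: "pseudorep 2 A E tri_law"
  unfolding pseudorep_def polynomial_law_def Let_def
proof (intro conjI allI impI ballI)
  show "nc_algebra A E" by (rule E_algebra)
  fix B :: "'u ring" and f :: "'u \<Rightarrow> 'u" assume B: "comm_alg A B f"
  interpret X: algebra_ext A E B f by (rule ext_alg[OF B])
  note p = tri_proj[OF B, of pa, simplified] and q = tri_proj[OF B, of pd, simplified]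
  note pc = ring_hom_closed[OF p(1)] and qc = ring_hom_closed[OF q(1)]
  show "tri_law B f \<in> carrier X.MB \<rightarrow> carrier B"
    using pc qc by (simp add: tri_law_def[abs_def])
  show "tri_law B f (b \<odot>\<^bsub>X.MB\<^esub> x) = b [^]\<^bsub>B\<^esub> (2::nat) \<otimes>\<^bsub>B\<^esub> tri_law B f x"
    if "b \<in> carrier B" "x \<in> carrier X.MB" for b x
    using that pc qc by (simp add: tri_law_def p(2) q(2) X.B.m_ac numeral_2_eq_2)
  show "tri_law B f \<one>\<^bsub>X.MB\<^esub> = \<one>\<^bsub>B\<^esub>"
    by (simp add: tri_law_def ring_hom_one[OF p(1)] ring_hom_one[OF q(1)])
  show "tri_law B f (x \<otimes>\<^bsub>X.MB\<^esub> y) = tri_law B f x \<otimes>\<^bsub>B\<^esub> tri_law B f y"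
    if "x \<in> carrier X.MB" "y \<in> carrier X.MB" for x y
    using that pc qc by (simp add: tri_law_def ring_hom_mult[OF p(1)] ring_hom_mult[OF q(1)] X.B.m_ac)
next
  fix B :: "'u ring" and f :: "'u \<Rightarrow> 'u" and B' :: "'u ring" and f' k x
  assume "comm_alg A B f \<and> comm_alg A B' f' \<and> k \<in> ring_hom B B' \<and> (\<forall>a \<in> carrier A. k (f a) = f' a)"
    and x: "x \<in> carrier (base_change A E B f)"
  then have B: "comm_alg A B f" and B': "comm_alg A B' f'" and k: "k \<in> ring_hom B B'"
    and kf: "\<And>a. a \<in> carrier A \<Longrightarrow> k (f a) = f' a" by blast+
  show "tri_law B' f' (base_change_map A E B' f' (\<lambda>e. e) k x) = k (tri_law B f x)"
    using tri_proj_natural[OF B B' k kf _ x]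
      ring_hom_closed[OF tri_proj(1)[OF B] x] by (simp add: tri_law_def ring_hom_mult[OF k])
qed

text \<open>The Cayley--Hamilton identity factors as \<open>(x - \<pi>\<^sub>a x) (x - \<pi>\<^sub>d x) = 0\<close>: the first column of
  the left factor and the second row of the right factor vanish.\<close>

lemma tri_cayley_hamilton_product:
  assumes B: "comm_alg A B f" and x: "x \<in> carrier (base_change A E B f)"
  shows "(x \<ominus>\<^bsub>base_change A E B f\<^esub> tri_proj pa B f x \<odot>\<^bsub>base_change A E B f\<^esub> \<one>\<^bsub>base_change A E B f\<^esub>) \<otimes>\<^bsub>base_change A E B f\<^esub>
    (x \<ominus>\<^bsub>base_change A E B f\<^esub> tri_proj pd B f x \<odot>\<^bsub>base_change A E B f\<^esub> \<one>\<^bsub>base_change A E B f\<^esub>) = \<zero>\<^bsub>base_change A E B f\<^esub>"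
proof -
  interpret X: algebra_ext A E B f by (rule ext_alg[OF B])
  note p = tri_proj[OF B, of pa, simplified] and q = tri_proj[OF B, of pd, simplified]
  note pc = ring_hom_closed[OF p(1)] and qc = ring_hom_closed[OF q(1)]
  let ?e1 = "enc (\<one>, \<zero>\<^bsub>M\<^esub>, \<zero>)" and ?e2 = "enc (\<zero>, \<zero>\<^bsub>M\<^esub>, \<one>)"
  let ?d1 = "X.pu ?e1 \<one>\<^bsub>B\<^esub>" and ?d2 = "X.pu ?e2 \<one>\<^bsub>B\<^esub>"
  have e: "?e1 \<in> carrier E" "?e2 \<in> carrier E" by simp_all
  have d: "?d1 \<in> carrier X.MB" "?d2 \<in> carrier X.MB" by simp_all
  have left: "y \<otimes>\<^bsub>X.MB\<^esub> ?d1 = tri_proj pa B f y \<odot>\<^bsub>X.MB\<^esub> ?d1" if "y \<in> carrier X.MB" for y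
    using that
  proof (induction rule: X.pure_induct)
    case zero
    show ?case using ring_hom_closed[OF p(1)] additive_zero[OF X.MB_abelian_group X.B.abelian_group_axioms, of "tri_proj pa B f"]
      by (simp add: ring_hom_add[OF p(1)] X.MB.smult_l_null Pi_def)
  next
    case (pure x b)
    have *: "x \<otimes>\<^bsub>E\<^esub> ?e1 = pa x \<odot>\<^bsub>E\<^esub> ?e1" using pure(1) by (elim E_cases) simp
    have "X.pu (x \<otimes>\<^bsub>E\<^esub> ?e1) b = X.pu ?e1 (f (pa x) \<otimes>\<^bsub>B\<^esub> b)"
      unfolding * using pure by (intro X.pure_balanced) simp_all
    then show ?case using pure by (simp add: p(3))
  next
    case (add c d)
    then show ?case by (simp add: X.MB.l_distr X.MB.smult_l_distr ring_hom_add[OF p(1)] pc X.pure_add_r)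
  qed
  have right: "?d2 \<otimes>\<^bsub>X.MB\<^esub> y = tri_proj pd B f y \<odot>\<^bsub>X.MB\<^esub> ?d2" if "y \<in> carrier X.MB" for y
    using that
  proof (induction rule: X.pure_induct)
    case zero
    show ?case using ring_hom_closed[OF q(1)] additive_zero[OF X.MB_abelian_group X.B.abelian_group_axioms, of "tri_proj pd B f"]
      by (simp add: ring_hom_add[OF q(1)] X.MB.smult_l_null Pi_def)
  next
    case (pure x b)
    have *: "?e2 \<otimes>\<^bsub>E\<^esub> x = pd x \<odot>\<^bsub>E\<^esub> ?e2" using pure(1) by (elim E_cases) simp
    have "X.pu (?e2 \<otimes>\<^bsub>E\<^esub> x) b = X.pu ?e2 (f (pd x) \<otimes>\<^bsub>B\<^esub> b)"
      unfolding * using pure by (intro X.pure_balanced) simp_all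
    then show ?case using pure by (simp add: q(3))
  next
    case (add c d)
    then show ?case by (simp add: X.MB.r_distr X.MB.smult_l_distr ring_hom_add[OF q(1)] qc X.pure_add_r)
  qed
  have one: "?d1 \<oplus>\<^bsub>X.MB\<^esub> ?d2 = \<one>\<^bsub>X.MB\<^esub>"
    using X.pure_add_l[OF e X.B.one_closed] by (simp add: X.one_pure E_simps(3))
  have sub: "\<pi> (x \<ominus>\<^bsub>X.MB\<^esub> \<pi> x \<odot>\<^bsub>X.MB\<^esub> \<one>\<^bsub>X.MB\<^esub>) = \<zero>\<^bsub>B\<^esub>"
    if \<pi>: "\<pi> \<in> ring_hom X.MB B" "\<And>b c. b \<in> carrier B \<Longrightarrow> c \<in> carrier X.MB \<Longrightarrow> \<pi> (b \<odot>\<^bsub>X.MB\<^esub> c) = b \<otimes>\<^bsub>B\<^esub> \<pi> c" for \<pi>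
  proof -
    have c: "\<pi> x \<in> carrier B" "\<pi> x \<odot>\<^bsub>X.MB\<^esub> \<one>\<^bsub>X.MB\<^esub> \<in> carrier X.MB" using ring_hom_closed[OF \<pi>(1) x] by simp_all
    let ?w = "\<pi> x \<odot>\<^bsub>X.MB\<^esub> \<one>\<^bsub>X.MB\<^esub>"
    have "\<pi> x = \<pi> (?w \<oplus>\<^bsub>X.MB\<^esub> (x \<ominus>\<^bsub>X.MB\<^esub> ?w))" using X.MB.add_minus_cancel[OF x c(2)] by simp
    also have "\<dots> = \<pi> x \<oplus>\<^bsub>B\<^esub> \<pi> (x \<ominus>\<^bsub>X.MB\<^esub> ?w)"
      using x c by (simp add: ring_hom_add[OF \<pi>(1)] \<pi>(2) ring_hom_one[OF \<pi>(1)])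
    finally show ?thesis using c ring_hom_closed[OF \<pi>(1)] x by (simp add: X.B.add.l_cancel_one)
  qed
  let ?y = "x \<ominus>\<^bsub>X.MB\<^esub> tri_proj pa B f x \<odot>\<^bsub>X.MB\<^esub> \<one>\<^bsub>X.MB\<^esub>"
  let ?z = "x \<ominus>\<^bsub>X.MB\<^esub> tri_proj pd B f x \<odot>\<^bsub>X.MB\<^esub> \<one>\<^bsub>X.MB\<^esub>"
  have y: "?y \<in> carrier X.MB" and z: "?z \<in> carrier X.MB" using x pc qc by simp_all
  have py: "tri_proj pa B f ?y = \<zero>\<^bsub>B\<^esub>" by (rule sub[OF p(1)]) (rule p(2))
  have qz: "tri_proj pd B f ?z = \<zero>\<^bsub>B\<^esub>" by (rule sub[OF q(1)]) (rule q(2))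
  \<comment> \<open>Inserting the identity as the sum of the two idempotents splits the product into
    two terms, each with a vanishing factor.\<close>
  have "?y \<otimes>\<^bsub>X.MB\<^esub> ?z = ?y \<otimes>\<^bsub>X.MB\<^esub> ((?d1 \<oplus>\<^bsub>X.MB\<^esub> ?d2) \<otimes>\<^bsub>X.MB\<^esub> ?z)" using one y z by simp
  also have "\<dots> = (?y \<otimes>\<^bsub>X.MB\<^esub> ?d1) \<otimes>\<^bsub>X.MB\<^esub> ?z \<oplus>\<^bsub>X.MB\<^esub> ?y \<otimes>\<^bsub>X.MB\<^esub> (?d2 \<otimes>\<^bsub>X.MB\<^esub> ?z)"
    using y z d by (simp add: X.MB.l_distr X.MB.r_distr X.MB.m_assoc)
  also have "\<dots> = \<zero>\<^bsub>X.MB\<^esub>"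
    unfolding left[OF y] right[OF z] py qz using y z d by (simp only: X.MB.smult_l_null X.MB_null X.MB.r_zero X.MB.zero_closed)
  finally show ?thesis .
qed

end

section \<open>Characteristic polynomials of degree two\<close>

lemma UP_quadratic_coeff:
  assumes B: "cring B" and c: "c \<in> carrier B" "d \<in> carrier B"
    and q: "q = (monom (UP B) \<one>\<^bsub>B\<^esub> 1 \<ominus>\<^bsub>UP B\<^esub> monom (UP B) c 0) \<otimes>\<^bsub>UP B\<^esub> (monom (UP B) \<one>\<^bsub>B\<^esub> 1 \<ominus>\<^bsub>UP B\<^esub> monom (UP B) d 0)"
  shows "q \<in> carrier (UP B)" "coeff (UP B) q 0 = c \<otimes>\<^bsub>B\<^esub> d" "coeff (UP B) q (Suc 0) = \<ominus>\<^bsub>B\<^esub> (c \<oplus>\<^bsub>B\<^esub> d)"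
    "coeff (UP B) q (Suc (Suc 0)) = \<one>\<^bsub>B\<^esub>" "\<And>n. n > Suc (Suc 0) \<Longrightarrow> coeff (UP B) q n = \<zero>\<^bsub>B\<^esub>"
proof -
  interpret B: cring B by (rule B)
  interpret U: UP_cring B "UP B" by unfold_locales simp
  define L where "L c = monom (UP B) \<one>\<^bsub>B\<^esub> 1 \<ominus>\<^bsub>UP B\<^esub> monom (UP B) c 0" for c
  have l: "L c \<in> carrier (UP B)" "coeff (UP B) (L c) 0 = \<ominus>\<^bsub>B\<^esub> c" "coeff (UP B) (L c) (Suc 0) = \<one>\<^bsub>B\<^esub>"
    "\<And>n. n > Suc 0 \<Longrightarrow> coeff (UP B) (L c) n = \<zero>\<^bsub>B\<^esub>" if "c \<in> carrier B" for c
    using that by (simp_all add: L_def U.P.minus_eq)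
  note lc = l[OF c(1)] and ld = l[OF c(2)]
  have q: "q = L c \<otimes>\<^bsub>UP B\<^esub> L d" by (simp add: q L_def)
  show "q \<in> carrier (UP B)" unfolding q using lc(1) ld(1) by simp
  note m = U.coeff_mult[OF lc(1) ld(1), folded q]
  let ?t = "\<lambda>n i. coeff (UP B) (L c) i \<otimes>\<^bsub>B\<^esub> coeff (UP B) (L d) (n - i)"
  have t: "?t n \<in> N \<rightarrow> carrier B" for n N
    using U.coeff_closed[OF lc(1)] U.coeff_closed[OF ld(1)] by simp
  have s0: "finsum B (?t n) {..0} = ?t n 0" for n by (rule B.finsum_0[OF t])
  have s1: "finsum B (?t n) {..Suc 0} = ?t n (Suc 0) \<oplus>\<^bsub>B\<^esub> ?t n 0" for n
    using B.finsum_Suc[OF t, of n 0] s0 by simp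
  have s2: "finsum B (?t n) {..Suc (Suc 0)} = ?t n (Suc (Suc 0)) \<oplus>\<^bsub>B\<^esub> (?t n (Suc 0) \<oplus>\<^bsub>B\<^esub> ?t n 0)" for n
    using B.finsum_Suc[OF t, of n "Suc 0"] s1 by simp
  show "coeff (UP B) q 0 = c \<otimes>\<^bsub>B\<^esub> d" unfolding m s0 using c lc ld by (simp add: B.l_minus B.r_minus)
  show "coeff (UP B) q (Suc 0) = \<ominus>\<^bsub>B\<^esub> (c \<oplus>\<^bsub>B\<^esub> d)"
    unfolding m s1 using c by (simp add: lc ld B.minus_add B.a_comm)
  show "coeff (UP B) q (Suc (Suc 0)) = \<one>\<^bsub>B\<^esub>"
    unfolding m s2 using c by (simp add: lc ld)
  show "coeff (UP B) q n = \<zero>\<^bsub>B\<^esub>" if n: "n > Suc (Suc 0)" for n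
  proof -
    \<comment> \<open>Above degree 2 one of the indices \<open>i\<close> and \<open>n - i\<close>
      exceeds 1, the degree of a linear factor.\<close>
    have "?t n i = \<zero>\<^bsub>B\<^esub>" if "i \<in> {..n}" for i
    proof (cases "i > Suc 0")
      case True
      then show ?thesis using lc(4)[OF True] U.coeff_closed[OF ld(1)] by simp
    next
      case False
      then have "n - i > Suc 0" using n by simp
      then show ?thesis using ld(4) U.coeff_closed[OF lc(1)] by simp
    qed
    then have "finsum B (?t n) {..n} = finsum B (\<lambda>_. \<zero>\<^bsub>B\<^esub>) {..n}" by (intro B.finsum_cong') auto
    then show ?thesis unfolding m by simp
  qed
qed

text \<open>The target ring may be noncommutative, so the value is computed by expanding the
  defining sum and not through multiplicativity of evaluation.\<close>

lemma eval_quadratic: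
  assumes B: "cring B" and S: "ring S" and c: "c \<in> carrier B" "d \<in> carrier B"
    and q: "q = (monom (UP B) \<one>\<^bsub>B\<^esub> 1 \<ominus>\<^bsub>UP B\<^esub> monom (UP B) c 0) \<otimes>\<^bsub>UP B\<^esub> (monom (UP B) \<one>\<^bsub>B\<^esub> 1 \<ominus>\<^bsub>UP B\<^esub> monom (UP B) d 0)"
    and \<phi>: "\<And>b. b \<in> carrier B \<Longrightarrow> \<phi> b \<in> carrier S" "\<phi> \<zero>\<^bsub>B\<^esub> = \<zero>\<^bsub>S\<^esub>" and s: "s \<in> carrier S"
  shows "eval B S \<phi> s q = \<phi> \<one>\<^bsub>B\<^esub> \<otimes>\<^bsub>S\<^esub> (s \<otimes>\<^bsub>S\<^esub> s) \<oplus>\<^bsub>S\<^esub> (\<phi> (\<ominus>\<^bsub>B\<^esub> (c \<oplus>\<^bsub>B\<^esub> d)) \<otimes>\<^bsub>S\<^esub> s \<oplus>\<^bsub>S\<^esub> \<phi> (c \<otimes>\<^bsub>B\<^esub> d))"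
proof -
  interpret B: cring B by (rule B)
  interpret S: ring S by (rule S)
  interpret U: UP_cring B "UP B" by unfold_locales simp
  note qc = UP_quadratic_coeff[OF B c q]
  \<comment> \<open>Only an upper bound for the degree: over the zero ring the degree is 0, so the
    sum is extended up to index 2 by vanishing terms.\<close>
  have deg: "deg B q \<le> Suc (Suc 0)" by (rule U.deg_aboveI[OF qc(5) qc(1)])
  let ?t = "\<lambda>i. \<phi> (coeff (UP B) q i) \<otimes>\<^bsub>S\<^esub> s [^]\<^bsub>S\<^esub> i"
  have t: "?t i \<in> carrier S" for i using \<phi>(1) U.coeff_closed[OF qc(1)] s by simp
  have "eval B S \<phi> s q = finsum S ?t {..deg B q}" using qc(1) by (simp add: eval_def)
  also have "\<dots> = finsum S ?t {..Suc (Suc 0)}"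
  proof (rule S.add.finprod_mono_neutral_cong_left)
    show "?t i = \<zero>\<^bsub>S\<^esub>" if "i \<in> {..Suc (Suc 0)} - {..deg B q}" for i
      using that U.deg_aboveD[of q i] qc(1) \<phi>(2) s by simp
  qed (use deg t in auto)
  also have "\<dots> = ?t (Suc (Suc 0)) \<oplus>\<^bsub>S\<^esub> (?t (Suc 0) \<oplus>\<^bsub>S\<^esub> ?t 0)"
  proof -
    have T: "?t \<in> N \<rightarrow> carrier S" for N using t by blast
    have 0: "finsum S ?t {..0} = ?t 0" by (rule S.finsum_0[OF T])
    have 1: "finsum S ?t {..Suc 0} = ?t (Suc 0) \<oplus>\<^bsub>S\<^esub> ?t 0"
      using S.finsum_Suc[OF T, of 0] 0 by simp
    show ?thesis using S.finsum_Suc[OF T, of "Suc 0"] 1 by simp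
  qed
  also have "\<dots> = \<phi> \<one>\<^bsub>B\<^esub> \<otimes>\<^bsub>S\<^esub> (s \<otimes>\<^bsub>S\<^esub> s) \<oplus>\<^bsub>S\<^esub> (\<phi> (\<ominus>\<^bsub>B\<^esub> (c \<oplus>\<^bsub>B\<^esub> d)) \<otimes>\<^bsub>S\<^esub> s \<oplus>\<^bsub>S\<^esub> \<phi> (c \<otimes>\<^bsub>B\<^esub> d))"
    using s c \<phi>(1) by (simp add: qc(2-4))
  finally show ?thesis .
qed

context triangular
begin

text \<open>The characteristic polynomial of \<open>x\<close> is the product of \<open>t - c\<close>
  and \<open>t - d\<close> for the two diagonal projections \<open>c\<close>, \<open>d\<close> of
  \<open>x\<close>, so its value at \<open>x\<close> is the product already shown to vanish.\<close>

lemma tri_cayley_hamilton: "cayley_hamilton A E tri_law"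
  unfolding cayley_hamilton_def Let_def
proof (intro allI impI ballI)
  fix B :: "'u ring" and f :: "'u \<Rightarrow> 'u" and P :: "'u ring" and h x
  assume "comm_alg A B f \<and> cring P \<and> h \<in> ring_iso (UP B) P" and x: "x \<in> carrier (base_change A E B f)"
  then have B: "comm_alg A B f" and P: "cring P" and h: "h \<in> ring_hom (UP B) P"
    and hinj: "inj_on h (carrier (UP B))" by (auto simp: ring_iso_def bij_betw_def)
  interpret X: algebra_ext A E B f by (rule ext_alg[OF B])
  interpret U: UP_cring B "UP B" by unfold_locales simp
  interpret P: cring P by (rule P)
  define inc where "inc b = h (up_ring.monom (UP B) b 0)" for b
  define t where "t = h (up_ring.monom (UP B) \<one>\<^bsub>B\<^esub> 1)"
  define f' where "f' a = inc (f a)" for a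
  have inc: "inc \<in> ring_hom B P"
  proof (rule ring_hom_memI)
    show "inc (a \<otimes>\<^bsub>B\<^esub> b) = inc a \<otimes>\<^bsub>P\<^esub> inc b" if "a \<in> carrier B" "b \<in> carrier B" for a b
      using U.monom_mult[OF that, of 0 0] that by (simp add: inc_def ring_hom_mult[OF h])
  qed (simp_all add: inc_def ring_hom_closed[OF h] ring_hom_add[OF h] ring_hom_one[OF h])
  have f'_hom: "f' \<in> ring_hom A P"
    using ring_hom_trans[OF X.k_hom inc] by (simp add: f'_def[abs_def] o_def)
  have P': "comm_alg A P f'" using P f'_hom by (simp add: comm_alg_def)
  interpret Y: algebra_ext A E P f' by (rule ext_alg[OF P'])
  define y where "y = base_change_map A E P f' (\<lambda>e. e) inc x"
  have y: "y \<in> carrier Y.MB" unfolding y_def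
    by (rule X.base_change_map_hom(1)[OF Y.scalar_ext_axioms, where \<eta> = "\<lambda>a. a"]) (use inc x in \<open>simp_all add: f'_def\<close>)
  have tc: "t \<in> carrier P" unfolding t_def by (rule ring_hom_closed[OF h]) simp
  let ?c = "tri_proj pa B f x" and ?d = "tri_proj pd B f x"
  have cd: "?c \<in> carrier B" "?d \<in> carrier B"
    using ring_hom_closed[OF tri_proj(1)[OF B] x] by simp_all
  \<comment> \<open>Each projection is a \<open>P\<close>-linear ring homomorphism, natural in the
    coefficients, and so sends \<open>t - x\<close> to the corresponding linear factor, read in the
    copy \<open>P\<close> of the polynomial ring.\<close>
  have proj: "tri_proj pr P f' ((t \<odot>\<^bsub>Y.MB\<^esub> \<one>\<^bsub>Y.MB\<^esub>) \<ominus>\<^bsub>Y.MB\<^esub> y) =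
      h (up_ring.monom (UP B) \<one>\<^bsub>B\<^esub> 1 \<ominus>\<^bsub>UP B\<^esub> up_ring.monom (UP B) (tri_proj pr B f x) 0)" if pr: "pr = pa \<or> pr = pd" for pr
  proof -
    note p = tri_proj[OF P' pr]
    interpret p: ring_hom_ring Y.MB P "tri_proj pr P f'"
      by (rule ring_hom_ringI2[OF Y.MB_ring P.ring_axioms p(1)])
    interpret hh: ring_hom_ring "UP B" P h
      by (rule ring_hom_ringI2[OF U.P.ring_axioms P.ring_axioms h])
    have cB: "tri_proj pr B f x \<in> carrier B" using ring_hom_closed[OF tri_proj(1)[OF B pr] x] .
    have "tri_proj pr P f' y = inc (tri_proj pr B f x)"
      unfolding y_def by (rule tri_proj_natural[OF B P' inc _ pr x]) (simp add: f'_def)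
    then show ?thesis
      using tc y cB by (simp add: Y.MB.minus_eq U.P.minus_eq p(2) t_def inc_def)
  qed
  define q where "q = (up_ring.monom (UP B) \<one>\<^bsub>B\<^esub> 1 \<ominus>\<^bsub>UP B\<^esub> up_ring.monom (UP B) ?c 0) \<otimes>\<^bsub>UP B\<^esub> (up_ring.monom (UP B) \<one>\<^bsub>B\<^esub> 1 \<ominus>\<^bsub>UP B\<^esub> up_ring.monom (UP B) ?d 0)"
  note qc = UP_quadratic_coeff(1)[OF X.B.is_cring cd q_def]
  have lin: "up_ring.monom (UP B) \<one>\<^bsub>B\<^esub> 1 \<ominus>\<^bsub>UP B\<^esub> up_ring.monom (UP B) c 0 \<in> carrier (UP B)" if "c \<in> carrier B" for c
    using that by simp
  have "tri_law P f' ((t \<odot>\<^bsub>Y.MB\<^esub> \<one>\<^bsub>Y.MB\<^esub>) \<ominus>\<^bsub>Y.MB\<^esub> y) = h q"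
    unfolding tri_law_def q_def using proj[of pa] proj[of pd]
    by (simp only: simp_thms ring_hom_mult[OF h lin[OF cd(1)] lin[OF cd(2)]])
  then have "char_poly A E tri_law B f P h x = inv_into (carrier (UP B)) h (h q)"
    unfolding char_poly_def Let_def y_def f'_def[abs_def] inc_def[abs_def] t_def by simp
  then have char: "char_poly A E tri_law B f P h x = q" using inv_into_f_f[OF hinj qc] by simp
  have "UnivPoly.eval B X.MB (\<lambda>b. b \<odot>\<^bsub>X.MB\<^esub> \<one>\<^bsub>X.MB\<^esub>) x q =
      (\<one>\<^bsub>B\<^esub> \<odot>\<^bsub>X.MB\<^esub> \<one>\<^bsub>X.MB\<^esub>) \<otimes>\<^bsub>X.MB\<^esub> (x \<otimes>\<^bsub>X.MB\<^esub> x) \<oplus>\<^bsub>X.MB\<^esub>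
      (((\<ominus>\<^bsub>B\<^esub> (?c \<oplus>\<^bsub>B\<^esub> ?d)) \<odot>\<^bsub>X.MB\<^esub> \<one>\<^bsub>X.MB\<^esub>) \<otimes>\<^bsub>X.MB\<^esub> x \<oplus>\<^bsub>X.MB\<^esub> (?c \<otimes>\<^bsub>B\<^esub> ?d) \<odot>\<^bsub>X.MB\<^esub> \<one>\<^bsub>X.MB\<^esub>)"
    by (rule eval_quadratic[OF X.B.is_cring X.MB_ring cd q_def]) (use x in \<open>simp_all add: X.MB.smult_l_null\<close>)
  also have "\<dots> = (x \<ominus>\<^bsub>X.MB\<^esub> ?c \<odot>\<^bsub>X.MB\<^esub> \<one>\<^bsub>X.MB\<^esub>) \<otimes>\<^bsub>X.MB\<^esub> (x \<ominus>\<^bsub>X.MB\<^esub> ?d \<odot>\<^bsub>X.MB\<^esub> \<one>\<^bsub>X.MB\<^esub>)"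
    using x cd
    by (simp add: X.MB.minus_eq X.MB.l_distr X.MB.r_distr X.MB.l_minus X.MB.r_minus X.MB_smult_mult
        X.MB.smult_l_minus X.MB.smult_l_distr X.MB.smult_r_distr X.MB.smult_r_minus X.MB.minus_add X.MB.a_ac X.B.m_comm flip: X.MB.smult_assoc1)
  also have "\<dots> = \<zero>\<^bsub>X.MB\<^esub>" by (rule tri_cayley_hamilton_product[OF B x])
  finally show "UnivPoly.eval B X.MB (\<lambda>b. b \<odot>\<^bsub>X.MB\<^esub> \<one>\<^bsub>X.MB\<^esub>) x (char_poly A E tri_law B f P h x) = \<zero>\<^bsub>X.MB\<^esub>"
    unfolding char .
qed

end

section \<open>Representations by triangular matrices\<close>

locale triangular_rep = char_pair A G T \<chi> \<chi>' + triangular A M enc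
  for A :: "('u, 'x) ring_scheme" (structure) and G :: "'g monoid" and T :: "'g topology" and \<chi> \<chi>' :: "'g \<Rightarrow> 'u"
    and M :: "('u, 'm) module" and enc :: "'u \<times> 'm \<times> 'u \<Rightarrow> 'u" +
  fixes b :: "'g \<Rightarrow> 'm"
  assumes b: "cocycle M b"
begin

lemmas b_closed [simp] = cocycleD(1)[OF b]

definition tri_rep :: "'g \<Rightarrow> 'u" where
  "tri_rep g = enc (\<chi>' g, b g, \<chi> g)"

lemma tri_rep_closed [simp]: "g \<in> carrier G \<Longrightarrow> tri_rep g \<in> carrier E"
  by (simp add: tri_rep_def)

lemma tri_rep_mult:
  assumes "g \<in> carrier G" "h \<in> carrier G"
  shows "tri_rep (g \<otimes>\<^bsub>G\<^esub> h) = tri_rep g \<otimes>\<^bsub>E\<^esub> tri_rep h"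
  using assms by (simp add: tri_rep_def cocycleD(2)[OF b])

lemma tri_rep_one: "tri_rep \<one>\<^bsub>G\<^esub> = \<one>\<^bsub>E\<^esub>"
proof -
  have "b \<one>\<^bsub>G\<^esub> = \<zero>\<^bsub>M\<^esub>"
    using cocycleD(2)[OF b, of "\<one>\<^bsub>G\<^esub>" "\<one>\<^bsub>G\<^esub>"] b_closed[of "\<one>\<^bsub>G\<^esub>"] by (simp add: M.add.l_cancel_one')
  then show ?thesis by (simp add: tri_rep_def E_simps(3))
qed

lemma tri_rep_hom: "tri_rep \<in> hom G (units_of E)"
proof (rule homI)
  show "tri_rep g \<in> carrier (units_of E)" if g: "g \<in> carrier G" for g
  proof -
    have "tri_rep g \<otimes>\<^bsub>E\<^esub> tri_rep (inv\<^bsub>G\<^esub> g) = \<one>\<^bsub>E\<^esub>" "tri_rep (inv\<^bsub>G\<^esub> g) \<otimes>\<^bsub>E\<^esub> tri_rep g = \<one>\<^bsub>E\<^esub>"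
      using g by (simp_all add: tri_rep_mult[symmetric] tri_rep_one)
    then show ?thesis using g by (auto simp: units_of_def Units_def intro!: bexI[of _ "tri_rep (inv\<^bsub>G\<^esub> g)"])
  qed
  show "tri_rep (g \<otimes>\<^bsub>G\<^esub> h) = tri_rep g \<otimes>\<^bsub>units_of E\<^esub> tri_rep h" if "g \<in> carrier G" "h \<in> carrier G" for g h
    using tri_rep_mult[OF that] by (simp add: units_of_def)
qed

lemma E_adic: "adic_module A E" by (rule adic_moduleI[OF E_module])

lemma tri_rep_continuous: "continuous_map T (adic A E) tri_rep"
proof -
  interpret Ea: adic_module A E by (rule E_adic)
  \<comment> \<open>As for the extension, the representation is a sum of three continuous functions,
    each followed by a linear map placing it in one matrix entry.\<close>
  have 1: "(\<lambda>a. enc (a, \<zero>\<^bsub>M\<^esub>, \<zero>)) \<in> mod_hom A (self_module A) E"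
    and 2: "(\<lambda>m. enc (\<zero>, m, \<zero>)) \<in> mod_hom A M E"
    and 3: "(\<lambda>a. enc (\<zero>, \<zero>\<^bsub>M\<^esub>, a)) \<in> mod_hom A (self_module A) E"
    by (rule mod_homI; simp)+
  note c = continuous_map_mod_hom[OF _ E_adic]
  have "continuous_map T (adic A E) (\<lambda>g. (enc (\<chi>' g, \<zero>\<^bsub>M\<^esub>, \<zero>) \<oplus>\<^bsub>E\<^esub> enc (\<zero>, b g, \<zero>)) \<oplus>\<^bsub>E\<^esub> enc (\<zero>, \<zero>\<^bsub>M\<^esub>, \<chi> g))"
    by (intro Ea.continuous_map_add)
      (use continuous_map_compose[OF \<chi>'(2) c[OF self_adic 1]]
          continuous_map_compose[OF cocycleD(3)[OF b] c[OF adic_moduleI[OF module_axioms] 2]]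
          continuous_map_compose[OF \<chi>(2) c[OF self_adic 3]] in \<open>simp_all only: o_def\<close>)
  then show ?thesis by (rule continuous_map_eq) (simp add: top tri_rep_def)
qed

abbreviation "EG \<equiv> with_action E (\<lambda>g x. tri_rep g \<otimes>\<^bsub>E\<^esub> x)"

lemma EG_lin_action: "lin_action G A EG"
  unfolding lin_action_def
proof (intro conjI ballI)
  show "adic_module A EG" by (rule adic_moduleI[OF module_cong[OF E_module]]) simp_all
  show "act EG g \<in> mod_hom A EG EG" if "g \<in> carrier G" for g
    using that E_algebra by (intro mod_homI) (simp_all add: E.r_distr nc_algebra_def)
qed (simp_all add: tri_rep_one tri_rep_mult E.m_assoc)

lemma char_lin_action: "lin_action G A (char_module A \<chi>')"
  unfolding lin_action_def
proof (intro conjI ballI)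
  show "adic_module A (char_module A \<chi>')"
    by (rule adic_moduleI[OF module_cong[OF self_module[OF A]]]) simp_all
  show "act (char_module A \<chi>') g \<in> mod_hom A (char_module A \<chi>') (char_module A \<chi>')" if "g \<in> carrier G" for g
    using that by (intro mod_homI) (simp_all add: A.r_distr A.m_lcomm)
qed (simp_all add: A.m_assoc)

text \<open>As a left module the triangular algebra is the sum of its two columns: the first carries
  the character \<open>\<chi>'\<close>, the second is the extension itself.\<close>

lemma EG_satisfies:
  assumes C: "stable_class p G T C" and s: "satisfies G C A (char_module A \<chi>')" "satisfies G C A (VE M b)"
  shows "satisfies G C A EG"
proof (rule stable_class.satisfies_sum[OF C char_lin_action s(1) _ s(2) EG_lin_action])
  show "lin_action G A (VE M b)" by (rule AG_module_lin_action[OF VE_AG_module[OF module_axioms b] max])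
  show "(\<lambda>a. enc (a, \<zero>\<^bsub>M\<^esub>, \<zero>)) \<in> AG_hom G A (char_module A \<chi>') EG"
    by (intro AG_homI mod_homI) (simp_all add: tri_rep_def)
  show "(\<lambda>v. enc (\<zero>, fst v, snd v)) \<in> AG_hom G A (VE M b) EG"
    by (intro AG_homI mod_homI) (auto simp: tri_rep_def)
  show "\<exists>v \<in> carrier (char_module A \<chi>'). \<exists>v' \<in> carrier (VE M b).
      w = enc (v, \<zero>\<^bsub>M\<^esub>, \<zero>) \<oplus>\<^bsub>EG\<^esub> enc (\<zero>, fst v', snd v')" if w: "w \<in> carrier EG" for w
  proof -
    obtain a m d where x: "w = enc (a, m, d)" "a \<in> carrier A" "m \<in> carrier M" "d \<in> carrier A"
      using w by (auto elim: E_cases)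
    then show ?thesis by (intro bexI[of _ a] bexI[of _ "(m, d)"]) simp_all
  qed
qed

text \<open>Applied to an element of the group ring, the two diagonal projections are the two
  character sums whose product defines \<open>psi_sum\<close>.\<close>

lemma tri_specializes:
  fixes F :: "('f, 'y) ring_scheme" and k :: "'u \<Rightarrow> 'f"
  assumes k: "k \<in> ring_hom A F" "\<And>g. g \<in> carrier G \<Longrightarrow> k (\<chi>' g) = \<chi>b1 g" "\<And>g. g \<in> carrier G \<Longrightarrow> k (\<chi> g) = \<chi>b2 g"
  shows "specializes_to_sum G A E tri_rep tri_law F k \<chi>b1 \<chi>b2"
  unfolding specializes_to_sum_def
proof (intro allI impI ballI)
  fix B :: "'u ring" and f :: "'f \<Rightarrow> 'u" and s
  assume B: "comm_alg F B f" and s: "s \<in> group_ring_carrier G B"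
  have fk: "(\<lambda>a. f (k a)) \<in> ring_hom A B"
    using ring_hom_trans[OF k(1), of f B] B by (simp add: comm_alg_def o_def)
  have B': "comm_alg A B (\<lambda>a. f (k a))" using B fk by (simp add: comm_alg_def)
  interpret X: algebra_ext A E B "\<lambda>a. f (k a)" by (rule ext_alg[OF B'])
  let ?S = "{g \<in> carrier G. s g \<noteq> \<zero>\<^bsub>B\<^esub>}"
  have sc: "s g \<in> carrier B" if "g \<in> carrier G" for g using s that by (auto simp: group_ring_carrier_def)
  have pr: "tri_proj pr B (\<lambda>a. f (k a)) (finsum X.MB (\<lambda>g. X.pu (tri_rep g) (s g)) ?S) =
      finsum B (\<lambda>g. f (k (pr (tri_rep g))) \<otimes>\<^bsub>B\<^esub> s g) ?S" if pr: "pr = pa \<or> pr = pd" for pr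
  proof -
    interpret p: ring_hom_ring X.MB B "tri_proj pr B (\<lambda>a. f (k a))"
      by (rule ring_hom_ringI2[OF X.MB_ring X.B.ring_axioms tri_proj(1)[OF B' pr]])
    have "tri_proj pr B (\<lambda>a. f (k a)) (finsum X.MB (\<lambda>g. X.pu (tri_rep g) (s g)) ?S) =
        finsum B (tri_proj pr B (\<lambda>a. f (k a)) \<circ> (\<lambda>g. X.pu (tri_rep g) (s g))) ?S"
      by (rule p.hom_finsum) (use sc in auto)
    also have "\<dots> = finsum B (\<lambda>g. f (k (pr (tri_rep g))) \<otimes>\<^bsub>B\<^esub> s g) ?S"
    proof (rule X.B.finsum_cong')
      show "(\<lambda>g. f (k (pr (tri_rep g))) \<otimes>\<^bsub>B\<^esub> s g) \<in> ?S \<rightarrow> carrier B"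
        using pr sc ring_hom_closed[OF fk] by auto
    qed (use tri_proj(3)[OF B' pr] sc in auto)
    finally show ?thesis .
  qed
  have fc: "f (\<chi>b1 g) \<in> carrier B" "f (\<chi>b2 g) \<in> carrier B" if "g \<in> carrier G" for g
    using ring_hom_closed[OF fk, of "\<chi>' g"] ring_hom_closed[OF fk, of "\<chi> g"] k that by simp_all
  have "finsum B (\<lambda>g. f (k (pa (tri_rep g))) \<otimes>\<^bsub>B\<^esub> s g) ?S = finsum B (\<lambda>g. f (\<chi>b1 g) \<otimes>\<^bsub>B\<^esub> s g) ?S"
    "finsum B (\<lambda>g. f (k (pd (tri_rep g))) \<otimes>\<^bsub>B\<^esub> s g) ?S = finsum B (\<lambda>g. f (\<chi>b2 g) \<otimes>\<^bsub>B\<^esub> s g) ?S"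
    by (rule X.B.finsum_cong'; use k fc sc in \<open>auto simp: tri_rep_def\<close>)+
  then show "induced_law G A E tri_rep tri_law B (\<lambda>a. f (k a)) s = psi_sum G \<chi>b1 \<chi>b2 B f s"
    unfolding induced_law_def psi_sum_def Let_def tri_law_def using pr by simp
qed

lemma tri_CH_rep:
  assumes "fg_module A M"
  shows "CH_rep G T A E tri_rep tri_law"
  unfolding CH_rep_def
  using E_fg[OF assms] tri_pseudorep tri_cayley_hamilton tri_rep_hom tri_rep_continuous by blast

end

section \<open>Generalized matrix algebras\<close>

lemma cring_cong:
  assumes A: "cring A" and eq: "carrier B = carrier A" "monoid.mult B = monoid.mult A" "monoid.one B = monoid.one A"
    "ring.zero B = ring.zero A" "ring.add B = ring.add A"
  shows "cring B"
proof -
  interpret A: cring A by (rule A)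
  show ?thesis
  proof (rule cringI)
    show "abelian_group B"
    proof (rule abelian_groupI)
      show "\<exists>y \<in> carrier B. y \<oplus>\<^bsub>B\<^esub> x = \<zero>\<^bsub>B\<^esub>" if "x \<in> carrier B" for x
        using that by (intro bexI[of _ "\<ominus>\<^bsub>A\<^esub> x"]) (simp_all add: eq A.l_neg)
    qed (simp_all add: eq A.a_ac)
    show "comm_monoid B" by (rule comm_monoidI) (simp_all add: eq A.m_ac)
  qed (simp_all add: eq A.l_distr)
qed

text \<open>Polynomial laws range over plain \<open>ring\<close> records, so a coefficient ring with
  extra fields is truncated before it serves as an algebra over itself.\<close>

lemma truncate_alg:
  assumes "cring A"
  shows "comm_alg A (ring.truncate A) (\<lambda>r. r)"
proof -
  have "cring (ring.truncate A)" by (rule cring_cong[OF assms]) (simp_all add: ring.defs)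
  then show ?thesis by (simp add: comm_alg_def ring_hom_def ring.defs)
qed

locale gma =
  fixes G :: "'g monoid" and \<chi>b1 \<chi>b2 :: "'g \<Rightarrow> 'f"
    and R :: "('u, 'w, 'f) coef" and E :: "('u, 'u) module" (structure) and \<rho> :: "'g \<Rightarrow> 'u"
    and D :: "('u, 'u, 'u) law" and e1 e2 :: 'u
  assumes E_alg: "nc_algebra R E" and D_pseudorep: "pseudorep 2 R E D"
    and gma: "gma_structure G \<chi>b1 \<chi>b2 R E \<rho> D e1 e2"
begin

sublocale E: module R E using E_alg by (simp add: nc_algebra_def)
sublocale Er: ring E using E_alg by (simp add: nc_algebra_def)

lemma smult_mult [simp]:
  assumes "r \<in> carrier R" "x \<in> carrier E" "y \<in> carrier E"
  shows "(r \<odot> x) \<otimes> y = r \<odot> (x \<otimes> y)" "x \<otimes> (r \<odot> y) = r \<odot> (x \<otimes> y)"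
  using E_alg assms by (simp_all add: nc_algebra_def)

lemma idem [simp]:
  "e1 \<in> carrier E" "e2 \<in> carrier E" "e1 \<otimes> e1 = e1" "e2 \<otimes> e2 = e2"
  "e1 \<otimes> e2 = \<zero>" "e2 \<otimes> e1 = \<zero>"
  using gma by (simp_all add: gma_structure_def)

lemma e_sum: "e1 \<oplus> e2 = \<one>"
  using gma by (simp add: gma_structure_def)

lemma idem_left [simp]:
  assumes "x \<in> carrier E"
  shows "e1 \<otimes> (e1 \<otimes> x) = e1 \<otimes> x" "e2 \<otimes> (e2 \<otimes> x) = e2 \<otimes> x"
    "e1 \<otimes> (e2 \<otimes> x) = \<zero>" "e2 \<otimes> (e1 \<otimes> x) = \<zero>"
  using assms by (simp_all flip: Er.m_assoc)

lemma corner_bij: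
  "bij_betw (\<lambda>r. r \<odot> e1) (carrier R) (corner E e1 e1)"
  "bij_betw (\<lambda>r. r \<odot> e2) (carrier R) (corner E e2 e2)"
  using gma by (simp_all add: gma_structure_def)

text \<open>The upper left diagonal entry of a matrix, and below it the lower right one, read off
  through the isomorphisms of the corners with \<open>R\<close>.\<close>

definition c1 where "c1 x = inv_into (carrier R) (\<lambda>r. r \<odot> e1) (e1 \<otimes> x \<otimes> e1)"
definition c2 where "c2 x = inv_into (carrier R) (\<lambda>r. r \<odot> e2) (e2 \<otimes> x \<otimes> e2)"

lemma c1: "x \<in> carrier E \<Longrightarrow> c1 x \<in> carrier R" "x \<in> carrier E \<Longrightarrow> c1 x \<odot> e1 = e1 \<otimes> x \<otimes> e1"
proof -
  assume "x \<in> carrier E"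
  then have "e1 \<otimes> x \<otimes> e1 \<in> (\<lambda>r. r \<odot> e1) ` carrier R"
    using corner_bij(1) unfolding bij_betw_def corner_def by blast
  then show "c1 x \<in> carrier R" "c1 x \<odot> e1 = e1 \<otimes> x \<otimes> e1"
    unfolding c1_def by (rule inv_into_into, rule f_inv_into_f)
qed

lemma c2: "x \<in> carrier E \<Longrightarrow> c2 x \<in> carrier R" "x \<in> carrier E \<Longrightarrow> c2 x \<odot> e2 = e2 \<otimes> x \<otimes> e2"
proof -
  assume "x \<in> carrier E"
  then have "e2 \<otimes> x \<otimes> e2 \<in> (\<lambda>r. r \<odot> e2) ` carrier R"
    using corner_bij(2) unfolding bij_betw_def corner_def by blast
  then show "c2 x \<in> carrier R" "c2 x \<odot> e2 = e2 \<otimes> x \<otimes> e2"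
    unfolding c2_def by (rule inv_into_into, rule f_inv_into_f)
qed

lemma e_cancel:
  "r \<in> carrier R \<Longrightarrow> s \<in> carrier R \<Longrightarrow> r \<odot> e1 = s \<odot> e1 \<Longrightarrow> r = s"
  "r \<in> carrier R \<Longrightarrow> s \<in> carrier R \<Longrightarrow> r \<odot> e2 = s \<odot> e2 \<Longrightarrow> r = s"
  using corner_bij unfolding bij_betw_def inj_on_def by blast+

lemma c1_unique: "r \<in> carrier R \<Longrightarrow> x \<in> carrier E \<Longrightarrow> r \<odot> e1 = e1 \<otimes> x \<otimes> e1 \<Longrightarrow> c1 x = r"
  using e_cancel(1)[of "c1 x" r] c1 by simp

lemma c2_unique: "r \<in> carrier R \<Longrightarrow> x \<in> carrier E \<Longrightarrow> r \<odot> e2 = e2 \<otimes> x \<otimes> e2 \<Longrightarrow> c2 x = r"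
  using e_cancel(2)[of "c2 x" r] c2 by simp

lemma c_add:
  assumes "x \<in> carrier E" "y \<in> carrier E"
  shows "c1 (x \<oplus> y) = c1 x \<oplus>\<^bsub>R\<^esub> c1 y" "c2 (x \<oplus> y) = c2 x \<oplus>\<^bsub>R\<^esub> c2 y"
  by (rule c1_unique c2_unique; use assms c1 c2 in \<open>simp add: E.smult_l_distr Er.r_distr Er.l_distr\<close>)+

lemma c_smult:
  assumes "r \<in> carrier R" "x \<in> carrier E"
  shows "c1 (r \<odot> x) = r \<otimes>\<^bsub>R\<^esub> c1 x" "c2 (r \<odot> x) = r \<otimes>\<^bsub>R\<^esub> c2 x"
  by (rule c1_unique c2_unique; use assms c1 c2 in \<open>simp add: E.smult_assoc1\<close>)+

lemma c_e [simp]: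
  "c1 e1 = \<one>\<^bsub>R\<^esub>" "c1 e2 = \<zero>\<^bsub>R\<^esub>" "c2 e1 = \<zero>\<^bsub>R\<^esub>" "c2 e2 = \<one>\<^bsub>R\<^esub>" "c1 \<one> = \<one>\<^bsub>R\<^esub>" "c2 \<one> = \<one>\<^bsub>R\<^esub>"
  by (rule c1_unique c2_unique; simp)+

lemma c1_e_mult:
  assumes "x \<in> carrier E"
  shows "c1 (e1 \<otimes> x) = c1 x" "c1 (x \<otimes> e1) = c1 x" "c1 (e2 \<otimes> x) = \<zero>\<^bsub>R\<^esub>" "c1 (x \<otimes> e2) = \<zero>\<^bsub>R\<^esub>"
    "c2 (e2 \<otimes> x) = c2 x" "c2 (x \<otimes> e2) = c2 x" "c2 (e1 \<otimes> x) = \<zero>\<^bsub>R\<^esub>" "c2 (x \<otimes> e1) = \<zero>\<^bsub>R\<^esub>"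
  by (rule c1_unique c2_unique; use assms c1 c2 in \<open>simp add: Er.m_assoc\<close>)+

lemma e_decomp:
  assumes "x \<in> carrier E"
  shows "e1 \<otimes> x \<oplus> e2 \<otimes> x = x" "x \<otimes> e1 \<oplus> x \<otimes> e2 = x"
  using assms Er.l_distr[of e1 e2 x] Er.r_distr[of e1 e2 x] by (simp_all add: e_sum)

text \<open>Matrix multiplication on the diagonal. The correction terms are products of off-diagonal
  entries, and it is these that generate the reducibility ideal.\<close>

lemma c_mult:
  assumes x: "x \<in> carrier E" and y: "y \<in> carrier E"
  shows "c1 (x \<otimes> y) = c1 x \<otimes>\<^bsub>R\<^esub> c1 y \<oplus>\<^bsub>R\<^esub> c1 (x \<otimes> (e2 \<otimes> y))"
    and "c2 (x \<otimes> y) = c2 x \<otimes>\<^bsub>R\<^esub> c2 y \<oplus>\<^bsub>R\<^esub> c2 (x \<otimes> (e1 \<otimes> y))"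
proof -
  have "c1 (x \<otimes> (e1 \<otimes> y)) = c1 x \<otimes>\<^bsub>R\<^esub> c1 y"
  proof (rule c1_unique)
    have "(c1 x \<otimes>\<^bsub>R\<^esub> c1 y) \<odot> e1 = (c1 x \<odot> e1) \<otimes> (c1 y \<odot> e1)"
      using c1(1)[OF x] c1(1)[OF y] by (simp add: E.R.m_comm[of "c1 x"] E.smult_assoc1)
    also have "\<dots> = e1 \<otimes> (x \<otimes> (e1 \<otimes> y)) \<otimes> e1"
      unfolding c1(2)[OF x] c1(2)[OF y] using x y by (simp add: Er.m_assoc)
    finally show "(c1 x \<otimes>\<^bsub>R\<^esub> c1 y) \<odot> e1 = e1 \<otimes> (x \<otimes> (e1 \<otimes> y)) \<otimes> e1" .
  qed (use x y c1 in auto)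
  then show "c1 (x \<otimes> y) = c1 x \<otimes>\<^bsub>R\<^esub> c1 y \<oplus>\<^bsub>R\<^esub> c1 (x \<otimes> (e2 \<otimes> y))"
    using c_add(1)[of "x \<otimes> (e1 \<otimes> y)" "x \<otimes> (e2 \<otimes> y)"] x y e_decomp(1)[OF y] by (simp flip: Er.r_distr)
  have "c2 (x \<otimes> (e2 \<otimes> y)) = c2 x \<otimes>\<^bsub>R\<^esub> c2 y"
  proof (rule c2_unique)
    have "(c2 x \<otimes>\<^bsub>R\<^esub> c2 y) \<odot> e2 = (c2 x \<odot> e2) \<otimes> (c2 y \<odot> e2)"
      using c2(1)[OF x] c2(1)[OF y] by (simp add: E.R.m_comm[of "c2 x"] E.smult_assoc1)
    also have "\<dots> = e2 \<otimes> (x \<otimes> (e2 \<otimes> y)) \<otimes> e2"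
      unfolding c2(2)[OF x] c2(2)[OF y] using x y by (simp add: Er.m_assoc)
    finally show "(c2 x \<otimes>\<^bsub>R\<^esub> c2 y) \<odot> e2 = e2 \<otimes> (x \<otimes> (e2 \<otimes> y)) \<otimes> e2" .
  qed (use x y c2 in auto)
  then show "c2 (x \<otimes> y) = c2 x \<otimes>\<^bsub>R\<^esub> c2 y \<oplus>\<^bsub>R\<^esub> c2 (x \<otimes> (e1 \<otimes> y))"
    using c_add(2)[of "x \<otimes> (e1 \<otimes> y)" "x \<otimes> (e2 \<otimes> y)"] x y e_decomp(1)[OF y] c2(1)
    by (simp add: E.R.a_comm flip: Er.r_distr)
qed

section \<open>The determinant and the exchange of the two corners\<close>

lemma ext_alg: "comm_alg R B k \<Longrightarrow> algebra_ext R E B k"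
  using algebra_extI[OF E_alg, of B k] by (simp add: comm_alg_def)

lemma D_value:
  fixes B :: "'u ring" and k :: "'u \<Rightarrow> 'u"
  assumes B: "comm_alg R B k"
    and x: "x \<in> carrier (base_change R E B k)" and a: "a1 \<in> carrier B" "a2 \<in> carrier B" "m \<in> carrier B"
    and eq: "pure R E B k e1 \<one>\<^bsub>B\<^esub> \<otimes>\<^bsub>base_change R E B k\<^esub> x \<otimes>\<^bsub>base_change R E B k\<^esub> pure R E B k e1 \<one>\<^bsub>B\<^esub> = a1 \<odot>\<^bsub>base_change R E B k\<^esub> pure R E B k e1 \<one>\<^bsub>B\<^esub>"
      "pure R E B k e2 \<one>\<^bsub>B\<^esub> \<otimes>\<^bsub>base_change R E B k\<^esub> x \<otimes>\<^bsub>base_change R E B k\<^esub> pure R E B k e2 \<one>\<^bsub>B\<^esub> = a2 \<odot>\<^bsub>base_change R E B k\<^esub> pure R E B k e2 \<one>\<^bsub>B\<^esub>"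
      "(pure R E B k e1 \<one>\<^bsub>B\<^esub> \<otimes>\<^bsub>base_change R E B k\<^esub> x \<otimes>\<^bsub>base_change R E B k\<^esub> pure R E B k e2 \<one>\<^bsub>B\<^esub>) \<otimes>\<^bsub>base_change R E B k\<^esub>
       (pure R E B k e2 \<one>\<^bsub>B\<^esub> \<otimes>\<^bsub>base_change R E B k\<^esub> x \<otimes>\<^bsub>base_change R E B k\<^esub> pure R E B k e1 \<one>\<^bsub>B\<^esub>) = m \<odot>\<^bsub>base_change R E B k\<^esub> pure R E B k e1 \<one>\<^bsub>B\<^esub>"
  shows "D B k x = a1 \<otimes>\<^bsub>B\<^esub> a2 \<ominus>\<^bsub>B\<^esub> m"
proof -
  have "\<forall>B k. comm_alg R B k \<longrightarrow>
        (let EB = base_change R E B k; d1 = pure R E B k e1 \<one>\<^bsub>B\<^esub>; d2 = pure R E B k e2 \<one>\<^bsub>B\<^esub> in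
         \<forall>x \<in> carrier EB. \<forall>a1 \<in> carrier B. \<forall>a2 \<in> carrier B. \<forall>m \<in> carrier B.
           d1 \<otimes>\<^bsub>EB\<^esub> x \<otimes>\<^bsub>EB\<^esub> d1 = a1 \<odot>\<^bsub>EB\<^esub> d1 \<and>
           d2 \<otimes>\<^bsub>EB\<^esub> x \<otimes>\<^bsub>EB\<^esub> d2 = a2 \<odot>\<^bsub>EB\<^esub> d2 \<and>
           (d1 \<otimes>\<^bsub>EB\<^esub> x \<otimes>\<^bsub>EB\<^esub> d2) \<otimes>\<^bsub>EB\<^esub> (d2 \<otimes>\<^bsub>EB\<^esub> x \<otimes>\<^bsub>EB\<^esub> d1) = m \<odot>\<^bsub>EB\<^esub> d1 \<longrightarrow>
           D B k x = a1 \<otimes>\<^bsub>B\<^esub> a2 \<ominus>\<^bsub>B\<^esub> m)"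
    using gma unfolding gma_structure_def by (elim conjE)
  from this[rule_format, OF B, unfolded Let_def, rule_format, OF x a] eq show ?thesis by blast
qed

text \<open>Multiplicativity of \<open>D\<close> on \<open>(1 + c) (1 + b)\<close> forces \<open>b c\<close> and \<open>c b\<close> to have the same
  coefficient, so the two indices play symmetric roles.\<close>

lemma off_diagonal_swap:
  fixes B :: "'u ring" and k :: "'u \<Rightarrow> 'u"
  assumes B: "comm_alg R B k"
  defines "EB \<equiv> base_change R E B k" and "d1 \<equiv> pure R E B k e1 \<one>\<^bsub>B\<^esub>" and "d2 \<equiv> pure R E B k e2 \<one>\<^bsub>B\<^esub>"
  assumes b: "b \<in> carrier EB" "d1 \<otimes>\<^bsub>EB\<^esub> b = b" "b \<otimes>\<^bsub>EB\<^esub> d2 = b"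
    and c: "c \<in> carrier EB" "d2 \<otimes>\<^bsub>EB\<^esub> c = c" "c \<otimes>\<^bsub>EB\<^esub> d1 = c"
    and m: "m \<in> carrier B" "m' \<in> carrier B" "b \<otimes>\<^bsub>EB\<^esub> c = m \<odot>\<^bsub>EB\<^esub> d1" "c \<otimes>\<^bsub>EB\<^esub> b = m' \<odot>\<^bsub>EB\<^esub> d2"
  shows "m = m'"
proof -
  interpret X: algebra_ext R E B k by (rule ext_alg[OF B])
  have EB: "EB = X.MB" by (simp add: EB_def)
  have d: "d1 \<in> carrier EB" "d2 \<in> carrier EB" by (simp_all add: EB d1_def d2_def)
  have dd: "d1 \<otimes>\<^bsub>EB\<^esub> d1 = d1" "d2 \<otimes>\<^bsub>EB\<^esub> d2 = d2" "d1 \<otimes>\<^bsub>EB\<^esub> d2 = \<zero>\<^bsub>EB\<^esub>" "d2 \<otimes>\<^bsub>EB\<^esub> d1 = \<zero>\<^bsub>EB\<^esub>"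
    by (simp_all add: EB d1_def d2_def)
  interpret N: ring EB unfolding EB by (rule X.MB_ring)
  interpret N: module B EB unfolding EB by (rule X.MB_module)
  have z1: "b \<otimes>\<^bsub>EB\<^esub> d1 = \<zero>\<^bsub>EB\<^esub>"
    using N.m_assoc[OF b(1) d(2) d(1)] unfolding b(3) dd(4) by (simp add: b(1))
  have z2: "d2 \<otimes>\<^bsub>EB\<^esub> b = \<zero>\<^bsub>EB\<^esub>"
    using N.m_assoc[OF d(2) d(1) b(1)] unfolding b(2) dd(4) by (simp add: b(1))
  have z3: "c \<otimes>\<^bsub>EB\<^esub> d2 = \<zero>\<^bsub>EB\<^esub>"
    using N.m_assoc[OF c(1) d(1) d(2)] unfolding c(3) dd(3) by (simp add: c(1))
  have z4: "d1 \<otimes>\<^bsub>EB\<^esub> c = \<zero>\<^bsub>EB\<^esub>"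
    using N.m_assoc[OF d(1) d(2) c(1)] unfolding c(2) dd(3) by (simp add: c(1))
  note z = z1 z2 z3 z4
  note val = D_value[OF B, folded EB_def d1_def d2_def]
  \<comment> \<open>Unipotent elements have determinant 1: the diagonal entries are 1 and one of the
    off-diagonal entries vanishes.\<close>
  have Db: "D B k (\<one>\<^bsub>EB\<^esub> \<oplus>\<^bsub>EB\<^esub> b) = \<one>\<^bsub>B\<^esub>"
    using val[of "\<one>\<^bsub>EB\<^esub> \<oplus>\<^bsub>EB\<^esub> b" "\<one>\<^bsub>B\<^esub>" "\<one>\<^bsub>B\<^esub>" "\<zero>\<^bsub>B\<^esub>"] b c d dd z
    by (simp add: N.l_distr N.r_distr N.smult_l_null X.B.minus_eq)
  have Dc: "D B k (\<one>\<^bsub>EB\<^esub> \<oplus>\<^bsub>EB\<^esub> c) = \<one>\<^bsub>B\<^esub>"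
    using val[of "\<one>\<^bsub>EB\<^esub> \<oplus>\<^bsub>EB\<^esub> c" "\<one>\<^bsub>B\<^esub>" "\<one>\<^bsub>B\<^esub>" "\<zero>\<^bsub>B\<^esub>"] b c d dd z
    by (simp add: N.l_distr N.r_distr N.smult_l_null X.B.minus_eq)
  let ?w = "(\<one>\<^bsub>EB\<^esub> \<oplus>\<^bsub>EB\<^esub> c) \<otimes>\<^bsub>EB\<^esub> (\<one>\<^bsub>EB\<^esub> \<oplus>\<^bsub>EB\<^esub> b)"
  \<comment> \<open>The product has diagonal entries 1 and \<open>1 + m'\<close> and off-diagonal
    entries \<open>b\<close> and \<open>c\<close> with product \<open>m\<close>, so its determinant
    is \<open>1 + m' - m\<close>.\<close>
  have w: "?w = (\<one>\<^bsub>EB\<^esub> \<oplus>\<^bsub>EB\<^esub> b) \<oplus>\<^bsub>EB\<^esub> (c \<oplus>\<^bsub>EB\<^esub> m' \<odot>\<^bsub>EB\<^esub> d2)"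
    using b c m d by (simp add: N.l_distr N.r_distr N.a_ac)
  have sm: "(r \<odot>\<^bsub>EB\<^esub> x) \<otimes>\<^bsub>EB\<^esub> y = r \<odot>\<^bsub>EB\<^esub> (x \<otimes>\<^bsub>EB\<^esub> y)" "x \<otimes>\<^bsub>EB\<^esub> (r \<odot>\<^bsub>EB\<^esub> y) = r \<odot>\<^bsub>EB\<^esub> (x \<otimes>\<^bsub>EB\<^esub> y)"
    if "r \<in> carrier B" "x \<in> carrier EB" "y \<in> carrier EB" for r x y
    using X.MB_smult_mult that unfolding EB by blast+
  have "D B k ?w = \<one>\<^bsub>B\<^esub> \<otimes>\<^bsub>B\<^esub> (\<one>\<^bsub>B\<^esub> \<oplus>\<^bsub>B\<^esub> m') \<ominus>\<^bsub>B\<^esub> m"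
    unfolding w
  proof (rule val)
    show "d1 \<otimes>\<^bsub>EB\<^esub> ((\<one>\<^bsub>EB\<^esub> \<oplus>\<^bsub>EB\<^esub> b) \<oplus>\<^bsub>EB\<^esub> (c \<oplus>\<^bsub>EB\<^esub> m' \<odot>\<^bsub>EB\<^esub> d2)) \<otimes>\<^bsub>EB\<^esub> d1 = \<one>\<^bsub>B\<^esub> \<odot>\<^bsub>EB\<^esub> d1"
      using b c m d dd z sm by (simp add: N.l_distr N.r_distr)
    show "d2 \<otimes>\<^bsub>EB\<^esub> ((\<one>\<^bsub>EB\<^esub> \<oplus>\<^bsub>EB\<^esub> b) \<oplus>\<^bsub>EB\<^esub> (c \<oplus>\<^bsub>EB\<^esub> m' \<odot>\<^bsub>EB\<^esub> d2)) \<otimes>\<^bsub>EB\<^esub> d2 = (\<one>\<^bsub>B\<^esub> \<oplus>\<^bsub>B\<^esub> m') \<odot>\<^bsub>EB\<^esub> d2"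
      using b c m d dd z sm by (simp add: N.l_distr N.r_distr N.smult_l_distr)
    have "d1 \<otimes>\<^bsub>EB\<^esub> ((\<one>\<^bsub>EB\<^esub> \<oplus>\<^bsub>EB\<^esub> b) \<oplus>\<^bsub>EB\<^esub> (c \<oplus>\<^bsub>EB\<^esub> m' \<odot>\<^bsub>EB\<^esub> d2)) \<otimes>\<^bsub>EB\<^esub> d2 = b"
      "d2 \<otimes>\<^bsub>EB\<^esub> ((\<one>\<^bsub>EB\<^esub> \<oplus>\<^bsub>EB\<^esub> b) \<oplus>\<^bsub>EB\<^esub> (c \<oplus>\<^bsub>EB\<^esub> m' \<odot>\<^bsub>EB\<^esub> d2)) \<otimes>\<^bsub>EB\<^esub> d1 = c"
      using b c m d dd z sm by (simp_all add: N.l_distr N.r_distr)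
    then show "(d1 \<otimes>\<^bsub>EB\<^esub> ((\<one>\<^bsub>EB\<^esub> \<oplus>\<^bsub>EB\<^esub> b) \<oplus>\<^bsub>EB\<^esub> (c \<oplus>\<^bsub>EB\<^esub> m' \<odot>\<^bsub>EB\<^esub> d2)) \<otimes>\<^bsub>EB\<^esub> d2) \<otimes>\<^bsub>EB\<^esub>
        (d2 \<otimes>\<^bsub>EB\<^esub> ((\<one>\<^bsub>EB\<^esub> \<oplus>\<^bsub>EB\<^esub> b) \<oplus>\<^bsub>EB\<^esub> (c \<oplus>\<^bsub>EB\<^esub> m' \<odot>\<^bsub>EB\<^esub> d2)) \<otimes>\<^bsub>EB\<^esub> d1) = m \<odot>\<^bsub>EB\<^esub> d1"
      using m(3) by simp
  qed (use b c m d in simp_all)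
  moreover have "D B k ?w = \<one>\<^bsub>B\<^esub>"
  proof -
    have "\<forall>x \<in> carrier EB. \<forall>y \<in> carrier EB. D B k (x \<otimes>\<^bsub>EB\<^esub> y) = D B k x \<otimes>\<^bsub>B\<^esub> D B k y"
      using D_pseudorep B unfolding pseudorep_def Let_def EB_def by blast
    then have "D B k ?w = D B k (\<one>\<^bsub>EB\<^esub> \<oplus>\<^bsub>EB\<^esub> c) \<otimes>\<^bsub>B\<^esub> D B k (\<one>\<^bsub>EB\<^esub> \<oplus>\<^bsub>EB\<^esub> b)"
      using b c by simp
    then show ?thesis using Db Dc by simp
  qed
  ultimately have "\<one>\<^bsub>B\<^esub> \<oplus>\<^bsub>B\<^esub> (m' \<ominus>\<^bsub>B\<^esub> m) = \<one>\<^bsub>B\<^esub>" using m by (simp add: X.B.minus_eq X.B.a_assoc)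
  then have "m' \<ominus>\<^bsub>B\<^esub> m = \<zero>\<^bsub>B\<^esub>" using m by (simp add: X.B.add.l_cancel_one')
  then show ?thesis using X.B.add_minus_cancel[OF m(2,1)] m by simp
qed

text \<open>Pure tensors get their coefficient from the isomorphism of \<open>R\<close> with the
  first corner, and coefficients add. This supplies the input of the determinant formula when the
  off-diagonal product is given in the other corner.\<close>

lemma diagonal_coeff:
  fixes B :: "'u ring" and k :: "'u \<Rightarrow> 'u"
  assumes B: "comm_alg R B k" and z: "z \<in> carrier (base_change R E B k)"
  shows "\<exists>m \<in> carrier B. pure R E B k e1 \<one>\<^bsub>B\<^esub> \<otimes>\<^bsub>base_change R E B k\<^esub> z \<otimes>\<^bsub>base_change R E B k\<^esub> pure R E B k e1 \<one>\<^bsub>B\<^esub>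
    = m \<odot>\<^bsub>base_change R E B k\<^esub> pure R E B k e1 \<one>\<^bsub>B\<^esub>"
proof -
  interpret X: algebra_ext R E B k by (rule ext_alg[OF B])
  show ?thesis using z
  proof (induction rule: X.pure_induct)
    case zero
    show ?case by (rule bexI[of _ "\<zero>\<^bsub>B\<^esub>"]) (simp_all add: X.MB.smult_l_null del: X.smult_pure)
  next
    case (pure x b)
    have "X.pu (c1 x \<odot> e1) b = X.pu e1 (k (c1 x) \<otimes>\<^bsub>B\<^esub> b)"
      using pure c1 by (intro X.pure_balanced) simp_all
    then show ?case using pure c1 by (intro bexI[of _ "k (c1 x) \<otimes>\<^bsub>B\<^esub> b"]) simp_all
  next
    case (add c d)
    then obtain m n where "m \<in> carrier B" "n \<in> carrier B"
      "X.pu e1 \<one>\<^bsub>B\<^esub> \<otimes>\<^bsub>X.MB\<^esub> c \<otimes>\<^bsub>X.MB\<^esub> X.pu e1 \<one>\<^bsub>B\<^esub> = m \<odot>\<^bsub>X.MB\<^esub> X.pu e1 \<one>\<^bsub>B\<^esub>"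
      "X.pu e1 \<one>\<^bsub>B\<^esub> \<otimes>\<^bsub>X.MB\<^esub> d \<otimes>\<^bsub>X.MB\<^esub> X.pu e1 \<one>\<^bsub>B\<^esub> = n \<odot>\<^bsub>X.MB\<^esub> X.pu e1 \<one>\<^bsub>B\<^esub>" by blast
    then show ?case using add
      by (intro bexI[of _ "m \<oplus>\<^bsub>B\<^esub> n"])
        (simp_all add: X.MB.l_distr X.MB.r_distr X.MB.smult_l_distr del: X.smult_pure)
  qed
qed

text \<open>The clause that is not visibly symmetric is the determinant formula, which takes the
  off-diagonal product in the corner of \<open>e1\<close>. The coefficient there agrees with the one
  in the corner of \<open>e2\<close>.\<close>

lemma swap: "gma_structure G \<chi>b2 \<chi>b1 R E \<rho> D e2 e1"
proof -
  have "D B k x = a1 \<otimes>\<^bsub>B\<^esub> a2 \<ominus>\<^bsub>B\<^esub> m"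
    if B: "comm_alg R B k" and x: "x \<in> carrier (base_change R E B k)" and a: "a1 \<in> carrier B" "a2 \<in> carrier B" "m \<in> carrier B"
      and eq: "pure R E B k e2 \<one>\<^bsub>B\<^esub> \<otimes>\<^bsub>base_change R E B k\<^esub> x \<otimes>\<^bsub>base_change R E B k\<^esub> pure R E B k e2 \<one>\<^bsub>B\<^esub> = a1 \<odot>\<^bsub>base_change R E B k\<^esub> pure R E B k e2 \<one>\<^bsub>B\<^esub>"
      "pure R E B k e1 \<one>\<^bsub>B\<^esub> \<otimes>\<^bsub>base_change R E B k\<^esub> x \<otimes>\<^bsub>base_change R E B k\<^esub> pure R E B k e1 \<one>\<^bsub>B\<^esub> = a2 \<odot>\<^bsub>base_change R E B k\<^esub> pure R E B k e1 \<one>\<^bsub>B\<^esub>"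
      "(pure R E B k e2 \<one>\<^bsub>B\<^esub> \<otimes>\<^bsub>base_change R E B k\<^esub> x \<otimes>\<^bsub>base_change R E B k\<^esub> pure R E B k e1 \<one>\<^bsub>B\<^esub>) \<otimes>\<^bsub>base_change R E B k\<^esub>
       (pure R E B k e1 \<one>\<^bsub>B\<^esub> \<otimes>\<^bsub>base_change R E B k\<^esub> x \<otimes>\<^bsub>base_change R E B k\<^esub> pure R E B k e2 \<one>\<^bsub>B\<^esub>) = m \<odot>\<^bsub>base_change R E B k\<^esub> pure R E B k e2 \<one>\<^bsub>B\<^esub>"
    for B :: "'u ring" and k :: "'u \<Rightarrow> 'u" and x a1 a2 m
  proof -
    interpret X: algebra_ext R E B k by (rule ext_alg[OF B])
    let ?d1 = "X.pu e1 \<one>\<^bsub>B\<^esub>" and ?d2 = "X.pu e2 \<one>\<^bsub>B\<^esub>"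
    let ?b = "?d1 \<otimes>\<^bsub>X.MB\<^esub> x \<otimes>\<^bsub>X.MB\<^esub> ?d2" and ?c = "?d2 \<otimes>\<^bsub>X.MB\<^esub> x \<otimes>\<^bsub>X.MB\<^esub> ?d1"
    have d: "?d1 \<in> carrier X.MB" "?d2 \<in> carrier X.MB" by simp_all
    have dd: "?d1 \<otimes>\<^bsub>X.MB\<^esub> ?d1 = ?d1" "?d2 \<otimes>\<^bsub>X.MB\<^esub> ?d2 = ?d2" by simp_all
    have l: "?d1 \<otimes>\<^bsub>X.MB\<^esub> (?d1 \<otimes>\<^bsub>X.MB\<^esub> y) = ?d1 \<otimes>\<^bsub>X.MB\<^esub> y" "?d2 \<otimes>\<^bsub>X.MB\<^esub> (?d2 \<otimes>\<^bsub>X.MB\<^esub> y) = ?d2 \<otimes>\<^bsub>X.MB\<^esub> y"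
      if "y \<in> carrier X.MB" for y
      using X.MB.m_assoc[OF d(1) d(1) that] X.MB.m_assoc[OF d(2) d(2) that] dd by simp_all
    have bc: "?b \<otimes>\<^bsub>X.MB\<^esub> ?c = ?d1 \<otimes>\<^bsub>X.MB\<^esub> (x \<otimes>\<^bsub>X.MB\<^esub> ?d2 \<otimes>\<^bsub>X.MB\<^esub> x) \<otimes>\<^bsub>X.MB\<^esub> ?d1"
      using x d l by (simp add: X.MB.m_assoc del: X.mult_pure)
    have "x \<otimes>\<^bsub>X.MB\<^esub> ?d2 \<otimes>\<^bsub>X.MB\<^esub> x \<in> carrier X.MB" using x d by simp
    from diagonal_coeff[OF B this] obtain m0 where m0: "m0 \<in> carrier B" "?b \<otimes>\<^bsub>X.MB\<^esub> ?c = m0 \<odot>\<^bsub>X.MB\<^esub> ?d1"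
      unfolding bc by blast
    have "m0 = m"
      by (rule off_diagonal_swap[OF B _ _ _ _ _ _ m0(1) a(3) m0(2) eq(3)])
        (use x d l dd in \<open>simp_all add: X.MB.m_assoc del: X.mult_pure\<close>)
    then show ?thesis
      using D_value[OF B x a(2) a(1) m0(1) eq(2) eq(1) m0(2)] a by (simp add: X.B.m_comm)
  qed
  then show ?thesis
    using gma unfolding gma_structure_def Let_def by (simp add: E.M.a_comm[of e2 e1])
qed

lemma base_alg: "comm_alg R (ring.truncate R) (\<lambda>r. r)"
  by (rule truncate_alg[OF E.R.is_cring])

text \<open>The symmetry of off-diagonal products over \<open>R\<close> itself, obtained by base
  change along the identity.\<close>

lemma c_swap:
  assumes x: "x \<in> carrier E" and y: "y \<in> carrier E"
  shows "c1 (x \<otimes> (e2 \<otimes> y)) = c2 (y \<otimes> (e1 \<otimes> x))"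
proof -
  let ?B = "ring.truncate R"
  interpret X: algebra_ext R E ?B "\<lambda>r. r" by (rule ext_alg[OF base_alg])
  have B: "carrier ?B = carrier R" "\<one>\<^bsub>?B\<^esub> = \<one>\<^bsub>R\<^esub>" "\<And>a b. a \<otimes>\<^bsub>?B\<^esub> b = a \<otimes>\<^bsub>R\<^esub> b" by (simp_all add: ring.defs)
  let ?b = "e1 \<otimes> x \<otimes> e2" and ?c = "e2 \<otimes> y \<otimes> e1"
  let ?r = "c1 (x \<otimes> (e2 \<otimes> y))" and ?s = "c2 (y \<otimes> (e1 \<otimes> x))"
  have r: "?r \<in> carrier R" and s: "?s \<in> carrier R" using x y c1 c2 by simp_all
  have bc: "?b \<otimes> ?c = ?r \<odot> e1" "?c \<otimes> ?b = ?s \<odot> e2"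
    using x y by (simp_all add: c1 c2 Er.m_assoc)
  have one: "\<one>\<^bsub>R\<^esub> \<in> carrier ?B" by (simp add: B)
  have p1: "X.pu (?r \<odot> e1) \<one>\<^bsub>R\<^esub> = ?r \<odot>\<^bsub>X.MB\<^esub> X.pu e1 \<one>\<^bsub>R\<^esub>"
    using X.pure_balanced[of ?r e1 "\<one>\<^bsub>R\<^esub>"] X.smult_pure[of ?r e1 "\<one>\<^bsub>R\<^esub>"] r by (simp add: B)
  have p2: "X.pu (?s \<odot> e2) \<one>\<^bsub>R\<^esub> = ?s \<odot>\<^bsub>X.MB\<^esub> X.pu e2 \<one>\<^bsub>R\<^esub>"
    using X.pure_balanced[of ?s e2 "\<one>\<^bsub>R\<^esub>"] X.smult_pure[of ?s e2 "\<one>\<^bsub>R\<^esub>"] s by (simp add: B)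
  show ?thesis
  proof (rule off_diagonal_swap[OF base_alg, of "X.pu ?b \<one>\<^bsub>R\<^esub>" "X.pu ?c \<one>\<^bsub>R\<^esub>", unfolded B(2)])
    show "X.pu ?b \<one>\<^bsub>R\<^esub> \<otimes>\<^bsub>X.MB\<^esub> X.pu ?c \<one>\<^bsub>R\<^esub> = ?r \<odot>\<^bsub>X.MB\<^esub> X.pu e1 \<one>\<^bsub>R\<^esub>"
      using x y one bc(1) p1 by (simp add: B(3) del: X.smult_pure)
    show "X.pu ?c \<one>\<^bsub>R\<^esub> \<otimes>\<^bsub>X.MB\<^esub> X.pu ?b \<one>\<^bsub>R\<^esub> = ?s \<odot>\<^bsub>X.MB\<^esub> X.pu e2 \<one>\<^bsub>R\<^esub>"
      using x y one bc(2) p2 by (simp add: B(3) del: X.smult_pure)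
  qed (use x y one r s in \<open>simp_all add: B(1,3) Er.m_assoc\<close>)
qed

section \<open>The reducibility ideal\<close>

abbreviation "J \<equiv> reducibility_ideal R E e1 e2"

lemma J_incl:
  assumes x: "x \<in> carrier E" and y: "y \<in> carrier E"
  shows "c1 (x \<otimes> (e2 \<otimes> y)) \<in> J"
proof -
  have "c1 (x \<otimes> (e2 \<otimes> y)) \<odot> e1 = (e1 \<otimes> x \<otimes> e2) \<otimes> (e2 \<otimes> y \<otimes> e1)"
    using x y by (simp add: c1 Er.m_assoc)
  also have "\<dots> \<in> generate (add_monoid E) {b \<otimes> c | b c. b \<in> corner E e1 e2 \<and> c \<in> corner E e2 e1}"
    unfolding corner_def using x y by (blast intro: generate.incl)
  finally show ?thesis using x y c1 by (simp add: reducibility_ideal_def)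
qed

lemma J_subset: "J \<subseteq> carrier R" by (auto simp: reducibility_ideal_def)

text \<open>The ideal is defined by a subgroup generated inside \<open>E\<close>; injectivity of
  \<open>r \<mapsto> r e1\<close> moves induction on that subgroup to \<open>R\<close>.\<close>

lemma J_induct:
  assumes r: "r \<in> J" and zero: "P \<zero>\<^bsub>R\<^esub>"
    and incl: "\<And>x y. x \<in> carrier E \<Longrightarrow> y \<in> carrier E \<Longrightarrow> P (c1 (x \<otimes> (e2 \<otimes> y)))"
    and minus: "\<And>r. r \<in> carrier R \<Longrightarrow> P r \<Longrightarrow> P (\<ominus>\<^bsub>R\<^esub> r)"
    and add: "\<And>r s. r \<in> carrier R \<Longrightarrow> s \<in> carrier R \<Longrightarrow> P r \<Longrightarrow> P s \<Longrightarrow> P (r \<oplus>\<^bsub>R\<^esub> s)"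
  shows "P r"
proof -
  have inc: "\<exists>r \<in> carrier R. h = r \<odot> e1 \<and> P r" if "h \<in> {b \<otimes> c | b c. b \<in> corner E e1 e2 \<and> c \<in> corner E e2 e1}" for h
  proof -
    obtain x y where xy: "x \<in> carrier E" "y \<in> carrier E" "h = (e1 \<otimes> x \<otimes> e2) \<otimes> (e2 \<otimes> y \<otimes> e1)"
      using \<open>h \<in> _\<close> unfolding corner_def by blast
    then show ?thesis using incl[OF xy(1,2)] c1
      by (intro bexI[of _ "c1 (x \<otimes> (e2 \<otimes> y))"]) (simp_all add: Er.m_assoc)
  qed
  have "r \<odot> e1 \<in> generate (add_monoid E) {b \<otimes> c | b c. b \<in> corner E e1 e2 \<and> c \<in> corner E e2 e1}"
    using r by (simp add: reducibility_ideal_def)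
  then have "\<exists>s \<in> carrier R. r \<odot> e1 = s \<odot> e1 \<and> P s"
  proof (induction rule: generate.induct)
    case one
    then show ?case using zero by (intro bexI[of _ "\<zero>\<^bsub>R\<^esub>"]) (simp_all add: E.smult_l_null)
  next
    case (incl h)
    then show ?case by (rule inc)
  next
    case (inv h)
    obtain s where s: "s \<in> carrier R" "h = s \<odot> e1" "P s" using inc[OF inv] by blast
    then show ?case using minus[OF s(1,3)]
      by (intro bexI[of _ "\<ominus>\<^bsub>R\<^esub> s"]) (simp_all add: E.smult_l_minus flip: a_inv_def)
  next
    case (eng h1 h2)
    then obtain s t where "s \<in> carrier R" "h1 = s \<odot> e1" "P s" "t \<in> carrier R" "h2 = t \<odot> e1" "P t" by blast
    then show ?case using add[of s t] by (intro bexI[of _ "s \<oplus>\<^bsub>R\<^esub> t"]) (simp_all add: E.smult_l_distr)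
  qed
  then show ?thesis using e_cancel(1) J_subset r by blast
qed

lemma J_ideal: "ideal J R"
proof -
  let ?S = "{b \<otimes> c | b c. b \<in> corner E e1 e2 \<and> c \<in> corner E e2 e1}"
  have S: "?S \<subseteq> carrier (add_monoid E)" by (auto simp: corner_def)
  have sg: "subgroup (generate (add_monoid E) ?S) (add_monoid E)"
    by (rule E.M.add.generate_is_subgroup[OF S[simplified], simplified])
  have sub: "subgroup J (add_monoid R)"
  proof (rule E.R.add.subgroupI)
    show "J \<subseteq> carrier R" by (rule J_subset)
    show "J \<noteq> {}" using subgroup.one_closed[OF sg] by (auto simp: reducibility_ideal_def E.smult_l_null intro!: exI[of _ "\<zero>\<^bsub>R\<^esub>"])
    show "\<ominus>\<^bsub>R\<^esub> r \<in> J" if "r \<in> J" for r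
      using that subgroup.m_inv_closed[OF sg, of "r \<odot> e1"]
      by (simp add: reducibility_ideal_def E.smult_l_minus flip: a_inv_def)
    show "r \<oplus>\<^bsub>R\<^esub> s \<in> J" if "r \<in> J" "s \<in> J" for r s
      using that subgroup.m_closed[OF sg, of "r \<odot> e1" "s \<odot> e1"]
      by (simp add: reducibility_ideal_def E.smult_l_distr)
  qed
  \<comment> \<open>A scalar is absorbed into the left factor of a generator.\<close>
  have mul: "r \<otimes>\<^bsub>R\<^esub> s \<in> J" if r: "r \<in> carrier R" and s: "s \<in> J" for r s
    using s
  proof (rule J_induct)
    show "r \<otimes>\<^bsub>R\<^esub> \<zero>\<^bsub>R\<^esub> \<in> J" using subgroup.one_closed[OF sub] r by simp
    show "r \<otimes>\<^bsub>R\<^esub> c1 (x \<otimes> (e2 \<otimes> y)) \<in> J" if "x \<in> carrier E" "y \<in> carrier E" for x y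
      using J_incl[of "r \<odot> x" y] r that by (simp add: c_smult)
    show "r \<otimes>\<^bsub>R\<^esub> (\<ominus>\<^bsub>R\<^esub> t) \<in> J" if "t \<in> carrier R" "r \<otimes>\<^bsub>R\<^esub> t \<in> J" for t
      using subgroup.m_inv_closed[OF sub that(2)] r that by (simp add: E.R.r_minus flip: a_inv_def)
    show "r \<otimes>\<^bsub>R\<^esub> (t \<oplus>\<^bsub>R\<^esub> u) \<in> J" if "t \<in> carrier R" "u \<in> carrier R" "r \<otimes>\<^bsub>R\<^esub> t \<in> J" "r \<otimes>\<^bsub>R\<^esub> u \<in> J" for t u
      using subgroup.m_closed[OF sub that(3,4)] r that by (simp add: E.R.r_distr)
  qed
  show ?thesis
  proof (rule idealI[OF E.R.ring_axioms sub])
    show "x \<otimes>\<^bsub>R\<^esub> a \<in> J" "a \<otimes>\<^bsub>R\<^esub> x \<in> J" if "a \<in> J" "x \<in> carrier R" for a x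
      using mul[OF that(2,1)] E.R.m_comm[of x a] J_subset that by auto
  qed
qed

text \<open>Once the reducibility ideal dies, the product of the off-diagonal entries vanishes and
  only the product of the diagonal entries is left in the determinant.\<close>

lemma D_split:
  fixes B :: "'u ring" and k :: "'u \<Rightarrow> 'u"
  assumes B: "comm_alg R B k" and kill: "\<And>r. r \<in> J \<Longrightarrow> k r = \<zero>\<^bsub>B\<^esub>"
    and x: "x \<in> carrier (base_change R E B k)" and a: "a1 \<in> carrier B" "a2 \<in> carrier B"
    and eq: "pure R E B k e1 \<one>\<^bsub>B\<^esub> \<otimes>\<^bsub>base_change R E B k\<^esub> x \<otimes>\<^bsub>base_change R E B k\<^esub> pure R E B k e1 \<one>\<^bsub>B\<^esub> = a1 \<odot>\<^bsub>base_change R E B k\<^esub> pure R E B k e1 \<one>\<^bsub>B\<^esub>"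
      "pure R E B k e2 \<one>\<^bsub>B\<^esub> \<otimes>\<^bsub>base_change R E B k\<^esub> x \<otimes>\<^bsub>base_change R E B k\<^esub> pure R E B k e2 \<one>\<^bsub>B\<^esub> = a2 \<odot>\<^bsub>base_change R E B k\<^esub> pure R E B k e2 \<one>\<^bsub>B\<^esub>"
  shows "D B k x = a1 \<otimes>\<^bsub>B\<^esub> a2"
proof -
  interpret X: algebra_ext R E B k by (rule ext_alg[OF B])
  let ?d1 = "X.pu e1 \<one>\<^bsub>B\<^esub>" and ?d2 = "X.pu e2 \<one>\<^bsub>B\<^esub>"
  have d: "?d1 \<in> carrier X.MB" "?d2 \<in> carrier X.MB" by simp_all
  \<comment> \<open>The off-diagonal product is additive in both occurrences of \<open>x\<close>. It
    is shown to vanish first for two pure tensors, then for an arbitrary right factor, then for an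
    arbitrary left one.\<close>
  have pp: "?d1 \<otimes>\<^bsub>X.MB\<^esub> (X.pu u b \<otimes>\<^bsub>X.MB\<^esub> (?d2 \<otimes>\<^bsub>X.MB\<^esub> (X.pu v b' \<otimes>\<^bsub>X.MB\<^esub> ?d1))) = \<zero>\<^bsub>X.MB\<^esub>"
    if "u \<in> carrier E" "b \<in> carrier B" "v \<in> carrier E" "b' \<in> carrier B" for u b v b'
  proof -
    let ?r = "c1 (u \<otimes> (e2 \<otimes> v))"
    have r: "?r \<in> carrier R" "k ?r = \<zero>\<^bsub>B\<^esub>" using that c1 J_incl kill by simp_all
    have "?d1 \<otimes>\<^bsub>X.MB\<^esub> (X.pu u b \<otimes>\<^bsub>X.MB\<^esub> (?d2 \<otimes>\<^bsub>X.MB\<^esub> (X.pu v b' \<otimes>\<^bsub>X.MB\<^esub> ?d1))) = X.pu (?r \<odot> e1) (b \<otimes>\<^bsub>B\<^esub> b')"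
      using that by (simp add: c1 Er.m_assoc)
    also have "\<dots> = X.pu e1 (k ?r \<otimes>\<^bsub>B\<^esub> (b \<otimes>\<^bsub>B\<^esub> b'))" using that r by (intro X.pure_balanced) simp_all
    finally show ?thesis using that r by simp
  qed
  have px: "?d1 \<otimes>\<^bsub>X.MB\<^esub> (X.pu u b \<otimes>\<^bsub>X.MB\<^esub> (?d2 \<otimes>\<^bsub>X.MB\<^esub> (w \<otimes>\<^bsub>X.MB\<^esub> ?d1))) = \<zero>\<^bsub>X.MB\<^esub>"
    if "u \<in> carrier E" "b \<in> carrier B" "w \<in> carrier X.MB" for u b w
    using that(3)
  proof (induction rule: X.pure_induct)
    case (pure v b')
    then show ?case using pp that by blast
  next
    case (add c d)
    then show ?case using that by (simp add: X.MB.l_distr X.MB.r_distr del: X.mult_pure)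
  qed (use that in \<open>simp del: X.mult_pure\<close>)
  have xx: "?d1 \<otimes>\<^bsub>X.MB\<^esub> (v \<otimes>\<^bsub>X.MB\<^esub> (?d2 \<otimes>\<^bsub>X.MB\<^esub> (x \<otimes>\<^bsub>X.MB\<^esub> ?d1))) = \<zero>\<^bsub>X.MB\<^esub>" if "v \<in> carrier X.MB" for v
    using that
  proof (induction rule: X.pure_induct)
    case (pure v b')
    then show ?case using px x by blast
  next
    case (add c d)
    then show ?case using x by (simp add: X.MB.l_distr X.MB.r_distr del: X.mult_pure)
  qed (use x in \<open>simp del: X.mult_pure\<close>)
  have d22: "?d2 \<otimes>\<^bsub>X.MB\<^esub> (?d2 \<otimes>\<^bsub>X.MB\<^esub> y) = ?d2 \<otimes>\<^bsub>X.MB\<^esub> y" if "y \<in> carrier X.MB" for y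
    using X.MB.m_assoc[OF d(2) d(2) that] by simp
  have "(?d1 \<otimes>\<^bsub>X.MB\<^esub> x \<otimes>\<^bsub>X.MB\<^esub> ?d2) \<otimes>\<^bsub>X.MB\<^esub> (?d2 \<otimes>\<^bsub>X.MB\<^esub> x \<otimes>\<^bsub>X.MB\<^esub> ?d1) = \<zero>\<^bsub>B\<^esub> \<odot>\<^bsub>X.MB\<^esub> ?d1"
    using x d d22 xx[OF x] by (simp add: X.MB.m_assoc X.MB.smult_l_null del: X.mult_pure X.smult_pure)
  from D_value[OF B x a X.B.zero_closed eq this] show ?thesis using a by (simp add: X.B.minus_eq)
qed

end

text \<open>The generators \<open>c1 (x e2 y)\<close> and \<open>c2 (y e1 x)\<close> coincide, so
  both corners define the same ideal.\<close>

lemma (in gma) reducibility_ideal_swap: "reducibility_ideal R E e2 e1 = J"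
proof -
  interpret s: gma G \<chi>b2 \<chi>b1 R E \<rho> D e2 e1
    by unfold_locales (rule E_alg, rule D_pseudorep, rule swap)
  have cs: "s.c1 = c2" "s.c2 = c1" by (simp_all add: s.c1_def[abs_def] s.c2_def[abs_def] c1_def[abs_def] c2_def[abs_def])
  interpret J: ideal J R by (rule J_ideal)
  interpret sJ: ideal s.J R by (rule s.J_ideal)
  show ?thesis
  proof
    show "s.J \<subseteq> J"
    proof
      fix r assume "r \<in> s.J"
      then show "r \<in> J"
      proof (rule s.J_induct)
        show "s.c1 (x \<otimes>\<^bsub>E\<^esub> (e1 \<otimes>\<^bsub>E\<^esub> y)) \<in> J" if "x \<in> carrier E" "y \<in> carrier E" for x y
          unfolding cs c_swap[OF that(2,1), symmetric] by (rule J_incl[OF that(2,1)])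
      qed (simp_all add: J.a_inv_closed)
    qed
    show "J \<subseteq> s.J"
    proof
      fix r assume "r \<in> J"
      then show "r \<in> s.J"
      proof (rule J_induct)
        show "c1 (x \<otimes>\<^bsub>E\<^esub> (e2 \<otimes>\<^bsub>E\<^esub> y)) \<in> s.J" if "x \<in> carrier E" "y \<in> carrier E" for x y
          unfolding c_swap[OF that] cs(1)[symmetric] by (rule s.J_incl[OF that(2,1)])
      qed (simp_all add: sJ.a_inv_closed)
    qed
  qed
qed

section \<open>The universal algebra and derivations\<close>

lemma a_kernel_iff: "x \<in> a_kernel A F h \<longleftrightarrow> x \<in> carrier A \<and> h x = \<zero>\<^bsub>F\<^esub>"
  by (simp add: a_kernel_def')

text \<open>Every residue comes from \<open>W\<close>, so an element of \<open>R\<close> is the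
  image of an element of \<open>W\<close> plus an element of the maximal ideal. The homomorphism
  respects both parts.\<close>

lemma coef_hom_res:
  assumes R: "coef_ring F W red R" and A: "coef_ring F W red A" and F: "ring F"
    and red: "red ` carrier W = carrier F" and f: "coef_hom W R A f" and r: "r \<in> carrier R"
  shows "res A (f r) = res R r"
proof -
  note Rr = R[unfolded coef_ring_def complete_noetherian_local_def] and Ar = A[unfolded coef_ring_def complete_noetherian_local_def]
  interpret R: cring R using Rr by blast
  interpret A: cring A using Ar by blast
  interpret F: ring F by (rule F)
  have rR: "res R \<in> ring_hom R F" and rA: "res A \<in> ring_hom A F" using Rr Ar by blast+
  have fh: "f \<in> ring_hom R A" using f by (simp add: coef_hom_def)
  have "res R r \<in> red ` carrier W" unfolding red by (rule ring_hom_closed[OF rR r])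
  then obtain w where w: "w \<in> carrier W" "red w = res R r" by force
  have sw: "str R w \<in> carrier R" using Rr w(1) by (blast intro: ring_hom_closed)
  have rw: "res R (str R w) = res R r" using Rr w by simp
  let ?d = "r \<ominus>\<^bsub>R\<^esub> str R w"
  have dc: "?d \<in> carrier R" using r sw by simp
  have sum: "r = str R w \<oplus>\<^bsub>R\<^esub> ?d" using R.add_minus_cancel[OF r sw] by simp
  have "res R r = res R r \<oplus>\<^bsub>F\<^esub> res R ?d"
    using arg_cong[OF sum, of "res R"] ring_hom_add[OF rR sw dc] rw by simp
  then have "res R ?d = \<zero>\<^bsub>F\<^esub>"
    using F.add.l_cancel_one[of "res R r" "res R ?d"] ring_hom_closed[OF rR] r dc by simp
  then have "?d \<in> maxid R" using Rr dc a_kernel_iff[of ?d R F "res R"] by simp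
  then have "f ?d \<in> maxid A" using f unfolding coef_hom_def by blast
  then have fd: "f ?d \<in> carrier A" "res A (f ?d) = \<zero>\<^bsub>F\<^esub>" using Ar a_kernel_iff[of "f ?d" A F "res A"] by simp_all
  have "f r = f (str R w) \<oplus>\<^bsub>A\<^esub> f ?d" using arg_cong[OF sum, of f] ring_hom_add[OF fh sw dc] by simp
  then have "res A (f r) = res A (f (str R w)) \<oplus>\<^bsub>F\<^esub> res A (f ?d)"
    using ring_hom_add[OF rA] ring_hom_closed[OF fh sw] fd(1) by simp
  also have "f (str R w) = str A w" using f w(1) by (simp add: coef_hom_def)
  also have "res A (str A w) = red w" using Ar w(1) by blast
  finally show ?thesis using fd w ring_hom_closed[OF rR r] by simp
qed

section \<open>Recovering the two characters from their determinant\<close>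

lemma (in abelian_group) eq_minusI:
  assumes "x \<in> carrier G" "y \<in> carrier G" "x \<oplus> y = z"
  shows "y = z \<ominus> x"
proof -
  have "y = (y \<oplus> x) \<ominus> x" using assms(1,2) by (simp add: minus_eq a_assoc r_neg)
  then show ?thesis using a_comm[OF assms(1,2)] assms(3) by simp
qed

text \<open>If \<open>a\<close> and its partner \<open>(b + c) - a\<close> have product
  \<open>b c\<close>, the right side vanishes: an entry with the right trace and determinant is a
  root of the quadratic with roots \<open>b\<close> and \<open>c\<close>.\<close>

lemma (in cring) quadratic_root:
  assumes "a \<in> carrier R" "b \<in> carrier R" "c \<in> carrier R"
  shows "(a \<ominus> c) \<otimes> (a \<ominus> b) = b \<otimes> c \<ominus> a \<otimes> ((b \<oplus> c) \<ominus> a)"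
  using assms by (simp add: minus_eq l_distr r_distr l_minus r_minus minus_add a_ac m_ac)

text \<open>Shifting one entry by \<open>u\<close> and the other by \<open>- u\<close> without
  changing the mixed determinant forces \<open>q - p\<close> to annihilate \<open>u\<close>; in the
  application \<open>q - p\<close> is a unit.\<close>

lemma (in cring) linear_system:
  assumes "c \<in> carrier R" "d \<in> carrier R" "u \<in> carrier R" "p \<in> carrier R" "q \<in> carrier R"
    and eq: "(c \<oplus> u) \<otimes> q \<oplus> p \<otimes> (d \<ominus> u) = c \<otimes> q \<oplus> p \<otimes> d"
  shows "(q \<ominus> p) \<otimes> u = \<zero>"
proof -
  have "(c \<oplus> u) \<otimes> q \<oplus> p \<otimes> (d \<ominus> u) = (c \<otimes> q \<oplus> p \<otimes> d) \<oplus> (q \<ominus> p) \<otimes> u"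
    using assms(1-5) by (simp add: minus_eq l_distr r_distr l_minus r_minus a_ac m_ac)
  then show ?thesis using eq assms(1-5) by (simp add: add.l_cancel_one)
qed

text \<open>\<open>\<psi>\<close> stands for the composite of the quotient map by \<open>J\<close>
  with \<open>\<phi>\<close>. The characters enter as \<open>char_pair A G T \<chi>2 \<chi>1\<close>
  because \<open>\<chi>2\<close> lives on the quotient of the extension and \<open>\<chi>1\<close>
  on the submodule.\<close>

locale ext_setup =
  gma G \<chi>b1 \<chi>b2 R E \<rho> D e1 e2 + stable_class p G T C + char_pair A G T \<chi>2 \<chi>1
  for G :: "'g monoid" and \<chi>b1 \<chi>b2 :: "'g \<Rightarrow> 'f" and R :: "('u, 'w, 'f) coef"
    and E :: "('u, 'u) module" and \<rho> :: "'g \<Rightarrow> 'u" and D :: "('u, 'u, 'u) law" and e1 e2 :: 'u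
    and p :: nat and T :: "'g topology" and C :: "'g fin_class" and A :: "('u, 'w, 'f) coef" (structure)
    and \<chi>1 \<chi>2 :: "'g \<Rightarrow> 'u" +
  fixes F :: "'f ring" and W :: "'w ring" and red :: "'w \<Rightarrow> 'f" and \<psi> :: "'u \<Rightarrow> 'u"
  assumes inf: "infinite (UNIV :: 'u set)" and F: "field F" and red: "red ` carrier W = carrier F"
    and distinct: "\<exists>g \<in> carrier G. \<chi>b1 g \<noteq> \<chi>b2 g"
    and univ: "universal_CH_rep G T C F W red \<chi>b1 \<chi>b2 R E \<rho> D"
    and A_coef: "coef_ring F W red A"
    and res_\<chi>: "\<And>g. g \<in> carrier G \<Longrightarrow> res A (\<chi>1 g) = \<chi>b1 g" "\<And>g. g \<in> carrier G \<Longrightarrow> res A (\<chi>2 g) = \<chi>b2 g"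
    and sat: "satisfies G C A (char_module A \<chi>1)" "satisfies G C A (char_module A \<chi>2)"
    and \<psi>: "coef_hom W R A \<psi>" "\<And>r. r \<in> J \<Longrightarrow> \<psi> r = \<zero>\<^bsub>A\<^esub>" "specializes_to_sum G R E \<rho> D A \<psi> \<chi>1 \<chi>2"
begin

lemma R_coef: "coef_ring F W red R" and E_CH: "CH_rep G T R E \<rho> D"
  and E_sat: "satisfies G C R (with_action E (\<lambda>g x. \<rho> g \<otimes>\<^bsub>E\<^esub> x))"
  using univ unfolding universal_CH_rep_def CH_rep_satisfying_def by blast+

lemma max_R: "ideal (maxid R) R"
  using R_coef by (simp add: coef_ring_def complete_noetherian_local_def)

lemma \<rho>_closed [simp]: "g \<in> carrier G \<Longrightarrow> \<rho> g \<in> carrier E"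
  using E_CH by (auto simp: CH_rep_def hom_def units_of_def)

lemma \<rho>_mult: "g \<in> carrier G \<Longrightarrow> h \<in> carrier G \<Longrightarrow> \<rho> (g \<otimes>\<^bsub>G\<^esub> h) = \<rho> g \<otimes>\<^bsub>E\<^esub> \<rho> h"
  using E_CH by (auto simp: CH_rep_def hom_def units_of_def)

lemma \<rho>_one: "\<rho> \<one>\<^bsub>G\<^esub> = \<one>\<^bsub>E\<^esub>"
proof -
  have "\<rho> \<in> hom G (units_of E)" using E_CH by (simp add: CH_rep_def)
  from hom_one[OF this grp Er.units_group] show ?thesis by (simp add: units_of_def)
qed

lemma c_closed [simp]: "x \<in> carrier E \<Longrightarrow> c1 x \<in> carrier R" "x \<in> carrier E \<Longrightarrow> c2 x \<in> carrier R"
  using c1 c2 by simp_all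

lemma res_c: "g \<in> carrier G \<Longrightarrow> res R (c1 (\<rho> g)) = \<chi>b1 g" "g \<in> carrier G \<Longrightarrow> res R (c2 (\<rho> g)) = \<chi>b2 g"
proof -
  assume g: "g \<in> carrier G"
  obtain r where "r \<in> carrier R" "e1 \<otimes>\<^bsub>E\<^esub> \<rho> g \<otimes>\<^bsub>E\<^esub> e1 = r \<odot>\<^bsub>E\<^esub> e1" "res R r = \<chi>b1 g"
    using gma g unfolding gma_structure_def by meson
  then show "res R (c1 (\<rho> g)) = \<chi>b1 g" using c1_unique[of r "\<rho> g"] g by simp
  obtain s where "s \<in> carrier R" "e2 \<otimes>\<^bsub>E\<^esub> \<rho> g \<otimes>\<^bsub>E\<^esub> e2 = s \<odot>\<^bsub>E\<^esub> e2" "res R s = \<chi>b2 g"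
    using gma g unfolding gma_structure_def by meson
  then show "res R (c2 (\<rho> g)) = \<chi>b2 g" using c2_unique[of s "\<rho> g"] g by simp
qed

lemma F_ring: "ring F" using F by (simp add: field_def domain_def cring_def)

lemmas coef_hom_res' = coef_hom_res[OF R_coef A_coef F_ring red]

lemma A_local: "a \<in> carrier A \<Longrightarrow> res A a \<noteq> \<zero>\<^bsub>F\<^esub> \<Longrightarrow> a \<in> Units A"
proof -
  assume a: "a \<in> carrier A" "res A a \<noteq> \<zero>\<^bsub>F\<^esub>"
  have "a_kernel A F (res A) = maxid A" using A_coef by (simp add: coef_ring_def)
  then show "a \<in> Units A" using a a_kernel_iff[of a A F "res A"] by (auto simp: maxid_def)
qed

lemma res_A: "res A \<in> ring_hom A F" using A_coef by (simp add: coef_ring_def)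

lemma unit_diff:
  assumes a: "a \<in> carrier A" "b \<in> carrier A" "res A a \<noteq> res A b"
  shows "a \<ominus> b \<in> Units A"
proof (rule A_local)
  interpret F: ring F by (rule F_ring)
  show c: "a \<ominus> b \<in> carrier A" using a by simp
  show "res A (a \<ominus> b) \<noteq> \<zero>\<^bsub>F\<^esub>"
  proof
    assume "res A (a \<ominus> b) = \<zero>\<^bsub>F\<^esub>"
    moreover have "res A a = res A (b \<oplus> (a \<ominus> b))" using A.add_minus_cancel[OF a(1,2)] by simp
    ultimately have "res A a = res A b"
      using a c ring_hom_add[OF res_A a(2) c] ring_hom_closed[OF res_A a(2)] by simp
    then show False using a(3) by simp
  qed
qed

lemma unit_cancel:
  assumes "u \<in> Units A" "x \<in> carrier A" "u \<otimes> x = \<zero>"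
  shows "x = \<zero>"
proof -
  have u: "inv\<^bsub>A\<^esub> u \<in> carrier A" "u \<in> carrier A" using A.Units_inv_closed[OF assms(1)] A.Units_closed[OF assms(1)] .
  have "x = inv\<^bsub>A\<^esub> u \<otimes> (u \<otimes> x)" using A.m_assoc[OF u assms(2)] A.Units_l_inv[OF assms(1)] assms(2) by simp
  also have "\<dots> = \<zero>" unfolding assms(3) using u by simp
  finally show ?thesis .
qed

abbreviation \<alpha> where "\<alpha> g \<equiv> \<psi> (c1 (\<rho> g))"
abbreviation \<delta> where "\<delta> g \<equiv> \<psi> (c2 (\<rho> g))"

lemma \<psi>_hom: "\<psi> \<in> ring_hom R A" using \<psi>(1) by (simp add: coef_hom_def)

lemma \<psi>_closed [simp]: "r \<in> carrier R \<Longrightarrow> \<psi> r \<in> carrier A" by (rule ring_hom_closed[OF \<psi>_hom])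

lemma A_nontrivial: "\<one> \<noteq> \<zero>" using A_coef by (simp add: coef_ring_def complete_noetherian_local_def)

text \<open>Evaluating the equality of pseudorepresentations at the sums of one and of two group elements
  gives the determinant and its polarization.\<close>

lemma det_eq:
  assumes S: "finite S" "S \<subseteq> carrier G"
  shows "finsum A \<alpha> S \<otimes> finsum A \<delta> S = finsum A \<chi>1 S \<otimes> finsum A \<chi>2 S"
proof -
  let ?B = "ring.truncate A"
  have B: "carrier ?B = carrier A" "\<one>\<^bsub>?B\<^esub> = \<one>" "\<zero>\<^bsub>?B\<^esub> = \<zero>" "\<And>a b. a \<otimes>\<^bsub>?B\<^esub> b = a \<otimes> b"
    "\<And>a b. a \<oplus>\<^bsub>?B\<^esub> b = a \<oplus> b" by (simp_all add: ring.defs)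
  have BA: "comm_alg A ?B (\<lambda>r. r)" by (rule truncate_alg[OF A])
  have BR: "comm_alg R ?B \<psi>"
    using BA \<psi>_hom by (simp add: comm_alg_def ring_hom_def B)
  interpret X: algebra_ext R E ?B \<psi> by (rule ext_alg[OF BR])
  have fin: "finsum ?B f U = finsum A f U" for f :: "'g \<Rightarrow> 'u" and U
    by (simp add: finsum_def ring.defs finprod_def)
  \<comment> \<open>The sum of the elements of \<open>S\<close> in the group ring; its support is
    \<open>S\<close> because \<open>A\<close> is nonzero.\<close>
  let ?s = "\<lambda>g. if g \<in> S then \<one> else \<zero>"
  have supp: "{g \<in> carrier G. ?s g \<noteq> \<zero>\<^bsub>?B\<^esub>} = S" using S A_nontrivial by (auto simp: B)
  have "?s \<in> group_ring_carrier G ?B"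
    using S supp by (auto simp: group_ring_carrier_def B)
  then have eq: "induced_law G R E \<rho> D ?B \<psi> ?s = psi_sum G \<chi>1 \<chi>2 ?B (\<lambda>r. r) ?s"
    using \<psi>(3) BA unfolding specializes_to_sum_def by blast
  have Gc: "g \<in> carrier G" if "g \<in> S" for g using S that by blast
  have 1: "finsum ?B (\<lambda>g. f g \<otimes>\<^bsub>?B\<^esub> ?s g) S = finsum A f S" if "\<And>g. g \<in> S \<Longrightarrow> f g \<in> carrier A" for f
    unfolding fin by (rule A.finsum_cong') (use that in \<open>auto simp: B\<close>)
  have rhs: "psi_sum G \<chi>1 \<chi>2 ?B (\<lambda>r. r) ?s = finsum A \<chi>1 S \<otimes> finsum A \<chi>2 S"
    unfolding psi_sum_def supp using 1[of \<chi>1] 1[of \<chi>2] Gc by (simp add: B(4))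
  let ?x = "finsum X.MB (\<lambda>g. X.pu (\<rho> g) \<one>) S"
  have xs: "finsum X.MB (\<lambda>g. X.pu (\<rho> g) (?s g)) S = ?x"
    by (rule X.MB.finsum_cong') (use Gc in \<open>auto simp: B\<close>)
  have lhs: "induced_law G R E \<rho> D ?B \<psi> ?s = D ?B \<psi> ?x"
    unfolding induced_law_def Let_def supp xs by (rule refl)
  \<comment> \<open>The diagonal corners are additive, so those of the sum are found by induction on
    \<open>S\<close>.\<close>
  have key: "?x \<in> carrier X.MB \<and>
      X.pu e1 \<one> \<otimes>\<^bsub>X.MB\<^esub> ?x \<otimes>\<^bsub>X.MB\<^esub> X.pu e1 \<one> = finsum A \<alpha> S \<odot>\<^bsub>X.MB\<^esub> X.pu e1 \<one> \<and>
      X.pu e2 \<one> \<otimes>\<^bsub>X.MB\<^esub> ?x \<otimes>\<^bsub>X.MB\<^esub> X.pu e2 \<one> = finsum A \<delta> S \<odot>\<^bsub>X.MB\<^esub> X.pu e2 \<one>"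
    using S
  proof (induction)
    case empty
    show ?case using X.MB.smult_l_null[of "X.pu e1 \<one>"] X.MB.smult_l_null[of "X.pu e2 \<one>"] by (simp add: B)
  next
    case (insert g S)
    have g: "g \<in> carrier G" using insert by blast
    have fc: "finsum A \<alpha> S \<in> carrier A" "finsum A \<delta> S \<in> carrier A"
      using insert by (auto intro!: A.finsum_closed)
    have ad: "finsum A \<alpha> (insert g S) = \<alpha> g \<oplus> finsum A \<alpha> S" "finsum A \<delta> (insert g S) = \<delta> g \<oplus> finsum A \<delta> S"
      using insert by (auto intro!: A.finsum_insert)
    let ?y = "finsum X.MB (\<lambda>g. X.pu (\<rho> g) \<one>) S"
    have x: "finsum X.MB (\<lambda>g. X.pu (\<rho> g) \<one>) (insert g S) = X.pu (\<rho> g) \<one> \<oplus>\<^bsub>X.MB\<^esub> ?y"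
      using insert by (intro X.MB.finsum_insert) (auto simp: B)
    have y: "?y \<in> carrier X.MB" using insert by blast
    have p1: "X.pu e1 \<one> \<otimes>\<^bsub>X.MB\<^esub> X.pu (\<rho> g) \<one> \<otimes>\<^bsub>X.MB\<^esub> X.pu e1 \<one> = \<alpha> g \<odot>\<^bsub>X.MB\<^esub> X.pu e1 \<one>"
      using X.pure_balanced[of "c1 (\<rho> g)" e1 "\<one>"] g by (simp add: B c1)
    have p2: "X.pu e2 \<one> \<otimes>\<^bsub>X.MB\<^esub> X.pu (\<rho> g) \<one> \<otimes>\<^bsub>X.MB\<^esub> X.pu e2 \<one> = \<delta> g \<odot>\<^bsub>X.MB\<^esub> X.pu e2 \<one>"
      using X.pure_balanced[of "c2 (\<rho> g)" e2 "\<one>"] g by (simp add: B c2)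
    have d: "X.pu e1 \<one> \<in> carrier X.MB" "X.pu e2 \<one> \<in> carrier X.MB" "X.pu (\<rho> g) \<one> \<in> carrier X.MB"
      using g by (simp_all add: B)
    have sd: "(a \<oplus> b) \<odot>\<^bsub>X.MB\<^esub> z = a \<odot>\<^bsub>X.MB\<^esub> z \<oplus>\<^bsub>X.MB\<^esub> b \<odot>\<^bsub>X.MB\<^esub> z"
      if "a \<in> carrier A" "b \<in> carrier A" "z \<in> carrier X.MB" for a b z
      using X.MB.smult_l_distr[of a b z] that by (simp add: B)
    have IH: "X.pu e1 \<one> \<otimes>\<^bsub>X.MB\<^esub> ?y \<otimes>\<^bsub>X.MB\<^esub> X.pu e1 \<one> = finsum A \<alpha> S \<odot>\<^bsub>X.MB\<^esub> X.pu e1 \<one>"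
      "X.pu e2 \<one> \<otimes>\<^bsub>X.MB\<^esub> ?y \<otimes>\<^bsub>X.MB\<^esub> X.pu e2 \<one> = finsum A \<delta> S \<odot>\<^bsub>X.MB\<^esub> X.pu e2 \<one>"
      using insert by blast+
    have ac: "\<alpha> g \<in> carrier A" "\<delta> g \<in> carrier A" using g by simp_all
    show ?case unfolding x ad
      using d y by (simp only: X.MB.l_distr X.MB.r_distr p1 p2 IH sd[OF ac(1) fc(1) d(1)] sd[OF ac(2) fc(2) d(2)]
          X.MB.m_closed X.MB.a_closed simp_thms)
  qed
  \<comment> \<open>\<open>\<psi>\<close> kills \<open>J\<close>, so the determinant is the product
    of the two diagonal sums.\<close>
  have "D ?B \<psi> ?x = finsum A \<alpha> S \<otimes>\<^bsub>?B\<^esub> finsum A \<delta> S"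
    by (rule D_split[OF BR]) (use key \<psi>(2) Gc in \<open>auto simp: B intro!: A.finsum_closed\<close>)
  then show ?thesis using eq lhs rhs by (simp add: B)
qed

lemma det_one: "g \<in> carrier G \<Longrightarrow> \<alpha> g \<otimes> \<delta> g = \<chi>1 g \<otimes> \<chi>2 g"
  using det_eq[of "{g}"] by simp

text \<open>Subtracting the determinants at \<open>g\<close> and at \<open>h\<close> from the one at
  \<open>g + h\<close> leaves the mixed terms. The two elements are distinct because the sum is
  encoded by the set of its terms.\<close>

lemma det_polarized:
  assumes g: "g \<in> carrier G" and h: "h \<in> carrier G" and ne: "g \<noteq> h"
  shows "\<alpha> g \<otimes> \<delta> h \<oplus> \<alpha> h \<otimes> \<delta> g = \<chi>1 g \<otimes> \<chi>2 h \<oplus> \<chi>1 h \<otimes> \<chi>2 g"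
proof -
  have cl: "\<alpha> g \<in> carrier A" "\<alpha> h \<in> carrier A" "\<delta> g \<in> carrier A" "\<delta> h \<in> carrier A"
    "\<chi>1 g \<in> carrier A" "\<chi>1 h \<in> carrier A" "\<chi>2 g \<in> carrier A" "\<chi>2 h \<in> carrier A"
    using g h by simp_all
  have expand: "(a \<oplus> b) \<otimes> (c \<oplus> d) = (a \<otimes> c \<oplus> b \<otimes> d) \<oplus> (a \<otimes> d \<oplus> b \<otimes> c)"
    if "a \<in> carrier A" "b \<in> carrier A" "c \<in> carrier A" "d \<in> carrier A" for a b c d
    using that by (simp add: A.l_distr A.r_distr A.a_ac)
  have "(\<alpha> g \<oplus> \<alpha> h) \<otimes> (\<delta> g \<oplus> \<delta> h) = (\<chi>1 g \<oplus> \<chi>1 h) \<otimes> (\<chi>2 g \<oplus> \<chi>2 h)"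
    using det_eq[of "{g, h}"] g h ne by simp
  then have "(\<alpha> g \<otimes> \<delta> g \<oplus> \<alpha> h \<otimes> \<delta> h) \<oplus> (\<alpha> g \<otimes> \<delta> h \<oplus> \<alpha> h \<otimes> \<delta> g) =
      (\<chi>1 g \<otimes> \<chi>2 g \<oplus> \<chi>1 h \<otimes> \<chi>2 h) \<oplus> (\<chi>1 g \<otimes> \<chi>2 h \<oplus> \<chi>1 h \<otimes> \<chi>2 g)"
    by (simp only: expand[OF cl(1,2,3,4)] expand[OF cl(5,6,7,8)])
  then have "(\<chi>1 g \<otimes> \<chi>2 g \<oplus> \<chi>1 h \<otimes> \<chi>2 h) \<oplus> (\<alpha> g \<otimes> \<delta> h \<oplus> \<alpha> h \<otimes> \<delta> g) =
      (\<chi>1 g \<otimes> \<chi>2 g \<oplus> \<chi>1 h \<otimes> \<chi>2 h) \<oplus> (\<chi>1 g \<otimes> \<chi>2 h \<oplus> \<chi>1 h \<otimes> \<chi>2 g)"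
    by (simp only: det_one[OF g] det_one[OF h])
  moreover have "\<chi>1 g \<otimes> \<chi>2 g \<oplus> \<chi>1 h \<otimes> \<chi>2 h \<in> carrier A" "\<alpha> g \<otimes> \<delta> h \<oplus> \<alpha> h \<otimes> \<delta> g \<in> carrier A"
    "\<chi>1 g \<otimes> \<chi>2 h \<oplus> \<chi>1 h \<otimes> \<chi>2 g \<in> carrier A"
    by (intro A.a_closed A.m_closed cl)+
  ultimately show ?thesis by (simp only: A.add.l_cancel)
qed

lemma \<alpha>_one: "\<alpha> \<one>\<^bsub>G\<^esub> = \<one>" "\<delta> \<one>\<^bsub>G\<^esub> = \<one>"
  by (simp_all add: \<rho>_one ring_hom_one[OF \<psi>_hom])

text \<open>Polarizing against the identity element, where all four entries are 1, turns the
  determinant into the trace; the identity element itself is a separate case, as polarization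
  compares distinct elements.\<close>

lemma trace_eq:
  assumes g: "g \<in> carrier G"
  shows "\<alpha> g \<oplus> \<delta> g = \<chi>1 g \<oplus> \<chi>2 g"
proof (cases "g = \<one>\<^bsub>G\<^esub>")
  case True
  then show ?thesis by (simp add: \<alpha>_one)
next
  case False
  from det_polarized[OF g G.one_closed False] g show ?thesis unfolding \<alpha>_one by simp
qed

lemma A_eqI: "a \<in> carrier A \<Longrightarrow> b \<in> carrier A \<Longrightarrow> a \<ominus> b = \<zero> \<Longrightarrow> a = b"
  using A.add_minus_cancel[of a b] by simp

text \<open>At an element \<open>h\<close> where the residual characters differ,
  \<open>\<alpha> h\<close> is a root of the quadratic with roots \<open>\<chi>1 h\<close> and
  \<open>\<chi>2 h\<close>, and its residue decides which one. Any other \<open>g\<close> is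
  compared with \<open>h\<close> through the polarized determinant, a linear condition with unit
  coefficient.\<close>

lemma characters:
  assumes g: "g \<in> carrier G"
  shows "\<alpha> g = \<chi>1 g" "\<delta> g = \<chi>2 g"
proof -
  obtain h where h: "h \<in> carrier G" "\<chi>b1 h \<noteq> \<chi>b2 h" using distinct by blast
  have cl: "\<alpha> g \<in> carrier A" "\<alpha> h \<in> carrier A" "\<delta> g \<in> carrier A" "\<delta> h \<in> carrier A"
    "\<chi>1 g \<in> carrier A" "\<chi>1 h \<in> carrier A" "\<chi>2 g \<in> carrier A" "\<chi>2 h \<in> carrier A"
    using g h by simp_all
  have tr: "\<delta> k = (\<chi>1 k \<oplus> \<chi>2 k) \<ominus> \<alpha> k" if "k \<in> carrier G" for k
  proof -
    have "(\<chi>1 k \<oplus> \<chi>2 k) \<ominus> \<alpha> k = (\<alpha> k \<oplus> \<delta> k) \<ominus> \<alpha> k" using trace_eq[OF that] by simp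
    also have "\<dots> = \<alpha> k \<oplus> (\<delta> k \<ominus> \<alpha> k)" using that by (simp add: A.minus_eq A.a_assoc)
    also have "\<dots> = \<delta> k" using that by (intro A.add_minus_cancel) simp_all
    finally show ?thesis by simp
  qed
  have "(\<alpha> h \<ominus> \<chi>2 h) \<otimes> (\<alpha> h \<ominus> \<chi>1 h) = \<chi>1 h \<otimes> \<chi>2 h \<ominus> \<alpha> h \<otimes> ((\<chi>1 h \<oplus> \<chi>2 h) \<ominus> \<alpha> h)"
    by (rule A.quadratic_root[OF cl(2,6,8)])
  also have "\<dots> = \<zero>" unfolding tr[OF h(1), symmetric] det_one[OF h(1)] using cl by (simp add: A.minus_eq A.r_neg)
  finally have prod: "(\<alpha> h \<ominus> \<chi>2 h) \<otimes> (\<alpha> h \<ominus> \<chi>1 h) = \<zero>" .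
  \<comment> \<open>The residue of \<open>\<alpha> h\<close> is \<open>\<chi>b1 h\<close> by the
    matrix structure, so the factor with \<open>\<chi>2 h\<close> is a unit and cancels.\<close>
  have "res A (\<alpha> h) \<noteq> res A (\<chi>2 h)"
    using coef_hom_res'[OF \<psi>(1), of "c1 (\<rho> h)"] res_c[OF h(1)] res_\<chi>[OF h(1)] h by simp
  then have "\<alpha> h \<ominus> \<chi>1 h = \<zero>"
    using unit_cancel[OF unit_diff[OF cl(2,8)] _ prod] A.minus_closed[OF cl(2,6)] by blast
  then have \<alpha>h: "\<alpha> h = \<chi>1 h" by (rule A_eqI[OF cl(2,6)])
  have \<delta>: "\<delta> k = \<chi>2 k" if "k \<in> carrier G" "\<alpha> k = \<chi>1 k" for k
  proof -
    have "\<chi>1 k \<oplus> \<delta> k = \<chi>1 k \<oplus> \<chi>2 k" using trace_eq[OF that(1)] that(2) by simp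
    then show ?thesis using that(1) by (simp add: A.add.l_cancel)
  qed
  note \<delta>h = \<delta>[OF h(1) \<alpha>h]
  have "\<alpha> g = \<chi>1 g"
  proof (cases "g = h")
    case True
    then show ?thesis using \<alpha>h by simp
  next
    case False
    have pol: "\<alpha> g \<otimes> \<chi>2 h \<oplus> \<chi>1 h \<otimes> \<delta> g = \<chi>1 g \<otimes> \<chi>2 h \<oplus> \<chi>1 h \<otimes> \<chi>2 g"
      using det_polarized[OF g h(1) False] unfolding \<alpha>h \<delta>h .
    let ?u = "\<alpha> g \<ominus> \<chi>1 g"
    have u: "?u \<in> carrier A" using cl by simp
    have \<alpha>g: "\<alpha> g = \<chi>1 g \<oplus> ?u" using A.add_minus_cancel[OF cl(1,5)] by simp
    have "\<chi>1 g \<oplus> (?u \<oplus> \<delta> g) = \<chi>1 g \<oplus> \<chi>2 g"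
      using trace_eq[OF g] \<alpha>g cl u A.a_assoc[OF cl(5) u cl(3)] by simp
    then have "?u \<oplus> \<delta> g = \<chi>2 g" by (rule A.add.l_cancel) (use cl u in simp_all)
    then have \<delta>g: "\<delta> g = \<chi>2 g \<ominus> ?u" by (rule A.eq_minusI[OF u cl(3)])
    have "(\<chi>1 g \<oplus> ?u) \<otimes> \<chi>2 h \<oplus> \<chi>1 h \<otimes> (\<chi>2 g \<ominus> ?u) = \<chi>1 g \<otimes> \<chi>2 h \<oplus> \<chi>1 h \<otimes> \<chi>2 g"
      using pol unfolding \<alpha>g[symmetric] \<delta>g[symmetric] .
    from A.linear_system[OF cl(5,7) u cl(6,8) this]
    have "(\<chi>2 h \<ominus> \<chi>1 h) \<otimes> ?u = \<zero>" .
    moreover have "\<chi>2 h \<ominus> \<chi>1 h \<in> Units A"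
      by (rule unit_diff[OF cl(8,6)]) (use res_\<chi>[OF h(1)] h(2) in simp)
    ultimately have "?u = \<zero>" using unit_cancel[OF _ u] by blast
    then show ?thesis by (rule A_eqI[OF cl(1,5)])
  qed
  then show "\<alpha> g = \<chi>1 g" "\<delta> g = \<chi>2 g" using \<delta>[OF g] by blast+
qed

end

lemma (in abelian_group) add_interchange:
  assumes "a \<in> carrier G" "b \<in> carrier G" "c \<in> carrier G" "d \<in> carrier G"
  shows "(a \<oplus> b) \<oplus> (c \<oplus> d) = (a \<oplus> c) \<oplus> (b \<oplus> d)"
proof -
  have "b \<oplus> (c \<oplus> d) = c \<oplus> (b \<oplus> d)" using assms by (intro a_lcomm)
  then show ?thesis using assms by (simp add: a_assoc)
qed

lemma carrier_fil_quot_twist: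
  "carrier (fil_quot A n (twist \<chi> M)) = carrier (fil_quot A n M)"
proof -
  have "ideal_smul (ideal_pow A (maxid A) n) (twist \<chi> M) = ideal_smul (ideal_pow A (maxid A) n) M"
    by (rule ideal_smul_cong) simp_all
  then show ?thesis by (simp add: fil_quot_def FactGroup_def RCOSETS_def r_coset_def)
qed

section \<open>Derivations of the universal algebra\<close>

context ext_setup
begin

text \<open>The properties of \<open>\<psi>\<close> that the argument uses. They are stated for an
  arbitrary map because a morphism obtained from universality brings its own, which is identified
  with \<open>\<psi>\<close> in \<open>good_unique\<close>.\<close>

definition good :: "('u \<Rightarrow> 'u) \<Rightarrow> bool" where
  "good f \<longleftrightarrow> coef_hom W R A f \<and> (\<forall>r \<in> J. f r = \<zero>) \<and>
     (\<forall>g \<in> carrier G. f (c1 (\<rho> g)) = \<chi>1 g \<and> f (c2 (\<rho> g)) = \<chi>2 g)"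

lemma good_\<psi>: "good \<psi>"
  using \<psi>(1,2) characters by (simp add: good_def)

lemma goodD:
  assumes "good f"
  shows "coef_hom W R A f" "f \<in> ring_hom R A" "r \<in> J \<Longrightarrow> f r = \<zero>"
    "g \<in> carrier G \<Longrightarrow> f (c1 (\<rho> g)) = \<chi>1 g" "g \<in> carrier G \<Longrightarrow> f (c2 (\<rho> g)) = \<chi>2 g"
    "r \<in> carrier R \<Longrightarrow> f r \<in> carrier A"
    "r \<in> carrier R \<Longrightarrow> s \<in> carrier R \<Longrightarrow> f (r \<oplus>\<^bsub>R\<^esub> s) = f r \<oplus> f s"
    "r \<in> carrier R \<Longrightarrow> s \<in> carrier R \<Longrightarrow> f (r \<otimes>\<^bsub>R\<^esub> s) = f r \<otimes> f s"
    "f \<one>\<^bsub>R\<^esub> = \<one>" "f \<zero>\<^bsub>R\<^esub> = \<zero>"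
proof -
  show h: "f \<in> ring_hom R A" using assms by (simp add: good_def coef_hom_def)
  show "f \<zero>\<^bsub>R\<^esub> = \<zero>" by (rule ring_hom_zero[OF h E.R.ring_axioms A.ring_axioms])
  show "r \<in> carrier R \<Longrightarrow> f r \<in> carrier A" "f \<one>\<^bsub>R\<^esub> = \<one>"
    "r \<in> carrier R \<Longrightarrow> s \<in> carrier R \<Longrightarrow> f (r \<oplus>\<^bsub>R\<^esub> s) = f r \<oplus> f s"
    "r \<in> carrier R \<Longrightarrow> s \<in> carrier R \<Longrightarrow> f (r \<otimes>\<^bsub>R\<^esub> s) = f r \<otimes> f s"
    using h by (auto simp: ring_hom_def)
qed (use assms in \<open>simp_all add: good_def\<close>)

text \<open>The off-diagonal contributions to the diagonal entries lie in \<open>J\<close>, which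
  \<open>f\<close> kills.\<close>

lemma good_mult:
  assumes f: "good f" and x: "x \<in> carrier E" and y: "y \<in> carrier E"
  shows "f (c1 (x \<otimes>\<^bsub>E\<^esub> y)) = f (c1 x) \<otimes> f (c1 y)" "f (c2 (x \<otimes>\<^bsub>E\<^esub> y)) = f (c2 x) \<otimes> f (c2 y)"
proof -
  have "c1 (x \<otimes>\<^bsub>E\<^esub> (e2 \<otimes>\<^bsub>E\<^esub> y)) \<in> J" "c2 (x \<otimes>\<^bsub>E\<^esub> (e1 \<otimes>\<^bsub>E\<^esub> y)) \<in> J"
    using J_incl[OF x y] J_incl[OF y x] c_swap[OF y x] by simp_all
  then have 0: "f (c1 (x \<otimes>\<^bsub>E\<^esub> (e2 \<otimes>\<^bsub>E\<^esub> y))) = \<zero>" "f (c2 (x \<otimes>\<^bsub>E\<^esub> (e1 \<otimes>\<^bsub>E\<^esub> y))) = \<zero>"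
    using goodD(3)[OF f] by simp_all
  show "f (c1 (x \<otimes>\<^bsub>E\<^esub> y)) = f (c1 x) \<otimes> f (c1 y)" "f (c2 (x \<otimes>\<^bsub>E\<^esub> y)) = f (c2 x) \<otimes> f (c2 y)"
    unfolding c_mult[OF x y] using x y 0 by (simp_all add: goodD[OF f])
qed

text \<open>The rule for the upper right entry of an algebra map to triangular matrices: a
  derivation into \<open>M\<close>, on which \<open>E\<close> acts from the left through
  \<open>f \<circ> c1\<close> and from the right through \<open>f \<circ> c2\<close>.\<close>

definition der :: "('u, 'm) module \<Rightarrow> ('u \<Rightarrow> 'u) \<Rightarrow> ('u \<Rightarrow> 'm) \<Rightarrow> bool" where
  "der M f \<beta> \<longleftrightarrow> \<beta> \<in> carrier E \<rightarrow> carrier M \<and>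
     (\<forall>x \<in> carrier E. \<forall>y \<in> carrier E. \<beta> (x \<oplus>\<^bsub>E\<^esub> y) = \<beta> x \<oplus>\<^bsub>M\<^esub> \<beta> y) \<and>
     (\<forall>r \<in> carrier R. \<forall>x \<in> carrier E. \<beta> (r \<odot>\<^bsub>E\<^esub> x) = f r \<odot>\<^bsub>M\<^esub> \<beta> x) \<and>
     (\<forall>x \<in> carrier E. \<forall>y \<in> carrier E.
        \<beta> (x \<otimes>\<^bsub>E\<^esub> y) = f (c1 x) \<odot>\<^bsub>M\<^esub> \<beta> y \<oplus>\<^bsub>M\<^esub> f (c2 y) \<odot>\<^bsub>M\<^esub> \<beta> x)"

lemma derD:
  assumes "der M f \<beta>"
  shows "x \<in> carrier E \<Longrightarrow> \<beta> x \<in> carrier M"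
    "x \<in> carrier E \<Longrightarrow> y \<in> carrier E \<Longrightarrow> \<beta> (x \<oplus>\<^bsub>E\<^esub> y) = \<beta> x \<oplus>\<^bsub>M\<^esub> \<beta> y"
    "r \<in> carrier R \<Longrightarrow> x \<in> carrier E \<Longrightarrow> \<beta> (r \<odot>\<^bsub>E\<^esub> x) = f r \<odot>\<^bsub>M\<^esub> \<beta> x"
    "x \<in> carrier E \<Longrightarrow> y \<in> carrier E \<Longrightarrow>
      \<beta> (x \<otimes>\<^bsub>E\<^esub> y) = f (c1 x) \<odot>\<^bsub>M\<^esub> \<beta> y \<oplus>\<^bsub>M\<^esub> f (c2 y) \<odot>\<^bsub>M\<^esub> \<beta> x"
  using assms by (auto simp: der_def)

lemma der_minus:
  assumes M: "module A M" and \<beta>: "der M f \<beta>" and x: "x \<in> carrier E" "y \<in> carrier E"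
  shows "\<beta> (x \<ominus>\<^bsub>E\<^esub> y) = \<beta> x \<ominus>\<^bsub>M\<^esub> \<beta> y"
proof -
  interpret M: module A M by (rule M)
  have "\<beta> (\<ominus>\<^bsub>E\<^esub> y) = \<ominus>\<^bsub>M\<^esub> \<beta> y"
    by (rule additive_minus[OF E.abelian_group_axioms M.abelian_group_axioms _ _ x(2)]) (use derD[OF \<beta>] in auto)
  then show ?thesis using x derD(2)[OF \<beta> x(1), of "\<ominus>\<^bsub>E\<^esub> y"] by (simp add: a_minus_def)
qed

lemma der_one:
  assumes M: "module A M" and f: "good f" and \<beta>: "der M f \<beta>"
  shows "\<beta> \<one>\<^bsub>E\<^esub> = \<zero>\<^bsub>M\<^esub>"
proof -
  interpret M: module A M by (rule M)
  have c: "\<beta> \<one>\<^bsub>E\<^esub> \<in> carrier M" by (rule derD(1)[OF \<beta>]) simp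
  have "\<beta> \<one>\<^bsub>E\<^esub> = \<beta> \<one>\<^bsub>E\<^esub> \<oplus>\<^bsub>M\<^esub> \<beta> \<one>\<^bsub>E\<^esub>"
    using derD(4)[OF \<beta> Er.one_closed Er.one_closed] c goodD(9)[OF f] by simp
  then show ?thesis using c M.M.add.l_cancel_one[of "\<beta> \<one>\<^bsub>E\<^esub>" "\<beta> \<one>\<^bsub>E\<^esub>"] by simp
qed

lemma good_ideal_pow:
  assumes f: "good f" and r: "r \<in> ideal_pow R (maxid R) n"
  shows "f r \<in> ideal_pow A (maxid A) n"
proof -
  have "f ` maxid R \<subseteq> maxid A" using goodD(1)[OF f] by (simp add: coef_hom_def)
  from ideal_pow_hom[OF E.R.is_cring A goodD(2)[OF f] max_R max this, of n] show ?thesis using r by blast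
qed

lemma E_adic: "adic_module R E"
  by (rule adic_module.intro[OF E.module_axioms]) (simp add: adic_module_axioms_def max_R)

text \<open>A local homomorphism maps powers of the maximal ideal into powers of the maximal ideal,
  so maps semilinear over it respect the filtrations.\<close>

lemma semilinear_fil:
  assumes f: "good f" and N: "module A N" and \<theta>: "\<And>x. x \<in> carrier E \<Longrightarrow> \<theta> x \<in> carrier N"
    "\<And>x y. x \<in> carrier E \<Longrightarrow> y \<in> carrier E \<Longrightarrow> \<theta> (x \<oplus>\<^bsub>E\<^esub> y) = \<theta> x \<oplus>\<^bsub>N\<^esub> \<theta> y"
    "\<And>r x. r \<in> carrier R \<Longrightarrow> x \<in> carrier E \<Longrightarrow> \<theta> (r \<odot>\<^bsub>E\<^esub> x) = f r \<odot>\<^bsub>N\<^esub> \<theta> x"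
    and x: "x \<in> ideal_smul (ideal_pow R (maxid R) n) E"
  shows "\<theta> x \<in> ideal_smul (ideal_pow A (maxid A) n) N"
proof -
  interpret Ea: adic_module R E by (rule E_adic)
  interpret N: adic_module A N by (rule adic_moduleI[OF N])
  show ?thesis
  proof (rule E.ideal_smul_image[OF N N.ideal_pow_carrier _ \<theta>(2) _ x Ea.ideal_pow_carrier])
    show "\<theta> \<in> carrier E \<rightarrow> carrier N" using \<theta>(1) by blast
    fix a y assume a: "a \<in> ideal_pow R (maxid R) n" "y \<in> carrier E"
    then have "\<theta> (a \<odot>\<^bsub>E\<^esub> y) = f a \<odot>\<^bsub>N\<^esub> \<theta> y" using \<theta>(3) Ea.ideal_pow_carrier by blast
    then show "\<theta> (a \<odot>\<^bsub>E\<^esub> y) \<in> ideal_smul (ideal_pow A (maxid A) n) N"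
      using N.ideal_smul_incl[OF good_ideal_pow[OF f a(1)] \<theta>(1)[OF a(2)]] by simp
  qed
qed

text \<open>On group elements the derivation rule becomes the cocycle rule, since \<open>f\<close>
  sends the diagonal entries to the characters. Continuity is that of \<open>\<rho>\<close>, as
  \<open>\<beta>\<close> respects the filtrations.\<close>

lemma der_cocycle:
  assumes M: "module A M" and f: "good f" and \<beta>: "der M f \<beta>"
  shows "cocycle M (\<lambda>g. \<beta> (\<rho> g))"
  unfolding cocycle_def
proof (intro conjI ballI)
  interpret Ea: adic_module R E by (rule E_adic)
  interpret M: adic_module A M by (rule adic_moduleI[OF M])
  fix g h assume g: "g \<in> carrier G"
  show "\<beta> (\<rho> g) \<in> carrier M" using derD(1)[OF \<beta>] g by simp
  assume h: "h \<in> carrier G"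
  show "\<beta> (\<rho> (g \<otimes>\<^bsub>G\<^esub> h)) = \<chi>1 g \<odot>\<^bsub>M\<^esub> \<beta> (\<rho> h) \<oplus>\<^bsub>M\<^esub> \<chi>2 h \<odot>\<^bsub>M\<^esub> \<beta> (\<rho> g)"
    using derD(4)[OF \<beta>] g h by (simp add: \<rho>_mult goodD[OF f])
next
  interpret Ea: adic_module R E by (rule E_adic)
  interpret M: adic_module A M by (rule adic_moduleI[OF M])
  have \<rho>: "continuous_map T (adic R E) \<rho>" using E_CH by (simp add: CH_rep_def)
  show "continuous_map T (adic A M) (\<lambda>g. \<beta> (\<rho> g))"
    unfolding M.continuous_map_adic
  proof (intro conjI ballI allI)
    show "(\<lambda>g. \<beta> (\<rho> g)) \<in> topspace T \<rightarrow> carrier M" using derD(1)[OF \<beta>] by (simp add: top)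
    fix t n assume t: "t \<in> topspace T"
    then obtain U where U: "openin T U" "t \<in> U" "\<And>u. u \<in> U \<Longrightarrow> \<rho> u \<ominus>\<^bsub>E\<^esub> \<rho> t \<in> Ea.fil n"
      using \<rho> unfolding Ea.continuous_map_adic by meson
    have "\<beta> (\<rho> u) \<ominus>\<^bsub>M\<^esub> \<beta> (\<rho> t) \<in> M.fil n" if "u \<in> U" for u
    proof -
      have u: "u \<in> carrier G" "t \<in> carrier G" using openin_subset[OF U(1)] that U(2) by (auto simp: top)
      have "\<beta> (\<rho> u \<ominus>\<^bsub>E\<^esub> \<rho> t) \<in> M.fil n"
        by (rule semilinear_fil[OF f M _ _ _ U(3)[OF that]]) (simp_all add: derD[OF \<beta>])
      then show ?thesis using der_minus[OF M \<beta>] u by simp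
    qed
    then show "\<exists>U. openin T U \<and> t \<in> U \<and> (\<forall>u \<in> U. \<beta> (\<rho> u) \<ominus>\<^bsub>M\<^esub> \<beta> (\<rho> t) \<in> M.fil n)" using U by blast
  qed
qed

abbreviation "EV \<equiv> with_action E (\<lambda>g x. \<rho> g \<otimes>\<^bsub>E\<^esub> x)"

lemma EV_lin_action: "lin_action G R EV"
proof -
  have "module R EV" by (rule module_cong[OF E.module_axioms]) simp_all
  then have "adic_module R EV" by (rule adic_module.intro) (simp add: adic_module_axioms_def max_R)
  moreover have "act EV g \<in> mod_hom R EV EV" if "g \<in> carrier G" for g
    by (rule mod_homI) (use that in \<open>simp_all add: Er.r_distr\<close>)
  ultimately show ?thesis
    unfolding lin_action_def by (simp add: \<rho>_one \<rho>_mult Er.m_assoc)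
qed

text \<open>Finiteness of the quotients of \<open>A\<close> is read off from the fact that
  \<open>A\<close> twisted by \<open>\<chi>2\<close> satisfies the condition. It spreads to
  \<open>M\<close> by finite generation and then to the product.\<close>

lemma VE_fil_quot_finite:
  assumes fg: "fg_module A M" and b: "cocycle M b" and i: "i \<ge> 1"
  shows "finite (carrier (fil_quot A i (VE M b)))"
proof -
  have M: "module A M" using fg by (simp add: fg_module_def)
  interpret M: adic_module A M by (rule adic_moduleI[OF M])
  interpret S: adic_module A "self_module A" by (rule self_adic)
  interpret V: adic_module A "VE M b" by (rule adic_moduleI[OF VE_module[OF M]])
  have "in_class G C (fil_quot A i V1) (\<lambda>g c. act V1 g ` c)" using sat(2) i unfolding satisfies_iff by blast
  from in_class_finite[OF this] have S: "finite (carrier (fil_quot A i (self_module A)))" by (simp add: carrier_fil_quot_twist)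
  have Mf: "finite (carrier (fil_quot A i M))" by (rule fg_module_finite_quot[OF fg max S])
  have 1: "(\<lambda>m. (m, \<zero>)) \<in> mod_hom A M (VE M b)" and 2: "(\<lambda>x. (\<zero>\<^bsub>M\<^esub>, x)) \<in> mod_hom A (self_module A) (VE M b)"
    by (rule mod_homI; simp)+
  have "\<exists>\<theta> \<in> hom (fil_quot A i M) (fil_quot A i (VE M b)). \<forall>x \<in> carrier M. \<theta> (fil_coset A i M x) = fil_coset A i (VE M b) (x, \<zero>)"
    by (rule M.fil_quot_map[OF V.adic_module_axioms mod_homD(1)[OF 1] mod_homD(2)[OF 1] mod_hom_fil[OF M.adic_module_axioms V.adic_module_axioms 1]])
  then obtain \<theta>1 where \<theta>1: "\<And>x. x \<in> carrier M \<Longrightarrow> \<theta>1 (fil_coset A i M x) = fil_coset A i (VE M b) (x, \<zero>)" by blast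
  have "\<exists>\<theta> \<in> hom (fil_quot A i (self_module A)) (fil_quot A i (VE M b)).
      \<forall>x \<in> carrier (self_module A). \<theta> (fil_coset A i (self_module A) x) = fil_coset A i (VE M b) (\<zero>\<^bsub>M\<^esub>, x)"
    by (rule S.fil_quot_map[OF V.adic_module_axioms mod_homD(1)[OF 2] mod_homD(2)[OF 2] mod_hom_fil[OF S.adic_module_axioms V.adic_module_axioms 2]])
  then obtain \<theta>2 where \<theta>2: "\<And>x. x \<in> carrier A \<Longrightarrow> \<theta>2 (fil_coset A i (self_module A) x) = fil_coset A i (VE M b) (\<zero>\<^bsub>M\<^esub>, x)"
    by auto
  let ?Q = "fil_quot A i (VE M b)"
  have "carrier ?Q \<subseteq> (\<lambda>(s, t). \<theta>1 s \<otimes>\<^bsub>?Q\<^esub> \<theta>2 t) ` (carrier (fil_quot A i M) \<times> carrier (fil_quot A i (self_module A)))"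
  proof
    fix c assume "c \<in> carrier ?Q"
    then obtain m x where c: "m \<in> carrier M" "x \<in> carrier A" "c = fil_coset A i (VE M b) (m, x)"
      unfolding V.carrier_fil_quot by auto
    then have "c = \<theta>1 (fil_coset A i M m) \<otimes>\<^bsub>?Q\<^esub> \<theta>2 (fil_coset A i (self_module A) x)"
      by (simp add: \<theta>1 \<theta>2 V.fil_coset_add)
    then show "c \<in> (\<lambda>(s, t). \<theta>1 s \<otimes>\<^bsub>?Q\<^esub> \<theta>2 t) ` (carrier (fil_quot A i M) \<times> carrier (fil_quot A i (self_module A)))"
      using c by (intro rev_image_eqI[of "(fil_coset A i M m, fil_coset A i (self_module A) x)"]) simp_all
  qed
  then show ?thesis by (rule finite_subset) (intro finite_imageI finite_cartesian_product Mf S)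
qed

text \<open>Every vector of the extension lies in the image of the universal algebra under an equivariant
  map, so the condition passes from the universal algebra to the extension.\<close>

lemma der_satisfies:
  assumes fg: "fg_module A M" and f: "good f" and \<beta>: "der M f \<beta>"
  shows "satisfies G C A (VE M (\<lambda>g. \<beta> (\<rho> g)))"
proof -
  have M: "module A M" using fg by (simp add: fg_module_def)
  interpret M: module A M by (rule M)
  let ?b = "\<lambda>g. \<beta> (\<rho> g)"
  have b: "cocycle M ?b" by (rule der_cocycle[OF M f \<beta>])
  have lin: "lin_action G A (VE M ?b)" by (rule AG_module_lin_action[OF VE_AG_module[OF M b] max])
  note fD = goodD[OF f] and \<beta>D = derD[OF \<beta>]
  show ?thesis
  proof (rule satisfies_cover[OF lin VE_fil_quot_finite[OF fg b]])
    fix i :: nat and w assume i: "i \<ge> 1" and w: "w \<in> carrier (VE M ?b)"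
    obtain m x where w: "w = (m, x)" "m \<in> carrier M" "x \<in> carrier A" using w by auto
    \<comment> \<open>The triangular matrix attached to \<open>e\<close> applied to the vector
      \<open>w\<close>: equivariant for left multiplication on \<open>E\<close>, with value
      \<open>w\<close> at the identity.\<close>
    define \<theta> where "\<theta> e = (f (c1 e) \<odot>\<^bsub>M\<^esub> m \<oplus>\<^bsub>M\<^esub> x \<odot>\<^bsub>M\<^esub> \<beta> e, f (c2 e) \<otimes> x)" for e
    have cl: "f (c1 e) \<in> carrier A" "f (c2 e) \<in> carrier A" "\<beta> e \<in> carrier M" if "e \<in> carrier E" for e
      using that by (simp_all add: fD \<beta>D)
    have t1: "\<theta> e \<in> carrier (VE M ?b)" if "e \<in> carrier E" for e using cl[OF that] w by (simp add: \<theta>_def)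
    have t2: "\<theta> (e \<oplus>\<^bsub>E\<^esub> e') = \<theta> e \<oplus>\<^bsub>VE M ?b\<^esub> \<theta> e'" if "e \<in> carrier E" "e' \<in> carrier E" for e e'
    proof -
      have s: "x \<odot>\<^bsub>M\<^esub> (\<beta> e \<oplus>\<^bsub>M\<^esub> \<beta> e') = x \<odot>\<^bsub>M\<^esub> \<beta> e \<oplus>\<^bsub>M\<^esub> x \<odot>\<^bsub>M\<^esub> \<beta> e'"
        "(f (c1 e) \<oplus> f (c1 e')) \<odot>\<^bsub>M\<^esub> m = f (c1 e) \<odot>\<^bsub>M\<^esub> m \<oplus>\<^bsub>M\<^esub> f (c1 e') \<odot>\<^bsub>M\<^esub> m"
        using cl[OF that(1)] cl[OF that(2)] w by (simp_all add: M.smult_r_distr M.smult_l_distr)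
      have sw: "(f (c1 e) \<odot>\<^bsub>M\<^esub> m \<oplus>\<^bsub>M\<^esub> f (c1 e') \<odot>\<^bsub>M\<^esub> m) \<oplus>\<^bsub>M\<^esub> (x \<odot>\<^bsub>M\<^esub> \<beta> e \<oplus>\<^bsub>M\<^esub> x \<odot>\<^bsub>M\<^esub> \<beta> e') =
          (f (c1 e) \<odot>\<^bsub>M\<^esub> m \<oplus>\<^bsub>M\<^esub> x \<odot>\<^bsub>M\<^esub> \<beta> e) \<oplus>\<^bsub>M\<^esub> (f (c1 e') \<odot>\<^bsub>M\<^esub> m \<oplus>\<^bsub>M\<^esub> x \<odot>\<^bsub>M\<^esub> \<beta> e')"
        by (rule M.M.add_interchange) (use cl[OF that(1)] cl[OF that(2)] w in simp_all)
      show ?thesis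
        unfolding \<theta>_def c_add[OF that] \<beta>D(2)[OF that] fD(7)[OF c_closed(1)[OF that(1)] c_closed(1)[OF that(2)]]
          fD(7)[OF c_closed(2)[OF that(1)] c_closed(2)[OF that(2)]] s sw
        using cl[OF that(1)] cl[OF that(2)] w by (simp add: A.l_distr)
    qed
    have t3: "\<theta> (r \<odot>\<^bsub>E\<^esub> e) = f r \<odot>\<^bsub>VE M ?b\<^esub> \<theta> e" if "r \<in> carrier R" "e \<in> carrier E" for r e
    proof -
      have r: "f r \<in> carrier A" using that by (simp add: fD)
      have "x \<odot>\<^bsub>M\<^esub> (f r \<odot>\<^bsub>M\<^esub> \<beta> e) = f r \<odot>\<^bsub>M\<^esub> (x \<odot>\<^bsub>M\<^esub> \<beta> e)"
        using cl[OF that(2)] w r by (simp add: M.smult_assoc1[symmetric] A.m_comm)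
      then show ?thesis
        using cl[OF that(2)] w that r by (simp add: \<theta>_def c_smult fD \<beta>D M.smult_assoc1 M.smult_r_distr A.m_assoc)
    qed
    have t4: "\<theta> (\<rho> g \<otimes>\<^bsub>E\<^esub> e) = act (VE M ?b) g (\<theta> e)" if "g \<in> carrier G" "e \<in> carrier E" for g e
    proof -
      have g: "\<rho> g \<in> carrier E" "\<beta> (\<rho> g) \<in> carrier M" "\<chi>1 g \<in> carrier A" "\<chi>2 g \<in> carrier A"
        using that by (simp_all add: \<beta>D)
      note c = cl[OF that(2)]
      have "x \<odot>\<^bsub>M\<^esub> \<beta> (\<rho> g \<otimes>\<^bsub>E\<^esub> e) = \<chi>1 g \<odot>\<^bsub>M\<^esub> (x \<odot>\<^bsub>M\<^esub> \<beta> e) \<oplus>\<^bsub>M\<^esub> (f (c2 e) \<otimes> x) \<odot>\<^bsub>M\<^esub> \<beta> (\<rho> g)"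
        using c g w that by (simp add: \<beta>D(4) fD M.smult_r_distr M.smult_assoc1[symmetric] A.m_comm)
      moreover have "f (c1 (\<rho> g \<otimes>\<^bsub>E\<^esub> e)) = \<chi>1 g \<otimes> f (c1 e)" "f (c2 (\<rho> g \<otimes>\<^bsub>E\<^esub> e)) = \<chi>2 g \<otimes> f (c2 e)"
        using good_mult[OF f g(1) that(2)] that(1) by (simp_all add: fD)
      ultimately show ?thesis
        using c g w by (simp add: \<theta>_def M.smult_assoc1 M.smult_r_distr A.m_assoc M.M.a_assoc)
    qed
    have "sub_class (fil_quot A i (VE M ?b)) (\<lambda>g c. act (VE M ?b) g ` c) ((\<lambda>e. fil_coset A i (VE M ?b) (\<theta> e)) ` carrier EV)"
    proof (rule image_sub_class[OF EV_lin_action E_sat lin i])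
      fix e assume "e \<in> ideal_smul (ideal_pow R (maxid R) i) EV"
      then have "e \<in> ideal_smul (ideal_pow R (maxid R) i) E"
        using ideal_smul_cong[of EV E "ideal_pow R (maxid R) i"] by simp
      then show "\<theta> e \<in> ideal_smul (ideal_pow A (maxid A) i) (VE M ?b)"
        by (rule semilinear_fil[OF f VE_module[OF M] t1 t2 t3, rotated -1])
    qed (use t1 t2 t4 in simp_all)
    moreover have "\<theta> \<one>\<^bsub>E\<^esub> = w" using w der_one[OF M f \<beta>] by (simp add: \<theta>_def fD)
    then have "fil_coset A i (VE M ?b) w \<in> (\<lambda>e. fil_coset A i (VE M ?b) (\<theta> e)) ` carrier EV"
      by (intro rev_image_eqI[of "\<one>\<^bsub>E\<^esub>"]) simp_all
    ultimately show "\<exists>H. sub_class (fil_quot A i (VE M ?b)) (\<lambda>g c. act (VE M ?b) g ` c) H \<and> fil_coset A i (VE M ?b) w \<in> H"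
      by blast
  qed
qed

lemma universal_morphism:
  fixes E' :: "('u, 'u) module" and D' :: "('u, 'u, 'u) law"
  assumes "CH_rep_satisfying G T C F W red \<chi>b1 \<chi>b2 A E' \<rho>' D'"
  obtains f h where "CH_morphism G W R E \<rho> D A E' \<rho>' D' f h"
    "\<And>f' h' r. CH_morphism G W R E \<rho> D A E' \<rho>' D' f' h' \<Longrightarrow> r \<in> carrier R \<Longrightarrow> f' r = f r"
    "\<And>f' h' x. CH_morphism G W R E \<rho> D A E' \<rho>' D' f' h' \<Longrightarrow> x \<in> carrier E \<Longrightarrow> h' x = h x"
proof -
  note univ[unfolded universal_CH_rep_def, THEN conjunct2, THEN spec, THEN spec, THEN spec, THEN spec, THEN mp, OF assms]
  then obtain f h where m: "CH_morphism G W R E \<rho> D A E' \<rho>' D' f h"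
    and u: "\<forall>f' h'. CH_morphism G W R E \<rho> D A E' \<rho>' D' f' h' \<longrightarrow> (\<forall>r \<in> carrier R. f' r = f r) \<and> (\<forall>x \<in> carrier E. h' x = h x)"
    by (elim exE conjE)
  show thesis
  proof (rule that[OF m])
    fix f' h' assume f': "CH_morphism G W R E \<rho> D A E' \<rho>' D' f' h'"
    note u[THEN spec, THEN spec, THEN mp, OF f']
    then show "r \<in> carrier R \<Longrightarrow> f' r = f r" "x \<in> carrier E \<Longrightarrow> h' x = h x" for r x by simp_all
  qed
qed

section \<open>Morphisms from the universal algebra to triangular algebras\<close>

context
  fixes M :: "('u, 'm) module" and enc :: "'u \<times> 'm \<times> 'u \<Rightarrow> 'u"
  assumes fg: "fg_module A M" and enc: "inj_on enc (carrier A \<times> carrier M \<times> carrier A)"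
begin

lemma M_triangular: "triangular A M enc"
  using fg enc by (simp add: fg_module_def triangular_def triangular_axioms_def)

interpretation X: triangular A M enc by (rule M_triangular)

lemma tri_satisfying:
  assumes b: "cocycle M b" and s: "satisfies G C A (VE M b)"
  shows "CH_rep_satisfying G T C F W red \<chi>b1 \<chi>b2 A X.E (\<lambda>g. enc (\<chi>1 g, b g, \<chi>2 g)) X.tri_law"
proof -
  interpret Y: triangular_rep A G T \<chi>2 \<chi>1 M enc b
    by (intro triangular_rep.intro char_pair_axioms M_triangular triangular_rep_axioms.intro b)
  have rep: "(\<lambda>g. enc (\<chi>1 g, b g, \<chi>2 g)) = Y.tri_rep" by (simp add: fun_eq_iff Y.tri_rep_def)
  have 1: "CH_rep G T A X.E Y.tri_rep X.tri_law" by (rule Y.tri_CH_rep[OF fg])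
  have 2: "specializes_to_sum G A X.E Y.tri_rep X.tri_law F (res A) \<chi>b1 \<chi>b2"
    by (rule Y.tri_specializes[OF res_A]) (simp_all add: res_\<chi>)
  have 3: "satisfies G C A (with_action X.E (\<lambda>g x. Y.tri_rep g \<otimes>\<^bsub>X.E\<^esub> x))"
    by (rule Y.EG_satisfies[OF stable_class_axioms sat(1) s])
  show ?thesis unfolding CH_rep_satisfying_def rep using A_coef 1 2 3 by blast
qed

text \<open>\<open>f\<close> kills \<open>J\<close>, so over \<open>B\<close> the law
  \<open>D\<close> is the product of the diagonal entries, and these are the two projections of the
  triangular image.\<close>

lemma tri_morphism_det:
  assumes f: "good f" and \<beta>: "der M f \<beta>" and B: "comm_alg A B k"
    and x: "x \<in> carrier (base_change R E B (\<lambda>a. k (f a)))"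
  shows "X.tri_law B k (base_change_map A X.E B k (\<lambda>x. enc (f (c1 x), \<beta> x, f (c2 x))) (\<lambda>b. b) x) =
    D B (\<lambda>a. k (f a)) x"
proof -
  let ?h = "\<lambda>x. enc (f (c1 x), \<beta> x, f (c2 x))" and ?k = "\<lambda>a. k (f a)"
  note fD = goodD[OF f] and \<beta>D = derD[OF \<beta>]
  have kh: "k \<in> ring_hom A B" and Bc: "cring B" using B by (simp_all add: comm_alg_def)
  have BR: "comm_alg R B ?k"
    using ring_hom_trans[OF fD(2) kh] Bc by (simp add: comm_alg_def comp_def)
  interpret B: cring B by (rule Bc)
  interpret Z: algebra_ext R E B ?k by (rule ext_alg[OF BR])
  have T: "scalar_ext A X.E B k" by (rule algebra_ext.axioms(1)[OF X.ext_alg[OF B]])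
  let ?bc = "base_change_map A X.E B k ?h (\<lambda>b. b)" and ?EB = "base_change A X.E B k"
  have h: "?h x \<in> carrier X.E" "X.pa (?h x) = f (c1 x)" "X.pd (?h x) = f (c2 x)" if "x \<in> carrier E" for x
    using that by (simp_all add: fD \<beta>D)
  have h_add: "?h (x \<oplus>\<^bsub>E\<^esub> y) = ?h x \<oplus>\<^bsub>X.E\<^esub> ?h y" if "x \<in> carrier E" "y \<in> carrier E" for x y
    using that by (simp add: fD \<beta>D c_add)
  have h_smult: "?h (r \<odot>\<^bsub>E\<^esub> x) = f r \<odot>\<^bsub>X.E\<^esub> ?h x" if "r \<in> carrier R" "x \<in> carrier E" for r x
    using that by (simp add: fD \<beta>D c_smult)
  have bc1: "?bc c \<in> carrier ?EB" if "c \<in> carrier Z.MB" for c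
    by (rule Z.base_change_map_hom(1)[OF T, where \<eta> = f]) (use that h h_add h_smult fD(6) in \<open>simp_all add: ring_hom_def\<close>)
  have bc2: "?bc (c \<oplus>\<^bsub>Z.MB\<^esub> d) = ?bc c \<oplus>\<^bsub>?EB\<^esub> ?bc d" if "c \<in> carrier Z.MB" "d \<in> carrier Z.MB" for c d
    by (rule Z.base_change_map_hom(2)[OF T, where \<eta> = f]) (use that h h_add h_smult fD(6) in \<open>simp_all add: ring_hom_def\<close>)
  have bc3: "?bc (Z.pu x b) = pure A X.E B k (?h x) b" if "x \<in> carrier E" "b \<in> carrier B" for x b
    by (rule Z.base_change_map_hom(3)[OF T, where \<eta> = f]) (use that h h_add h_smult fD(6) in \<open>simp_all add: ring_hom_def\<close>)
  note pj = X.tri_proj[OF B]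
  have pc: "X.tri_proj pr B k (?bc c) \<in> carrier B" if "c \<in> carrier Z.MB" "pr = X.pa \<or> pr = X.pd" for c pr
    using ring_hom_closed[OF pj(1)[OF that(2)] bc1[OF that(1)]] .
  have pure_case: "?bc (Z.pu x b) \<in> carrier ?EB"
    "X.tri_proj X.pa B k (?bc (Z.pu x b)) = ?k (c1 x) \<otimes>\<^bsub>B\<^esub> b"
    "X.tri_proj X.pd B k (?bc (Z.pu x b)) = ?k (c2 x) \<otimes>\<^bsub>B\<^esub> b" if xb: "x \<in> carrier E" "b \<in> carrier B" for x b
  proof -
    show "?bc (Z.pu x b) \<in> carrier ?EB" by (rule bc1[OF Z.pure_closed[OF xb]])
    show "X.tri_proj X.pa B k (?bc (Z.pu x b)) = ?k (c1 x) \<otimes>\<^bsub>B\<^esub> b"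
      unfolding bc3[OF xb] using pj(3)[of X.pa "?h x" b] h[OF xb(1)] xb by simp
    show "X.tri_proj X.pd B k (?bc (Z.pu x b)) = ?k (c2 x) \<otimes>\<^bsub>B\<^esub> b"
      unfolding bc3[OF xb] using pj(3)[of X.pd "?h x" b] h[OF xb(1)] xb by simp
  qed
  let ?d1 = "Z.pu e1 \<one>\<^bsub>B\<^esub>" and ?d2 = "Z.pu e2 \<one>\<^bsub>B\<^esub>"
  have P: "?d1 \<otimes>\<^bsub>Z.MB\<^esub> Z.pu x b \<otimes>\<^bsub>Z.MB\<^esub> ?d1 = (?k (c1 x) \<otimes>\<^bsub>B\<^esub> b) \<odot>\<^bsub>Z.MB\<^esub> ?d1 \<and>
      ?d2 \<otimes>\<^bsub>Z.MB\<^esub> Z.pu x b \<otimes>\<^bsub>Z.MB\<^esub> ?d2 = (?k (c2 x) \<otimes>\<^bsub>B\<^esub> b) \<odot>\<^bsub>Z.MB\<^esub> ?d2" if xb: "x \<in> carrier E" "b \<in> carrier B" for x b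
  proof -
    have "?k (c1 x) \<in> carrier B" "?k (c2 x) \<in> carrier B" using xb Z.k_closed by simp_all
    then show ?thesis
      using xb Z.pure_balanced[of "c1 x" e1 b] Z.pure_balanced[of "c2 x" e2 b] by (simp add: c1 c2)
  qed
  \<comment> \<open>Both sides are additive, so the identification of corners with projections is
    checked on pure tensors.\<close>
  have key: "?d1 \<otimes>\<^bsub>Z.MB\<^esub> c \<otimes>\<^bsub>Z.MB\<^esub> ?d1 = X.tri_proj X.pa B k (?bc c) \<odot>\<^bsub>Z.MB\<^esub> ?d1 \<and>
      ?d2 \<otimes>\<^bsub>Z.MB\<^esub> c \<otimes>\<^bsub>Z.MB\<^esub> ?d2 = X.tri_proj X.pd B k (?bc c) \<odot>\<^bsub>Z.MB\<^esub> ?d2" if "c \<in> carrier Z.MB" for c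
    using that
  proof (induction rule: Z.pure_induct)
    case (pure x b)
    then show ?case using P pure_case by presburger
  next
    case zero
    \<comment> \<open>Zero is written as a pure tensor, to which the case already settled
      applies.\<close>
    have z: "\<zero>\<^bsub>Z.MB\<^esub> = Z.pu \<zero>\<^bsub>E\<^esub> \<zero>\<^bsub>B\<^esub>" by simp
    show ?case unfolding z using P[OF E.M.zero_closed B.zero_closed] pure_case[OF E.M.zero_closed B.zero_closed] by presburger
  next
    case (add c d)
    have d: "?d1 \<in> carrier Z.MB" "?d2 \<in> carrier Z.MB" by simp_all
    have tp: "X.tri_proj pr B k (?bc (c \<oplus>\<^bsub>Z.MB\<^esub> d)) = X.tri_proj pr B k (?bc c) \<oplus>\<^bsub>B\<^esub> X.tri_proj pr B k (?bc d)"
      if "pr = X.pa \<or> pr = X.pd" for pr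
      unfolding bc2[OF add.hyps(1,2)] by (rule ring_hom_add[OF pj(1)[OF that] bc1[OF add.hyps(1)] bc1[OF add.hyps(2)]])
    have pcs: "X.tri_proj X.pa B k (?bc c) \<in> carrier B" "X.tri_proj X.pa B k (?bc d) \<in> carrier B"
      "X.tri_proj X.pd B k (?bc c) \<in> carrier B" "X.tri_proj X.pd B k (?bc d) \<in> carrier B"
      by (intro pc add.hyps; blast)+
    show ?case unfolding tp[OF disjI1[OF refl]] tp[OF disjI2[OF refl]]
        Z.MB.smult_l_distr[OF pcs(1,2) d(1)] Z.MB.smult_l_distr[OF pcs(3,4) d(2)]
        add.IH(1)[THEN conjunct1, symmetric] add.IH(1)[THEN conjunct2, symmetric]
        add.IH(2)[THEN conjunct1, symmetric] add.IH(2)[THEN conjunct2, symmetric]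
      using d add.hyps by (simp only: Z.MB.l_distr Z.MB.r_distr Z.MB.m_closed simp_thms)
  qed
  have kill: "?k r = \<zero>\<^bsub>B\<^esub>" if "r \<in> J" for r
    using fD(3)[OF that] ring_hom_zero[OF kh A.ring_axioms B.ring_axioms] by simp
  have "D B ?k x = X.tri_proj X.pa B k (?bc x) \<otimes>\<^bsub>B\<^esub> X.tri_proj X.pd B k (?bc x)"
    by (rule D_split[OF BR kill x pc[OF x disjI1[OF refl]] pc[OF x disjI2[OF refl]]]) (use key[OF x] in blast)+
  then show ?thesis by (simp add: X.tri_law_def)
qed

lemma tri_morphism:
  assumes f: "good f" and \<beta>: "der M f \<beta>" and b: "\<And>g. g \<in> carrier G \<Longrightarrow> \<beta> (\<rho> g) = b g"
  shows "CH_morphism G W R E \<rho> D A X.E (\<lambda>g. enc (\<chi>1 g, b g, \<chi>2 g)) X.tri_law f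
    (\<lambda>x. enc (f (c1 x), \<beta> x, f (c2 x)))"
  unfolding CH_morphism_def
proof (intro conjI ballI allI impI)
  note fD = goodD[OF f] and \<beta>D = derD[OF \<beta>]
  have M: "module A M" using fg by (simp add: fg_module_def)
  show "coef_hom W R A f" by (rule fD(1))
  show "(\<lambda>x. enc (f (c1 x), \<beta> x, f (c2 x))) \<in> ring_hom E X.E"
    by (rule ring_hom_memI)
      (simp_all add: fD \<beta>D c_add good_mult[OF f] der_one[OF M f \<beta>] X.E_simps(3))
  show "enc (f (c1 (r \<odot>\<^bsub>E\<^esub> x)), \<beta> (r \<odot>\<^bsub>E\<^esub> x), f (c2 (r \<odot>\<^bsub>E\<^esub> x))) = f r \<odot>\<^bsub>X.E\<^esub> enc (f (c1 x), \<beta> x, f (c2 x))"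
    if "r \<in> carrier R" "x \<in> carrier E" for r x
    using that by (simp add: fD \<beta>D c_smult)
  show "enc (f (c1 (\<rho> g)), \<beta> (\<rho> g), f (c2 (\<rho> g))) = enc (\<chi>1 g, b g, \<chi>2 g)" if "g \<in> carrier G" for g
    using that by (simp add: fD b)
  show "X.tri_law B k (base_change_map A X.E B k (\<lambda>x. enc (f (c1 x), \<beta> x, f (c2 x))) (\<lambda>b. b) x) = D B (\<lambda>a. k (f a)) x"
    if "comm_alg A B k" "x \<in> carrier (base_change R E B (\<lambda>a. k (f a)))" for B k x
    by (rule tri_morphism_det[OF f \<beta> that])
qed

text \<open>Two derivations with the same values on the group define morphisms to one triangular
  representation, which satisfies the condition by \<open>der_satisfies\<close>. Universality makes
  the morphisms equal, and with them their base maps and upper right entries.\<close>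

lemma der_unique:
  assumes f: "good f" "der M f \<beta>" and f': "good f'" "der M f' \<beta>'"
    and eq: "\<And>g. g \<in> carrier G \<Longrightarrow> \<beta> (\<rho> g) = \<beta>' (\<rho> g)"
  shows "r \<in> carrier R \<Longrightarrow> f r = f' r" "x \<in> carrier E \<Longrightarrow> \<beta> x = \<beta>' x"
proof -
  have M: "module A M" using fg by (simp add: fg_module_def)
  let ?b = "\<lambda>g. \<beta> (\<rho> g)" and ?h = "\<lambda>f \<beta> x. enc (f (c1 x), \<beta> x, f (c2 x))"
  have "CH_rep_satisfying G T C F W red \<chi>b1 \<chi>b2 A X.E (\<lambda>g. enc (\<chi>1 g, ?b g, \<chi>2 g)) X.tri_law"
    by (rule tri_satisfying[OF der_cocycle[OF M f] der_satisfies[OF fg f]])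
  then obtain f0 h0 where "CH_morphism G W R E \<rho> D A X.E (\<lambda>g. enc (\<chi>1 g, ?b g, \<chi>2 g)) X.tri_law f0 h0"
    and u: "\<And>f' h' r. CH_morphism G W R E \<rho> D A X.E (\<lambda>g. enc (\<chi>1 g, ?b g, \<chi>2 g)) X.tri_law f' h' \<Longrightarrow> r \<in> carrier R \<Longrightarrow> f' r = f0 r"
    "\<And>f' h' x. CH_morphism G W R E \<rho> D A X.E (\<lambda>g. enc (\<chi>1 g, ?b g, \<chi>2 g)) X.tri_law f' h' \<Longrightarrow> x \<in> carrier E \<Longrightarrow> h' x = h0 x"
    by (rule universal_morphism) (rule that)
  note m1 = tri_morphism[OF f refl] and m2 = tri_morphism[OF f' eq[symmetric]]
  show "r \<in> carrier R \<Longrightarrow> f r = f' r" using u(1)[OF m1] u(1)[OF m2] by simp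
  assume x: "x \<in> carrier E"
  have "?h f \<beta> x = ?h f' \<beta>' x" using u(2)[OF m1 x] u(2)[OF m2 x] by simp
  then have "X.pm (?h f \<beta> x) = X.pm (?h f' \<beta>' x)" by (rule arg_cong)
  then show "\<beta> x = \<beta>' x" using x derD(1)[OF f(2)] derD(1)[OF f'(2)] by (simp add: goodD[OF f(1)] goodD[OF f'(1)])
qed

text \<open>The zero derivation exists along every good map, so two good maps give morphisms to the
  same triangular representation, the one with zero cocycle.\<close>

lemma good_unique:
  assumes f: "good f" and r: "r \<in> carrier R"
  shows "f r = \<psi> r"
proof (rule der_unique(1)[OF f _ good_\<psi>])
  interpret M: module A M using fg by (simp add: fg_module_def)
  show "der M f (\<lambda>x. \<zero>\<^bsub>M\<^esub>)" "der M \<psi> (\<lambda>x. \<zero>\<^bsub>M\<^esub>)"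
    by (simp_all add: der_def goodD[OF f] goodD[OF good_\<psi>])
qed (use r in simp_all)

end

section \<open>Inner derivations and normalization\<close>

lemma der_add:
  assumes M: "module A M" and f: "good f" and \<beta>: "der M f \<beta>" and \<gamma>: "der M f \<gamma>"
  shows "der M f (\<lambda>x. \<beta> x \<oplus>\<^bsub>M\<^esub> \<gamma> x)"
proof -
  interpret M: module A M by (rule M)
  note D = derD[OF \<beta>] derD[OF \<gamma>]
  show ?thesis
    unfolding der_def
  proof (intro conjI ballI)
    show "(\<lambda>x. \<beta> x \<oplus>\<^bsub>M\<^esub> \<gamma> x) \<in> carrier E \<rightarrow> carrier M" using D(1,5) by simp
    fix x y assume x: "x \<in> carrier E"
    show "\<beta> (r \<odot>\<^bsub>E\<^esub> x) \<oplus>\<^bsub>M\<^esub> \<gamma> (r \<odot>\<^bsub>E\<^esub> x) = f r \<odot>\<^bsub>M\<^esub> (\<beta> x \<oplus>\<^bsub>M\<^esub> \<gamma> x)" if "r \<in> carrier R" for r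
      unfolding D(3)[OF that x] D(7)[OF that x]
      by (rule M.smult_r_distr[symmetric]) (use that x D(1,5) goodD(6)[OF f] in simp_all)
    assume y: "y \<in> carrier E"
    have c: "\<beta> x \<in> carrier M" "\<gamma> x \<in> carrier M" "\<beta> y \<in> carrier M" "\<gamma> y \<in> carrier M"
      "f (c1 x) \<in> carrier A" "f (c2 y) \<in> carrier A"
      using D(1,5) x y goodD(6)[OF f] by simp_all
    show "\<beta> (x \<oplus>\<^bsub>E\<^esub> y) \<oplus>\<^bsub>M\<^esub> \<gamma> (x \<oplus>\<^bsub>E\<^esub> y) = (\<beta> x \<oplus>\<^bsub>M\<^esub> \<gamma> x) \<oplus>\<^bsub>M\<^esub> (\<beta> y \<oplus>\<^bsub>M\<^esub> \<gamma> y)"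
      unfolding D(2)[OF x y] D(6)[OF x y] by (rule M.M.add_interchange) (use c in simp_all)
    show "\<beta> (x \<otimes>\<^bsub>E\<^esub> y) \<oplus>\<^bsub>M\<^esub> \<gamma> (x \<otimes>\<^bsub>E\<^esub> y) =
        f (c1 x) \<odot>\<^bsub>M\<^esub> (\<beta> y \<oplus>\<^bsub>M\<^esub> \<gamma> y) \<oplus>\<^bsub>M\<^esub> f (c2 y) \<odot>\<^bsub>M\<^esub> (\<beta> x \<oplus>\<^bsub>M\<^esub> \<gamma> x)"
      unfolding D(4)[OF x y] D(8)[OF x y] M.smult_r_distr[OF c(5) c(3,4)] M.smult_r_distr[OF c(6) c(1,2)]
      by (rule M.M.add_interchange) (use c in simp_all)
  qed
qed

text \<open>Conjugating diagonal matrices by a unipotent matrix produces this derivation, up to the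
  sign of \<open>n\<close>. Its values on the group form the coboundary of \<open>n\<close>.\<close>

lemma der_inner:
  assumes M: "module A M" and f: "good f" and n: "n \<in> carrier M"
  shows "der M f (\<lambda>x. (f (c1 x) \<ominus> f (c2 x)) \<odot>\<^bsub>M\<^esub> n)"
proof -
  interpret M: module A M by (rule M)
  note fD = goodD[OF f]
  have c: "f (c1 x) \<in> carrier A" "f (c2 x) \<in> carrier A" if "x \<in> carrier E" for x using that by (simp_all add: fD)
  show ?thesis
    unfolding der_def
  proof (intro conjI ballI)
    show "(\<lambda>x. (f (c1 x) \<ominus> f (c2 x)) \<odot>\<^bsub>M\<^esub> n) \<in> carrier E \<rightarrow> carrier M" using c n by simp
    fix x y assume x: "x \<in> carrier E"
    show "(f (c1 (r \<odot>\<^bsub>E\<^esub> x)) \<ominus> f (c2 (r \<odot>\<^bsub>E\<^esub> x))) \<odot>\<^bsub>M\<^esub> n = f r \<odot>\<^bsub>M\<^esub> ((f (c1 x) \<ominus> f (c2 x)) \<odot>\<^bsub>M\<^esub> n)"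
      if "r \<in> carrier R" for r
    proof -
      have "f (c1 (r \<odot>\<^bsub>E\<^esub> x)) \<ominus> f (c2 (r \<odot>\<^bsub>E\<^esub> x)) = f r \<otimes> (f (c1 x) \<ominus> f (c2 x))"
        using that x c[OF x] by (simp add: c_smult fD A.minus_eq A.r_distr A.r_minus)
      then show ?thesis using that c[OF x] n by (simp add: M.smult_assoc1 fD)
    qed
    assume y: "y \<in> carrier E"
    show "(f (c1 (x \<oplus>\<^bsub>E\<^esub> y)) \<ominus> f (c2 (x \<oplus>\<^bsub>E\<^esub> y))) \<odot>\<^bsub>M\<^esub> n =
        (f (c1 x) \<ominus> f (c2 x)) \<odot>\<^bsub>M\<^esub> n \<oplus>\<^bsub>M\<^esub> (f (c1 y) \<ominus> f (c2 y)) \<odot>\<^bsub>M\<^esub> n"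
    proof -
      have "f (c1 (x \<oplus>\<^bsub>E\<^esub> y)) \<ominus> f (c2 (x \<oplus>\<^bsub>E\<^esub> y)) = (f (c1 x) \<ominus> f (c2 x)) \<oplus> (f (c1 y) \<ominus> f (c2 y))"
        using x y c[OF x] c[OF y] by (simp add: c_add fD A.minus_eq A.minus_add A.add_interchange)
      then show ?thesis using c[OF x] c[OF y] n by (simp add: M.smult_l_distr)
    qed
    show "(f (c1 (x \<otimes>\<^bsub>E\<^esub> y)) \<ominus> f (c2 (x \<otimes>\<^bsub>E\<^esub> y))) \<odot>\<^bsub>M\<^esub> n =
        f (c1 x) \<odot>\<^bsub>M\<^esub> ((f (c1 y) \<ominus> f (c2 y)) \<odot>\<^bsub>M\<^esub> n) \<oplus>\<^bsub>M\<^esub> f (c2 y) \<odot>\<^bsub>M\<^esub> ((f (c1 x) \<ominus> f (c2 x)) \<odot>\<^bsub>M\<^esub> n)"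
    proof -
      let ?a = "f (c1 x)" and ?b = "f (c1 y)" and ?c = "f (c2 x)" and ?d = "f (c2 y)"
      have t: "?a \<otimes> (?b \<ominus> ?d) = ?a \<otimes> ?b \<oplus> \<ominus> (?a \<otimes> ?d)"
        "?d \<otimes> (?a \<ominus> ?c) = ?a \<otimes> ?d \<oplus> \<ominus> (?c \<otimes> ?d)"
        using c[OF x] c[OF y] by (simp_all add: A.minus_eq A.r_distr A.r_minus A.m_comm)
      \<comment> \<open>The two mixed terms cancel.\<close>
      have "(?a \<otimes> ?b \<oplus> \<ominus> (?a \<otimes> ?d)) \<oplus> (?a \<otimes> ?d \<oplus> \<ominus> (?c \<otimes> ?d)) =
          ?a \<otimes> ?b \<oplus> \<ominus> (?c \<otimes> ?d)"
        using c[OF x] c[OF y] by (simp add: A.a_assoc A.r_neg1)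
      then have "f (c1 (x \<otimes>\<^bsub>E\<^esub> y)) \<ominus> f (c2 (x \<otimes>\<^bsub>E\<^esub> y)) = ?a \<otimes> (?b \<ominus> ?d) \<oplus> ?d \<otimes> (?a \<ominus> ?c)"
        unfolding t good_mult[OF f x y] by (simp add: A.minus_eq)
      then show ?thesis using c[OF x] c[OF y] n by (simp add: M.smult_l_distr M.smult_assoc1)
    qed
  qed
qed

lemma good_e:
  assumes f: "good f" and x: "x \<in> carrier E"
  shows "f (c1 (e1 \<otimes>\<^bsub>E\<^esub> x)) = f (c1 x)" "f (c1 (x \<otimes>\<^bsub>E\<^esub> e2)) = \<zero>"
    "f (c2 (e1 \<otimes>\<^bsub>E\<^esub> x)) = \<zero>" "f (c2 (x \<otimes>\<^bsub>E\<^esub> e2)) = f (c2 x)"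
  using x by (simp_all add: c1_e_mult goodD[OF f])

text \<open>\<open>\<beta>\<close> and its composite with the projection to the upper right corner
  differ by the inner derivation of \<open>\<beta> e1\<close>. The equation has the shape of the
  hypothesis of \<open>ext_class_eqI\<close>, so that both derivations define the same
  class.\<close>

lemma der_corner:
  assumes M: "module A M" and f: "good f" and \<beta>: "der M f \<beta>" and x: "x \<in> carrier E"
  shows "\<beta> (e1 \<otimes>\<^bsub>E\<^esub> x \<otimes>\<^bsub>E\<^esub> e2) \<oplus>\<^bsub>M\<^esub> f (c1 x) \<odot>\<^bsub>M\<^esub> \<beta> e1 = \<beta> x \<oplus>\<^bsub>M\<^esub> f (c2 x) \<odot>\<^bsub>M\<^esub> \<beta> e1"
proof -
  interpret M: module A M by (rule M)
  note fD = goodD[OF f] and D = derD[OF \<beta>]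
  have c: "f (c1 x) \<in> carrier A" "f (c2 x) \<in> carrier A" "\<beta> x \<in> carrier M" "\<beta> e1 \<in> carrier M" "\<beta> e2 \<in> carrier M"
    using x by (simp_all add: fD D)
  \<comment> \<open>\<open>\<beta>\<close> vanishes on the identity, which is
    \<open>e1 + e2\<close>.\<close>
  have 0: "\<beta> e2 \<oplus>\<^bsub>M\<^esub> \<beta> e1 = \<zero>\<^bsub>M\<^esub>"
    using D(2)[of e1 e2] der_one[OF M f \<beta>] c by (simp add: e_sum M.M.a_comm)
  have 1: "\<beta> (x \<otimes>\<^bsub>E\<^esub> e2) = f (c1 x) \<odot>\<^bsub>M\<^esub> \<beta> e2 \<oplus>\<^bsub>M\<^esub> \<beta> x"
    using D(4)[OF x, of e2] c by (simp add: fD)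
  have "\<beta> (e1 \<otimes>\<^bsub>E\<^esub> (x \<otimes>\<^bsub>E\<^esub> e2)) = \<beta> (x \<otimes>\<^bsub>E\<^esub> e2) \<oplus>\<^bsub>M\<^esub> f (c2 x) \<odot>\<^bsub>M\<^esub> \<beta> e1"
    using D(4)[of e1 "x \<otimes>\<^bsub>E\<^esub> e2"] x c D(1)[of "x \<otimes>\<^bsub>E\<^esub> e2"] good_e[OF f x] by (simp add: fD)
  then have "\<beta> (e1 \<otimes>\<^bsub>E\<^esub> x \<otimes>\<^bsub>E\<^esub> e2) \<oplus>\<^bsub>M\<^esub> f (c1 x) \<odot>\<^bsub>M\<^esub> \<beta> e1 =
      ((f (c1 x) \<odot>\<^bsub>M\<^esub> \<beta> e2 \<oplus>\<^bsub>M\<^esub> \<beta> x) \<oplus>\<^bsub>M\<^esub> f (c2 x) \<odot>\<^bsub>M\<^esub> \<beta> e1) \<oplus>\<^bsub>M\<^esub> f (c1 x) \<odot>\<^bsub>M\<^esub> \<beta> e1"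
    unfolding 1 using x by (simp add: Er.m_assoc)
  also have "\<dots> = (f (c1 x) \<odot>\<^bsub>M\<^esub> \<beta> e2 \<oplus>\<^bsub>M\<^esub> f (c1 x) \<odot>\<^bsub>M\<^esub> \<beta> e1) \<oplus>\<^bsub>M\<^esub> (\<beta> x \<oplus>\<^bsub>M\<^esub> f (c2 x) \<odot>\<^bsub>M\<^esub> \<beta> e1)"
    using c by (simp add: M.M.a_ac)
  also have "f (c1 x) \<odot>\<^bsub>M\<^esub> \<beta> e2 \<oplus>\<^bsub>M\<^esub> f (c1 x) \<odot>\<^bsub>M\<^esub> \<beta> e1 = \<zero>\<^bsub>M\<^esub>"
    using M.smult_r_distr[OF c(1) c(5,4)] 0 c M.smult_r_null by simp
  finally show ?thesis using c by simp
qed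

text \<open>Splitting a product in the middle by \<open>e1 + e2\<close> leaves two terms, and in
  each of them one summand of the derivation rule vanishes.\<close>

lemma der_normalize:
  assumes M: "module A M" and f: "good f" and \<beta>: "der M f \<beta>"
  shows "der M f (\<lambda>x. \<beta> (e1 \<otimes>\<^bsub>E\<^esub> x \<otimes>\<^bsub>E\<^esub> e2))"
proof -
  interpret M: module A M by (rule M)
  note fD = goodD[OF f] and D = derD[OF \<beta>]
  show ?thesis
    unfolding der_def
  proof (intro conjI ballI)
    show "(\<lambda>x. \<beta> (e1 \<otimes>\<^bsub>E\<^esub> x \<otimes>\<^bsub>E\<^esub> e2)) \<in> carrier E \<rightarrow> carrier M" using D(1) by simp
    fix x y assume x: "x \<in> carrier E"
    show "\<beta> (e1 \<otimes>\<^bsub>E\<^esub> (r \<odot>\<^bsub>E\<^esub> x) \<otimes>\<^bsub>E\<^esub> e2) = f r \<odot>\<^bsub>M\<^esub> \<beta> (e1 \<otimes>\<^bsub>E\<^esub> x \<otimes>\<^bsub>E\<^esub> e2)" if "r \<in> carrier R" for r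
      using that x by (simp add: D)
    assume y: "y \<in> carrier E"
    show "\<beta> (e1 \<otimes>\<^bsub>E\<^esub> (x \<oplus>\<^bsub>E\<^esub> y) \<otimes>\<^bsub>E\<^esub> e2) = \<beta> (e1 \<otimes>\<^bsub>E\<^esub> x \<otimes>\<^bsub>E\<^esub> e2) \<oplus>\<^bsub>M\<^esub> \<beta> (e1 \<otimes>\<^bsub>E\<^esub> y \<otimes>\<^bsub>E\<^esub> e2)"
      using x y by (simp add: D Er.l_distr Er.r_distr)
    let ?b = "e1 \<otimes>\<^bsub>E\<^esub> x" and ?c = "y \<otimes>\<^bsub>E\<^esub> e2"
    have b: "?b \<in> carrier E" "?c \<in> carrier E" using x y by simp_all
    have "e1 \<otimes>\<^bsub>E\<^esub> (x \<otimes>\<^bsub>E\<^esub> y) \<otimes>\<^bsub>E\<^esub> e2 = ?b \<otimes>\<^bsub>E\<^esub> ?c" using x y by (simp add: Er.m_assoc)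
    also have "\<dots> = (?b \<otimes>\<^bsub>E\<^esub> e1 \<oplus>\<^bsub>E\<^esub> ?b \<otimes>\<^bsub>E\<^esub> e2) \<otimes>\<^bsub>E\<^esub> ?c" by (simp add: e_decomp(2)[OF b(1)])
    also have "\<dots> = ?b \<otimes>\<^bsub>E\<^esub> (e1 \<otimes>\<^bsub>E\<^esub> ?c) \<oplus>\<^bsub>E\<^esub> (?b \<otimes>\<^bsub>E\<^esub> e2) \<otimes>\<^bsub>E\<^esub> ?c"
      using b by (simp add: Er.l_distr Er.m_assoc)
    finally have *: "\<beta> (e1 \<otimes>\<^bsub>E\<^esub> (x \<otimes>\<^bsub>E\<^esub> y) \<otimes>\<^bsub>E\<^esub> e2) = \<beta> (?b \<otimes>\<^bsub>E\<^esub> (e1 \<otimes>\<^bsub>E\<^esub> ?c)) \<oplus>\<^bsub>M\<^esub> \<beta> ((?b \<otimes>\<^bsub>E\<^esub> e2) \<otimes>\<^bsub>E\<^esub> ?c)"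
      using D(2)[of "?b \<otimes>\<^bsub>E\<^esub> (e1 \<otimes>\<^bsub>E\<^esub> ?c)" "(?b \<otimes>\<^bsub>E\<^esub> e2) \<otimes>\<^bsub>E\<^esub> ?c"] b by simp
    have c: "\<beta> ?b \<in> carrier M" "\<beta> ?c \<in> carrier M" "\<beta> (e1 \<otimes>\<^bsub>E\<^esub> ?c) \<in> carrier M" "\<beta> (?b \<otimes>\<^bsub>E\<^esub> e2) \<in> carrier M"
      "f (c1 x) \<in> carrier A" "f (c2 y) \<in> carrier A"
      using x y by (simp_all add: D fD)
    have 1: "\<beta> (?b \<otimes>\<^bsub>E\<^esub> (e1 \<otimes>\<^bsub>E\<^esub> ?c)) = f (c1 x) \<odot>\<^bsub>M\<^esub> \<beta> (e1 \<otimes>\<^bsub>E\<^esub> ?c)"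
      using D(4)[OF b(1), of "e1 \<otimes>\<^bsub>E\<^esub> ?c"] b(2) c by (simp add: good_e[OF f x] good_e[OF f b(2)])
    have 2: "\<beta> ((?b \<otimes>\<^bsub>E\<^esub> e2) \<otimes>\<^bsub>E\<^esub> ?c) = f (c2 y) \<odot>\<^bsub>M\<^esub> \<beta> (?b \<otimes>\<^bsub>E\<^esub> e2)"
      using D(4)[of "?b \<otimes>\<^bsub>E\<^esub> e2" ?c] b c by (simp add: good_e[OF f y] good_e[OF f b(1)])
    show "\<beta> (e1 \<otimes>\<^bsub>E\<^esub> (x \<otimes>\<^bsub>E\<^esub> y) \<otimes>\<^bsub>E\<^esub> e2) =
        f (c1 x) \<odot>\<^bsub>M\<^esub> \<beta> (e1 \<otimes>\<^bsub>E\<^esub> y \<otimes>\<^bsub>E\<^esub> e2) \<oplus>\<^bsub>M\<^esub> f (c2 y) \<odot>\<^bsub>M\<^esub> \<beta> (e1 \<otimes>\<^bsub>E\<^esub> x \<otimes>\<^bsub>E\<^esub> e2)"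
      unfolding * 1 2 using y by (simp add: Er.m_assoc)
  qed
qed

text \<open>A local ring has only trivial idempotents: one of \<open>a\<close> and \<open>b\<close>
  has nonzero residue and is a unit, which kills the other.\<close>

lemma idempotent_cases:
  assumes a: "a \<in> carrier A" "b \<in> carrier A" "a \<oplus> b = \<one>" "a \<otimes> b = \<zero>"
  shows "a = \<one> \<and> b = \<zero> \<or> a = \<zero> \<and> b = \<one>"
proof (cases "a \<in> Units A")
  case True
  then have "b = \<zero>" using unit_cancel[OF True a(2,4)] by blast
  then show ?thesis using a(1,3) by simp
next
  case False
  interpret F: field F by (rule F)
  have "res A a = \<zero>\<^bsub>F\<^esub>" using A_local[OF a(1)] False by blast
  then have "res A b = \<one>\<^bsub>F\<^esub>"
    using ring_hom_add[OF res_A a(1,2)] a(3) ring_hom_one[OF res_A] ring_hom_closed[OF res_A a(2)] by simp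
  then have "b \<in> Units A" using A_local[OF a(2)] by simp
  then have "a = \<zero>" using unit_cancel[OF _ a(1)] a(4) A.m_comm[OF a(1,2)] by simp
  then show ?thesis using a(2,3) by simp
qed

text \<open>Universality for the triangular algebra of the extension gives a homomorphism
  \<open>h\<close> whose diagonal entries must still be identified with those of \<open>E\<close>.
  The images of \<open>e1\<close> and \<open>e2\<close> settle this, and the residual characters
  determine these images.\<close>

lemma der_exists:
  assumes fg: "fg_module A M" and b: "cocycle M b" and s: "satisfies G C A (VE M b)"
  obtains \<beta> where "der M \<psi> \<beta>" "\<And>x. x \<in> carrier E \<Longrightarrow> \<beta> x = \<beta> (e1 \<otimes>\<^bsub>E\<^esub> x \<otimes>\<^bsub>E\<^esub> e2)"
    "ext_class M b = ext_class M (\<lambda>g. \<beta> (\<rho> g))"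
proof -
  have M: "module A M" using fg by (simp add: fg_module_def)
  obtain enc :: "'u \<times> 'a \<times> 'u \<Rightarrow> 'u" where enc: "inj_on enc (carrier A \<times> carrier M \<times> carrier A)"
    using fg_module_encoding[OF fg inf] by blast
  interpret X: triangular A M enc by (rule M_triangular[OF fg enc])
  interpret M: module A M by (rule M)
  obtain f h where m: "CH_morphism G W R E \<rho> D A X.E (\<lambda>g. enc (\<chi>1 g, b g, \<chi>2 g)) X.tri_law f h"
    using universal_morphism[OF tri_satisfying[OF fg enc b s]] by metis
  have f: "coef_hom W R A f" and h: "h \<in> ring_hom E X.E"
    and hs: "\<And>r x. r \<in> carrier R \<Longrightarrow> x \<in> carrier E \<Longrightarrow> h (r \<odot>\<^bsub>E\<^esub> x) = f r \<odot>\<^bsub>X.E\<^esub> h x"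
    and h\<rho>: "\<And>g. g \<in> carrier G \<Longrightarrow> h (\<rho> g) = enc (\<chi>1 g, b g, \<chi>2 g)"
    using m unfolding CH_morphism_def by blast+
  have fh: "f \<in> ring_hom R A" using f by (simp add: coef_hom_def)
  have fc: "f r \<in> carrier A" if "r \<in> carrier R" for r by (rule ring_hom_closed[OF fh that])
  have hc: "h x \<in> carrier X.E" if "x \<in> carrier E" for x by (rule ring_hom_closed[OF h that])
  \<comment> \<open>The upper left, lower right and upper right entries of the matrix
    \<open>h x\<close>.\<close>
  define P Q N where "P x = X.pa (h x)" and "Q x = X.pd (h x)" and "N x = X.pm (h x)" for x
  note defs = P_def Q_def N_def
  have cl: "P x \<in> carrier A" "Q x \<in> carrier A" "N x \<in> carrier M" if "x \<in> carrier E" for x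
    using hc[OF that] by (simp_all add: defs)
  have add: "P (x \<oplus>\<^bsub>E\<^esub> y) = P x \<oplus> P y" "Q (x \<oplus>\<^bsub>E\<^esub> y) = Q x \<oplus> Q y" "N (x \<oplus>\<^bsub>E\<^esub> y) = N x \<oplus>\<^bsub>M\<^esub> N y"
    if "x \<in> carrier E" "y \<in> carrier E" for x y
    using cl[OF that(1)] cl[OF that(2)] unfolding defs ring_hom_add[OF h that] X.E_simps(5) by simp_all
  have mult: "P (x \<otimes>\<^bsub>E\<^esub> y) = P x \<otimes> P y" "Q (x \<otimes>\<^bsub>E\<^esub> y) = Q x \<otimes> Q y"
    "N (x \<otimes>\<^bsub>E\<^esub> y) = P x \<odot>\<^bsub>M\<^esub> N y \<oplus>\<^bsub>M\<^esub> Q y \<odot>\<^bsub>M\<^esub> N x"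
    if "x \<in> carrier E" "y \<in> carrier E" for x y
    using cl[OF that(1)] cl[OF that(2)] unfolding defs ring_hom_mult[OF h that] X.E_simps(2) by simp_all
  have smult: "P (r \<odot>\<^bsub>E\<^esub> x) = f r \<otimes> P x" "Q (r \<odot>\<^bsub>E\<^esub> x) = f r \<otimes> Q x" "N (r \<odot>\<^bsub>E\<^esub> x) = f r \<odot>\<^bsub>M\<^esub> N x"
    if "r \<in> carrier R" "x \<in> carrier E" for r x
    using cl[OF that(2)] fc[OF that(1)] unfolding defs hs[OF that] X.E_simps(6) by simp_all
  have one: "P \<one>\<^bsub>E\<^esub> = \<one>" "Q \<one>\<^bsub>E\<^esub> = \<one>" unfolding defs ring_hom_one[OF h] X.E_simps(3) by simp_all
  have zero: "P \<zero>\<^bsub>E\<^esub> = \<zero>" "Q \<zero>\<^bsub>E\<^esub> = \<zero>"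
    unfolding defs ring_hom_zero[OF h Er.ring_axioms X.E_ring] X.E_simps(4) by simp_all
  have rho: "P (\<rho> g) = \<chi>1 g" "Q (\<rho> g) = \<chi>2 g" "N (\<rho> g) = b g" if "g \<in> carrier G" for g
    using that cocycleD(1)[OF b] unfolding defs h\<rho>[OF that] by simp_all
  have corner: "P (e1 \<otimes>\<^bsub>E\<^esub> x \<otimes>\<^bsub>E\<^esub> e1) = f (c1 x) \<otimes> P e1" "Q (e1 \<otimes>\<^bsub>E\<^esub> x \<otimes>\<^bsub>E\<^esub> e1) = f (c1 x) \<otimes> Q e1"
    "P (e2 \<otimes>\<^bsub>E\<^esub> x \<otimes>\<^bsub>E\<^esub> e2) = f (c2 x) \<otimes> P e2" "Q (e2 \<otimes>\<^bsub>E\<^esub> x \<otimes>\<^bsub>E\<^esub> e2) = f (c2 x) \<otimes> Q e2"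
    if "x \<in> carrier E" for x
    unfolding c1(2)[OF that, symmetric] c2(2)[OF that, symmetric] using that by (simp_all add: smult)
  obtain g where g: "g \<in> carrier G" "\<chi>b1 g \<noteq> \<chi>b2 g" using distinct by blast
  have \<rho>g: "\<rho> g \<in> carrier E" using g(1) by simp
  have rf: "res A (f (c1 (\<rho> g))) = \<chi>b1 g" "res A (f (c2 (\<rho> g))) = \<chi>b2 g"
    using coef_hom_res'[OF f] res_c[OF g(1)] \<rho>g by simp_all
  have es: "P e1 \<oplus> P e2 = \<one>" "Q e1 \<oplus> Q e2 = \<one>" "P e1 \<otimes> P e2 = \<zero>" "Q e1 \<otimes> Q e2 = \<zero>"
    using add[of e1 e2] mult[of e1 e2] by (simp_all add: e_sum one zero)
  \<comment> \<open>The images of \<open>e1\<close> and \<open>e2\<close> are complementary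
    idempotents of a local ring. If \<open>e1\<close> went to 0, then \<open>\<chi>1 g\<close> would
    be the image of the other entry \<open>c2 (\<rho> g)\<close>, whose residue is
    \<open>\<chi>b2 g\<close>, although the residual characters differ at \<open>g\<close>.\<close>
  have P: "P e1 = \<one>" "P e2 = \<zero>"
  proof -
    have "\<not> (P e1 = \<zero> \<and> P e2 = \<one>)"
    proof
      assume "P e1 = \<zero> \<and> P e2 = \<one>"
      then have "\<chi>1 g = f (c2 (\<rho> g))"
        using corner(3)[OF \<rho>g] \<rho>g g(1) fc[of "c2 (\<rho> g)"] by (simp add: mult rho)
      then show False using rf(2) res_\<chi>(1)[OF g(1)] g(2) by simp
    qed
    then show "P e1 = \<one>" "P e2 = \<zero>"
      using idempotent_cases[OF cl(1)[OF idem(1)] cl(1)[OF idem(2)] es(1,3)] by blast+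
  qed
  have Q: "Q e1 = \<zero>" "Q e2 = \<one>"
  proof -
    have "\<not> (Q e1 = \<one> \<and> Q e2 = \<zero>)"
    proof
      assume "Q e1 = \<one> \<and> Q e2 = \<zero>"
      then have "\<chi>2 g = f (c1 (\<rho> g))"
        using corner(2)[OF \<rho>g] \<rho>g g(1) fc[of "c1 (\<rho> g)"] by (simp add: mult rho)
      then show False using rf(1) res_\<chi>(2)[OF g(1)] g(2) by simp
    qed
    then show "Q e1 = \<zero>" "Q e2 = \<one>"
      using idempotent_cases[OF cl(2)[OF idem(1)] cl(2)[OF idem(2)] es(2,4)] by blast+
  qed
  have Pf: "P x = f (c1 x)" "Q x = f (c2 x)" if "x \<in> carrier E" for x
    using corner(1,4)[OF that] that cl[OF that] fc[of "c1 x"] fc[of "c2 x"] by (simp_all add: mult P Q)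
  \<comment> \<open>Generators of \<open>J\<close> pass through \<open>e2\<close>, where
    \<open>P\<close> vanishes, so the base map found by universality kills \<open>J\<close>
    too.\<close>
  have kill: "f r = \<zero>" if "r \<in> J" for r
    using that
  proof (induction rule: J_induct[consumes 1, case_names zero incl minus add])
    case zero
    show ?case by (rule ring_hom_zero[OF fh E.R.ring_axioms A.ring_axioms])
  next
    case (incl x y)
    have "f (c1 (x \<otimes>\<^bsub>E\<^esub> (e2 \<otimes>\<^bsub>E\<^esub> y))) = P (x \<otimes>\<^bsub>E\<^esub> (e2 \<otimes>\<^bsub>E\<^esub> y))" by (rule Pf(1)[symmetric]) (use incl in simp)
    also have "\<dots> = \<zero>" using incl cl by (simp add: mult P)
    finally show ?case .
  next
    case (minus r)
    then have "f (\<ominus>\<^bsub>R\<^esub> r) \<oplus> f r = f \<zero>\<^bsub>R\<^esub>" using ring_hom_add[OF fh, of "\<ominus>\<^bsub>R\<^esub> r" r] by (simp add: E.R.l_neg)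
    then show ?case using minus fc[of "\<ominus>\<^bsub>R\<^esub> r"] ring_hom_zero[OF fh E.R.ring_axioms A.ring_axioms] by simp
  next
    case (add r s)
    then show ?case using ring_hom_add[OF fh] by simp
  qed
  have good: "good f"
    unfolding good_def using f kill Pf[OF \<rho>_closed] rho by simp
  \<comment> \<open>Here the base map of the morphism is identified with the given one.\<close>
  have f\<psi>: "f r = \<psi> r" if "r \<in> carrier R" for r by (rule good_unique[OF fg enc good that])
  have N: "der M \<psi> N"
    unfolding der_def using cl add mult smult Pf f\<psi> by simp
  show thesis
  proof (rule that[OF der_normalize[OF M good_\<psi> N]])
    show "N (e1 \<otimes>\<^bsub>E\<^esub> x \<otimes>\<^bsub>E\<^esub> e2) = N (e1 \<otimes>\<^bsub>E\<^esub> (e1 \<otimes>\<^bsub>E\<^esub> x \<otimes>\<^bsub>E\<^esub> e2) \<otimes>\<^bsub>E\<^esub> e2)" if "x \<in> carrier E" for x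
      using that by (simp add: Er.m_assoc)
    \<comment> \<open>Normalization changes the cocycle by the coboundary of
      \<open>N e1\<close>.\<close>
    show "ext_class M b = ext_class M (\<lambda>g. N (e1 \<otimes>\<^bsub>E\<^esub> \<rho> g \<otimes>\<^bsub>E\<^esub> e2))"
    proof (rule ext_class_eqI[OF M b der_cocycle[OF M good_\<psi> der_normalize[OF M good_\<psi> N]] cl(3)[OF idem(1)]])
      fix g assume g: "g \<in> carrier G"
      show "b g \<oplus>\<^bsub>M\<^esub> \<chi>2 g \<odot>\<^bsub>M\<^esub> N e1 = N (e1 \<otimes>\<^bsub>E\<^esub> \<rho> g \<otimes>\<^bsub>E\<^esub> e2) \<oplus>\<^bsub>M\<^esub> \<chi>1 g \<odot>\<^bsub>M\<^esub> N e1"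
        using der_corner[OF M good_\<psi> N \<rho>_closed[OF g]] by (simp add: goodD(4,5)[OF good_\<psi> g] rho[OF g])
    qed
  qed
qed

text \<open>Equal classes make the derivations agree on the group up to the coboundary of some
  \<open>n\<close>, hence everywhere up to the inner derivation of \<open>n\<close>. Normalized
  derivations vanish at \<open>e1\<close>, where the inner one takes the value \<open>n\<close>, so
  \<open>n\<close> is zero.\<close>

lemma der_inj:
  assumes fg: "fg_module A M" and \<beta>: "der M \<psi> \<beta>" and \<gamma>: "der M \<psi> \<gamma>"
    and norm: "\<And>x. x \<in> carrier E \<Longrightarrow> \<beta> x = \<beta> (e1 \<otimes>\<^bsub>E\<^esub> x \<otimes>\<^bsub>E\<^esub> e2)"
      "\<And>x. x \<in> carrier E \<Longrightarrow> \<gamma> x = \<gamma> (e1 \<otimes>\<^bsub>E\<^esub> x \<otimes>\<^bsub>E\<^esub> e2)"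
    and eq: "ext_class M (\<lambda>g. \<beta> (\<rho> g)) = ext_class M (\<lambda>g. \<gamma> (\<rho> g))" and x: "x \<in> carrier E"
  shows "\<beta> x = \<gamma> x"
proof -
  have M: "module A M" using fg by (simp add: fg_module_def)
  interpret M: module A M by (rule M)
  obtain enc :: "'u \<times> 'a \<times> 'u \<Rightarrow> 'u" where enc: "inj_on enc (carrier A \<times> carrier M \<times> carrier A)"
    using fg_module_encoding[OF fg inf] by blast
  note good = good_\<psi>
  obtain n where n: "n \<in> carrier M"
    "\<And>g. g \<in> carrier G \<Longrightarrow> \<beta> (\<rho> g) \<oplus>\<^bsub>M\<^esub> \<chi>2 g \<odot>\<^bsub>M\<^esub> n = \<gamma> (\<rho> g) \<oplus>\<^bsub>M\<^esub> \<chi>1 g \<odot>\<^bsub>M\<^esub> n"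
    using ext_class_eqD[OF M der_cocycle[OF M good \<beta>] der_cocycle[OF M good \<gamma>] eq] by metis
  let ?\<iota> = "\<lambda>x. (\<psi> (c1 x) \<ominus> \<psi> (c2 x)) \<odot>\<^bsub>M\<^esub> n"
  have \<gamma>\<iota>: "der M \<psi> (\<lambda>x. \<gamma> x \<oplus>\<^bsub>M\<^esub> ?\<iota> x)" by (rule der_add[OF M good \<gamma> der_inner[OF M good n(1)]])
  have ag: "\<beta> (\<rho> g) = \<gamma> (\<rho> g) \<oplus>\<^bsub>M\<^esub> ?\<iota> (\<rho> g)" if g: "g \<in> carrier G" for g
  proof -
    have c: "\<beta> (\<rho> g) \<in> carrier M" "\<gamma> (\<rho> g) \<in> carrier M" "\<chi>1 g \<in> carrier A" "\<chi>2 g \<in> carrier A" "\<chi>2 g \<odot>\<^bsub>M\<^esub> n \<in> carrier M"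
      using g derD(1)[OF \<beta>] derD(1)[OF \<gamma>] n(1) by simp_all
    have "\<beta> (\<rho> g) = (\<beta> (\<rho> g) \<oplus>\<^bsub>M\<^esub> \<chi>2 g \<odot>\<^bsub>M\<^esub> n) \<oplus>\<^bsub>M\<^esub> \<ominus>\<^bsub>M\<^esub> (\<chi>2 g \<odot>\<^bsub>M\<^esub> n)"
      using c by (simp add: M.M.a_assoc M.M.r_neg)
    also have "\<dots> = \<gamma> (\<rho> g) \<oplus>\<^bsub>M\<^esub> (\<chi>1 g \<odot>\<^bsub>M\<^esub> n \<oplus>\<^bsub>M\<^esub> \<ominus>\<^bsub>M\<^esub> (\<chi>2 g \<odot>\<^bsub>M\<^esub> n))"
      unfolding n(2)[OF g] using c n(1) by (simp add: M.M.a_assoc)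
    also have "\<chi>1 g \<odot>\<^bsub>M\<^esub> n \<oplus>\<^bsub>M\<^esub> \<ominus>\<^bsub>M\<^esub> (\<chi>2 g \<odot>\<^bsub>M\<^esub> n) = (\<chi>1 g \<ominus> \<chi>2 g) \<odot>\<^bsub>M\<^esub> n"
      using c n(1) by (simp add: A.minus_eq M.smult_l_distr M.smult_l_minus)
    finally show ?thesis using g by (simp add: goodD(4,5)[OF good])
  qed
  have all: "\<beta> y = \<gamma> y \<oplus>\<^bsub>M\<^esub> ?\<iota> y" if "y \<in> carrier E" for y
    by (rule der_unique(2)[OF fg enc good \<beta> good \<gamma>\<iota> ag that])
  have e1: "e1 \<otimes>\<^bsub>E\<^esub> e1 \<otimes>\<^bsub>E\<^esub> e2 = \<zero>\<^bsub>E\<^esub>" by simp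
  have z: "\<delta> e1 = \<zero>\<^bsub>M\<^esub>" if "der M \<psi> \<delta>" "\<And>x. x \<in> carrier E \<Longrightarrow> \<delta> x = \<delta> (e1 \<otimes>\<^bsub>E\<^esub> x \<otimes>\<^bsub>E\<^esub> e2)" for \<delta>
  proof -
    have "\<delta> e1 = \<delta> \<zero>\<^bsub>E\<^esub>" using that(2)[OF idem(1)] unfolding e1 .
    also have "\<dots> = \<zero>\<^bsub>M\<^esub>"
      by (rule additive_zero[OF E.abelian_group_axioms M.abelian_group_axioms]) (use derD[OF that(1)] in auto)
    finally show ?thesis .
  qed
  have "n = \<zero>\<^bsub>M\<^esub>"
    using all[OF idem(1)] n(1) by (simp add: z[OF \<beta> norm(1)] z[OF \<gamma> norm(2)] goodD(9,10)[OF good] A.minus_eq)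
  then show ?thesis using all[OF x] x derD(1)[OF \<gamma> x] by (simp add: M.smult_r_null)
qed

end

section \<open>The reduced corner\<close>

context gma
begin

text \<open>Scalars from \<open>R\<close> are central in \<open>E\<close>, so multiples by
  \<open>J\<close> absorb multiplication on either side.\<close>

lemma JE_ideal: "ideal (ideal_smul J E) E"
proof -
  interpret J: ideal J R by (rule J_ideal)
  note cl = E.ideal_smul_closed[OF J_subset]
  let ?H = "{x \<in> carrier E. \<forall>y \<in> carrier E. y \<otimes> x \<in> ideal_smul J E \<and> x \<otimes> y \<in> ideal_smul J E}"
  have "ideal_smul J E \<subseteq> ?H"
  proof (rule E.ideal_smul_minimal)
    show "subgroup ?H (add_monoid E)"
    proof (rule subgroup.intro)
      show "inv\<^bsub>add_monoid E\<^esub> x \<in> ?H" if "x \<in> ?H" for x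
        using that cl(3) by (simp add: a_inv_def[symmetric] Er.l_minus Er.r_minus)
    qed (use cl in \<open>auto simp: Er.l_distr Er.r_distr\<close>)
    show "a \<odot> x \<in> ?H" if "a \<in> J" "x \<in> carrier E" for a x
      using that J_subset E.ideal_smul_incl[OF that(1)] by (auto simp: subsetD)
  qed
  then show ?thesis
    by (intro idealI Er.ring_axioms E.ideal_smul_subgroup J_subset) blast+
qed

abbreviation "q x \<equiv> ideal_smul J E +> x"
abbreviation "Rq \<equiv> quot_coef R J"
abbreviation "RC \<equiv> red_corner E J e1 e2"

lemma q_add: "x \<in> carrier E \<Longrightarrow> y \<in> carrier E \<Longrightarrow> q x <+> q y = q (x \<oplus> y)"
  by (rule ideal.a_rcos_sum[OF JE_ideal])

lemma q_mult: "x \<in> carrier E \<Longrightarrow> y \<in> carrier E \<Longrightarrow> rcoset_mult E (ideal_smul J E) (q x) (q y) = q (x \<otimes> y)"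
  by (rule ideal.rcoset_mult_add[OF JE_ideal])

lemma q_eq: "x \<in> carrier E \<Longrightarrow> y \<in> carrier E \<Longrightarrow> q x = q y \<longleftrightarrow> x \<ominus> y \<in> ideal_smul J E"
  by (rule Er.quotient_eq_iff_same_a_r_cos[OF JE_ideal, symmetric])

lemma q_zero: "q \<zero> = ideal_smul J E"
proof -
  interpret JE: ideal "ideal_smul J E" E by (rule JE_ideal)
  show ?thesis by (rule JE.a_rcos_const) (rule JE.zero_closed)
qed

lemma Rq_simps:
  "carrier Rq = (\<lambda>r. J +>\<^bsub>R\<^esub> r) ` carrier R" "\<one>\<^bsub>Rq\<^esub> = J +>\<^bsub>R\<^esub> \<one>\<^bsub>R\<^esub>"
  "r \<in> carrier R \<Longrightarrow> s \<in> carrier R \<Longrightarrow> (J +>\<^bsub>R\<^esub> r) \<oplus>\<^bsub>Rq\<^esub> (J +>\<^bsub>R\<^esub> s) = J +>\<^bsub>R\<^esub> (r \<oplus>\<^bsub>R\<^esub> s)"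
  "r \<in> carrier R \<Longrightarrow> s \<in> carrier R \<Longrightarrow> (J +>\<^bsub>R\<^esub> r) \<otimes>\<^bsub>Rq\<^esub> (J +>\<^bsub>R\<^esub> s) = J +>\<^bsub>R\<^esub> (r \<otimes>\<^bsub>R\<^esub> s)"
proof -
  interpret J: ideal J R by (rule J_ideal)
  show "carrier Rq = (\<lambda>r. J +>\<^bsub>R\<^esub> r) ` carrier R" "\<one>\<^bsub>Rq\<^esub> = J +>\<^bsub>R\<^esub> \<one>\<^bsub>R\<^esub>"
    by (auto simp: quot_coef_def ring.defs FactRing_simps)
  show "r \<in> carrier R \<Longrightarrow> s \<in> carrier R \<Longrightarrow> (J +>\<^bsub>R\<^esub> r) \<oplus>\<^bsub>Rq\<^esub> (J +>\<^bsub>R\<^esub> s) = J +>\<^bsub>R\<^esub> (r \<oplus>\<^bsub>R\<^esub> s)"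
    by (simp add: quot_coef_def ring.defs FactRing_def J.a_rcos_sum)
  show "r \<in> carrier R \<Longrightarrow> s \<in> carrier R \<Longrightarrow> (J +>\<^bsub>R\<^esub> r) \<otimes>\<^bsub>Rq\<^esub> (J +>\<^bsub>R\<^esub> s) = J +>\<^bsub>R\<^esub> (r \<otimes>\<^bsub>R\<^esub> s)"
    by (simp add: quot_coef_def ring.defs FactRing_def J.rcoset_mult_add)
qed

lemma Rq_cring: "cring Rq"
proof -
  interpret J: ideal J R by (rule J_ideal)
  show ?thesis
    by (rule cring_cong[OF J.quotient_is_cring[OF E.R.is_cring]]) (simp_all add: quot_coef_def ring.defs)
qed

text \<open>The corner \<open>e1 E e2\<close>, described by a fixed-point equation from which its
  closure properties are immediate.\<close>

definition off_diagonal :: "'u set" where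
  "off_diagonal = {x \<in> carrier E. e1 \<otimes> x \<otimes> e2 = x}"

lemma off_diagonal_closed:
  "x \<in> off_diagonal \<Longrightarrow> x \<in> carrier E" "\<zero> \<in> off_diagonal"
  "x \<in> off_diagonal \<Longrightarrow> y \<in> off_diagonal \<Longrightarrow> x \<oplus> y \<in> off_diagonal"
  "x \<in> off_diagonal \<Longrightarrow> \<ominus> x \<in> off_diagonal"
  "r \<in> carrier R \<Longrightarrow> x \<in> off_diagonal \<Longrightarrow> r \<odot> x \<in> off_diagonal"
  "x \<in> carrier E \<Longrightarrow> e1 \<otimes> x \<otimes> e2 \<in> off_diagonal"
  by (simp_all add: off_diagonal_def Er.l_distr Er.r_distr Er.l_minus Er.r_minus Er.m_assoc)

text \<open>\<open>quot_algebra\<close> multiplies by scalars through unions over representatives.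
  All sets in such a union are the same coset, so the reduced corner can be computed on
  representatives in \<open>E\<close>.\<close>

lemma RC_simps:
  "carrier RC = q ` off_diagonal" "\<zero>\<^bsub>RC\<^esub> = q \<zero>"
  "x \<in> carrier E \<Longrightarrow> y \<in> carrier E \<Longrightarrow> q x \<oplus>\<^bsub>RC\<^esub> q y = q (x \<oplus> y)"
  "r \<in> carrier R \<Longrightarrow> x \<in> carrier E \<Longrightarrow> (J +>\<^bsub>R\<^esub> r) \<odot>\<^bsub>RC\<^esub> q x = q (r \<odot> x)"
proof -
  interpret J: ideal J R by (rule J_ideal)
  interpret JE: ideal "ideal_smul J E" E by (rule JE_ideal)
  let ?Q = "quot_algebra E J"
  have Q: "carrier ?Q = q ` carrier E" "monoid.mult ?Q = rcoset_mult E (ideal_smul J E)"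
    by (auto simp: quot_algebra_def Let_def ring.defs FactRing_simps)
  show "carrier RC = q ` off_diagonal"
  proof
    show "carrier RC \<subseteq> q ` off_diagonal"
      using off_diagonal_closed(6) by (auto simp: red_corner_def Let_def corner_def Q q_mult)
    show "q ` off_diagonal \<subseteq> carrier RC"
    proof
      fix c assume "c \<in> q ` off_diagonal"
      then obtain x where x: "x \<in> carrier E" "e1 \<otimes> x \<otimes> e2 = x" "c = q x" by (auto simp: off_diagonal_def)
      then have "c = q e1 \<otimes>\<^bsub>?Q\<^esub> q x \<otimes>\<^bsub>?Q\<^esub> q e2" by (simp add: Q q_mult)
      then show "c \<in> carrier RC" using x by (auto simp: red_corner_def Let_def corner_def Q)
    qed
  qed
  show "\<zero>\<^bsub>RC\<^esub> = q \<zero>"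
    by (simp add: q_zero red_corner_def Let_def quot_algebra_def ring.defs FactRing_def)
  show "x \<in> carrier E \<Longrightarrow> y \<in> carrier E \<Longrightarrow> q x \<oplus>\<^bsub>RC\<^esub> q y = q (x \<oplus> y)"
    by (simp add: q_add red_corner_def Let_def quot_algebra_def ring.defs FactRing_def)
  assume r: "r \<in> carrier R" and x: "x \<in> carrier E"
  \<comment> \<open>With \<open>a = j + r\<close> and \<open>y = k + x\<close>, the elements
    \<open>a y\<close> and \<open>r x\<close> differ by \<open>j y + r k\<close>, which lies in
    \<open>J E\<close>.\<close>
  have eq: "q (a \<odot> y) = q (r \<odot> x)" if "a \<in> J +>\<^bsub>R\<^esub> r" "y \<in> q x" for a y
  proof -
    obtain j where j: "j \<in> J" "a = j \<oplus>\<^bsub>R\<^esub> r" using \<open>a \<in> J +>\<^bsub>R\<^esub> r\<close> by (auto simp: a_r_coset_def')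
    obtain k where k: "k \<in> ideal_smul J E" "y = k \<oplus> x" using \<open>y \<in> q x\<close> by (auto simp: a_r_coset_def')
    have jR: "j \<in> carrier R" and kE: "k \<in> carrier E" using J.Icarr[OF j(1)] JE.Icarr[OF k(1)] by blast+
    let ?z = "j \<odot> y \<oplus> r \<odot> k"
    have z: "?z \<in> ideal_smul J E"
      using E.ideal_smul_closed(2)[OF J_subset E.ideal_smul_incl[OF j(1)] E.ideal_smul_smult[OF J_ideal r k(1)]] k(2) kE x by simp
    have "a \<odot> y = ?z \<oplus> r \<odot> x"
    proof -
      have y: "y \<in> carrier E" "r \<odot> y = r \<odot> k \<oplus> r \<odot> x" using k(2) kE x r by (simp_all add: E.smult_r_distr)
      have "a \<odot> y = j \<odot> y \<oplus> r \<odot> y" unfolding j(2) by (rule E.smult_l_distr[OF jR r y(1)])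
      then show ?thesis unfolding y(2) using jR r kE x y(1) by (simp add: E.M.a_assoc)
    qed
    then have "a \<odot> y \<in> q (r \<odot> x)" using z by (auto simp: a_r_coset_def')
    then show ?thesis using JE.a_repr_independence'[of "a \<odot> y" "r \<odot> x"] r x by simp
  qed
  have ne: "r \<in> J +>\<^bsub>R\<^esub> r" "x \<in> q x" using J.a_rcos_self[OF r] JE.a_rcos_self[OF x] .
  have "(J +>\<^bsub>R\<^esub> r) \<odot>\<^bsub>RC\<^esub> q x = (\<Union>a \<in> J +>\<^bsub>R\<^esub> r. \<Union>y \<in> q x. q (a \<odot> y))"
    by (simp add: red_corner_def Let_def quot_algebra_def ring.defs module.defs)
  also have "\<dots> = (\<Union>a \<in> J +>\<^bsub>R\<^esub> r. \<Union>y \<in> q x. q (r \<odot> x))" by (intro SUP_cong refl eq)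
  also have "\<dots> = q (r \<odot> x)" using ne by blast
  finally show "(J +>\<^bsub>R\<^esub> r) \<odot>\<^bsub>RC\<^esub> q x = q (r \<odot> x)" .
qed

lemma RC_module: "module Rq RC"
proof (rule moduleI[OF Rq_cring])
  note S = RC_simps and O = off_diagonal_closed
  show "abelian_group RC"
  proof (rule abelian_groupI)
    show "\<exists>y \<in> carrier RC. y \<oplus>\<^bsub>RC\<^esub> c = \<zero>\<^bsub>RC\<^esub>" if c: "c \<in> carrier RC" for c
    proof -
      obtain x where x: "x \<in> off_diagonal" "c = q x" using c unfolding S(1) by blast
      show ?thesis
        by (rule bexI[of _ "q (\<ominus> x)"]) (use x O(1)[OF x(1)] O(4)[OF x(1)] in \<open>auto simp: S E.M.l_neg\<close>)
    qed
  qed (use O in \<open>auto simp: S E.M.a_ac\<close>)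
qed (use off_diagonal_closed in \<open>auto simp: RC_simps Rq_simps E.smult_l_distr E.smult_r_distr E.smult_assoc1\<close>)

end

section \<open>From homomorphisms to extension classes\<close>

locale hom_ext =
  ext_setup G \<chi>b1 \<chi>b2 R E \<rho> D e1 e2 p T C A \<chi>1 \<chi>2 F W red
    "\<lambda>r. \<phi> (reducibility_ideal R E e1 e2 +>\<^bsub>R\<^esub> r)"
  for G :: "'g monoid" and \<chi>b1 \<chi>b2 :: "'g \<Rightarrow> 'f" and R :: "('u, 'w, 'f) coef"
    and E :: "('u, 'u) module" and \<rho> :: "'g \<Rightarrow> 'u" and D :: "('u, 'u, 'u) law" and e1 e2 :: 'u
    and p :: nat and T :: "'g topology" and C :: "'g fin_class" and A :: "('u, 'w, 'f) coef" (structure)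
    and \<chi>1 \<chi>2 :: "'g \<Rightarrow> 'u" and F :: "'f ring" and W :: "'w ring" and red :: "'w \<Rightarrow> 'f"
    and \<phi> :: "'u set \<Rightarrow> 'u" +
  assumes \<phi>_hom: "\<phi> \<in> ring_hom (quot_coef R (reducibility_ideal R E e1 e2)) A"
begin

abbreviation "\<psi> \<equiv> \<lambda>r. \<phi> (J +>\<^bsub>R\<^esub> r)"
abbreviation "N \<equiv> base_change Rq RC A \<phi>"

lemma RC_scalar_ext: "scalar_ext Rq RC A \<phi>"
  by (intro scalar_ext.intro RC_module A scalar_ext_axioms.intro \<phi>_hom)

interpretation Z: scalar_ext Rq RC A \<phi> by (rule RC_scalar_ext)

abbreviation off :: "'u \<Rightarrow> 'u" where "off x \<equiv> e1 \<otimes>\<^bsub>E\<^esub> x \<otimes>\<^bsub>E\<^esub> e2"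

lemma off_add: "x \<in> carrier E \<Longrightarrow> y \<in> carrier E \<Longrightarrow> off (x \<oplus>\<^bsub>E\<^esub> y) = off x \<oplus>\<^bsub>E\<^esub> off y"
  by (simp add: Er.l_distr Er.r_distr)

text \<open>The upper right entry of a product of matrices, obtained by inserting
  \<open>e1 + e2\<close>. It is the source of the derivation rule for
  \<open>hom_der\<close>.\<close>

lemma off_mult:
  assumes x: "x \<in> carrier E" and y: "y \<in> carrier E"
  shows "off (x \<otimes>\<^bsub>E\<^esub> y) = c1 x \<odot>\<^bsub>E\<^esub> off y \<oplus>\<^bsub>E\<^esub> c2 y \<odot>\<^bsub>E\<^esub> off x"
proof -
  have "off (x \<otimes>\<^bsub>E\<^esub> y) = e1 \<otimes>\<^bsub>E\<^esub> x \<otimes>\<^bsub>E\<^esub> (e1 \<otimes>\<^bsub>E\<^esub> y \<oplus>\<^bsub>E\<^esub> e2 \<otimes>\<^bsub>E\<^esub> y) \<otimes>\<^bsub>E\<^esub> e2"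
    using x y by (simp add: e_decomp(1)[OF y] Er.m_assoc)
  also have "\<dots> = (e1 \<otimes>\<^bsub>E\<^esub> x \<otimes>\<^bsub>E\<^esub> e1) \<otimes>\<^bsub>E\<^esub> (y \<otimes>\<^bsub>E\<^esub> e2) \<oplus>\<^bsub>E\<^esub> (e1 \<otimes>\<^bsub>E\<^esub> x) \<otimes>\<^bsub>E\<^esub> (e2 \<otimes>\<^bsub>E\<^esub> y \<otimes>\<^bsub>E\<^esub> e2)"
    using x y by (simp add: Er.l_distr Er.r_distr Er.m_assoc)
  also have "\<dots> = c1 x \<odot>\<^bsub>E\<^esub> off y \<oplus>\<^bsub>E\<^esub> c2 y \<odot>\<^bsub>E\<^esub> off x"
    unfolding c1(2)[OF x, symmetric] c2(2)[OF y, symmetric] using x y by (simp add: Er.m_assoc)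
  finally show ?thesis .
qed

lemma off_off: "x \<in> carrier E \<Longrightarrow> off (off x) = off x"
  by (simp add: Er.m_assoc)

definition hom_der :: "((('u set) \<times> 'u \<Rightarrow>\<^sub>0 int) set \<Rightarrow> 'm) \<Rightarrow> 'u \<Rightarrow> 'm" where
  "hom_der H x = H (pure Rq RC A \<phi> (q (off x)) \<one>)"

lemma q_off_closed: "x \<in> carrier E \<Longrightarrow> q (off x) \<in> carrier RC"
  unfolding RC_simps(1) by (rule imageI[OF off_diagonal_closed(6)])

lemma pure_off_closed: "x \<in> carrier E \<Longrightarrow> a \<in> carrier A \<Longrightarrow> Z.pu (q (off x)) a \<in> carrier N"
  by (rule Z.pure_closed[OF q_off_closed])

lemma hom_der:
  assumes M: "module A M" and H: "H \<in> mod_hom A N M"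
  shows "der M \<psi> (hom_der H)" "x \<in> carrier E \<Longrightarrow> hom_der H x = hom_der H (off x)"
proof -
  interpret M: module A M by (rule M)
  note HD = mod_homD[OF H]
  have cl: "hom_der H x \<in> carrier M" if "x \<in> carrier E" for x
    unfolding hom_der_def by (rule HD(1)[OF pure_off_closed[OF that A.one_closed]])
  have add: "H (Z.pu (q (y \<oplus>\<^bsub>E\<^esub> z)) \<one>) = H (Z.pu (q y) \<one>) \<oplus>\<^bsub>M\<^esub> H (Z.pu (q z) \<one>)"
    if "y \<in> off_diagonal" "z \<in> off_diagonal" for y z
  proof -
    have qc: "q y \<in> carrier RC" "q z \<in> carrier RC" using that by (simp_all add: RC_simps(1))
    have "q (y \<oplus>\<^bsub>E\<^esub> z) = q y \<oplus>\<^bsub>RC\<^esub> q z" using that off_diagonal_closed(1) by (simp add: RC_simps(3))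
    then show ?thesis
      using Z.pure_add_l[OF qc A.one_closed] HD(2)[OF Z.pure_closed[OF qc(1) A.one_closed] Z.pure_closed[OF qc(2) A.one_closed]] by simp
  qed
  have smult: "H (Z.pu (q (r \<odot>\<^bsub>E\<^esub> y)) \<one>) = \<psi> r \<odot>\<^bsub>M\<^esub> H (Z.pu (q y) \<one>)"
    if "r \<in> carrier R" "y \<in> off_diagonal" for r y
  proof -
    have qc: "q y \<in> carrier RC" using that by (simp add: RC_simps(1))
    have r: "J +>\<^bsub>R\<^esub> r \<in> carrier Rq" using that by (simp add: Rq_simps(1))
    have p: "\<psi> r \<in> carrier A" using Z.k_closed[OF r] .
    have "Z.pu (q (r \<odot>\<^bsub>E\<^esub> y)) \<one> = Z.pu ((J +>\<^bsub>R\<^esub> r) \<odot>\<^bsub>RC\<^esub> q y) \<one>"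
      using that off_diagonal_closed(1) by (simp add: RC_simps(4))
    also have "\<dots> = \<psi> r \<odot>\<^bsub>N\<^esub> Z.pu (q y) \<one>"
      unfolding Z.pure_balanced[OF r qc A.one_closed] Z.smult_pure[OF p qc A.one_closed] ..
    finally show ?thesis using HD(3)[OF p Z.pure_closed[OF qc A.one_closed]] by simp
  qed
  note O = off_diagonal_closed
  show "der M \<psi> (hom_der H)"
    unfolding der_def
  proof (intro conjI ballI)
    show "hom_der H \<in> carrier E \<rightarrow> carrier M" using cl by simp
    fix x y assume x: "x \<in> carrier E"
    show "hom_der H (r \<odot>\<^bsub>E\<^esub> x) = \<psi> r \<odot>\<^bsub>M\<^esub> hom_der H x" if "r \<in> carrier R" for r
      using smult[OF that O(6)[OF x]] that x by (simp add: hom_der_def)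
    assume y: "y \<in> carrier E"
    show "hom_der H (x \<oplus>\<^bsub>E\<^esub> y) = hom_der H x \<oplus>\<^bsub>M\<^esub> hom_der H y"
      unfolding hom_der_def off_add[OF x y] by (rule add[OF O(6)[OF x] O(6)[OF y]])
    show "hom_der H (x \<otimes>\<^bsub>E\<^esub> y) = \<psi> (c1 x) \<odot>\<^bsub>M\<^esub> hom_der H y \<oplus>\<^bsub>M\<^esub> \<psi> (c2 y) \<odot>\<^bsub>M\<^esub> hom_der H x"
      unfolding hom_der_def off_mult[OF x y]
        add[OF O(5)[OF c_closed(1)[OF x] O(6)[OF y]] O(5)[OF c_closed(2)[OF y] O(6)[OF x]]]
        smult[OF c_closed(1)[OF x] O(6)[OF y]] smult[OF c_closed(2)[OF y] O(6)[OF x]] ..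
  qed
  show "x \<in> carrier E \<Longrightarrow> hom_der H x = hom_der H (off x)" by (simp add: hom_der_def off_off)
qed

text \<open>A pure tensor \<open>y \<otimes> a\<close> is \<open>a\<close> times
  \<open>y \<otimes> 1\<close>, and every element of the reduced corner is the class of an element
  equal to its own upper right corner.\<close>

lemma hom_der_inj:
  assumes M: "module A M" and H: "H \<in> mod_hom A N M" and K: "K \<in> mod_hom A N M"
    and eq: "\<And>x. x \<in> carrier E \<Longrightarrow> hom_der H x = hom_der K x" and c: "c \<in> carrier N"
  shows "H c = K c"
proof (rule Z.additive_eqI[OF _ _ _ mod_homD(2)[OF H] mod_homD(2)[OF K] _ c])
  interpret M: module A M by (rule M)
  show "abelian_group M" by (rule M.abelian_group_axioms)
  show "H \<in> carrier N \<rightarrow> carrier M" "K \<in> carrier N \<rightarrow> carrier M"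
    using mod_homD(1)[OF H] mod_homD(1)[OF K] by blast+
  fix y a assume y: "y \<in> carrier RC" and a: "a \<in> carrier A"
  obtain x where x: "x \<in> off_diagonal" "y = q x" using y unfolding RC_simps(1) by blast
  have xE: "x \<in> carrier E" "off x = x" using x(1) by (simp_all add: off_diagonal_def)
  have pc: "Z.pu y \<one> \<in> carrier N" by (rule Z.pure_closed[OF y A.one_closed])
  have "Z.pu y a = a \<odot>\<^bsub>N\<^esub> Z.pu y \<one>" using Z.smult_pure[OF a y A.one_closed] a by simp
  moreover have "H (Z.pu y \<one>) = K (Z.pu y \<one>)" using eq[OF xE(1)] unfolding hom_der_def xE(2) x(2) .
  ultimately show "H (Z.pu y a) = K (Z.pu y a)" using mod_homD(3)[OF H a pc] mod_homD(3)[OF K a pc] by simp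
qed

text \<open>A derivation along \<open>\<psi>\<close> kills \<open>J E\<close> because
  \<open>\<psi>\<close> kills \<open>J\<close>. It therefore descends to a map
  \<open>\<gamma>\<close> on the reduced corner, and
  \<open>c \<otimes> a \<mapsto> a \<gamma> c\<close> is balanced.\<close>

lemma hom_der_surj:
  assumes M: "module A M" and \<beta>: "der M \<psi> \<beta>" and norm: "\<And>x. x \<in> carrier E \<Longrightarrow> \<beta> x = \<beta> (off x)"
  obtains H where "H \<in> mod_hom A N M" "H \<in> extensional (carrier N)"
    "\<And>x. x \<in> carrier E \<Longrightarrow> hom_der H x = \<beta> x"
proof -
  interpret M: module A M by (rule M)
  note \<beta>D = derD[OF \<beta>]
  have zero: "\<beta> \<zero>\<^bsub>E\<^esub> = \<zero>\<^bsub>M\<^esub>"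
    by (rule additive_zero[OF E.abelian_group_axioms M.abelian_group_axioms]) (use \<beta>D in auto)
  have minus: "\<beta> (\<ominus>\<^bsub>E\<^esub> x) = \<ominus>\<^bsub>M\<^esub> \<beta> x" if "x \<in> carrier E" for x
    by (rule additive_minus[OF E.abelian_group_axioms M.abelian_group_axioms _ _ that]) (use \<beta>D in auto)
  have kill: "\<beta> x = \<zero>\<^bsub>M\<^esub>" if "x \<in> ideal_smul J E" for x
  proof -
    have "ideal_smul J E \<subseteq> {x \<in> carrier E. \<beta> x = \<zero>\<^bsub>M\<^esub>}"
    proof (rule E.ideal_smul_minimal)
      show "subgroup {x \<in> carrier E. \<beta> x = \<zero>\<^bsub>M\<^esub>} (add_monoid E)"
        by (rule subgroup.intro) (auto simp: zero minus \<beta>D(2) a_inv_def[symmetric])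
      fix j x assume j: "j \<in> J" and x: "x \<in> carrier E"
      have jR: "j \<in> carrier R" using j J_subset by blast
      then show "j \<odot>\<^bsub>E\<^esub> x \<in> {x \<in> carrier E. \<beta> x = \<zero>\<^bsub>M\<^esub>}"
        using \<beta>D(3)[OF jR x] goodD(3)[OF good_\<psi> j] \<beta>D(1)[OF x] x by simp
    qed
    then show ?thesis using that by blast
  qed
  \<comment> \<open>The descent chooses a representative in \<open>E\<close>; vanishing on
    \<open>J E\<close> makes the value independent of the choice.\<close>
  define \<gamma> where "\<gamma> c = \<beta> (SOME x. x \<in> carrier E \<and> q x = c)" for c
  have \<gamma>: "\<gamma> (q x) = \<beta> x" if x: "x \<in> carrier E" for x
  proof -
    let ?y = "SOME y. y \<in> carrier E \<and> q y = q x"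
    have y: "?y \<in> carrier E \<and> q ?y = q x" by (rule someI[of _ x]) (use x in simp)
    then have "\<beta> (?y \<ominus>\<^bsub>E\<^esub> x) = \<zero>\<^bsub>M\<^esub>" using q_eq[of ?y x] x kill by blast
    then have "\<beta> ?y \<ominus>\<^bsub>M\<^esub> \<beta> x = \<zero>\<^bsub>M\<^esub>" using der_minus[OF M \<beta>] y x by simp
    then show ?thesis
      unfolding \<gamma>_def using M.add_minus_cancel[OF \<beta>D(1)[of ?y] \<beta>D(1)[OF x]] y \<beta>D(1)[OF x] by simp
  qed
  have rep: "\<exists>x \<in> carrier E. c = q x" if "c \<in> carrier RC" for c
    using that off_diagonal_closed(1) unfolding RC_simps(1) by blast
  have \<gamma>c: "\<gamma> c \<in> carrier M" if "c \<in> carrier RC" for c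
    using rep[OF that] \<gamma> \<beta>D(1) by auto
  have u2: "\<gamma> (c \<oplus>\<^bsub>RC\<^esub> d) = \<gamma> c \<oplus>\<^bsub>M\<^esub> \<gamma> d" if "c \<in> carrier RC" "d \<in> carrier RC" for c d
    using rep[OF that(1)] rep[OF that(2)] by (auto simp: RC_simps(3) \<gamma> \<beta>D)
  have u4: "\<gamma> (r \<odot>\<^bsub>RC\<^esub> c) = \<phi> r \<odot>\<^bsub>M\<^esub> \<gamma> c" if "r \<in> carrier Rq" "c \<in> carrier RC" for r c
    using rep[OF that(2)] that(1) by (auto simp: Rq_simps(1) RC_simps(4) \<gamma> \<beta>D)
  obtain h where h: "h \<in> carrier N \<rightarrow> carrier M"
    "\<And>c d. c \<in> carrier N \<Longrightarrow> d \<in> carrier N \<Longrightarrow> h (c \<oplus>\<^bsub>N\<^esub> d) = h c \<oplus>\<^bsub>M\<^esub> h d"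
    "\<And>c a. c \<in> carrier RC \<Longrightarrow> a \<in> carrier A \<Longrightarrow> h (Z.pu c a) = a \<odot>\<^bsub>M\<^esub> \<gamma> c"
  proof (rule Z.universal[of M "\<lambda>c a. a \<odot>\<^bsub>M\<^esub> \<gamma> c"])
    show "abelian_group M" by (rule M.abelian_group_axioms)
    show "a \<odot>\<^bsub>M\<^esub> \<gamma> (r \<odot>\<^bsub>RC\<^esub> c) = (\<phi> r \<otimes> a) \<odot>\<^bsub>M\<^esub> \<gamma> c"
      if "r \<in> carrier Rq" "c \<in> carrier RC" "a \<in> carrier A" for r c a
    proof -
      have r: "\<phi> r \<in> carrier A" by (rule Z.k_closed[OF that(1)])
      show ?thesis unfolding u4[OF that(1,2)] A.m_comm[OF r that(3)] by (rule M.smult_assoc1[symmetric, OF that(3) r \<gamma>c[OF that(2)]])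
    qed
  qed (use that in \<open>simp_all add: \<gamma>c u2 M.smult_r_distr M.smult_l_distr\<close>)
  let ?H = "restrict h (carrier N)"
  have hs: "h (a \<odot>\<^bsub>N\<^esub> c) = a \<odot>\<^bsub>M\<^esub> h c" if a: "a \<in> carrier A" and c: "c \<in> carrier N" for a c
  proof (rule Z.additive_eqI[of M "\<lambda>c. h (a \<odot>\<^bsub>N\<^esub> c)" "\<lambda>c. a \<odot>\<^bsub>M\<^esub> h c"])
    have hc: "h c \<in> carrier M" if "c \<in> carrier N" for c using h(1) that by blast
    show "(\<lambda>c. h (a \<odot>\<^bsub>N\<^esub> c)) \<in> carrier N \<rightarrow> carrier M"
      by (rule funcsetI) (rule hc[OF Z.MB_smult_closed[OF a]])
    show "(\<lambda>c. a \<odot>\<^bsub>M\<^esub> h c) \<in> carrier N \<rightarrow> carrier M"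
      by (rule funcsetI) (rule M.smult_closed[OF a hc])
    show "h (a \<odot>\<^bsub>N\<^esub> (c \<oplus>\<^bsub>N\<^esub> d)) = h (a \<odot>\<^bsub>N\<^esub> c) \<oplus>\<^bsub>M\<^esub> h (a \<odot>\<^bsub>N\<^esub> d)" if "c \<in> carrier N" "d \<in> carrier N" for c d
      unfolding Z.MB_smult_add[OF a that] by (rule h(2)[OF Z.MB_smult_closed[OF a that(1)] Z.MB_smult_closed[OF a that(2)]])
    show "a \<odot>\<^bsub>M\<^esub> h (c \<oplus>\<^bsub>N\<^esub> d) = a \<odot>\<^bsub>M\<^esub> h c \<oplus>\<^bsub>M\<^esub> a \<odot>\<^bsub>M\<^esub> h d" if "c \<in> carrier N" "d \<in> carrier N" for c d
      unfolding h(2)[OF that] by (rule M.smult_r_distr[OF a hc[OF that(1)] hc[OF that(2)]])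
    show "h (a \<odot>\<^bsub>N\<^esub> Z.pu c b) = a \<odot>\<^bsub>M\<^esub> h (Z.pu c b)" if "c \<in> carrier RC" "b \<in> carrier A" for c b
      unfolding Z.smult_pure[OF a that] h(3)[OF that] h(3)[OF that(1) A.m_closed[OF a that(2)]]
      by (rule M.smult_assoc1[OF a that(2) \<gamma>c[OF that(1)]])
  qed (use c M.abelian_group_axioms in simp_all)
  have H: "?H \<in> mod_hom A N M"
  proof (rule mod_homI)
    show "?H c \<in> carrier M" if "c \<in> carrier N" for c using h(1) that by auto
    show "?H (c \<oplus>\<^bsub>N\<^esub> d) = ?H c \<oplus>\<^bsub>M\<^esub> ?H d" if "c \<in> carrier N" "d \<in> carrier N" for c d
      using h(2)[OF that] Z.MB.a_closed[OF that] that by simp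
    show "?H (a \<odot>\<^bsub>N\<^esub> c) = a \<odot>\<^bsub>M\<^esub> ?H c" if "a \<in> carrier A" "c \<in> carrier N" for a c
      using hs[OF that] Z.MB_smult_closed[OF that] that by simp
  qed
  show thesis
  proof (rule that[OF H restrict_extensional])
    fix x assume x: "x \<in> carrier E"
    have "hom_der ?H x = h (Z.pu (q (off x)) \<one>)"
      unfolding hom_der_def using pure_off_closed[OF x A.one_closed] by simp
    also have "\<dots> = \<gamma> (q (off x))" using h(3)[OF q_off_closed[OF x] A.one_closed] \<gamma>c[OF q_off_closed[OF x]] by simp
    also have "\<dots> = \<beta> x" using \<gamma>[of "off x"] norm[OF x] x by simp
    finally show "hom_der ?H x = \<beta> x" .
  qed
qed

interpretation Z: scalar_ext Rq RC A \<phi> by (rule RC_scalar_ext)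

text \<open>Cocycles are total functions whose values matter on the carrier of \<open>G\<close>;
  agreement there is the case of the zero coboundary.\<close>

lemma ext_class_cong:
  assumes M: "module A M" and b: "cocycle M b" and b': "cocycle M b'"
    and eq: "\<And>g. g \<in> carrier G \<Longrightarrow> b g = b' g"
  shows "ext_class M b = ext_class M b'"
proof -
  interpret M: module A M by (rule M)
  show ?thesis
    by (rule ext_class_eqI[OF M b b' M.M.zero_closed])
      (use eq cocycleD(1)[OF b'] in \<open>simp add: M.smult_r_null\<close>)
qed

text \<open>The condition is demanded of every representative of the class, and it passes along
  isomorphisms of extensions.\<close>

lemma ext_class_in_Ext1_C:
  assumes M: "module A M" and b: "cocycle M b" and s: "satisfies G C A (VE M b)"
  shows "ext_class M b \<in> carrier (Ext1_C G T C A V1 (V2 M))"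
proof -
  have lin: "lin_action G A (VE M b)" by (rule AG_module_lin_action[OF VE_AG_module[OF M b] max])
  have "satisfies G C A V" if e: "(V, i, j) \<in> ext_class M b" for V i j
  proof -
    obtain \<theta> where \<theta>: "(V, i, j) \<in> extensions G T A V1 (V2 M)" "\<theta> \<in> AG_hom G A (VE M b) V"
      "bij_betw \<theta> (carrier (VE M b)) (carrier V)"
      using ext_relD[OF e[unfolded ext_class_iff]] by metis
    show ?thesis
      by (rule satisfies_surj[OF lin s AG_module_lin_action[OF extensionsD(1)[OF \<theta>(1)] max] \<theta>(2)
          bij_betw_imp_surj_on[OF \<theta>(3)]])
  qed
  then show ?thesis using ext_class_in_Ext1[OF M b] by (auto simp: Ext1_C_def)
qed

definition hom_ext_map :: "('u, 'm) module \<Rightarrow> (('u set \<times> 'u \<Rightarrow>\<^sub>0 int) set \<Rightarrow> 'm) \<Rightarrow> ('u, 'm, 'u, 'g) extension set" where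
  "hom_ext_map M H = ext_class M (\<lambda>g. hom_der H (\<rho> g))"

lemma hom_cocycle:
  assumes "module A M" "H \<in> mod_hom A N M"
  shows "cocycle M (\<lambda>g. hom_der H (\<rho> g))"
  by (rule der_cocycle[OF assms(1) good_\<psi> hom_der(1)[OF assms]])

lemma hom_ext_map_eqI:
  assumes M: "module A M" and H: "H \<in> mod_hom A N M" and b: "cocycle M b"
    and eq: "\<And>x. x \<in> carrier E \<Longrightarrow> hom_der H x = \<beta> x" and b_eq: "b = (\<lambda>g. \<beta> (\<rho> g))"
  shows "hom_ext_map M H = ext_class M b"
  unfolding hom_ext_map_def by (rule ext_class_cong[OF M hom_cocycle[OF M H] b]) (use eq b_eq in simp)

text \<open>Linearity is the computation of Baer sums and pushforwards on cocycles. For bijectivity,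
  homomorphisms correspond to normalized derivations, and these to the classes satisfying the
  condition.\<close>

lemma hom_ext_map_iso:
  assumes fg: "fg_module A M"
  shows "hom_ext_map M \<in> mod_iso A (Hom_module A N M) (Ext1_C G T C A V1 (V2 M))"
proof -
  have M: "module A M" using fg by (simp add: fg_module_def)
  interpret M: module A M by (rule M)
  have carr: "H \<in> carrier (Hom_module A N M) \<longleftrightarrow> H \<in> mod_hom A N M \<and> H \<in> extensional (carrier N)" for H
    by (simp add: Hom_module_def)
  have pc: "pure Rq RC A \<phi> (q (off x)) \<one> \<in> carrier N" if "x \<in> carrier E" for x
    by (rule pure_off_closed[OF that A.one_closed])
  have closed: "hom_ext_map M H \<in> carrier (Ext1_C G T C A V1 (V2 M))" if H: "H \<in> mod_hom A N M" for H
    unfolding hom_ext_map_def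
    by (rule ext_class_in_Ext1_C[OF M hom_cocycle[OF M H] der_satisfies[OF fg good_\<psi> hom_der(1)[OF M H]]])
  have "hom_ext_map M \<in> mod_hom A (Hom_module A N M) (Ext1_C G T C A V1 (V2 M))"
  proof (rule mod_homI)
    show "hom_ext_map M H \<in> carrier (Ext1_C G T C A V1 (V2 M))" if "H \<in> carrier (Hom_module A N M)" for H
      using closed that carr by blast
    show "hom_ext_map M (H \<oplus>\<^bsub>Hom_module A N M\<^esub> K) = hom_ext_map M H \<oplus>\<^bsub>Ext1_C G T C A V1 (V2 M)\<^esub> hom_ext_map M K"
      if HK: "H \<in> carrier (Hom_module A N M)" "K \<in> carrier (Hom_module A N M)" for H K
    proof -
      have H: "H \<in> mod_hom A N M" and K: "K \<in> mod_hom A N M" using HK carr by blast+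
      let ?S = "\<lambda>x \<in> carrier N. H x \<oplus>\<^bsub>M\<^esub> K x"
      have S: "?S \<in> mod_hom A N M"
      proof (rule mod_homI)
        show "?S c \<in> carrier M" if "c \<in> carrier N" for c
          using mod_homD(1)[OF H that] mod_homD(1)[OF K that] that by simp
        show "?S (c \<oplus>\<^bsub>N\<^esub> d) = ?S c \<oplus>\<^bsub>M\<^esub> ?S d" if c: "c \<in> carrier N" "d \<in> carrier N" for c d
        proof -
          have "?S (c \<oplus>\<^bsub>N\<^esub> d) = (H c \<oplus>\<^bsub>M\<^esub> H d) \<oplus>\<^bsub>M\<^esub> (K c \<oplus>\<^bsub>M\<^esub> K d)"
            unfolding mod_homD(2)[OF H c, symmetric] mod_homD(2)[OF K c, symmetric] using Z.MB.a_closed[OF c] by (rule restrict_apply')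
          also have "\<dots> = (H c \<oplus>\<^bsub>M\<^esub> K c) \<oplus>\<^bsub>M\<^esub> (H d \<oplus>\<^bsub>M\<^esub> K d)"
            by (intro M.M.add_interchange mod_homD(1)[OF H] mod_homD(1)[OF K] c)
          also have "\<dots> = ?S c \<oplus>\<^bsub>M\<^esub> ?S d" unfolding restrict_apply'[OF c(1)] restrict_apply'[OF c(2)] ..
          finally show ?thesis .
        qed
        show "?S (a \<odot>\<^bsub>N\<^esub> c) = a \<odot>\<^bsub>M\<^esub> ?S c" if a: "a \<in> carrier A" "c \<in> carrier N" for a c
          unfolding restrict_apply'[OF a(2)] restrict_apply'[OF Z.MB_smult_closed[OF a]] mod_homD(3)[OF H a] mod_homD(3)[OF K a]
          by (rule M.smult_r_distr[symmetric, OF a(1) mod_homD(1)[OF H a(2)] mod_homD(1)[OF K a(2)]])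
      qed
      note b = hom_cocycle[OF M H] hom_cocycle[OF M K]
      have "hom_ext_map M (H \<oplus>\<^bsub>Hom_module A N M\<^esub> K) = hom_ext_map M ?S" by (simp add: Hom_module_def)
      also have "\<dots> = ext_class M (\<lambda>g. hom_der H (\<rho> g) \<oplus>\<^bsub>M\<^esub> hom_der K (\<rho> g))"
        by (rule hom_ext_map_eqI[OF M S cocycle_add[OF M b], where \<beta> = "\<lambda>x. hom_der H x \<oplus>\<^bsub>M\<^esub> hom_der K x"])
          (simp_all only: hom_der_def restrict_apply'[OF pc])
      also have "\<dots> = hom_ext_map M H \<oplus>\<^bsub>Ext1_C G T C A V1 (V2 M)\<^esub> hom_ext_map M K"
        unfolding hom_ext_map_def using baer_sum_class[OF M b] by (simp add: Ext1_C_def Ext1_def)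
      finally show ?thesis .
    qed
    show "hom_ext_map M (a \<odot>\<^bsub>Hom_module A N M\<^esub> H) = a \<odot>\<^bsub>Ext1_C G T C A V1 (V2 M)\<^esub> hom_ext_map M H"
      if a: "a \<in> carrier A" and "H \<in> carrier (Hom_module A N M)" for a H
    proof -
      have H: "H \<in> mod_hom A N M" using that carr by blast
      let ?S = "\<lambda>x \<in> carrier N. a \<odot>\<^bsub>M\<^esub> H x"
      have m: "(\<lambda>x. a \<odot>\<^bsub>M\<^esub> x) \<in> mod_hom A M M"
      proof (rule mod_homI)
        show "a \<odot>\<^bsub>M\<^esub> (r \<odot>\<^bsub>M\<^esub> x) = r \<odot>\<^bsub>M\<^esub> (a \<odot>\<^bsub>M\<^esub> x)" if "r \<in> carrier A" "x \<in> carrier M" for r x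
          using that a by (simp add: M.smult_assoc1[symmetric] A.m_comm)
      qed (use a in \<open>simp_all add: M.smult_r_distr\<close>)
      have S: "?S \<in> mod_hom A N M"
      proof (rule mod_homI)
        show "?S c \<in> carrier M" if "c \<in> carrier N" for c
          using mod_homD(1)[OF H that] a that by simp
        show "?S (c \<oplus>\<^bsub>N\<^esub> d) = ?S c \<oplus>\<^bsub>M\<^esub> ?S d" if c: "c \<in> carrier N" "d \<in> carrier N" for c d
          unfolding restrict_apply'[OF c(1)] restrict_apply'[OF c(2)] restrict_apply'[OF Z.MB.a_closed[OF c]] mod_homD(2)[OF H c]
          by (rule M.smult_r_distr[OF a mod_homD(1)[OF H c(1)] mod_homD(1)[OF H c(2)]])
        show "?S (r \<odot>\<^bsub>N\<^esub> c) = r \<odot>\<^bsub>M\<^esub> ?S c" if c: "r \<in> carrier A" "c \<in> carrier N" for r c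
          unfolding restrict_apply'[OF c(2)] restrict_apply'[OF Z.MB_smult_closed[OF c]] mod_homD(3)[OF H c]
          by (rule mod_homD(3)[OF m c(1) mod_homD(1)[OF H c(2)]])
      qed
      note b = hom_cocycle[OF M H]
      have "hom_ext_map M (a \<odot>\<^bsub>Hom_module A N M\<^esub> H) = hom_ext_map M ?S" by (simp add: Hom_module_def)
      also have "\<dots> = ext_class M (\<lambda>g. a \<odot>\<^bsub>M\<^esub> hom_der H (\<rho> g))"
        by (rule hom_ext_map_eqI[OF M S cocycle_map[OF M M b m], where \<beta> = "\<lambda>x. a \<odot>\<^bsub>M\<^esub> hom_der H x"])
          (simp_all only: hom_der_def restrict_apply'[OF pc])
      also have "\<dots> = a \<odot>\<^bsub>Ext1_C G T C A V1 (V2 M)\<^esub> hom_ext_map M H"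
        unfolding hom_ext_map_def using ext_push_class[OF M M b m] by (simp add: Ext1_C_def Ext1_def)
      finally show ?thesis .
    qed
  qed
  moreover have "bij_betw (hom_ext_map M) (carrier (Hom_module A N M)) (carrier (Ext1_C G T C A V1 (V2 M)))"
    unfolding bij_betw_def
  proof (intro conjI inj_onI subset_antisym subsetI)
    fix H K assume "H \<in> carrier (Hom_module A N M)" "K \<in> carrier (Hom_module A N M)"
      and eq: "hom_ext_map M H = hom_ext_map M K"
    then have H: "H \<in> mod_hom A N M" "H \<in> extensional (carrier N)" and K: "K \<in> mod_hom A N M" "K \<in> extensional (carrier N)"
      using carr by blast+
    have d: "hom_der H x = hom_der K x" if "x \<in> carrier E" for x
      by (rule der_inj[OF fg hom_der(1)[OF M H(1)] hom_der(1)[OF M K(1)] hom_der(2)[OF M H(1)] hom_der(2)[OF M K(1)]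
          eq[unfolded hom_ext_map_def] that])
    show "H = K" by (rule extensionalityI[OF H(2) K(2) hom_der_inj[OF M H(1) K(1) d]])
  next
    fix c assume "c \<in> hom_ext_map M ` carrier (Hom_module A N M)"
    then show "c \<in> carrier (Ext1_C G T C A V1 (V2 M))" using closed carr by blast
  next
    fix c assume c: "c \<in> carrier (Ext1_C G T C A V1 (V2 M))"
    have "c \<in> carrier (Ext1 G T A V1 (V2 M))" using c by (simp add: Ext1_C_def)
    then obtain b where b: "cocycle M b" "c = ext_class M b" by (rule Ext1_ext_class[OF M])
    have "satisfies G C A (VE M b)" using c ext_class_self[OF M b(1)] b(2) by (auto simp: Ext1_C_def)
    then obtain \<beta> where \<beta>: "der M \<psi> \<beta>" "\<And>x. x \<in> carrier E \<Longrightarrow> \<beta> x = \<beta> (off x)"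
      "ext_class M b = ext_class M (\<lambda>g. \<beta> (\<rho> g))"
      using der_exists[OF fg b(1)] by metis
    obtain H where H: "H \<in> mod_hom A N M" "H \<in> extensional (carrier N)" "\<And>x. x \<in> carrier E \<Longrightarrow> hom_der H x = \<beta> x"
      using hom_der_surj[OF M \<beta>(1,2)] by metis
    have "hom_ext_map M H = ext_class M (\<lambda>g. \<beta> (\<rho> g))"
      by (rule hom_ext_map_eqI[OF M H(1) der_cocycle[OF M good_\<psi> \<beta>(1)] H(3) refl])
    then show "c \<in> hom_ext_map M ` carrier (Hom_module A N M)"
      using b(2) \<beta>(3) H(1,2) carr by (intro image_eqI[of _ _ H]) simp_all
  qed
  ultimately show ?thesis by (simp add: mod_iso_def)
qed

lemma hom_ext_map_natural:
  assumes M: "module A M" and M': "module A M'" and f: "f \<in> mod_hom A M M'" and H: "H \<in> mod_hom A N M"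
  shows "hom_ext_map M' (compose (carrier N) f H) = ext_push G T A V1 (V2 M) (V2 M') f (hom_ext_map M H)"
proof -
  have comp: "compose (carrier N) f H c = f (H c)" if "c \<in> carrier N" for c by (rule compose_eq[OF that])
  have S: "compose (carrier N) f H \<in> mod_hom A N M'"
  proof (rule mod_homI)
    show "compose (carrier N) f H c \<in> carrier M'" if "c \<in> carrier N" for c
      unfolding comp[OF that] by (rule mod_homD(1)[OF f mod_homD(1)[OF H that]])
    show "compose (carrier N) f H (c \<oplus>\<^bsub>N\<^esub> d) = compose (carrier N) f H c \<oplus>\<^bsub>M'\<^esub> compose (carrier N) f H d"
      if c: "c \<in> carrier N" "d \<in> carrier N" for c d
      unfolding comp[OF c(1)] comp[OF c(2)] comp[OF Z.MB.a_closed[OF c]] mod_homD(2)[OF H c]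
      by (rule mod_homD(2)[OF f mod_homD(1)[OF H c(1)] mod_homD(1)[OF H c(2)]])
    show "compose (carrier N) f H (a \<odot>\<^bsub>N\<^esub> c) = a \<odot>\<^bsub>M'\<^esub> compose (carrier N) f H c" if c: "a \<in> carrier A" "c \<in> carrier N" for a c
      unfolding comp[OF c(2)] comp[OF Z.MB_smult_closed[OF c]] mod_homD(3)[OF H c]
      by (rule mod_homD(3)[OF f c(1) mod_homD(1)[OF H c(2)]])
  qed
  note b = hom_cocycle[OF M H]
  have "hom_ext_map M' (compose (carrier N) f H) = ext_class M' (\<lambda>g. f (hom_der H (\<rho> g)))"
    by (rule hom_ext_map_eqI[OF M' S cocycle_map[OF M M' b f], where \<beta> = "\<lambda>x. f (hom_der H x)"])
      (simp_all only: hom_der_def comp[OF pure_off_closed[OF _ A.one_closed]])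
  then show ?thesis unfolding hom_ext_map_def using ext_push_class[OF M M' b f] by simp
qed

lemma hom_ext_map_natural_iso:
  "natural_Hom_Ext_iso G T C A N \<chi>2 \<chi>1 hom_ext_map"
  unfolding natural_Hom_Ext_iso_def
proof (intro conjI allI impI)
  show "hom_ext_map M \<in> mod_iso A (Hom_module A N M) (Ext1_C G T C A V1 (V2 M))" if "fg_module A M" for M
    by (rule hom_ext_map_iso[OF that])
  show "hom_ext_map M' (compose (carrier N) f H) = ext_push G T A V1 (V2 M) (V2 M') f (hom_ext_map M H)"
    if "fg_module A M \<and> fg_module A M' \<and> f \<in> mod_hom A M M' \<and> H \<in> carrier (Hom_module A N M)" for M M' f H
    by (rule hom_ext_map_natural) (use that in \<open>simp_all add: fg_module_def Hom_module_def\<close>)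
qed

end

section \<open>Exchanging the two characters\<close>

lemma specializes_to_sum_swap:
  assumes \<chi>: "\<chi>1 \<in> carrier G \<rightarrow> carrier A'" "\<chi>2 \<in> carrier G \<rightarrow> carrier A'"
  shows "specializes_to_sum G A E \<rho> D A' k \<chi>1 \<chi>2 \<longleftrightarrow> specializes_to_sum G A E \<rho> D A' k \<chi>2 \<chi>1"
proof -
  have psi: "psi_sum G \<chi>1 \<chi>2 B f s = psi_sum G \<chi>2 \<chi>1 B f s"
    if B: "comm_alg A' B f" and s: "s \<in> group_ring_carrier G B" for B f s
  proof -
    interpret B: cring B using B by (simp add: comm_alg_def)
    have f: "f \<in> ring_hom A' B" using B by (simp add: comm_alg_def)
    have "finsum B (\<lambda>g. f (\<chi> g) \<otimes>\<^bsub>B\<^esub> s g) {g \<in> carrier G. s g \<noteq> \<zero>\<^bsub>B\<^esub>} \<in> carrier B"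
      if "\<chi> \<in> carrier G \<rightarrow> carrier A'" for \<chi>
      using s ring_hom_closed[OF f] that by (auto simp: group_ring_carrier_def Pi_iff intro!: B.finsum_closed)
    from this[OF \<chi>(1)] this[OF \<chi>(2)] show ?thesis unfolding psi_sum_def by (rule B.m_comm)
  qed
  show ?thesis unfolding specializes_to_sum_def by (auto simp: psi)
qed

lemma universal_CH_rep_swap:
  assumes \<chi>: "\<chi>1 \<in> carrier G \<rightarrow> carrier F" "\<chi>2 \<in> carrier G \<rightarrow> carrier F"
    and univ: "universal_CH_rep G T C F W red \<chi>1 \<chi>2 R E \<rho> D"
  shows "universal_CH_rep G T C F W red \<chi>2 \<chi>1 R E \<rho> D"
proof -
  have eq: "CH_rep_satisfying G T C F W red \<chi>2 \<chi>1 A E' \<rho>' D' \<longleftrightarrow> CH_rep_satisfying G T C F W red \<chi>1 \<chi>2 A E' \<rho>' D'"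
    for A and E' :: "('u, 'u) module" and \<rho>' and D' :: "('u, 'u, 'u) law"
    unfolding CH_rep_satisfying_def specializes_to_sum_swap[OF \<chi>(2,1)] ..
  show ?thesis using univ unfolding universal_CH_rep_def eq .
qed

text \<open>Locality of \<open>\<phi>\<close> refers to the non-units of the quotient by
  \<open>J\<close>, so the point is that the quotient map sends non-units to non-units.\<close>

lemma (in gma) classifying_map:
  assumes R: "ideal (maxid R) R" and A: "cring A" "\<one>\<^bsub>A\<^esub> \<noteq> \<zero>\<^bsub>A\<^esub>" and \<phi>: "coef_hom W Rq A \<phi>"
  shows "coef_hom W R A (\<lambda>r. \<phi> (J +>\<^bsub>R\<^esub> r))" "r \<in> J \<Longrightarrow> \<phi> (J +>\<^bsub>R\<^esub> r) = \<zero>\<^bsub>A\<^esub>"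
proof -
  interpret J: ideal J R by (rule J_ideal)
  interpret A: cring A by (rule A)
  interpret Q: cring Rq by (rule Rq_cring)
  interpret m: ideal "maxid R" R by (rule R)
  have h: "\<phi> \<in> ring_hom Rq A" using \<phi> by (simp add: coef_hom_def)
  have Jz: "\<zero>\<^bsub>Rq\<^esub> = J" by (simp add: quot_coef_def ring.defs FactRing_def)
  show kill: "\<phi> (J +>\<^bsub>R\<^esub> r) = \<zero>\<^bsub>A\<^esub>" if "r \<in> J" for r
    using ring_hom_zero[OF h Q.ring_axioms A.ring_axioms] J.a_rcos_const[OF that] Jz by simp
  \<comment> \<open>A unit in \<open>J\<close> would put 1 into \<open>J\<close>, and then
    \<open>1 = 0\<close> in \<open>A\<close>.\<close>
  have J_max: "J \<subseteq> maxid R"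
  proof
    fix j assume j: "j \<in> J"
    have "j \<notin> Units R"
    proof
      assume u: "j \<in> Units R"
      have "\<one>\<^bsub>R\<^esub> = inv\<^bsub>R\<^esub> j \<otimes>\<^bsub>R\<^esub> j" using u by simp
      then have "\<one>\<^bsub>R\<^esub> \<in> J" using J.I_l_closed[OF j E.R.Units_inv_closed[OF u]] by simp
      then show False using kill[of "\<one>\<^bsub>R\<^esub>"] ring_hom_one[OF h] A(2) by (simp add: Rq_simps(2))
    qed
    then show "j \<in> maxid R" using J.Icarr[OF j] by (simp add: maxid_def)
  qed
  \<comment> \<open>If \<open>s r\<close> were 1 modulo \<open>J\<close>, then 1 would lie in the
    maximal ideal, which contains both \<open>r\<close> and \<open>J\<close>.\<close>
  have max: "J +>\<^bsub>R\<^esub> r \<in> maxid Rq" if r: "r \<in> maxid R" for r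
  proof -
    have rR: "r \<in> carrier R" using r by (simp add: maxid_def)
    have "J +>\<^bsub>R\<^esub> r \<notin> Units Rq"
    proof
      assume "J +>\<^bsub>R\<^esub> r \<in> Units Rq"
      then obtain c where c: "c \<in> carrier Rq" "c \<otimes>\<^bsub>Rq\<^esub> (J +>\<^bsub>R\<^esub> r) = \<one>\<^bsub>Rq\<^esub>" unfolding Units_def by blast
      obtain s where s: "s \<in> carrier R" "c = J +>\<^bsub>R\<^esub> s" using c(1) unfolding Rq_simps(1) by blast
      have "J +>\<^bsub>R\<^esub> (s \<otimes>\<^bsub>R\<^esub> r) = J +>\<^bsub>R\<^esub> \<one>\<^bsub>R\<^esub>" using c(2) s rR by (simp add: Rq_simps)
      then have "\<one>\<^bsub>R\<^esub> \<ominus>\<^bsub>R\<^esub> s \<otimes>\<^bsub>R\<^esub> r \<in> J"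
        using E.R.quotient_eq_iff_same_a_r_cos[OF J_ideal E.R.one_closed, of "s \<otimes>\<^bsub>R\<^esub> r"] s rR by simp
      then have "s \<otimes>\<^bsub>R\<^esub> r \<oplus>\<^bsub>R\<^esub> (\<one>\<^bsub>R\<^esub> \<ominus>\<^bsub>R\<^esub> s \<otimes>\<^bsub>R\<^esub> r) \<in> maxid R"
        using J_max m.I_l_closed[OF r s(1)] by (intro m.a_closed) blast+
      then have "\<one>\<^bsub>R\<^esub> \<in> maxid R" using E.R.add_minus_cancel[OF E.R.one_closed, of "s \<otimes>\<^bsub>R\<^esub> r"] s rR by simp
      then show False by (simp add: maxid_def)
    qed
    then show ?thesis using rR by (simp add: maxid_def Rq_simps(1))
  qed
  show "coef_hom W R A (\<lambda>r. \<phi> (J +>\<^bsub>R\<^esub> r))"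
    unfolding coef_hom_def
  proof (intro conjI ballI)
    have cl: "J +>\<^bsub>R\<^esub> r \<in> carrier Rq" if "r \<in> carrier R" for r using that by (simp add: Rq_simps(1))
    show "(\<lambda>r. \<phi> (J +>\<^bsub>R\<^esub> r)) \<in> ring_hom R A"
    proof (rule ring_hom_memI)
      fix r s assume r: "r \<in> carrier R"
      show "\<phi> (J +>\<^bsub>R\<^esub> r) \<in> carrier A" by (rule ring_hom_closed[OF h cl[OF r]])
      assume s: "s \<in> carrier R"
      show "\<phi> (J +>\<^bsub>R\<^esub> (r \<otimes>\<^bsub>R\<^esub> s)) = \<phi> (J +>\<^bsub>R\<^esub> r) \<otimes>\<^bsub>A\<^esub> \<phi> (J +>\<^bsub>R\<^esub> s)"
        using ring_hom_mult[OF h cl[OF r] cl[OF s]] by (simp add: Rq_simps(4)[OF r s])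
      show "\<phi> (J +>\<^bsub>R\<^esub> (r \<oplus>\<^bsub>R\<^esub> s)) = \<phi> (J +>\<^bsub>R\<^esub> r) \<oplus>\<^bsub>A\<^esub> \<phi> (J +>\<^bsub>R\<^esub> s)"
        using ring_hom_add[OF h cl[OF r] cl[OF s]] by (simp add: Rq_simps(3)[OF r s])
    next
      show "\<phi> (J +>\<^bsub>R\<^esub> \<one>\<^bsub>R\<^esub>) = \<one>\<^bsub>A\<^esub>" using ring_hom_one[OF h] by (simp add: Rq_simps(2))
    qed
    show "(\<lambda>r. \<phi> (J +>\<^bsub>R\<^esub> r)) ` maxid R \<subseteq> maxid A" using max \<phi> by (auto simp: coef_hom_def)
    fix w assume w: "w \<in> carrier W"
    have "\<phi> (str Rq w) = str A w" using \<phi> w by (simp add: coef_hom_def)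
    then show "\<phi> (J +>\<^bsub>R\<^esub> str R w) = str A w" by (simp add: quot_coef_def ring.defs coef.defs)
  qed
qed

text \<open>Stated for an ordered pair of indices, so that the second isomorphism is the instance
  with all indexed data exchanged.\<close>

lemma natural_iso_exists:
  fixes R A :: "('u, 'w, 'f) coef" and E :: "('u, 'u) module" and D :: "('u, 'u, 'u) law"
    and G :: "'g monoid"
  assumes inf: "infinite (UNIV :: 'u set)" and p: "Factorial_Ring.prime p"
    and G: "group G" "topspace T = carrier G" and F: "field F" and red: "red ` carrier W = carrier F"
    and distinct: "\<exists>g \<in> carrier G. \<chi>b1 g \<noteq> \<chi>b2 g"
    and C: "stable_condition p G T C"
    and E: "universal_CH_rep G T C F W red \<chi>b1 \<chi>b2 R E \<rho> D"
    and gma: "gma_structure G \<chi>b1 \<chi>b2 R E \<rho> D e1 e2"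
    and J: "J = reducibility_ideal R E e1 e2"
    and A: "coef_ring F W red A"
    and \<chi>1: "character_deforming G T A \<chi>b1 \<chi>1" "satisfies G C A (char_module A \<chi>1)"
    and \<chi>2: "character_deforming G T A \<chi>b2 \<chi>2" "satisfies G C A (char_module A \<chi>2)"
    and \<phi>: "coef_hom W (quot_coef R J) A \<phi>"
      "specializes_to_sum G R E \<rho> D A (\<lambda>r. \<phi> (J +>\<^bsub>R\<^esub> r)) \<chi>1 \<chi>2"
  shows "\<exists>\<Phi> :: ('u, 'm) module \<Rightarrow> (('u set \<times> 'u \<Rightarrow>\<^sub>0 int) set \<Rightarrow> 'm) \<Rightarrow> ('u, 'm, 'u, 'g) extension set.
    natural_Hom_Ext_iso G T C A (base_change (quot_coef R J) (red_corner E J e1 e2) A \<phi>) \<chi>2 \<chi>1 \<Phi>"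
proof -
  have R: "coef_ring F W red R" and CH: "CH_rep G T R E \<rho> D"
    using E unfolding universal_CH_rep_def CH_rep_satisfying_def by blast+
  have D: "pseudorep 2 R E D" using CH by (simp add: CH_rep_def)
  then have alg: "nc_algebra R E" by (simp add: pseudorep_def)
  interpret g: gma G \<chi>b1 \<chi>b2 R E \<rho> D e1 e2 by (rule gma.intro[OF alg D gma])
  have Ac: "cring A" "\<one>\<^bsub>A\<^esub> \<noteq> \<zero>\<^bsub>A\<^esub>" "ideal (maxid A) A"
    using A by (simp_all add: coef_ring_def complete_noetherian_local_def)
  have Rm: "ideal (maxid R) R" using R by (simp add: coef_ring_def complete_noetherian_local_def)
  note \<psi> = g.classifying_map[OF Rm Ac(1,2) \<phi>(1)[unfolded J]]
  have X: "hom_ext G \<chi>b1 \<chi>b2 R E \<rho> D e1 e2 p T C A \<chi>1 \<chi>2 F W red \<phi>"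
  proof (intro hom_ext.intro ext_setup.intro g.gma_axioms)
    show "stable_class p G T C" by (rule stable_class.intro[OF G(1) p G(2) C])
    show "char_pair A G T \<chi>2 \<chi>1"
      by (rule char_pair.intro) (use Ac G \<chi>1 \<chi>2 in \<open>simp_all add: character_deforming_def\<close>)
    show "ext_setup_axioms G \<chi>b1 \<chi>b2 R E \<rho> D e1 e2 T C A \<chi>1 \<chi>2 F W red (\<lambda>r. \<phi> (reducibility_ideal R E e1 e2 +>\<^bsub>R\<^esub> r))"
      by (rule ext_setup_axioms.intro)
        (use inf F red distinct E A \<chi>1 \<chi>2 \<psi> \<phi>(2)[unfolded J] in \<open>simp_all add: character_deforming_def\<close>)
    show "hom_ext_axioms R E e1 e2 A \<phi>"
      by (rule hom_ext_axioms.intro) (use \<phi>(1)[unfolded J] in \<open>simp add: coef_hom_def\<close>)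
  qed
  show ?thesis unfolding J by (rule exI, rule hom_ext.hom_ext_map_natural_iso[OF X])
qed

theorem theorem4p3p5:
  fixes p :: nat
    and G :: "'g monoid" and T :: "'g topology" and C :: "'g fin_class"
    and F :: "'f ring" and W :: "'w ring" and red :: "'w \<Rightarrow> 'f"
    and \<chi>b1 \<chi>b2 :: "'g \<Rightarrow> 'f"
    and R :: "('u, 'w, 'f) coef" and E :: "('u, 'u) module" and \<rho> :: "'g \<Rightarrow> 'u"
    and D :: "('u, 'u, 'u) law" and e1 e2 :: 'u and J :: "'u set"
    and A :: "('u, 'w, 'f) coef" and \<chi>1 \<chi>2 :: "'g \<Rightarrow> 'u" and \<phi> :: "'u set \<Rightarrow> 'u"
  assumes univ: "\<exists>\<iota> :: nat set \<Rightarrow> 'u. inj \<iota>"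
    and p: "Factorial_Ring.prime p"
    and G: "profinite_group G T" "mazur_Phi p G T"
    and F: "field F" "finite (carrier F)" "[p] \<cdot>\<^bsub>F\<^esub> \<one>\<^bsub>F\<^esub> = \<zero>\<^bsub>F\<^esub>"
    and W: "witt_ring p F W red"
    and \<chi>b: "residual_character G T F \<chi>b1" "residual_character G T F \<chi>b2"
    and distinct: "\<exists>g \<in> carrier G. \<chi>b1 g \<noteq> \<chi>b2 g"
    and C: "stable_condition p G T C"
    and E: "universal_CH_rep G T C F W red \<chi>b1 \<chi>b2 R E \<rho> D"
    and gma: "gma_structure G \<chi>b1 \<chi>b2 R E \<rho> D e1 e2"
    and J: "J = reducibility_ideal R E e1 e2"
    and A: "coef_ring F W red A"
    and \<chi>1: "character_deforming G T A \<chi>b1 \<chi>1" "satisfies G C A (char_module A \<chi>1)"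
    and \<chi>2: "character_deforming G T A \<chi>b2 \<chi>2" "satisfies G C A (char_module A \<chi>2)"
    and \<phi>: "coef_hom W (quot_coef R J) A \<phi>"
      "specializes_to_sum G R E \<rho> D A (\<lambda>r. \<phi> (J +>\<^bsub>R\<^esub> r)) \<chi>1 \<chi>2"
  shows
    "(\<exists>\<Phi> :: ('u, 'm) module \<Rightarrow> (('u set \<times> 'u \<Rightarrow>\<^sub>0 int) set \<Rightarrow> 'm) \<Rightarrow> ('u, 'm, 'u, 'g) extension set.
        natural_Hom_Ext_iso G T C A
          (base_change (quot_coef R J) (red_corner E J e1 e2) A \<phi>) \<chi>2 \<chi>1 \<Phi>) \<and>
     (\<exists>\<Psi> :: ('u, 'm) module \<Rightarrow> (('u set \<times> 'u \<Rightarrow>\<^sub>0 int) set \<Rightarrow> 'm) \<Rightarrow> ('u, 'm, 'u, 'g) extension set.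
        natural_Hom_Ext_iso G T C A
          (base_change (quot_coef R J) (red_corner E J e2 e1) A \<phi>) \<chi>1 \<chi>2 \<Psi>)"
proof -
  have "infinite (UNIV :: 'u set)"
  proof
    assume fin: "finite (UNIV :: 'u set)"
    obtain \<iota> :: "nat set \<Rightarrow> 'u" where "inj \<iota>" using univ by blast
    \<comment> \<open>Singletons already give infinitely many values.\<close>
    then have "inj (\<lambda>n. \<iota> {n})" by (auto simp: inj_def)
    with finite_subset[OF subset_UNIV fin] have "finite (UNIV :: nat set)" by (rule finite_imageD)
    then show False by simp
  qed
  note inf = this
  have gT: "group G" "topspace T = carrier G" using G(1) by (simp_all add: profinite_group_def)
  have red: "red ` carrier W = carrier F" using W by (simp add: witt_ring_def)
  have \<chi>bF: "\<chi>b1 \<in> carrier G \<rightarrow> carrier F" "\<chi>b2 \<in> carrier G \<rightarrow> carrier F"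
    using \<chi>b by (auto simp: residual_character_def hom_def units_of_def Units_def)
  have \<chi>A: "\<chi>1 \<in> carrier G \<rightarrow> carrier A" "\<chi>2 \<in> carrier G \<rightarrow> carrier A"
    using \<chi>1(1) \<chi>2(1) by (auto simp: character_deforming_def hom_def units_of_def Units_def)
  have D: "pseudorep 2 R E D"
    using E unfolding universal_CH_rep_def CH_rep_satisfying_def CH_rep_def by blast
  then have alg: "nc_algebra R E" by (simp add: pseudorep_def)
  interpret g: gma G \<chi>b1 \<chi>b2 R E \<rho> D e1 e2 by (rule gma.intro[OF alg D gma])
  show ?thesis
  proof
    show "\<exists>\<Phi> :: ('u, 'm) module \<Rightarrow> (('u set \<times> 'u \<Rightarrow>\<^sub>0 int) set \<Rightarrow> 'm) \<Rightarrow> ('u, 'm, 'u, 'g) extension set.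
        natural_Hom_Ext_iso G T C A (base_change (quot_coef R J) (red_corner E J e1 e2) A \<phi>) \<chi>2 \<chi>1 \<Phi>"
      by (rule natural_iso_exists[OF inf p gT F(1) red distinct C E gma J A \<chi>1 \<chi>2 \<phi>])
    have distinct': "\<exists>g \<in> carrier G. \<chi>b2 g \<noteq> \<chi>b1 g" using distinct by metis
    \<comment> \<open>The exchange of the idempotents leaves the reducibility ideal unchanged, so
      \<open>\<phi>\<close> keeps its domain.\<close>
    have J': "J = reducibility_ideal R E e2 e1" unfolding J g.reducibility_ideal_swap ..
    show "\<exists>\<Psi> :: ('u, 'm) module \<Rightarrow> (('u set \<times> 'u \<Rightarrow>\<^sub>0 int) set \<Rightarrow> 'm) \<Rightarrow> ('u, 'm, 'u, 'g) extension set.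
        natural_Hom_Ext_iso G T C A (base_change (quot_coef R J) (red_corner E J e2 e1) A \<phi>) \<chi>1 \<chi>2 \<Psi>"
      by (rule natural_iso_exists[OF inf p gT F(1) red distinct' C universal_CH_rep_swap[OF \<chi>bF E] g.swap J' A \<chi>2 \<chi>1
            \<phi>(1) specializes_to_sum_swap[OF \<chi>A, THEN iffD1, OF \<phi>(2)]])
  qed
qed

end
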